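(* Let $\frac1p<\alpha\le1$ and let $G$ be a finite abelian $p$-group. Then $$\lim_{n\to\infty}\mathbb P\big[\mathrm{Coker}(M_n^{(\alpha)})\cong G\big]=P_{\infty,1}(G)=\frac{1}{|\mathrm{Aut}(G)|}\prod_{j=1}^{\infty}(1-p^{-j}),$$ where $M_n^{(\alpha)}=M_{n,\lceil\alpha n\rceil}$ is the random matrix described in the context.
   Context: Fix a prime $p$ and $0<\epsilon<1$; $\mathbb Z_p$ is the ring of $p$-adic integers. A $\mathbb Z_p$-valued random variable $x$ is $\epsilon$-balanced if $\mathbb P[x\equiv a\pmod p]<1-\epsilon$ for every $a\in\mathbb Z/p\mathbb Z$. For positive integers $n_1\ge n_2$, $M_{n_1,n_2}$ is the random $(n_1+n_2)\times(n_1+n_2)$ matrix over $\mathbb Z_p$ with block form $\begin{bmatrix}\mathrm{diag}(c_1,\dots,c_{n_1}) & A\\ B' & \mathrm{diag}(d_1,\dots,d_{n_2})\end{bmatrix}$, where $A$ is the $n_1\times n_2$ matrix with $(i,j)$ entry $a_{ij}$ and $B'$ is the $n_2\times n_1$ matrix with $(j,i)$ entry $b_{ij}$ ($1\le i\le n_1$, $1\le j\le n_2$). All $a_{ij},b_{ij}$ are $\epsilon$-balanced, all $c_i,d_j$ are Haar-uniform on $\mathbb Z_p$, and all these random variables are mutually independent. $\mathrm{Coker}(M_{n_1,n_2})=\mathbb Z_p^{n_1+n_2}/\mathrm{im}(M_{n_1,n_2})$. For $0<u<p$, $P_{\infty,u}(G)=\frac{|G|^{\log_p(u)}}{|\mathrm{Aut}(G)|}\prod_{j=0}^\infty\big(1-\tfrac{u}{p}p^{-j}\big)$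 for finite abelian $p$-groups $G$. *)

theory Defs
  imports
    "HOL-Probability.Probability"
    "HOL-Number_Theory.Cong"
    "HOL-Algebra.Product_Groups"
    "HOL-Algebra.Bij"
    "Jordan_Normal_Form.Matrix"
begin

section \<open>The ring of p-adic integers\<close>

text \<open>The ring \<open>Z\<^sub>p\<close> is the inverse limit of the rings \<open>Z/p\<^sup>k\<close>: an element is a
  compatible sequence \<open>x\<close>, where \<open>x k\<close> is the representative in \<open>{0..<p\<^sup>k}\<close> of the
  element modulo \<open>p\<^sup>k\<close>.\<close>

type_synonym padic = "nat \<Rightarrow> int"

definition padic_int :: "nat \<Rightarrow> padic ring" where
  "padic_int p =
    \<lparr>carrier = {x. \<forall>k. x k \<in> {0..<int p ^ k} \<and> x (Suc k) mod int p ^ k = x k},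
     mult = (\<lambda>x y k. (x k * y k) mod int p ^ k),
     one = (\<lambda>k. 1 mod int p ^ k),
     zero = (\<lambda>k. 0),
     add = (\<lambda>x y k. (x k + y k) mod int p ^ k)\<rparr>"

lemma padic_int_cring:
  assumes "p > 0"
  shows "cring (padic_int p)"
proof -
  have comp: "(u mod int p ^ Suc k) mod int p ^ k = u mod int p ^ k" for u :: int and k
    by (rule mod_mod_cancel) simp
  have bound: "0 \<le> u mod int p ^ k" "u mod int p ^ k < int p ^ k" for u k
    using assms by simp_all
  have add_closed: "(\<lambda>k. (x k + y k) mod int p ^ k) \<in> carrier (padic_int p)"
    if "x \<in> carrier (padic_int p)" "y \<in> carrier (padic_int p)" for x y
    using that unfolding padic_int_def by (auto simp only: partial_object.simps mem_Collect_eq comp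
        atLeastLessThan_iff bound) (metis mod_add_eq)
  have mult_closed: "(\<lambda>k. (x k * y k) mod int p ^ k) \<in> carrier (padic_int p)"
    if "x \<in> carrier (padic_int p)" "y \<in> carrier (padic_int p)" for x y
    using that unfolding padic_int_def by (auto simp only: partial_object.simps mem_Collect_eq comp
        atLeastLessThan_iff bound) (metis mod_mult_eq)
  have uminus_closed: "(\<lambda>k. (- x k) mod int p ^ k) \<in> carrier (padic_int p)"
    if "x \<in> carrier (padic_int p)" for x
    using that unfolding padic_int_def by (auto simp only: partial_object.simps mem_Collect_eq comp
        atLeastLessThan_iff bound) (metis mod_minus_eq)
  have one_closed: "(\<lambda>k. 1 mod int p ^ k) \<in> carrier (padic_int p)"
    unfolding padic_int_def by (auto simp only: partial_object.simps mem_Collect_eq comp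
        atLeastLessThan_iff bound)
  have zero_closed: "(\<lambda>k. 0) \<in> carrier (padic_int p)"
    using assms by (simp add: padic_int_def)
  have reduced: "x k mod int p ^ k = x k" if "x \<in> carrier (padic_int p)" for x k
    using that by (simp add: padic_int_def)
  have ops: "x \<oplus>\<^bsub>padic_int p\<^esub> y = (\<lambda>k. (x k + y k) mod int p ^ k)"
    "x \<otimes>\<^bsub>padic_int p\<^esub> y = (\<lambda>k. (x k * y k) mod int p ^ k)"
    "\<one>\<^bsub>padic_int p\<^esub> = (\<lambda>k. 1 mod int p ^ k)" "\<zero>\<^bsub>padic_int p\<^esub> = (\<lambda>k. 0)" for x y
    by (simp_all add: padic_int_def)
  show ?thesis
  proof (rule cringI)
    show "abelian_group (padic_int p)"
    proof (rule abelian_groupI, unfold ops)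
      fix x assume x: "x \<in> carrier (padic_int p)"
      show "\<exists>y\<in>carrier (padic_int p). (\<lambda>k. (y k + x k) mod int p ^ k) = (\<lambda>k. 0)"
        by (rule rev_bexI[OF uminus_closed[OF x]]) (simp add: mod_add_left_eq)
    qed (simp_all add: add_closed zero_closed reduced mod_add_left_eq mod_add_right_eq ac_simps)
    show "Group.comm_monoid (padic_int p)"
      by (rule comm_monoidI, unfold ops)
        (simp_all add: mult_closed one_closed reduced mod_mult_left_eq mod_mult_right_eq ac_simps)
  qed (simp add: ops mod_mult_left_eq mod_add_eq distrib_right)
qed


section \<open>Random p-adic integers\<close>

text \<open>The type \<^typ>\<open>padic\<close> carries the product topology of discrete spaces, which induces the
  p-adic topology on \<open>Z\<^sub>p\<close>.\<close>

definition padic_borel :: "nat \<Rightarrow> padic measure" where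
  "padic_borel p = restrict_space borel (carrier (padic_int p))"

definition padic_haar :: "nat \<Rightarrow> padic measure \<Rightarrow> bool" where
  "padic_haar p \<mu> \<longleftrightarrow>
     prob_space \<mu> \<and> sets \<mu> = sets (padic_borel p) \<and>
     (\<forall>t\<in>carrier (padic_int p). \<forall>S\<in>sets \<mu>.
        emeasure \<mu> ((\<lambda>x. t \<oplus>\<^bsub>padic_int p\<^esub> x) ` S) = emeasure \<mu> S)"

definition haar_uniform :: "nat \<Rightarrow> 'w measure \<Rightarrow> ('w \<Rightarrow> padic) \<Rightarrow> bool" where
  "haar_uniform p \<Omega> x \<longleftrightarrow>
     x \<in> measurable \<Omega> (padic_borel p) \<and> padic_haar p (distr \<Omega> (padic_borel p) x)"

text \<open>The residue of \<open>x\<close> modulo \<open>p\<close> is \<open>x 1\<close>.\<close>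

definition balanced :: "nat \<Rightarrow> real \<Rightarrow> 'w measure \<Rightarrow> ('w \<Rightarrow> padic) \<Rightarrow> bool" where
  "balanced p \<epsilon> \<Omega> x \<longleftrightarrow>
     x \<in> measurable \<Omega> (padic_borel p) \<and>
     (\<forall>a::int. measure \<Omega> {\<omega> \<in> space \<Omega>. [x \<omega> 1 = a] (mod int p)} < 1 - \<epsilon>)"


section \<open>The random block matrix\<close>

text \<open>Indices start at \<open>0\<close>. The entry of the lower left block in row \<open>j\<close> and column \<open>i\<close>
  is \<open>b i j\<close>.\<close>

definition block_matrix ::
  "nat \<Rightarrow> nat \<Rightarrow> nat \<Rightarrow> (nat \<Rightarrow> nat \<Rightarrow> padic) \<Rightarrow> (nat \<Rightarrow> nat \<Rightarrow> padic) \<Rightarrow>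
    (nat \<Rightarrow> padic) \<Rightarrow> (nat \<Rightarrow> padic) \<Rightarrow> padic mat" where
  "block_matrix p n1 n2 a b c d =
     four_block_mat
       (mat n1 n1 (\<lambda>(i, j). if i = j then c i else \<zero>\<^bsub>padic_int p\<^esub>)) (mat n1 n2 (\<lambda>(i, j). a i j))
       (mat n2 n1 (\<lambda>(j, i). b i j)) (mat n2 n2 (\<lambda>(i, j). if i = j then d i else \<zero>\<^bsub>padic_int p\<^esub>))"

datatype entry = EntryA nat nat | EntryB nat nat | EntryC nat | EntryD nat

definition entry_set :: "nat \<Rightarrow> nat \<Rightarrow> entry set" where
  "entry_set n1 n2 =
     {EntryA i j | i j. i < n1 \<and> j < n2} \<union> {EntryB i j | i j. i < n1 \<and> j < n2} \<union>
     EntryC ` {..<n1} \<union> EntryD ` {..<n2}"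

definition random_block_entries ::
  "nat \<Rightarrow> real \<Rightarrow> nat \<Rightarrow> nat \<Rightarrow> 'w measure \<Rightarrow>
    (nat \<Rightarrow> nat \<Rightarrow> 'w \<Rightarrow> padic) \<Rightarrow> (nat \<Rightarrow> nat \<Rightarrow> 'w \<Rightarrow> padic) \<Rightarrow>
    (nat \<Rightarrow> 'w \<Rightarrow> padic) \<Rightarrow> (nat \<Rightarrow> 'w \<Rightarrow> padic) \<Rightarrow> bool" where
  "random_block_entries p \<epsilon> n1 n2 \<Omega> a b c d \<longleftrightarrow>
     prob_space \<Omega> \<and>
     (\<forall>i<n1. \<forall>j<n2. balanced p \<epsilon> \<Omega> (a i j) \<and> balanced p \<epsilon> \<Omega> (b i j)) \<and>
     (\<forall>i<n1. haar_uniform p \<Omega> (c i)) \<and>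
     (\<forall>j<n2. haar_uniform p \<Omega> (d j)) \<and>
     prob_space.indep_vars \<Omega> (\<lambda>_. padic_borel p) (case_entry a b c d) (entry_set n1 n2)"


section \<open>Cokernels and the limiting distribution\<close>

text \<open>\<open>padic_vectors p n\<close> is the additive group \<open>Z\<^sub>p\<^sup>n\<close>, written multiplicatively as all
  groups of HOL-Algebra.\<close>

definition padic_vectors :: "nat \<Rightarrow> nat \<Rightarrow> (nat \<Rightarrow> padic) monoid" where
  "padic_vectors p n = product_group {..<n} (\<lambda>_. add_monoid (padic_int p))"

definition padic_mult_vec :: "nat \<Rightarrow> padic mat \<Rightarrow> (nat \<Rightarrow> padic) \<Rightarrow> nat \<Rightarrow> padic" where
  "padic_mult_vec p M v =
     (\<lambda>i\<in>{..<dim_row M}. \<Oplus>\<^bsub>padic_int p\<^esub>j\<in>{..<dim_col M}. M $$ (i, j) \<otimes>\<^bsub>padic_int p\<^esub> v j)"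

definition coker :: "nat \<Rightarrow> padic mat \<Rightarrow> (nat \<Rightarrow> padic) set monoid" where
  "coker p M =
     padic_vectors p (dim_row M) Mod (padic_mult_vec p M ` carrier (padic_vectors p (dim_col M)))"

definition P_infinity :: "nat \<Rightarrow> real \<Rightarrow> ('g, 'r) monoid_scheme \<Rightarrow> real" where
  "P_infinity p u G =
     real (order G) powr log (real p) u / real (card (auto G)) *
     (\<Prod>j. 1 - u / real p * (1 / real p ^ j))"

end

theory Submission
  imports Defs
begin

text \<open>Let \<open>G\<close> be killed by \<open>p ^ (k - 1)\<close>, put \<open>q = p ^ k\<close>, let \<open>N\<close> be the size of the matrix and let \<open>Q\<close> be
the subgroup of \<open>V = (Z/q)\<^sup>N\<close> generated by the columns modulo \<open>q\<close>. A Nakayama argument shows that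
the cokernel is isomorphic to \<open>G\<close> exactly if \<open>V/Q\<close> is (\<open>coker_iso_iff\<close>), so only the residues of
the entries modulo \<open>q\<close> matter.

A homomorphism from \<open>V\<close> to a group \<open>H\<close> is a tuple \<open>F\<close> of \<open>N\<close> elements of \<open>H\<close>, the images of the
standard basis, and it is surjective if \<open>F\<close> generates \<open>H\<close>. If \<open>V/Q\<close> is isomorphic to \<open>G\<close>, then \<open>Q\<close>
is the kernel of \<open>|Aut G|\<close> surjections onto \<open>G\<close>, otherwise of none. Hence \<open>|Aut G|\<close> times the
probability in question is the sum, over the generating tuples \<open>F\<close> of \<open>G\<close>, of the probability
that \<open>Q\<close> equals the kernel \<open>A\<close> of \<open>F\<close>. Equality is sieved from inclusions: the subgroups between
\<open>Q + pA\<close> and \<open>A\<close> form the lattice of subspaces of a vector space over the field with \<open>p\<close> elements,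
and the partial alternating sums of Gaussian binomial coefficients have alternating signs. This
gives Bonferroni inequalities (\<open>bonferroni_subgroup\<close>) which bound the indicator of \<open>Q = A\<close> by
finitely many inclusions of \<open>Q\<close> in subgroups \<open>L\<close> of index \<open>p ^ r\<close> in \<open>A\<close>. Each such \<open>L\<close> is again
the kernel of a surjection, onto one of finitely many groups of order \<open>|G| p ^ r\<close>. If every
inclusion in the kernel of a surjection onto \<open>H\<close> had probability exactly \<open>|H| ^ (- N)\<close>, the term
of index \<open>r\<close> would converge to \<open>(-1) ^ r / ((p - 1) (p\<^sup>2 - 1) \<dots> (p ^ r - 1))\<close>, and by an identity of
Euler (\<open>euler_series\<close>) these terms add up to the product \<open>(1 - 1/p) (1 - 1/p\<^sup>2) \<dots>\<close>.

What remains is \<open>deviation_vanishes\<close>: for a fixed finite group \<open>H\<close> the sum over all generating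
tuples \<open>F\<close> of the deviation of the probability of \<open>Q \<subseteq> ker F\<close> from \<open>|H| ^ (- N)\<close> tends to \<open>0\<close>. For
a fixed diagonal the columns are independent, and column \<open>s\<close> lies in the kernel if a random word
in the values of \<open>F\<close> on the opposite block cancels the contribution \<open>c\<^sub>s F\<^sub>s\<close> of the diagonal
entry. A value which \<open>F\<close> takes at least \<open>\<delta> n\<close> times makes the word uniform on cosets, up to a
relative error that is exponentially small (\<open>heavy_word\<close>). Let \<open>K\<^sub>1\<close> and \<open>K\<^sub>2\<close> be the subgroups
generated by these heavy values in the two blocks. If \<open>K\<^sub>1 = K\<^sub>2 = H\<close>, then each column has
probability almost \<open>1 / |H|\<close>. All other tuples are negligible together. Up to few exceptional
positions they take values in \<open>K\<^sub>1\<close> on the first block and in \<open>K\<^sub>2\<close> on the second one, the sum over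
these values factors into a product over the columns, and a column of the first block contributes
about \<open>|K\<^sub>1 \<inter> K\<^sub>2| / |K\<^sub>2|\<close> if its diagonal entry is a unit and at most \<open>|K\<^sub>1| / |K\<^sub>2|\<close> otherwise. With
\<open>z\<close> non-units in the first block the power of \<open>|K\<^sub>1 \<inter> K\<^sub>2| / |K\<^sub>1|\<close> in the product is \<open>n\<^sub>2 - z\<close>, and
symmetrically for the second block; if \<open>K\<^sub>1\<close> and \<open>K\<^sub>2\<close> are the same proper subgroup, then instead an
exceptional value outside it costs a factor \<open>1 - \<epsilon>\<close> in every column of the opposite block. So the
product is exponentially small once the number of
non-units in each block is smaller than the size of the other block by a positive proportion of
\<open>n\<close>. This is where \<open>\<alpha> > 1/p\<close> enters: a Haar-distributed entry is a non-unit with probability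
\<open>1/p\<close>, so by Hoeffding's inequality the first block has about \<open>n/p\<close> non-units, and \<open>n\<^sub>2 \<ge> \<alpha> n\<close>.\<close>

section \<open>Gaussian binomial coefficients and an identity of Euler\<close>

definition qfac :: "nat \<Rightarrow> nat \<Rightarrow> real" where
  "qfac p n = (\<Prod>i=1..n. real p ^ i - 1)"

lemma qfac_0 [simp]: "qfac p 0 = 1" by (simp add: qfac_def)
lemma qfac_Suc: "qfac p (Suc n) = qfac p n * (real p ^ Suc n - 1)"
  by (simp add: qfac_def)

lemma qfac_pos: assumes "p \<ge> 2" shows "qfac p n > 0"
proof -
  have "real p ^ i > 1" if "i \<ge> 1" for i using assms that by (intro one_less_power) auto
  then show ?thesis unfolding qfac_def by (intro prod_pos) auto
qed

definition qbinom :: "nat \<Rightarrow> nat \<Rightarrow> nat \<Rightarrow> real" where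
  "qbinom p d r = (if r \<le> d then qfac p d / (qfac p r * qfac p (d - r)) else 0)"

lemma qbinom_nonneg: "p \<ge> 2 \<Longrightarrow> qbinom p d r \<ge> 0"
  using qfac_pos[of p] by (simp add: qbinom_def less_imp_le)

lemma qbinom_0 [simp]: "p \<ge> 2 \<Longrightarrow> qbinom p d 0 = 1"
  using qfac_pos[of p d] by (simp add: qbinom_def)

lemma qbinom_sym: "r \<le> d \<Longrightarrow> qbinom p d (d - r) = qbinom p d r"
  by (simp add: qbinom_def mult.commute)

lemma qbinom_Pascal:
  assumes "p \<ge> 2"
  shows "qbinom p (Suc d) (Suc r) = qbinom p d r + real p ^ Suc r * qbinom p d (Suc r)"
proof -
  note pos = qfac_pos[OF assms]
  consider "r > d" | "r = d" | "Suc r \<le> d" by linarith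
  then show ?thesis
  proof cases
    case 2
    then show ?thesis using pos[of "Suc d"] pos[of d] by (simp add: qbinom_def)
  next
    case 3
    then obtain m where m: "d = Suc (r + m)" by (metis less_eqE plus_nat.simps(2))
    define x y where "x = qfac p (Suc r)" and "y = qfac p m"
    have nz: "qfac p r \<noteq> 0" "qfac p m \<noteq> 0" "real p ^ Suc r - 1 \<noteq> 0" "real p ^ Suc m - 1 \<noteq> 0"
      using pos[of r] pos[of m] pos[of "Suc r"] pos[of "Suc m"] by (auto simp: qfac_Suc)
    have e: "real p ^ Suc (Suc (r + m)) = real p ^ Suc r * real p ^ Suc m"
      by (simp add: power_add)
    define a b where "a = real p ^ Suc r" and "b = real p ^ Suc m"
    have nz': "a - 1 \<noteq> 0" "b - 1 \<noteq> 0" using nz by (auto simp: a_def b_def)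
    have "qbinom p (Suc d) (Suc r) = qfac p d * (a * b - 1) / (qfac p r * (a - 1) * (qfac p m * (b - 1)))"
      using m e by (simp add: qbinom_def qfac_Suc[of p "Suc (r+m)"] qfac_Suc[of p r] qfac_Suc[of p m] a_def b_def
           del: power_Suc)
    moreover have "qbinom p d r = qfac p d / (qfac p r * (qfac p m * (b - 1)))"
      using m by (simp add: qbinom_def qfac_Suc[of p m] a_def b_def Suc_diff_le del: power_Suc)
    moreover have "qbinom p d (Suc r) = qfac p d / (qfac p r * (a - 1) * qfac p m)"
      using m by (simp add: qbinom_def qfac_Suc[of p r] a_def b_def del: power_Suc)
    moreover have "qfac p d * (a * b - 1) / (qfac p r * (a - 1) * (qfac p m * (b - 1))) =
       qfac p d / (qfac p r * (qfac p m * (b - 1))) + a * (qfac p d / (qfac p r * (a - 1) * qfac p m))"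
    proof -
      have gen: "D * ((u + 1) * (v + 1) - 1) / (x * u * (y * v)) = D / (x * (y * v)) + (u + 1) * (D / (x * u * y))"
        if "x \<noteq> 0" "y \<noteq> 0" "u \<noteq> 0" "v \<noteq> 0" for D x y u v :: real
        using that by (simp add: field_simps)
      show ?thesis using gen[of "qfac p r" "qfac p m" "a - 1" "b - 1" "qfac p d"] nz nz' by simp
    qed
    ultimately show ?thesis by (simp add: a_def)
  qed (simp add: qbinom_def)
qed

text \<open>The partial sums of the \<open>q\<close>-binomial theorem at \<open>-1\<close> telescope because of the Pascal rule. Their
alternating sign is the source of the Bonferroni inequalities for subgroups.\<close>

lemma qbinom_alternating_partial_sum:
  assumes "p \<ge> 2"
  shows "(\<Sum>r\<le>R. (-1) ^ r * real p ^ (r choose 2) * qbinom p (Suc d) r)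
       = (-1) ^ R * real p ^ (Suc R choose 2) * qbinom p d R"
proof (induction R)
  case 0
  then show ?case using assms by (simp add: numeral_2_eq_2)
next
  case (Suc R)
  have c: "Suc (Suc R) choose 2 = (Suc R choose 2) + Suc R" by (simp add: numeral_2_eq_2)
  have "(\<Sum>r\<le>Suc R. (-1) ^ r * real p ^ (r choose 2) * qbinom p (Suc d) r)
     = (-1) ^ R * real p ^ (Suc R choose 2) * qbinom p d R
     + (-1) ^ Suc R * real p ^ (Suc R choose 2) * (qbinom p d R + real p ^ Suc R * qbinom p d (Suc R))"
    using Suc.IH by (simp add: qbinom_Pascal[OF assms])
  also have "\<dots> = (-1) ^ Suc R * real p ^ (Suc (Suc R) choose 2) * qbinom p d (Suc R)"
    unfolding c power_add by (simp add: algebra_simps)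
  finally show ?case .
qed

lemma qfac_quotient:
  assumes "p \<ge> 2" "r \<le> N"
  shows "qfac p N / qfac p (N - r) = (\<Prod>i<r. real p ^ (N - i) - 1)"
  using assms(2)
proof (induction r)
  case 0
  then show ?case using qfac_pos[OF assms(1), of N] by simp
next
  case (Suc r)
  then have "N - r = Suc (N - Suc r)" by simp
  then have "qfac p (N - r) = qfac p (N - Suc r) * (real p ^ (N - r) - 1)" by (metis qfac_Suc)
  moreover have "qfac p (N - Suc r) > 0" "qfac p (N - r) > 0" using qfac_pos[OF assms(1)] by auto
  ultimately have "qfac p N / qfac p (N - Suc r) = qfac p N / qfac p (N - r) * (real p ^ (N - r) - 1)"
    by (cases "real p ^ (N - r) = 1") simp_all
  with Suc show ?case by simp
qed

lemma sum_lessThan_id_choose: "(\<Sum>i<r. i) = r choose 2"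
  by (induction r) (auto simp: numeral_2_eq_2)

text \<open>Of the \<open>p ^ (r * N)\<close> tuples of \<open>r\<close> vectors in a space of dimension \<open>N\<close> almost all are independent,
and each subspace of dimension \<open>r\<close> has \<open>p ^ (r choose 2) * qfac p r\<close> bases.\<close>

lemma qbinom_limit:
  assumes "p \<ge> 2"
  shows "(\<lambda>N. qbinom p N r / real p ^ (r * N)) \<longlonglongrightarrow> 1 / (real p ^ (r choose 2) * qfac p r)"
proof -
  have 1: "(\<lambda>N. (real p ^ (N - i) - 1) / real p ^ N) \<longlonglongrightarrow> 1 / real p ^ i" for i
  proof -
    have "(\<lambda>N. (1 / real p) ^ i - (1 / real p) ^ N) \<longlonglongrightarrow> (1 / real p) ^ i - 0"
      using assms by (intro tendsto_diff tendsto_const LIMSEQ_realpow_zero) auto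
    moreover have "eventually (\<lambda>N. (real p ^ (N - i) - 1) / real p ^ N = (1 / real p) ^ i - (1 / real p) ^ N) sequentially"
      using eventually_ge_at_top[of i]
    proof eventually_elim
      case (elim N)
      then show ?case using assms by (simp add: power_diff field_simps power_one_over)
    qed
    ultimately show ?thesis by (simp add: tendsto_cong power_one_over)
  qed
  have "(\<lambda>N. (\<Prod>i<r. (real p ^ (N - i) - 1) / real p ^ N) / qfac p r) \<longlonglongrightarrow> (\<Prod>i<r. 1 / real p ^ i) / qfac p r"
    using qfac_pos[OF assms, of r] by (intro tendsto_divide tendsto_prod 1 tendsto_const) auto
  moreover have "(\<Prod>i<r. 1 / real p ^ i) = 1 / real p ^ (r choose 2)"
    by (simp add: prod_dividef flip: power_sum sum_lessThan_id_choose)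
  moreover have "eventually (\<lambda>N. (\<Prod>i<r. (real p ^ (N - i) - 1) / real p ^ N) / qfac p r = qbinom p N r / real p ^ (r * N)) sequentially"
    using eventually_ge_at_top[of r]
  proof eventually_elim
    case (elim N)
    have "qbinom p N r = qfac p N / qfac p (N - r) / qfac p r" using elim by (simp add: qbinom_def)
    then show ?case using elim qfac_quotient[OF assms elim]
      by (simp add: prod_dividef mult.commute flip: power_mult)
  qed
  ultimately show ?thesis by (simp add: tendsto_cong mult.commute)
qed

text \<open>The power series \<open>f\<close> with these coefficients satisfies \<open>f x = (1 - x/p) f (x/p)\<close>. Iterating this
from \<open>x = 1\<close> produces the partial products, and \<open>f (1 / p ^ J)\<close> tends to \<open>f 0 = 1\<close>.\<close>

lemma euler_series:
  assumes "p \<ge> 2"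
  shows "(\<lambda>r. (-1) ^ r / qfac p r) sums (\<Prod>j. 1 - 1 / real p ^ Suc j)"
proof -
  define c :: "nat \<Rightarrow> real" where "c r = (-1) ^ r / qfac p r" for r
  define f where "f x = (\<Sum>r. c r * x ^ r)" for x
  have cb: "norm (c (Suc n)) \<le> (1/2) * norm (c n)" if "n \<ge> 1" for n
  proof -
    have "real p ^ Suc n \<ge> 2 ^ Suc n" using assms by (intro power_mono) auto
    moreover have "(2::real) ^ Suc n \<ge> 2 ^ 2" using that by (intro power_increasing) auto
    ultimately have "real p ^ Suc n - 1 \<ge> 2" by simp
    then have "2 * qfac p n \<le> qfac p (Suc n)"
      using qfac_pos[OF assms, of n] by (simp add: qfac_Suc mult.commute[of "qfac p n"] mult_right_mono del: power_Suc)
    then show ?thesis using qfac_pos[OF assms, of n] qfac_pos[OF assms, of "Suc n"]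
      by (simp add: c_def field_simps)
  qed
  have sum1: "summable (\<lambda>r. norm (c r))"
    by (rule summable_ratio_test[where c="1/2" and N=1]) (use cb in auto)
  have summ: "summable (\<lambda>r. c r * x ^ r)" if "norm x \<le> 1" for x
  proof (rule summable_comparison_test'[OF sum1, of 0])
    show "norm (c n * x ^ n) \<le> norm (c n)" for n
      using that by (simp add: abs_mult power_abs mult_left_le power_le_one)
  qed
  define P where "P = real p"
  have P: "P \<ge> 2" using assms by (simp add: P_def)
  have fe: "f x = (1 - x / P) * f (x / P)" if x: "norm x \<le> 1" for x
  proof -
    have x': "norm (x / P) \<le> 1" using x P by (simp add: divide_le_eq)
    have "f x - f (x / P) = (\<Sum>r. c r * x ^ r - c r * (x / P) ^ r)"
      unfolding f_def by (rule suminf_diff[OF summ[OF x] summ[OF x']])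
    also have "\<dots> = (\<Sum>r. c (Suc r) * x ^ Suc r - c (Suc r) * (x / P) ^ Suc r)"
      using suminf_split_head[OF summable_diff[OF summ[OF x] summ[OF x']]] by simp
    also have "\<dots> = (\<Sum>r. - (x / P) * (c r * (x / P) ^ r))"
    proof (rule suminf_cong)
      fix r
      have q: "P ^ Suc r - 1 > 0" using P by (simp add: less_1_mult one_less_power del: power_Suc)
      have cs: "c (Suc r) * (P ^ Suc r - 1) = - c r"
        using q qfac_pos[OF assms, of r] by (simp add: c_def qfac_Suc P_def del: power_Suc) (simp add: field_simps)
      have "c (Suc r) * x ^ Suc r - c (Suc r) * (x / P) ^ Suc r = c (Suc r) * (P ^ Suc r - 1) * (x / P) ^ Suc r"
        using P by (simp add: power_divide field_simps)
      also have "\<dots> = - (x / P) * (c r * (x / P) ^ r)" unfolding cs by simp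
      finally show "c (Suc r) * x ^ Suc r - c (Suc r) * (x / P) ^ Suc r = - (x / P) * (c r * (x / P) ^ r)" .
    qed
    also have "\<dots> = - (x / P) * f (x / P)"
      unfolding f_def by (rule suminf_mult[OF summ[OF x']])
    finally show ?thesis by (simp add: algebra_simps)
  qed
  have it: "f 1 = (\<Prod>j<J. 1 - 1 / P ^ Suc j) * f (1 / P ^ J)" for J
  proof (induction J)
    case (Suc J)
    have "f (1 / P ^ J) = (1 - 1 / P ^ J / P) * f (1 / P ^ J / P)"
      using P by (intro fe) (simp add: divide_le_eq one_le_power)
    with Suc show ?case by (simp add: mult.commute)
  qed simp
  have cont: "isCont f 0"
  proof -
    have "isCont (\<lambda>x. \<Sum>n. c n * x ^ n) 0"
      by (rule isCont_powser[where K=1]) (use summ[of 1] in auto)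
    then show ?thesis by (simp add: f_def[abs_def])
  qed
  have "(\<lambda>J. 1 / P ^ J) \<longlonglongrightarrow> 0"
    using LIMSEQ_realpow_zero[of "1 / P"] P by (simp add: power_one_over)
  then have "(\<lambda>J. f (1 / P ^ J)) \<longlonglongrightarrow> f 0" by (rule isCont_tendsto_compose[OF cont])
  moreover have "f 0 = c 0" unfolding f_def by (rule powser_zero)
  ultimately have limf: "(\<lambda>J. f (1 / P ^ J)) \<longlonglongrightarrow> 1" by (simp add: c_def)
  have "abs_convergent_prod (\<lambda>j. 1 - 1 / P ^ Suc j)"
  proof -
    have "summable (\<lambda>j. (1 / P) * (1 / P) ^ j)" using P by (intro summable_mult summable_geometric) auto
    then have "summable (\<lambda>i. norm ((1 - 1 / P ^ Suc i) - 1))" using P by (simp add: power_one_over)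
    then show ?thesis by (rule summable_imp_abs_convergent_prod)
  qed
  then have conv: "convergent_prod (\<lambda>j. 1 - 1 / P ^ Suc j)" by (rule abs_convergent_prod_imp_convergent_prod)
  have "(\<lambda>n. \<Prod>j\<le>n. 1 - 1 / P ^ Suc j) \<longlonglongrightarrow> (\<Prod>j. 1 - 1 / P ^ Suc j)"
    by (rule convergent_prod_LIMSEQ[OF conv])
  then have "(\<lambda>n. (\<Prod>j<n. 1 - 1 / P ^ Suc j)) \<longlonglongrightarrow> (\<Prod>j. 1 - 1 / P ^ Suc j)"
    by (subst (asm) lessThan_Suc_atMost[symmetric]) (rule LIMSEQ_imp_Suc)
  from tendsto_mult[OF this limf] have "(\<lambda>J. f 1) \<longlonglongrightarrow> (\<Prod>j. 1 - 1 / P ^ Suc j)"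
    unfolding it[symmetric] by (simp only: mult_1_right)
  then have "f 1 = (\<Prod>j. 1 - 1 / P ^ Suc j)" by (simp add: LIMSEQ_const_iff)
  moreover have "c sums f 1" using summ[of 1] by (simp add: f_def summable_sums)
  ultimately show ?thesis by (simp add: c_def[abs_def] P_def)
qed

section \<open>Random words in a commutative group\<close>

definition word :: "('h, 'x) monoid_scheme \<Rightarrow> 'i set \<Rightarrow> ('i \<Rightarrow> 'h) \<Rightarrow> ('i \<Rightarrow> int) \<Rightarrow> 'h" where
  "word H J g x = finprod H (\<lambda>r. g r [^]\<^bsub>H\<^esub> x r) J"

definition word_pmf :: "('h, 'x) monoid_scheme \<Rightarrow> 'i set \<Rightarrow> ('i \<Rightarrow> 'h) \<Rightarrow> ('i \<Rightarrow> int pmf) \<Rightarrow> 'h pmf" where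
  "word_pmf H J g \<mu> = map_pmf (word H J g) (Pi_pmf J 0 \<mu>)"

lemma (in comm_group) word_closed [simp]:
  "g \<in> J \<rightarrow> carrier G \<Longrightarrow> word G J g x \<in> carrier G"
  unfolding word_def by (rule finprod_closed) auto

lemma (in comm_group) word_cong:
  assumes "g \<in> J \<rightarrow> carrier G" "\<And>r. r \<in> J \<Longrightarrow> g r = g' r" "\<And>r. r \<in> J \<Longrightarrow> x r = x' r"
  shows "word G J g x = word G J g' x'"
  unfolding word_def by (rule finprod_cong') (use assms in \<open>auto simp: Pi_iff\<close>)

lemma (in comm_group) word_Un:
  assumes "finite A" "finite B" "A \<inter> B = {}" "g \<in> A \<union> B \<rightarrow> carrier G"
  shows "word G (A \<union> B) g x = word G A g x \<otimes> word G B g x"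
  unfolding word_def using assms by (intro finprod_Un_disjoint) (auto simp: Pi_iff)

lemma (in comm_group) word_insert:
  assumes "finite A" "r \<notin> A" "g \<in> insert r A \<rightarrow> carrier G"
  shows "word G (insert r A) g x = g r [^] x r \<otimes> word G A g x"
  unfolding word_def using assms by (intro finprod_insert) (auto simp: Pi_iff)

lemma (in comm_group) word_in_subgroup:
  assumes "subgroup K G" "finite J" "\<And>r. r \<in> J \<Longrightarrow> g r \<in> K"
  shows "word G J g x \<in> K"
  using assms(2,3)
proof (induction J)
  case empty
  then show ?case using assms(1) by (simp add: word_def subgroup.one_closed)
next
  case (insert r J)
  have sub: "K \<subseteq> carrier G" using assms(1) by (rule subgroup.subset)
  have "g r [^] x r \<in> K" using insert.prems assms(1) by (simp add: subgroup_int_pow_closed)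
  moreover have "word G J g x \<in> K" using insert by auto
  moreover have "word G (insert r J) g x = g r [^] x r \<otimes> word G J g x"
    using insert sub by (intro word_insert) auto
  ultimately show ?case using assms(1) by (simp add: subgroup.m_closed)
qed

lemma (in comm_group) word_const:
  assumes "v \<in> carrier G" "\<And>r. r \<in> J \<Longrightarrow> g r = v" "finite J"
  shows "word G J g x = v [^] (\<Sum>r\<in>J. x r)"
  using assms(3,2)
proof (induction J)
  case empty
  then show ?case by (simp add: word_def)
next
  case (insert r J)
  then have "word G (insert r J) g x = g r [^] x r \<otimes> word G J g x"
    using assms(1) by (intro word_insert) auto
  then show ?case using insert assms(1) by (simp add: int_pow_mult)
qed

lemma (in comm_group) set_word_pmf:
  "g \<in> J \<rightarrow> carrier G \<Longrightarrow> set_pmf (word_pmf G J g \<mu>) \<subseteq> carrier G"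
  unfolding word_pmf_def by auto

lemma pmf_map_pair:
  assumes "finite C" "set_pmf M \<subseteq> C"
  shows "pmf (map_pmf (\<lambda>(u, v). f u v) (pair_pmf M N)) h = (\<Sum>u\<in>C. pmf M u * measure_pmf.prob N {v. f u v = h})"
proof -
  have "map_pmf (\<lambda>(u, v). f u v) (pair_pmf M N) = bind_pmf M (\<lambda>u. map_pmf (f u) N)"
    unfolding pair_pmf_def map_pmf_def by (simp add: bind_assoc_pmf bind_return_pmf)
  then have "pmf (map_pmf (\<lambda>(u, v). f u v) (pair_pmf M N)) h = (\<integral>u. pmf (map_pmf (f u) N) h \<partial>measure_pmf M)"
    by (simp add: pmf_bind)
  also have "\<dots> = (\<Sum>u\<in>C. pmf (map_pmf (f u) N) h * pmf M u)"
    using assms by (intro integral_measure_pmf_real) auto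
  also have "\<dots> = (\<Sum>u\<in>C. pmf M u * measure_pmf.prob N {v. f u v = h})"
    by (simp add: pmf_map vimage_def mult.commute)
  finally show ?thesis .
qed

lemma (in comm_group) word_pmf_Un:
  assumes "finite A" "finite B" "A \<inter> B = {}" "g \<in> A \<union> B \<rightarrow> carrier G"
  shows "word_pmf G (A \<union> B) g \<mu> = map_pmf (\<lambda>(u, v). u \<otimes> v) (pair_pmf (word_pmf G A g \<mu>) (word_pmf G B g \<mu>))"
proof -
  have "word G (A \<union> B) g (\<lambda>x. if x \<in> A then f x else h x) = word G A g f \<otimes> word G B g h" for f h
    using assms by (subst word_Un) (auto intro!: arg_cong2[where f="(\<otimes>)"] word_cong)
  then show ?thesis
    unfolding word_pmf_def using assms
    by (subst Pi_pmf_union) (auto simp: pmf.map_comp o_def case_prod_unfold pair_map_pmf1 pair_map_pmf2)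
qed

lemma (in comm_group) pmf_word_Un:
  assumes fin: "finite (carrier G)" and AB: "finite A" "finite B" "A \<inter> B = {}" "g \<in> A \<union> B \<rightarrow> carrier G"
    and h: "h \<in> carrier G"
  shows "pmf (word_pmf G (A \<union> B) g \<mu>) h =
    (\<Sum>u\<in>carrier G. pmf (word_pmf G A g \<mu>) u * pmf (word_pmf G B g \<mu>) (h \<otimes> inv u))"
proof -
  have gA: "g \<in> A \<rightarrow> carrier G" and gB: "g \<in> B \<rightarrow> carrier G" using AB(4) by auto
  have "measure_pmf.prob (word_pmf G B g \<mu>) {v. u \<otimes> v = h} = pmf (word_pmf G B g \<mu>) (h \<otimes> inv u)"
    if u: "u \<in> carrier G" for u
  proof -
    have "measure_pmf.prob (word_pmf G B g \<mu>) {v. u \<otimes> v = h} = measure_pmf.prob (word_pmf G B g \<mu>) {h \<otimes> inv u}"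
    proof (rule measure_prob_cong_0)
      fix x assume x: "x \<in> {v. u \<otimes> v = h} - {h \<otimes> inv u}"
      have "x \<notin> carrier G" using x u by (auto simp: m_assoc m_comm[of u])
      then show "pmf (word_pmf G B g \<mu>) x = 0" using set_word_pmf[OF gB, of \<mu>] by (auto simp: pmf_eq_0_set_pmf)
    next
      fix x assume x: "x \<in> {h \<otimes> inv u} - {v. u \<otimes> v = h}"
      then have "False" using u h by (auto simp: m_lcomm)
      then show "pmf (word_pmf G B g \<mu>) x = 0" ..
    qed
    then show ?thesis by (simp add: measure_pmf_single)
  qed
  then show ?thesis
    unfolding word_pmf_Un[OF AB] by (subst pmf_map_pair[OF fin set_word_pmf[OF gA]]) (auto intro: sum.cong)
qed

section \<open>Sums of balanced residues\<close>

definition rsum :: "nat \<Rightarrow> 'i set \<Rightarrow> ('i \<Rightarrow> int pmf) \<Rightarrow> int pmf" where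
  "rsum q J \<mu> = map_pmf (\<lambda>x. (\<Sum>r\<in>J. x r) mod int q) (Pi_pmf J 0 \<mu>)"

lemma rsum_conv_word:
  assumes "q \<ge> 2" "finite J"
  shows "rsum q J \<mu> = word_pmf (integer_mod_group q) J (\<lambda>_. 1) \<mu>"
proof -
  interpret C: comm_group "integer_mod_group q" by simp
  have "word (integer_mod_group q) J (\<lambda>_. 1) x = (\<Sum>r\<in>J. x r) mod int q" for x
    using assms by (subst C.word_const[of 1]) (auto simp: int_pow_integer_mod_group)
  then have "word (integer_mod_group q) J (\<lambda>_. 1) = (\<lambda>x. (\<Sum>r\<in>J. x r) mod int q)" by (rule ext)
  then show ?thesis by (simp only: rsum_def word_pmf_def)
qed

lemma set_rsum: "q > 0 \<Longrightarrow> set_pmf (rsum q J \<mu>) \<subseteq> {0..<int q}"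
  by (auto simp: rsum_def)

lemma pmf_rsum_Un:
  assumes "q \<ge> 2" "finite A" "finite B" "A \<inter> B = {}"
  shows "pmf (rsum q (A \<union> B) \<mu>) (u mod int q) =
    (\<Sum>y\<in>{0..<int q}. pmf (rsum q A \<mu>) y * pmf (rsum q B \<mu>) ((u - y) mod int q))"
proof -
  interpret C: comm_group "integer_mod_group q" by simp
  have car: "carrier (integer_mod_group q) = {0..<int q}" using assms(1) by (simp add: carrier_integer_mod_group)
  have "pmf (rsum q (A \<union> B) \<mu>) (u mod int q) = (\<Sum>y\<in>{0..<int q}. pmf (rsum q A \<mu>) y *
      pmf (rsum q B \<mu>) (u mod int q \<otimes>\<^bsub>integer_mod_group q\<^esub> inv\<^bsub>integer_mod_group q\<^esub> y))"
    using assms C.pmf_word_Un[of A B "\<lambda>_. 1" "u mod int q" \<mu>] car by (simp add: rsum_conv_word)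
  also have "\<dots> = (\<Sum>y\<in>{0..<int q}. pmf (rsum q A \<mu>) y * pmf (rsum q B \<mu>) ((u - y) mod int q))"
    by (intro sum.cong) (auto simp: car mod_add_eq)
  finally show ?thesis .
qed

lemma rsum_total:
  assumes "q > 0"
  shows "(\<Sum>y\<in>{0..<int q}. pmf (rsum q J \<mu>) ((u - y) mod int q)) = 1"
proof -
  have "(\<Sum>y\<in>{0..<int q}. pmf (rsum q J \<mu>) ((u - y) mod int q)) = (\<Sum>y\<in>{0..<int q}. pmf (rsum q J \<mu>) y)"
    by (rule sum.reindex_bij_witness[of _ "\<lambda>y. (u - y) mod int q" "\<lambda>y. (u - y) mod int q"])
       (use assms in \<open>auto simp: mod_simps\<close>)
  also have "\<dots> = 1" using set_rsum[OF assms] by (intro sum_pmf_eq_1) auto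
  finally show ?thesis .
qed

definition bal_pmf :: "nat \<Rightarrow> nat \<Rightarrow> real \<Rightarrow> int pmf \<Rightarrow> bool" where
  "bal_pmf p q \<epsilon> \<mu> \<longleftrightarrow> set_pmf \<mu> \<subseteq> {0..<int q} \<and> (\<forall>a. measure_pmf.prob \<mu> {x. x mod int p = a} \<le> 1 - \<epsilon>)"

lemma pmf_large_atom:
  assumes "finite C" "measure_pmf.prob M C \<ge> \<epsilon>" "\<epsilon> > 0" "card C \<le> n"
  obtains x where "x \<in> C" "pmf M x \<ge> \<epsilon> / n"
proof -
  have ne: "C \<noteq> {}" using assms by auto
  then have n: "n > 0" using assms by (auto simp: card_gt_0_iff)
  have "\<exists>x\<in>C. pmf M x \<ge> \<epsilon> / n"
  proof (rule ccontr)
    assume "\<not> ?thesis"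
    then have "(\<Sum>x\<in>C. pmf M x) < (\<Sum>x\<in>C. \<epsilon> / n)" using ne assms by (intro sum_strict_mono) auto
    also have "\<dots> = card C * (\<epsilon> / n)" by simp
    also have "\<dots> \<le> n * (\<epsilon> / n)" using assms by (intro mult_right_mono) auto
    also have "\<dots> = \<epsilon>" using n by simp
    finally show False using assms by (simp add: measure_measure_pmf_finite)
  qed
  then show thesis using that by blast
qed

lemma bal_pmf_two_atoms:
  assumes "bal_pmf p q \<epsilon> \<mu>" "0 < \<epsilon>" "\<epsilon> < 1" "q > 0"
  obtains x y where "x mod int p \<noteq> y mod int p" "pmf \<mu> x \<ge> \<epsilon> / q" "pmf \<mu> y \<ge> \<epsilon> / q"
proof -
  have s: "set_pmf \<mu> \<subseteq> {0..<int q}" and b: "\<And>a. measure_pmf.prob \<mu> {x. x mod int p = a} \<le> 1 - \<epsilon>"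
    using assms(1) by (auto simp: bal_pmf_def)
  have tot: "measure_pmf.prob \<mu> {0..<int q} = 1"
    using s by (simp add: measure_measure_pmf_finite sum_pmf_eq_1)
  obtain x where x: "pmf \<mu> x \<ge> \<epsilon> / q"
    using pmf_large_atom[of "{0..<int q}" \<epsilon> \<mu> q] tot assms by auto
  define C where "C = {y\<in>{0..<int q}. y mod int p \<noteq> x mod int p}"
  have "measure_pmf.prob \<mu> {0..<int q} \<le> measure_pmf.prob \<mu> (C \<union> {y. y mod int p = x mod int p})"
    by (intro measure_pmf.finite_measure_mono) (auto simp: C_def)
  also have "\<dots> \<le> measure_pmf.prob \<mu> C + measure_pmf.prob \<mu> {y. y mod int p = x mod int p}"
    by (intro measure_Un_le) auto
  finally have "measure_pmf.prob \<mu> C \<ge> \<epsilon>" using tot b[of "x mod int p"] by linarith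
  moreover have "finite C" "card C \<le> q"
  proof -
    have "card C \<le> card {0..<int q}" unfolding C_def by (intro card_mono) auto
    then show "card C \<le> q" by simp
    show "finite C" by (rule finite_subset[of _ "{0..<int q}"]) (auto simp: C_def)
  qed
  ultimately obtain y where "y \<in> C" "pmf \<mu> y \<ge> \<epsilon> / q" using pmf_large_atom[of C \<epsilon> \<mu> q] assms(2) by auto
  with x show thesis by (intro that[of x y]) (auto simp: C_def)
qed

text \<open>A unit \<open>t\<close> generates the additive group of residues, so that repeated translation by \<open>t\<close> reaches
every residue from any given one.\<close>

lemma residues_closed_under_unit_translation:
  fixes A :: "int set"
  assumes "A \<subseteq> {0..<int q}" "A \<noteq> {}" "coprime t (int q)" "\<And>u. u \<in> A \<Longrightarrow> (u + t) mod int q \<in> A"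
  shows "A = {0..<int q}"
proof -
  obtain a where a: "a \<in> A" using assms by auto
  have q: "q > 0" using a assms(1) by auto
  have it: "(a + int n * t) mod int q \<in> A" for n
  proof (induction n)
    case 0
    then show ?case using a assms(1) by auto
  next
    case (Suc n)
    from assms(4)[OF this] show ?case by (simp add: mod_simps algebra_simps)
  qed
  have "b \<in> A" if b: "b \<in> {0..<int q}" for b
  proof -
    obtain s where s: "[t * s = 1] (mod int q)" using cong_solve_coprime_int[OF assms(3)] by auto
    \<comment> \<open>The number of translations that lead from \<open>a\<close> to \<open>b\<close>.\<close>
    define n where "n = nat (((b - a) * s) mod int q)"
    have n: "int n = ((b - a) * s) mod int q" using q by (simp add: n_def)
    have "[int n = (b - a) * s] (mod int q)" unfolding n by simp
    then have "[a + int n * t = a + (b - a) * s * t] (mod int q)" by (intro cong_add cong_mult cong_refl)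
    then have "[a + int n * t = a + (b - a) * (t * s)] (mod int q)" by (simp add: ac_simps)
    also have "[a + (b - a) * (t * s) = a + (b - a) * 1] (mod int q)"
      by (intro cong_add cong_mult cong_refl s)
    finally have "(a + int n * t) mod int q = b" using b by (simp add: cong_def)
    with it[of n] show ?thesis by simp
  qed
  with assms(1) show ?thesis by auto
qed

text \<open>A Cauchy-Davenport growth argument: a balanced residue has two atoms \<open>x\<close> and \<open>y\<close> of mass at least
\<open>\<epsilon> / q\<close> whose difference is a unit modulo \<open>q\<close>. The translates of \<open>A\<close> by \<open>x\<close> and by \<open>y\<close> coincide
only if \<open>A\<close> is everything, so each new summand enlarges the set of likely residues by at least one
element.\<close>

lemma rsum_support:
  assumes p: "prime p" and k: "q = p ^ k" "k \<ge> 1" and eps: "0 < \<epsilon>" "\<epsilon> < 1"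
    and "finite J" "\<And>r. r \<in> J \<Longrightarrow> bal_pmf p q \<epsilon> (\<mu> r)"
  shows "\<exists>A\<subseteq>{0..<int q}. card A \<ge> min q (Suc (card J)) \<and> (\<forall>u\<in>A. pmf (rsum q J \<mu>) u \<ge> (\<epsilon> / q) ^ card J)"
  using assms(6,7)
proof (induction J)
  case empty
  have "q > 0" using p k by (simp add: prime_gt_0_nat)
  then show ?case by (intro exI[of _ "{0}"]) (auto simp: rsum_def)
next
  case (insert j J)
  have p2: "p \<ge> 2" using p by (simp add: prime_ge_2_nat)
  have q2: "q \<ge> 2"
  proof -
    have "p ^ 1 \<le> p ^ k" using p2 k by (intro power_increasing) auto
    then show ?thesis using p2 k by simp
  qed
  obtain A where A: "A \<subseteq> {0..<int q}" "card A \<ge> min q (Suc (card J))" "\<And>u. u \<in> A \<Longrightarrow> pmf (rsum q J \<mu>) u \<ge> (\<epsilon> / q) ^ card J"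
    using insert by auto
  have finA: "finite A" using A(1) finite_subset by blast
  obtain x y where xy: "x mod int p \<noteq> y mod int p" "pmf (\<mu> j) x \<ge> \<epsilon> / q" "pmf (\<mu> j) y \<ge> \<epsilon> / q"
    using bal_pmf_two_atoms[of p q \<epsilon> "\<mu> j"] insert.prems eps q2 by auto
  have setj: "set_pmf (\<mu> j) \<subseteq> {0..<int q}" using insert.prems by (auto simp: bal_pmf_def)
  have rj: "pmf (rsum q {j} \<mu>) z = pmf (\<mu> j) z" for z
  proof -
    have "rsum q {j} \<mu> = map_pmf (\<lambda>z. z mod int q) (\<mu> j)"
      unfolding rsum_def by (simp add: Pi_pmf_singleton pmf.map_comp o_def)
    also have "\<dots> = map_pmf id (\<mu> j)"
      using setj by (intro map_pmf_cong) auto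
    finally show ?thesis by simp
  qed
  have low: "pmf (rsum q (insert j J) \<mu>) ((u + z) mod int q) \<ge> (\<epsilon> / q) ^ card (insert j J)"
    if u: "u \<in> A" and z: "pmf (\<mu> j) z \<ge> \<epsilon> / q" for u z
  proof -
    have "pmf (\<mu> j) z > 0" using z eps q2 by (smt (verit) divide_pos_pos of_nat_0_less_iff zero_less_numeral less_le_trans)
    then have zr: "z \<in> {0..<int q}" using setj by (auto simp: pmf_positive_iff)
    have "pmf (rsum q (insert j J) \<mu>) ((u + z) mod int q) =
       (\<Sum>y\<in>{0..<int q}. pmf (\<mu> j) y * pmf (rsum q J \<mu>) ((u + z - y) mod int q))"
      using pmf_rsum_Un[OF q2, of "{j}" J \<mu> "u + z"] insert.hyps by (simp add: rj)
    also have "\<dots> \<ge> pmf (\<mu> j) z * pmf (rsum q J \<mu>) ((u + z - z) mod int q)"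
      using zr by (intro member_le_sum) auto
    also have "pmf (rsum q J \<mu>) ((u + z - z) mod int q) = pmf (rsum q J \<mu>) u" using u A(1) by auto
    also have "pmf (\<mu> j) z * pmf (rsum q J \<mu>) u \<ge> (\<epsilon> / q) * (\<epsilon> / q) ^ card J"
      using z A(3)[OF u] eps by (intro mult_mono) auto
    finally show ?thesis using insert.hyps by simp
  qed
  define tr where "tr z = (\<lambda>u. (u + z) mod int q) ` A" for z
  have inj: "inj_on (\<lambda>u. (u + z) mod int q) A" for z
  proof (rule inj_onI)
    fix u v assume "u \<in> A" "v \<in> A" "(u + z) mod int q = (v + z) mod int q"
    then have "[u + z = v + z] (mod int q)" by (simp add: cong_def)
    then have "[u = v] (mod int q)" by (simp add: cong_add_rcancel)
    moreover have "u \<in> {0..<int q}" "v \<in> {0..<int q}" using \<open>u \<in> A\<close> \<open>v \<in> A\<close> A(1) by auto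
    ultimately show "u = v" by (simp add: cong_def)
  qed
  have ctr: "card (tr z) = card A" "finite (tr z)" for z
    using inj[of z] finA by (auto simp: tr_def card_image)
  define B where "B = tr x \<union> tr y"
  have B1: "B \<subseteq> {0..<int q}" using q2 by (auto simp: B_def tr_def)
  have B3: "\<forall>u\<in>B. pmf (rsum q (insert j J) \<mu>) u \<ge> (\<epsilon> / q) ^ card (insert j J)"
    using low xy by (auto simp: B_def tr_def)
  have "card B \<ge> min q (Suc (card (insert j J)))"
  proof (cases "A = {0..<int q}")
    case True
    then have "card (tr x) = q" using ctr by simp
    moreover have "card (tr x) \<le> card B" by (rule card_mono) (simp_all add: B_def ctr(2))
    ultimately show ?thesis by simp
  next
    case False
    have A0: "A \<noteq> {}" using A(2) q2 by auto
    have cop: "coprime (x - y) (int q)"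
    proof -
      have "\<not> int p dvd (x - y)" using xy(1) by (simp add: mod_eq_dvd_iff)
      then have "coprime (int p) (x - y)" using p by (simp add: prime_imp_coprime)
      then show ?thesis using k by (simp add: coprime_commute)
    qed
    have "tr x \<noteq> tr y"
    proof
      assume eq: "tr x = tr y"
      have "(u + (x - y)) mod int q \<in> A" if u: "u \<in> A" for u
      proof -
        have "(u + x) mod int q \<in> tr y" using u eq by (auto simp: tr_def)
        then obtain v where v: "v \<in> A" "(u + x) mod int q = (v + y) mod int q" by (auto simp: tr_def)
        have "[u + x = v + y] (mod int q)" using v by (simp add: cong_def)
        then have "[u + x - y = v + y - y] (mod int q)" by (intro cong_diff cong_refl)
        then have "(u + (x - y)) mod int q = v mod int q" by (simp add: cong_def add_diff_eq)
        then show ?thesis using v A(1) by auto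
      qed
      then show False using residues_closed_under_unit_translation[OF A(1) A0 cop] False by auto
    qed
    then have "\<not> tr y \<subseteq> tr x" using ctr card_subset_eq[of "tr x" "tr y"] by metis
    then have "tr x \<subset> B" unfolding B_def by blast
    then have "card (tr x) < card B" by (intro psubset_card_mono) (simp_all add: B_def ctr(2))
    then show ?thesis using ctr A(2) insert.hyps by auto
  qed
  with B1 B3 show ?case by blast
qed

lemma rsum_lower:
  assumes p: "prime p" and k: "q = p ^ k" "k \<ge> 1" and eps: "0 < \<epsilon>" "\<epsilon> < 1"
    and J: "finite J" "\<And>r. r \<in> J \<Longrightarrow> bal_pmf p q \<epsilon> (\<mu> r)" "card J = q" and u: "u \<in> {0..<int q}"
  shows "pmf (rsum q J \<mu>) u \<ge> (\<epsilon> / q) ^ q"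
proof -
  obtain A where A: "A \<subseteq> {0..<int q}" "card A \<ge> min q (Suc (card J))" "\<forall>u\<in>A. pmf (rsum q J \<mu>) u \<ge> (\<epsilon> / q) ^ card J"
    using rsum_support[where \<mu>=\<mu>, OF p k eps J(1) J(2)] by auto
  have "card A = card {0..<int q}" using A(1,2) J card_mono[OF _ A(1)] by auto
  then have "A = {0..<int q}" using A(1) by (intro card_subset_eq) auto
  with A u J show ?thesis by auto
qed

text \<open>A Doeblin argument: each block of \<open>q\<close> summands contains the uniform distribution with weight at
least \<open>(\<epsilon> / q) ^ q\<close>, and only the rest of the mass can contribute to the oscillation.\<close>

lemma rsum_osc:
  assumes p: "prime p" and k: "q = p ^ k" "k \<ge> 1" and eps: "0 < \<epsilon>" "\<epsilon> < 1"
    and J: "finite J" "\<And>r. r \<in> J \<Longrightarrow> bal_pmf p q \<epsilon> (\<mu> r)" "card J \<ge> t * q"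
  shows "\<bar>pmf (rsum q J \<mu>) (u mod int q) - pmf (rsum q J \<mu>) (v mod int q)\<bar> \<le> (1 - (\<epsilon> / q) ^ q) ^ t"
  using J
proof (induction t arbitrary: J u v)
  case 0
  have "pmf (rsum q J \<mu>) x \<le> 1" "pmf (rsum q J \<mu>) x \<ge> 0" for x by (auto simp: pmf_le_1)
  then show ?case by (smt (verit) power_0)
next
  case (Suc t)
  have q2: "q \<ge> 2"
  proof -
    have p2: "p \<ge> 2" using p by (simp add: prime_ge_2_nat)
    have "p ^ 1 \<le> p ^ k" using p2 k by (intro power_increasing) auto
    then show ?thesis using p2 k by simp
  qed
  define \<gamma> where "\<gamma> = (\<epsilon> / q) ^ q"
  have g1: "0 \<le> \<gamma>" using eps by (simp add: \<gamma>_def)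
  obtain B where B: "B \<subseteq> J" "card B = q" using Suc.prems by (metis le_add1 mult_Suc obtain_subset_with_card_n order_trans)
  define A where "A = J - B"
  have fin: "finite A" "finite B" "B \<inter> A = {}" "B \<union> A = J" using B Suc.prems by (auto simp: A_def finite_subset)
  have cA: "card A \<ge> t * q" using B Suc.prems fin by (simp add: A_def card_Diff_subset)
  have IH: "\<bar>pmf (rsum q A \<mu>) (u mod int q) - pmf (rsum q A \<mu>) (v mod int q)\<bar> \<le> (1 - \<gamma>) ^ t" for u v
    unfolding \<gamma>_def using fin cA Suc.prems by (intro Suc.IH) (auto simp: A_def)
  have low: "pmf (rsum q B \<mu>) y \<ge> \<gamma>" if "y \<in> {0..<int q}" for y
    unfolding \<gamma>_def using B fin Suc.prems that by (intro rsum_lower[OF p k eps]) auto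
  have tot: "(\<Sum>y\<in>{0..<int q}. pmf (rsum q B \<mu>) y) = 1"
    using q2 set_rsum[of q B \<mu>] by (intro sum_pmf_eq_1) auto
  have split: "pmf (rsum q J \<mu>) (w mod int q) =
      (\<Sum>y\<in>{0..<int q}. (pmf (rsum q B \<mu>) y - \<gamma>) * pmf (rsum q A \<mu>) ((w - y) mod int q)) + \<gamma>" for w
  proof -
    have "pmf (rsum q J \<mu>) (w mod int q) = (\<Sum>y\<in>{0..<int q}. pmf (rsum q B \<mu>) y * pmf (rsum q A \<mu>) ((w - y) mod int q))"
      using pmf_rsum_Un[OF q2 fin(2,1,3), of \<mu> w] fin by simp
    also have "\<dots> = (\<Sum>y\<in>{0..<int q}. (pmf (rsum q B \<mu>) y - \<gamma>) * pmf (rsum q A \<mu>) ((w - y) mod int q))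
       + \<gamma> * (\<Sum>y\<in>{0..<int q}. pmf (rsum q A \<mu>) ((w - y) mod int q))"
      by (simp add: sum.distrib[symmetric] sum_distrib_left algebra_simps)
    finally show ?thesis using rsum_total[of q A \<mu> w] q2 by simp
  qed
  have "\<bar>pmf (rsum q J \<mu>) (u mod int q) - pmf (rsum q J \<mu>) (v mod int q)\<bar> =
     \<bar>\<Sum>y\<in>{0..<int q}. (pmf (rsum q B \<mu>) y - \<gamma>) * (pmf (rsum q A \<mu>) ((u - y) mod int q) - pmf (rsum q A \<mu>) ((v - y) mod int q))\<bar>"
    unfolding split by (simp add: sum_subtractf[symmetric] algebra_simps)
  also have "\<dots> \<le> (\<Sum>y\<in>{0..<int q}. (pmf (rsum q B \<mu>) y - \<gamma>) * (1 - \<gamma>) ^ t)"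
    by (intro order_trans[OF sum_abs] sum_mono) (use low IH in \<open>auto simp: abs_mult intro!: mult_mono\<close>)
  also have "\<dots> = (1 - q * \<gamma>) * (1 - \<gamma>) ^ t"
    by (simp add: sum_distrib_right[symmetric] sum_subtractf tot)
  also have "\<dots> \<le> (1 - \<gamma>) * (1 - \<gamma>) ^ t"
  proof (intro mult_right_mono)
    have "1 * \<gamma> \<le> q * \<gamma>" using q2 g1 by (intro mult_right_mono) auto
    then show "1 - real q * \<gamma> \<le> 1 - \<gamma>" by simp
    have "\<epsilon> / q \<le> 1" using eps q2 by (simp add: divide_le_eq)
    then have "\<gamma> \<le> 1" using eps by (auto simp: \<gamma>_def intro!: power_le_one)
    then show "(1 - \<gamma>) ^ t \<ge> 0" by simp
  qed
  finally show ?case by (simp add: \<gamma>_def)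
qed

lemma rsum_near_uniform:
  assumes p: "prime p" and k: "q = p ^ k" "k \<ge> 1" and eps: "0 < \<epsilon>" "\<epsilon> < 1"
    and J: "finite J" "\<And>r. r \<in> J \<Longrightarrow> bal_pmf p q \<epsilon> (\<mu> r)" "card J \<ge> t * q" and u: "u \<in> {0..<int q}"
  shows "\<bar>pmf (rsum q J \<mu>) u - 1 / q\<bar> \<le> (1 - (\<epsilon> / q) ^ q) ^ t"
proof -
  have q0: "q > 0" using u by auto
  define D where "D = (1 - (\<epsilon> / q) ^ q) ^ t"
  have tot: "(\<Sum>y\<in>{0..<int q}. pmf (rsum q J \<mu>) y) = 1"
    using q0 set_rsum[of q J \<mu>] by (intro sum_pmf_eq_1) auto
  have osc: "\<bar>pmf (rsum q J \<mu>) u - pmf (rsum q J \<mu>) v\<bar> \<le> D" if "v \<in> {0..<int q}" for v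
    using rsum_osc[where \<mu>=\<mu> and u=u and v=v, OF p k eps J(1) J(2) J(3)] u that by (simp add: D_def)
  have "q * (pmf (rsum q J \<mu>) u - 1 / q) = (\<Sum>v\<in>{0..<int q}. pmf (rsum q J \<mu>) u - pmf (rsum q J \<mu>) v)"
    using q0 by (simp add: sum_subtractf tot algebra_simps)
  then have "q * \<bar>pmf (rsum q J \<mu>) u - 1 / q\<bar> = \<bar>\<Sum>v\<in>{0..<int q}. pmf (rsum q J \<mu>) u - pmf (rsum q J \<mu>) v\<bar>"
    by (metis abs_mult abs_of_nat)
  also have "\<dots> \<le> (\<Sum>v\<in>{0..<int q}. D)" by (intro order_trans[OF sum_abs] sum_mono osc) auto
  also have "\<dots> = q * D" by simp
  finally show ?thesis using q0 by (simp add: D_def)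
qed

section \<open>Words with heavy values\<close>

lemma (in group) int_pow_mod:
  assumes "x \<in> carrier G" "x [^] q = \<one>"
  shows "x [^] (n mod int q) = x [^] n"
proof -
  have "x [^] n = x [^] (n mod int q + int q * (n div int q))" by simp
  also have "\<dots> = x [^] (n mod int q) \<otimes> x [^] (int q * (n div int q))"
    by (rule int_pow_mult[OF assms(1)])
  also have "x [^] (int q * (n div int q)) = (x [^] int q) [^] (n div int q)"
    using assms(1) by (simp add: int_pow_pow)
  also have "x [^] int q = \<one>" using assms by (simp add: int_pow_int)
  finally show ?thesis using assms by simp
qed

lemma (in comm_group) translation_invariant_on_generate:
  assumes S: "S \<subseteq> carrier G"
    and inv: "\<And>s h. s \<in> S \<Longrightarrow> h \<in> carrier G \<Longrightarrow> \<psi> (h \<otimes> s) = \<psi> h"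
    and k: "k \<in> generate G S" and h: "h \<in> carrier G"
  shows "\<psi> (h \<otimes> k) = \<psi> h"
  using k h
proof (induction arbitrary: h)
  case (inv s)
  then have s: "s \<in> S" "s \<in> carrier G" using S by auto
  have "\<psi> (h \<otimes> inv s) = \<psi> (h \<otimes> inv s \<otimes> s)" using assms(2)[OF s(1)] inv s by simp
  also have "h \<otimes> inv s \<otimes> s = h" using inv s by (simp add: m_assoc)
  finally show ?case .
next
  case (eng k1 k2)
  then have "k1 \<in> carrier G" "k2 \<in> carrier G" using generate_in_carrier[OF S] by auto
  with eng show ?case by (simp add: m_assoc[symmetric])
qed (use assms in auto)

lemma (in comm_group) sum_translate_subgroup:
  assumes "subgroup K G" "k \<in> K" "h \<in> carrier G"
  shows "(\<Sum>l\<in>K. \<phi> (h \<otimes> k \<otimes> l)) = (\<Sum>l\<in>K. \<phi> (h \<otimes> l))"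
proof -
  interpret K: subgroup K G by fact
  show ?thesis
    by (rule sum.reindex_bij_witness[of _ "\<lambda>l. inv k \<otimes> l" "\<lambda>l. k \<otimes> l"])
       (use assms in \<open>auto simp: m_assoc[symmetric]\<close>)
qed

text \<open>Averaging over the cosets of a subgroup and then over the powers of \<open>v\<close> gives a function that is
invariant under \<open>S\<close> and under \<open>v\<close>, hence under the subgroup that they generate. Such a function
equals its own average over this subgroup, and there the two averages agree.\<close>

lemma (in comm_group) generate_insert_average:
  assumes fin: "finite (carrier G)" and q: "q > 0" "v [^] q = \<one>" and v: "v \<in> carrier G" and S: "S \<subseteq> carrier G"
    and h: "h \<in> carrier G"
  shows "(\<Sum>t\<in>{0..<int q}. (\<Sum>k\<in>generate G S. \<phi> (h \<otimes> inv (v [^] t) \<otimes> k)) / card (generate G S)) / q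
       = ((\<Sum>k\<in>generate G (insert v S). \<phi> (h \<otimes> k)) / card (generate G (insert v S)) :: real)"
proof -
  define K where "K = generate G S"
  define K' where "K' = generate G (insert v S)"
  have K: "subgroup K G" unfolding K_def by (rule generate_is_subgroup[OF S])
  have K': "subgroup K' G" unfolding K'_def using S v by (intro generate_is_subgroup) auto
  interpret K: subgroup K G by fact
  interpret K': subgroup K' G by fact
  have KK': "K \<subseteq> K'" unfolding K_def K'_def by (intro mono_generate) auto
  have vK': "v \<in> K'" unfolding K'_def by (rule generate.incl) auto
  have fK: "finite K" "finite K'" using fin K.subset K'.subset finite_subset by auto
  have "K \<noteq> {}" "K' \<noteq> {}" using K.one_closed K'.one_closed by blast+
  then have cK: "card K > 0" "card K' > 0" using fK by (auto simp: card_gt_0_iff)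
  define \<psi> where "\<psi> h = (\<Sum>t\<in>{0..<int q}. \<Sum>k\<in>K. \<phi> (h \<otimes> inv (v [^] t) \<otimes> k))" for h
  have inv: "\<psi> (h \<otimes> s) = \<psi> h" if s: "s \<in> insert v S" and h: "h \<in> carrier G" for s h
  proof (cases "s \<in> S")
    case True
    then have sK: "s \<in> K" unfolding K_def by (rule generate.incl)
    then have sc: "s \<in> carrier G" by simp
    show ?thesis unfolding \<psi>_def
    proof (rule sum.cong[OF refl])
      fix t :: int
      have "h \<otimes> s \<otimes> inv (v [^] t) = h \<otimes> inv (v [^] t) \<otimes> s"
        using h sc v by (simp add: m_ac)
      then show "(\<Sum>k\<in>K. \<phi> (h \<otimes> s \<otimes> inv (v [^] t) \<otimes> k)) = (\<Sum>k\<in>K. \<phi> (h \<otimes> inv (v [^] t) \<otimes> k))"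
        using sum_translate_subgroup[OF K sK, of "h \<otimes> inv (v [^] t)" \<phi>] h v by simp
    qed
  next
    case False
    then have s: "s = v" using that by simp
    have e: "h \<otimes> v \<otimes> inv (v [^] t) = h \<otimes> inv (v [^] ((t - 1) mod int q))" for t :: int
    proof -
      have "v \<otimes> inv (v [^] t) = inv (v [^] (t - 1))"
        using v by (simp add: int_pow_diff inv_mult m_comm)
      then show ?thesis using v h q by (simp add: int_pow_mod m_assoc)
    qed
    show ?thesis unfolding \<psi>_def s e
      by (rule sum.reindex_bij_witness[of _ "\<lambda>t. (t + 1) mod int q" "\<lambda>t. (t - 1) mod int q"])
         (use q in \<open>auto simp: mod_simps\<close>)
  qed
  have inv': "\<psi> (h \<otimes> k) = \<psi> h" if "k \<in> K'" for k
    using translation_invariant_on_generate[of "insert v S" \<psi> k h] inv that S v h by (auto simp: K'_def)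
  have "card K' * \<psi> h = (\<Sum>l\<in>K'. \<psi> (h \<otimes> l))" using inv' by simp
  also have "\<dots> = (\<Sum>t\<in>{0..<int q}. \<Sum>k\<in>K. \<Sum>l\<in>K'. \<phi> (h \<otimes> l \<otimes> inv (v [^] t) \<otimes> k))"
    unfolding \<psi>_def by (subst sum.swap) (intro sum.cong refl sum.swap)
  also have "\<dots> = (\<Sum>t\<in>{0..<int q}. \<Sum>k\<in>K. \<Sum>l\<in>K'. \<phi> (h \<otimes> l))"
  proof (rule sum.cong[OF refl], rule sum.cong[OF refl])
    fix t :: int and k assume k: "k \<in> K"
    have vt: "v [^] t \<in> K'" for t :: int using subgroup_int_pow_closed[OF K' vK'] .
    have c: "inv (v [^] t) \<otimes> k \<in> K'" using vt[of t] k KK' by blast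
    have "h \<otimes> l \<otimes> inv (v [^] t) \<otimes> k = h \<otimes> (inv (v [^] t) \<otimes> k) \<otimes> l" if "l \<in> K'" for l
      using h that v k by (simp add: m_ac)
    then have "(\<Sum>l\<in>K'. \<phi> (h \<otimes> l \<otimes> inv (v [^] t) \<otimes> k)) = (\<Sum>l\<in>K'. \<phi> (h \<otimes> (inv (v [^] t) \<otimes> k) \<otimes> l))"
      by (intro sum.cong) auto
    also have "\<dots> = (\<Sum>l\<in>K'. \<phi> (h \<otimes> l))" by (rule sum_translate_subgroup[OF K' c h])
    finally show "(\<Sum>l\<in>K'. \<phi> (h \<otimes> l \<otimes> inv (v [^] t) \<otimes> k)) = (\<Sum>l\<in>K'. \<phi> (h \<otimes> l))" .
  qed
  also have "\<dots> = q * card K * (\<Sum>l\<in>K'. \<phi> (h \<otimes> l))" by simp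
  finally have "card K' * \<psi> h = q * card K * (\<Sum>l\<in>K'. \<phi> (h \<otimes> l))" .
  moreover have "(\<Sum>t\<in>{0..<int q}. (\<Sum>k\<in>K. \<phi> (h \<otimes> inv (v [^] t) \<otimes> k)) / card K) / q = \<psi> h / (q * card K)"
    by (simp add: \<psi>_def sum_divide_distrib mult.commute)
  moreover have "\<psi> h / (q * card K) = (\<Sum>l\<in>K'. \<phi> (h \<otimes> l)) / card K'"
    using cK q calculation(1) by (simp add: field_simps)
  ultimately show ?thesis unfolding K_def[symmetric] K'_def[symmetric] by simp
qed

lemma (in comm_group) word_pmf_const:
  assumes v: "v \<in> carrier G" "v [^] q = \<one>" and "q > 0" "finite J" "\<And>r. r \<in> J \<Longrightarrow> g r = v"
  shows "word_pmf G J g \<mu> = map_pmf (\<lambda>t. v [^] t) (rsum q J \<mu>)"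
proof -
  have "word G J g = (\<lambda>x. v [^] ((\<Sum>r\<in>J. x r) mod int q))"
    using assms by (auto simp: int_pow_mod word_const)
  then show ?thesis by (simp add: word_pmf_def rsum_def pmf.map_comp o_def)
qed

lemma (in comm_group) pmf_word_split_const:
  assumes fin: "finite (carrier G)" and q: "q > 0" "v [^] q = \<one>" and v: "v \<in> carrier G"
    and A: "finite A" "finite B" "A \<inter> B = {}" "g \<in> A \<union> B \<rightarrow> carrier G" "\<And>r. r \<in> A \<Longrightarrow> g r = v" and h: "h \<in> carrier G"
  shows "pmf (word_pmf G (A \<union> B) g \<mu>) h = (\<Sum>t\<in>{0..<int q}. pmf (rsum q A \<mu>) t * pmf (word_pmf G B g \<mu>) (h \<otimes> inv (v [^] t)))"
proof -
  have gB: "g \<in> B \<rightarrow> carrier G" using A(4) by auto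
  have "word_pmf G (A \<union> B) g \<mu> = map_pmf (\<lambda>(t, w). v [^] t \<otimes> w) (pair_pmf (rsum q A \<mu>) (word_pmf G B g \<mu>))"
    unfolding word_pmf_Un[OF A(1-4)] using word_pmf_const[OF v q(2,1) A(1) A(5), where \<mu>=\<mu>]
    by (simp add: pair_map_pmf1 pmf.map_comp o_def case_prod_unfold)
  also have "pmf \<dots> h = (\<Sum>t\<in>{0..<int q}. pmf (rsum q A \<mu>) t * measure_pmf.prob (word_pmf G B g \<mu>) {w. v [^] t \<otimes> w = h})"
    by (rule pmf_map_pair) (use set_rsum[OF q(1)] in auto)
  also have "\<dots> = (\<Sum>t\<in>{0..<int q}. pmf (rsum q A \<mu>) t * pmf (word_pmf G B g \<mu>) (h \<otimes> inv (v [^] t)))"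
  proof (intro sum.cong refl arg_cong2[where f="(*)"])
    fix t :: int
    have "measure_pmf.prob (word_pmf G B g \<mu>) {w. v [^] t \<otimes> w = h} = measure_pmf.prob (word_pmf G B g \<mu>) {h \<otimes> inv (v [^] t)}"
    proof (rule measure_prob_cong_0)
      fix x assume x: "x \<in> {w. v [^] t \<otimes> w = h} - {h \<otimes> inv (v [^] t)}"
      have "x \<notin> carrier G" using x v by (auto simp: m_assoc m_comm[of "v [^] t"])
      then show "pmf (word_pmf G B g \<mu>) x = 0" using set_word_pmf[OF gB, of \<mu>] by (auto simp: pmf_eq_0_set_pmf)
    next
      fix x assume "x \<in> {h \<otimes> inv (v [^] t)} - {w. v [^] t \<otimes> w = h}"
      then have "False" using v h by (auto simp: m_lcomm)
      then show "pmf (word_pmf G B g \<mu>) x = 0" ..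
    qed
    then show "measure_pmf.prob (word_pmf G B g \<mu>) {w. v [^] t \<otimes> w = h} = pmf (word_pmf G B g \<mu>) (h \<otimes> inv (v [^] t))"
      by (simp add: measure_pmf_single)
  qed
  finally show ?thesis .
qed

text \<open>The heavy values are removed one at a time. The exponents of the factors with value \<open>v\<close> add up to
a residue whose law is uniform up to the factor \<open>1 \<plusminus> \<eta>\<close>, so the removal of \<open>v\<close> replaces the law of
the remaining word by its average over the powers of \<open>v\<close>.\<close>

lemma (in comm_group) heavy_word_aux:
  assumes fin: "finite (carrier G)" and q: "q > 0" "\<And>v. v \<in> carrier G \<Longrightarrow> v [^] q = \<one>"
    and \<eta>: "0 \<le> \<eta>" "\<eta> \<le> 1"
    and "finite S" "S \<subseteq> carrier G" "finite J" "g \<in> J \<rightarrow> carrier G" "h \<in> carrier G"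
    and "\<And>v t. v \<in> S \<Longrightarrow> t \<in> {0..<int q} \<Longrightarrow> \<bar>pmf (rsum q {r\<in>J. g r = v} \<mu>) t - 1 / q\<bar> \<le> \<eta> / q"
  shows "(1 - \<eta>) ^ card S * ((\<Sum>k\<in>generate G S. pmf (word_pmf G {r\<in>J. g r \<notin> S} g \<mu>) (h \<otimes> k)) / card (generate G S))
        \<le> pmf (word_pmf G J g \<mu>) h \<and>
    pmf (word_pmf G J g \<mu>) h \<le>
     (1 + \<eta>) ^ card S * ((\<Sum>k\<in>generate G S. pmf (word_pmf G {r\<in>J. g r \<notin> S} g \<mu>) (h \<otimes> k)) / card (generate G S))"
  using assms(6-)
proof (induction S arbitrary: J h rule: finite_induct)
  case empty
  have "generate G {} = {\<one>}" by (rule generate_empty)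
  then show ?case using empty by simp
next
  case (insert v S)
  define A where "A = {r\<in>J. g r = v}"
  define B where "B = {r\<in>J. g r \<noteq> v}"
  have AB: "finite A" "finite B" "A \<inter> B = {}" "A \<union> B = J" using insert.prems by (auto simp: A_def B_def)
  have v: "v \<in> carrier G" and S: "S \<subseteq> carrier G" using insert.prems by auto
  have gB: "g \<in> B \<rightarrow> carrier G" using insert.prems by (auto simp: B_def)
  have eq: "{r\<in>B. g r \<notin> S} = {r\<in>J. g r \<notin> insert v S}" by (auto simp: B_def)
  define \<phi> where "\<phi> = pmf (word_pmf G {r\<in>J. g r \<notin> insert v S} g \<mu>)"
  define f where "f t = pmf (word_pmf G B g \<mu>) (h \<otimes> inv (v [^] t))" for t :: int
  define a where "a t = (\<Sum>k\<in>generate G S. \<phi> (h \<otimes> inv (v [^] t) \<otimes> k)) / card (generate G S)" for t :: int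
  have IH: "(1 - \<eta>) ^ card S * a t \<le> f t \<and> f t \<le> (1 + \<eta>) ^ card S * a t" for t
  proof -
    have Bv: "{r\<in>B. g r = v'} = {r\<in>J. g r = v'}" if "v' \<in> S" for v' using that insert.hyps by (auto simp: B_def)
    show ?thesis
      using insert.IH[of B "h \<otimes> inv (v [^] t)"] S AB gB insert.prems v Bv by (simp add: f_def a_def \<phi>_def eq)
  qed
  have w: "(1 - \<eta>) / q \<le> pmf (rsum q A \<mu>) t" "pmf (rsum q A \<mu>) t \<le> (1 + \<eta>) / q" if "t \<in> {0..<int q}" for t
    using insert.prems(5)[of v t] that by (auto simp: A_def abs_le_iff diff_divide_distrib add_divide_distrib)
  have gAB: "g \<in> A \<union> B \<rightarrow> carrier G" unfolding AB(4) by (rule insert.prems(3))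
  have gA: "g r = v" if "r \<in> A" for r using that by (simp add: A_def)
  have split: "pmf (word_pmf G J g \<mu>) h = (\<Sum>t\<in>{0..<int q}. pmf (rsum q A \<mu>) t * f t)"
    using pmf_word_split_const[OF fin q(1) q(2)[OF v] v AB(1) AB(2) AB(3) gAB gA insert.prems(4), of \<mu>]
    unfolding AB(4) f_def .
  have avg: "(\<Sum>t\<in>{0..<int q}. a t) / q = (\<Sum>k\<in>generate G (insert v S). \<phi> (h \<otimes> k)) / card (generate G (insert v S))"
    unfolding a_def by (rule generate_insert_average[OF fin q(1) q(2)[OF v] v S]) (use insert.prems in auto)
  have a0: "a t \<ge> 0" for t unfolding a_def \<phi>_def by (auto intro!: divide_nonneg_nonneg sum_nonneg)
  have f0: "f t \<ge> 0" for t by (simp add: f_def)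
  have "(1 - \<eta>) ^ card (insert v S) * ((\<Sum>t\<in>{0..<int q}. a t) / q) = (\<Sum>t\<in>{0..<int q}. (1 - \<eta>) / q * ((1 - \<eta>) ^ card S * a t))"
    using insert.hyps by (simp add: sum_distrib_left sum_divide_distrib ac_simps)
  also have "\<dots> \<le> (\<Sum>t\<in>{0..<int q}. pmf (rsum q A \<mu>) t * f t)"
    using w IH a0 \<eta> by (intro sum_mono mult_mono) auto
  finally have lo: "(1 - \<eta>) ^ card (insert v S) * ((\<Sum>t\<in>{0..<int q}. a t) / q) \<le> pmf (word_pmf G J g \<mu>) h" unfolding split .
  have "(\<Sum>t\<in>{0..<int q}. pmf (rsum q A \<mu>) t * f t) \<le> (\<Sum>t\<in>{0..<int q}. (1 + \<eta>) / q * ((1 + \<eta>) ^ card S * a t))"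
    using w IH f0 \<eta> by (intro sum_mono mult_mono) auto
  also have "\<dots> = (1 + \<eta>) ^ card (insert v S) * ((\<Sum>t\<in>{0..<int q}. a t) / q)"
    using insert.hyps by (simp add: sum_distrib_left sum_divide_distrib ac_simps)
  finally show ?case using lo unfolding split avg \<phi>_def by blast
qed

lemma prob_pair_pmf:
  "measure_pmf.prob (pair_pmf M N) {z. Q (fst z) (snd z)} = (\<integral>x. measure_pmf.prob N {y. Q x y} \<partial>measure_pmf M)"
proof -
  have "measure_pmf.prob (pair_pmf M N) {z. Q (fst z) (snd z)} = pmf (map_pmf (\<lambda>z. Q (fst z) (snd z)) (pair_pmf M N)) True"
    by (simp add: pmf_map vimage_def)
  also have "map_pmf (\<lambda>z. Q (fst z) (snd z)) (pair_pmf M N) = bind_pmf M (\<lambda>x. map_pmf (Q x) N)"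
    unfolding pair_pmf_def map_pmf_def by (simp add: bind_assoc_pmf bind_return_pmf)
  finally show ?thesis by (simp add: pmf_bind pmf_map vimage_def)
qed

lemma Pi_pmf_prob_subset:
  assumes "finite A" "A' \<subseteq> A" "\<And>x y. (\<And>r. r \<in> A' \<Longrightarrow> x r = y r) \<Longrightarrow> Q x \<longleftrightarrow> Q y"
  shows "measure_pmf.prob (Pi_pmf A d \<mu>) {x. Q x} = measure_pmf.prob (Pi_pmf A' d \<mu>) {x. Q x}"
proof -
  have "measure_pmf.prob (Pi_pmf A' d \<mu>) {x. Q x} =
      measure_pmf.prob (Pi_pmf A d \<mu>) {x. Q (\<lambda>r. if r \<in> A' then x r else d)}"
    by (subst Pi_pmf_subset[OF assms(1,2)]) (simp add: vimage_def)
  also have "{x. Q (\<lambda>r. if r \<in> A' then x r else d)} = {x. Q x}"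
    by (intro Collect_cong assms(3)) auto
  finally show ?thesis ..
qed

lemma (in group) subgroup_mult_right_iff:
  assumes "subgroup K G" "a \<in> carrier G" "b \<in> K"
  shows "a \<otimes> b \<in> K \<longleftrightarrow> a \<in> K"
proof
  interpret K: subgroup K G by fact
  assume "a \<otimes> b \<in> K"
  then have "a \<otimes> b \<otimes> inv b \<in> K" using assms by simp
  then show "a \<in> K" using assms by (simp add: m_assoc)
qed (use assms in \<open>simp add: subgroup.m_closed\<close>)

text \<open>After all heavy values have been used, the word is uniform on each coset of the subgroup \<open>K\<close> that
they generate, and the coset itself depends only on the exceptional positions \<open>E\<close>, where the value
lies outside \<open>K\<close>.\<close>

lemma (in comm_group) heavy_word:
  assumes fin: "finite (carrier G)" and q: "q > 0" "\<And>v. v \<in> carrier G \<Longrightarrow> v [^] q = \<one>"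
    and \<eta>: "0 \<le> \<eta>" "\<eta> \<le> 1"
    and S: "S \<subseteq> carrier G" and J: "finite J" "g \<in> J \<rightarrow> carrier G" and h: "h \<in> carrier G"
    and near: "\<And>v t. v \<in> S \<Longrightarrow> t \<in> {0..<int q} \<Longrightarrow> \<bar>pmf (rsum q {r\<in>J. g r = v} \<mu>) t - 1 / q\<bar> \<le> \<eta> / q"
    and K: "K = generate G S" and E: "E = {r\<in>J. g r \<notin> K}"
    and nu: "\<nu> = measure_pmf.prob (Pi_pmf E 0 \<mu>) {x. word G E g x \<otimes> inv h \<in> K} / card K"
  shows "(1 - \<eta>) ^ card (carrier G) * \<nu> \<le> pmf (word_pmf G J g \<mu>) h"
    and "pmf (word_pmf G J g \<mu>) h \<le> (1 + \<eta>) ^ card (carrier G) * \<nu>"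
proof -
  have finS: "finite S" using S fin finite_subset by blast
  have Ksub: "subgroup K G" unfolding K by (rule generate_is_subgroup[OF S])
  interpret K: subgroup K G by fact
  have finK: "finite K" using fin K.subset finite_subset by auto
  define J0 where "J0 = {r\<in>J. g r \<notin> S}"
  have SK: "S \<subseteq> K" unfolding K by (auto intro: generate.incl)
  have EJ: "E \<subseteq> J0" "finite J0" "finite E" using J SK by (auto simp: E J0_def)
  have g: "g \<in> J0 \<rightarrow> carrier G" "g \<in> E \<rightarrow> carrier G" using J by (auto simp: J0_def E)
  have coset: "w \<in> (\<lambda>k. h \<otimes> k) ` K \<longleftrightarrow> w \<otimes> inv h \<in> K" if w: "w \<in> carrier G" for w
  proof
    assume "w \<otimes> inv h \<in> K"
    moreover have "w = h \<otimes> (w \<otimes> inv h)" using w h by (simp add: m_lcomm[of h w])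
    ultimately show "w \<in> (\<lambda>k. h \<otimes> k) ` K" by blast
  next
    assume "w \<in> (\<lambda>k. h \<otimes> k) ` K"
    then obtain k where k: "k \<in> K" "w = h \<otimes> k" by auto
    then have "w \<otimes> inv h = k" using h by (simp add: m_comm[of h] m_assoc)
    with k show "w \<otimes> inv h \<in> K" by simp
  qed
  have step: "word G J0 g x \<otimes> inv h \<in> K \<longleftrightarrow> word G E g x \<otimes> inv h \<in> K" for x
  proof -
    have J0: "J0 = E \<union> (J0 - E)" using EJ by auto
    have "word G J0 g x = word G E g x \<otimes> word G (J0 - E) g x"
      by (subst J0, rule word_Un) (use EJ g in auto)
    moreover have wK: "word G (J0 - E) g x \<in> K"
      by (rule word_in_subgroup[OF Ksub]) (use EJ in \<open>auto simp: E J0_def\<close>)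
    ultimately have e: "word G J0 g x \<otimes> inv h = (word G E g x \<otimes> inv h) \<otimes> word G (J0 - E) g x"
      using g h by (simp add: m_ac)
    show ?thesis unfolding e using wK g h by (intro subgroup_mult_right_iff[OF Ksub]) auto
  qed
  have "(\<Sum>k\<in>K. pmf (word_pmf G J0 g \<mu>) (h \<otimes> k)) = (\<Sum>w\<in>(\<lambda>k. h \<otimes> k) ` K. pmf (word_pmf G J0 g \<mu>) w)"
    using h by (subst sum.reindex) (auto simp: inj_on_def)
  also have "\<dots> = measure_pmf.prob (word_pmf G J0 g \<mu>) ((\<lambda>k. h \<otimes> k) ` K)"
    using finK by (simp add: measure_measure_pmf_finite)
  also have "\<dots> = measure_pmf.prob (Pi_pmf J0 0 \<mu>) {x. word G J0 g x \<otimes> inv h \<in> K}"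
    using coset word_closed[OF g(1)] by (simp add: word_pmf_def vimage_def)
  also have "\<dots> = measure_pmf.prob (Pi_pmf J0 0 \<mu>) {x. word G E g x \<otimes> inv h \<in> K}" by (simp only: step)
  also have "\<dots> = measure_pmf.prob (Pi_pmf E 0 \<mu>) {x. word G E g x \<otimes> inv h \<in> K}"
    using word_cong[OF g(2), of g] by (intro Pi_pmf_prob_subset EJ) metis
  finally have nu': "\<nu> = (\<Sum>k\<in>K. pmf (word_pmf G J0 g \<mu>) (h \<otimes> k)) / card K" by (simp add: nu)
  have nu0: "\<nu> \<ge> 0" by (simp add: nu)
  note aux = heavy_word_aux[OF fin q \<eta> finS S J h near, folded J0_def K, folded nu']
  have cS: "card S \<le> card (carrier G)" using S fin by (rule card_mono[rotated])
  have "(1 - \<eta>) ^ card (carrier G) * \<nu> \<le> (1 - \<eta>) ^ card S * \<nu>"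
    using nu0 \<eta> cS by (intro mult_right_mono power_decreasing) auto
  then show "(1 - \<eta>) ^ card (carrier G) * \<nu> \<le> pmf (word_pmf G J g \<mu>) h" using aux by linarith
  have "(1 + \<eta>) ^ card S * \<nu> \<le> (1 + \<eta>) ^ card (carrier G) * \<nu>"
    using nu0 \<eta> cS by (intro mult_right_mono power_increasing) auto
  then show "pmf (word_pmf G J g \<mu>) h \<le> (1 + \<eta>) ^ card (carrier G) * \<nu>" using aux by linarith
qed

lemma (in comm_group) mult_inv_cancel:
  assumes "x \<in> carrier G" "a \<in> carrier G" "b \<in> carrier G"
  shows "x \<otimes> a \<otimes> inv (x \<otimes> b) = a \<otimes> inv b"
    and "a \<otimes> x \<otimes> inv (b \<otimes> x) = a \<otimes> inv b"
proof -
  have "x \<otimes> a \<otimes> inv (x \<otimes> b) = (x \<otimes> inv x) \<otimes> (a \<otimes> inv b)"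
    using assms by (simp add: inv_mult m_ac del: r_inv l_inv)
  then show "x \<otimes> a \<otimes> inv (x \<otimes> b) = a \<otimes> inv b" using assms by simp
  then show "a \<otimes> x \<otimes> inv (b \<otimes> x) = a \<otimes> inv b" using assms by (simp add: m_comm)
qed

section \<open>Column events for a fixed finite group\<close>

locale torsion_model = comm_group G for G (structure) +
  fixes p k q :: nat and \<epsilon> :: real
  assumes fin: "finite (carrier G)" and prime: "prime p" and q_def: "q = p ^ k" and k_pos: "k \<ge> 1"
    and exponent: "\<And>v. v \<in> carrier G \<Longrightarrow> v [^] q = \<one>"
    and eps: "0 < \<epsilon>" "\<epsilon> < 1"
begin

lemma q_ge_2: "q \<ge> 2"
proof -
  have p2: "p \<ge> 2" using prime by (simp add: prime_ge_2_nat)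
  have "p ^ 1 \<le> p ^ k" using p2 k_pos by (intro power_increasing) auto
  then show ?thesis using p2 q_def by simp
qed

lemma card_carrier_pos: "card (carrier G) > 0" using fin one_closed by (auto simp: card_gt_0_iff)

text \<open>The factor by which \<open>q\<close> further balanced summands reduce the oscillation of the law of a sum of
residues.\<close>

definition rate :: real where "rate = 1 - (\<epsilon> / q) ^ q"

lemma rate: "0 \<le> rate" "rate < 1"
proof -
  have "\<epsilon> / q > 0" "\<epsilon> / q \<le> 1" using eps q_ge_2 by (auto simp: divide_le_eq)
  then show "0 \<le> rate" "rate < 1" unfolding rate_def by (auto intro!: power_le_one)
qed

definition heavy_span :: "nat \<Rightarrow> 'i set \<Rightarrow> ('i \<Rightarrow> 'a) \<Rightarrow> 'a set" where
  "heavy_span w J F = generate G {v\<in>carrier G. w \<le> card {r\<in>J. F r = v}}"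

lemma heavy_span_subgroup: "subgroup (heavy_span w J F) G"
  unfolding heavy_span_def by (rule generate_is_subgroup) auto

lemma card_outside_heavy_span:
  assumes "finite J" "F \<in> J \<rightarrow> carrier G"
  shows "card {r\<in>J. F r \<notin> heavy_span w J F} \<le> card (carrier G) * w"
proof -
  let ?C = "{v\<in>carrier G. v \<notin> heavy_span w J F}"
  have finC: "finite ?C" using fin by auto
  have "{r\<in>J. F r \<notin> heavy_span w J F} = (\<Union>v\<in>?C. {r\<in>J. F r = v})" using assms by auto
  then have "card {r\<in>J. F r \<notin> heavy_span w J F} \<le> (\<Sum>v\<in>?C. card {r\<in>J. F r = v})"
    using card_UN_le[OF finC, of "\<lambda>v. {r\<in>J. F r = v}"] by simp
  also have "\<dots> \<le> (\<Sum>v\<in>?C. w)"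
  proof (rule sum_mono)
    fix v assume v: "v \<in> ?C"
    have "\<not> w \<le> card {r\<in>J. F r = v}"
    proof
      assume "w \<le> card {r\<in>J. F r = v}"
      then have "v \<in> heavy_span w J F" unfolding heavy_span_def using v by (intro generate.incl) auto
      then show False using v by simp
    qed
    then show "card {r\<in>J. F r = v} \<le> w" by simp
  qed
  also have "\<dots> \<le> card (carrier G) * w" using fin by (auto intro!: mult_right_mono card_mono)
  finally show ?thesis .
qed

lemma word_heavy_bounds:
  assumes J: "finite J" "F \<in> J \<rightarrow> carrier G" "\<And>r. r \<in> J \<Longrightarrow> bal_pmf p q \<epsilon> (\<mu> r)"
    and h: "h \<in> carrier G" and w: "t * q \<le> w" and eta: "\<eta> = q * rate ^ t" "\<eta> \<le> 1"
    and K: "K = heavy_span w J F" and E: "E = {r\<in>J. F r \<notin> K}"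
    and nu: "\<nu> = measure_pmf.prob (Pi_pmf E 0 \<mu>) {x. word G E F x \<otimes> inv h \<in> K} / card K"
  shows "(1 - \<eta>) ^ card (carrier G) * \<nu> \<le> pmf (word_pmf G J F \<mu>) h"
    and "pmf (word_pmf G J F \<mu>) h \<le> (1 + \<eta>) ^ card (carrier G) * \<nu>"
proof -
  let ?S = "{v\<in>carrier G. w \<le> card {r\<in>J. F r = v}}"
  have near: "\<bar>pmf (rsum q {r\<in>J. F r = v} \<mu>) u - 1 / q\<bar> \<le> \<eta> / q" if "v \<in> ?S" "u \<in> {0..<int q}" for v u
  proof -
    have "\<bar>pmf (rsum q {r\<in>J. F r = v} \<mu>) u - 1 / q\<bar> \<le> (1 - (\<epsilon> / q) ^ q) ^ t"
    proof (rule rsum_near_uniform[OF prime q_def k_pos eps])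
      show "finite {r\<in>J. F r = v}" using J(1) by simp
      show "bal_pmf p q \<epsilon> (\<mu> r)" if "r \<in> {r\<in>J. F r = v}" for r using J(3) that by simp
      show "t * q \<le> card {r\<in>J. F r = v}" using w that(1) by simp
    qed (rule that(2))
    then show ?thesis using eta q_ge_2 by (simp add: rate_def)
  qed
  have eta0: "0 \<le> \<eta>" using eta rate by simp
  have S: "?S \<subseteq> carrier G" by auto
  have q0: "q > 0" using q_ge_2 by simp
  show "(1 - \<eta>) ^ card (carrier G) * \<nu> \<le> pmf (word_pmf G J F \<mu>) h"
    by (rule heavy_word(1)[OF fin q0 exponent eta0 eta(2) S J(1,2) h near K[unfolded heavy_span_def] E nu])
  show "pmf (word_pmf G J F \<mu>) h \<le> (1 + \<eta>) ^ card (carrier G) * \<nu>"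
    by (rule heavy_word(2)[OF fin q0 exponent eta0 eta(2) S J(1,2) h near K[unfolded heavy_span_def] E nu])
qed

lemma int_pow_in_subgroup_coprime:
  assumes "subgroup K G" "v \<in> carrier G" "v [^] (c::int) \<in> K" "\<not> int p dvd c"
  shows "v \<in> K"
proof -
  have "coprime (int p) c" using prime assms(4) by (simp add: prime_imp_coprime)
  then have "coprime c (int q)" using q_def by (simp add: coprime_commute)
  then obtain s where s: "[c * s = 1] (mod int q)" using cong_solve_coprime_int by blast
  have "v [^] (c * s) = v [^] ((c * s) mod int q)" using assms exponent by (simp add: int_pow_mod)
  also have "\<dots> = v [^] (1 mod int q)" using s by (simp add: cong_def)
  also have "\<dots> = v" using assms(2) q_ge_2 by simp
  finally have "(v [^] c) [^] s = v" using assms(2) by (simp add: int_pow_pow)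
  moreover have "(v [^] c) [^] s \<in> K" using assms(1,3) by (rule subgroup_int_pow_closed)
  ultimately show ?thesis by simp
qed

text \<open>Two solutions differ by an element of \<open>K1\<close> whose \<open>c\<close>-th power lies in \<open>K2\<close>. If \<open>c\<close> is a unit modulo
\<open>p\<close>, then \<open>c\<close> is invertible modulo the exponent \<open>q\<close> and the element itself lies in \<open>K2\<close>.\<close>

lemma card_power_solutions:
  assumes K1: "subgroup K1 G" and K2: "subgroup K2 G" and x: "x \<in> carrier G"
  shows "card {f\<in>K1. x \<otimes> f [^] (c::int) \<in> K2} \<le> (if int p dvd c then card K1 else card (K1 \<inter> K2))"
proof -
  interpret K1: subgroup K1 G by fact
  interpret K2: subgroup K2 G by fact
  have finK: "finite K1" using fin K1.subset finite_subset by auto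
  show ?thesis
  proof (cases "int p dvd c")
    case True
    then show ?thesis using finK by (auto intro!: card_mono)
  next
    case False
    let ?A = "{f\<in>K1. x \<otimes> f [^] c \<in> K2}"
    show ?thesis
    proof (cases "?A = {}")
      case False
      then obtain f0 where f0: "f0 \<in> K1" "x \<otimes> f0 [^] c \<in> K2" by auto
      have "f \<otimes> inv f0 \<in> K1 \<inter> K2" if f: "f \<in> K1" "x \<otimes> f [^] c \<in> K2" for f
      proof -
        have "(x \<otimes> f [^] c) \<otimes> inv (x \<otimes> f0 [^] c) \<in> K2" using f f0 by simp
        also have "(x \<otimes> f [^] c) \<otimes> inv (x \<otimes> f0 [^] c) = f [^] c \<otimes> inv (f0 [^] c)"
          using x f f0 by (intro mult_inv_cancel) auto
        also have "f [^] c \<otimes> inv (f0 [^] c) = (f \<otimes> inv f0) [^] c"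
          using f f0 by (simp add: int_pow_distrib int_pow_inv)
        finally have "f \<otimes> inv f0 \<in> K2"
          using int_pow_in_subgroup_coprime[OF K2, of "f \<otimes> inv f0" c] f f0 \<open>\<not> int p dvd c\<close> by auto
        then show ?thesis using f f0 by simp
      qed
      then have sub: "(\<lambda>f. f \<otimes> inv f0) ` ?A \<subseteq> K1 \<inter> K2" by auto
      have "card ?A = card ((\<lambda>f. f \<otimes> inv f0) ` ?A)"
        using f0 by (intro card_image[symmetric]) (auto simp: inj_on_def)
      also have "\<dots> \<le> card (K1 \<inter> K2)" using finK sub by (intro card_mono) auto
      finally show ?thesis using \<open>\<not> int p dvd c\<close> by simp
    next
      case True
      show ?thesis unfolding True by simp
    qed
  qed
qed

text \<open>With the other exponents fixed, membership in the coset determines the exponent of \<open>F r\<close> modulo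
\<open>p\<close>, and a balanced residue takes a given value modulo \<open>p\<close> with probability at most \<open>1 - \<epsilon>\<close>.\<close>

lemma prob_word_in_coset:
  assumes E: "finite E" "F \<in> E \<rightarrow> carrier G" "\<And>r. r \<in> E \<Longrightarrow> bal_pmf p q \<epsilon> (\<mu> r)"
    and r: "r \<in> E" "F r \<notin> K" and K: "subgroup K G" and b: "b \<in> carrier G"
  shows "measure_pmf.prob (Pi_pmf E 0 \<mu>) {x. word G E F x \<otimes> b \<in> K} \<le> 1 - \<epsilon>"
proof -
  interpret K: subgroup K G by fact
  define E' where "E' = E - {r}"
  have E': "finite E'" "r \<notin> E'" "E = insert r E'" using E r by (auto simp: E'_def)
  have Fr: "F r \<in> carrier G" and F': "F \<in> E' \<rightarrow> carrier G" using E r by (auto simp: E'_def)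
  have single: "measure_pmf.prob (\<mu> r) {t. F r [^] t \<otimes> u \<in> K} \<le> 1 - \<epsilon>" if u: "u \<in> carrier G" for u
  proof (cases "\<exists>t::int. F r [^] t \<otimes> u \<in> K")
    case True
    then obtain t0 :: int where t0: "F r [^] t0 \<otimes> u \<in> K" by auto
    have "t mod int p = t0 mod int p" if t: "F r [^] t \<otimes> u \<in> K" for t
    proof -
      have "(F r [^] t \<otimes> u) \<otimes> inv (F r [^] t0 \<otimes> u) \<in> K" using t t0 by simp
      also have "(F r [^] t \<otimes> u) \<otimes> inv (F r [^] t0 \<otimes> u) = F r [^] t \<otimes> inv (F r [^] t0)"
        using u Fr by (intro mult_inv_cancel) auto
      also have "\<dots> = F r [^] (t - t0)" using Fr by (simp add: int_pow_diff)
      finally have "int p dvd t - t0" using int_pow_in_subgroup_coprime[OF K Fr] r by blast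
      then show ?thesis by (simp add: mod_eq_dvd_iff)
    qed
    then have "measure_pmf.prob (\<mu> r) {t. F r [^] t \<otimes> u \<in> K} \<le> measure_pmf.prob (\<mu> r) {t. t mod int p = t0 mod int p}"
      by (intro measure_pmf.finite_measure_mono) auto
    also have "\<dots> \<le> 1 - \<epsilon>" using E(3)[OF r(1)] by (auto simp: bal_pmf_def)
    finally show ?thesis .
  qed (use eps in auto)
  have wi: "word G E F (f(r := t)) \<otimes> b = F r [^] t \<otimes> (word G E' F f \<otimes> b)" for f t
  proof -
    have "word G E F (f(r := t)) = F r [^] t \<otimes> word G E' F (f(r := t))"
      unfolding E'(3) using word_insert[OF E'(1,2), of F "f(r := t)"] Fr F' by auto
    also have "word G E' F (f(r := t)) = word G E' F f"
      by (rule word_cong) (use F' E' in auto)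
    finally have w: "word G E F (f(r := t)) = F r [^] t \<otimes> word G E' F f" .
    show ?thesis unfolding w using Fr F' b by (simp add: m_assoc)
  qed
  have "Pi_pmf E 0 \<mu> = map_pmf (\<lambda>(f, x). f(r := x)) (pair_pmf (Pi_pmf E' 0 \<mu>) (\<mu> r))"
    unfolding E'(3) using Pi_pmf_insert[OF E'(1,2), of 0 \<mu>] pair_commute_pmf[of "\<mu> r" "Pi_pmf E' 0 \<mu>"]
    by (simp add: pmf.map_comp o_def case_prod_unfold)
  then have "measure_pmf.prob (Pi_pmf E 0 \<mu>) {x. word G E F x \<otimes> b \<in> K} =
     measure_pmf.prob (pair_pmf (Pi_pmf E' 0 \<mu>) (\<mu> r)) {z. F r [^] snd z \<otimes> (word G E' F (fst z) \<otimes> b) \<in> K}"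
    by (simp add: vimage_def case_prod_unfold wi)
  also have "\<dots> = measure_pmf.expectation (Pi_pmf E' 0 \<mu>) (\<lambda>f. measure_pmf.prob (\<mu> r) {t. F r [^] t \<otimes> (word G E' F f \<otimes> b) \<in> K})"
    by (rule prob_pair_pmf)
  also have "\<dots> \<le> measure_pmf.expectation (Pi_pmf E' 0 \<mu>) (\<lambda>f. 1 - \<epsilon>)"
    by (intro integral_mono measure_pmf.integrable_const_bound[where B=1] AE_pmfI) (use single F' b eps in auto)
  also have "\<dots> = 1 - \<epsilon>" by simp
  finally show ?thesis .
qed

end

section \<open>Summation over the generating tuples of a two-block model\<close>

lemma (in group) two_card_subgroup_le:
  assumes L: "subgroup L G" and K: "subgroup K G" and "L \<subset> K" "finite K"
  shows "2 * card L \<le> card K"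
proof -
  interpret L: subgroup L G by fact
  interpret K: subgroup K G by fact
  obtain a where a: "a \<in> K" "a \<notin> L" using assms by auto
  have finL: "finite L" using assms finite_subset by auto
  let ?aL = "(\<lambda>l. a \<otimes> l) ` L"
  have "card ?aL = card L" using a by (intro card_image) (auto simp: inj_on_def)
  moreover have "L \<inter> ?aL = {}"
  proof (rule ccontr)
    assume "L \<inter> ?aL \<noteq> {}"
    then obtain l where l: "l \<in> L" "a \<otimes> l \<in> L" by auto
    then have "a \<otimes> l \<otimes> inv l \<in> L" by blast
    then show False using a l by (simp add: m_assoc)
  qed
  ultimately have "card (L \<union> ?aL) = 2 * card L" using finL by (simp add: card_Un_disjoint)
  moreover have "L \<union> ?aL \<subseteq> K" using assms a by auto
  ultimately show ?thesis using card_mono[OF \<open>finite K\<close>, of "L \<union> ?aL"] by simp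
qed

lemma sum_prob_le:
  assumes "finite A" "\<And>x. real (card {f\<in>A. Q f x}) \<le> C"
  shows "(\<Sum>f\<in>A. measure_pmf.prob M {x. Q f x}) \<le> C"
proof -
  have "(\<Sum>f\<in>A. measure_pmf.prob M {x. Q f x}) = (\<Sum>f\<in>A. measure_pmf.expectation M (\<lambda>x. indicat_real {x. Q f x} x))"
    by simp
  also have "\<dots> = measure_pmf.expectation M (\<lambda>x. \<Sum>f\<in>A. indicat_real {x. Q f x} x)"
    by (subst Bochner_Integration.integral_sum) (auto intro!: measure_pmf.integrable_const_bound[where B=1])
  also have "(\<lambda>x. \<Sum>f\<in>A. indicat_real {x. Q f x} x) = (\<lambda>x. real (card {f\<in>A. Q f x}))"
    using assms(1) by (auto simp: indicator_def sum.If_cases Int_def)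
  also have "measure_pmf.expectation M (\<lambda>x. real (card {f\<in>A. Q f x})) \<le> measure_pmf.expectation M (\<lambda>x. C)"
  proof (rule integral_mono)
    show "integrable (measure_pmf M) (\<lambda>x. real (card {f\<in>A. Q f x}))"
      by (rule measure_pmf.integrable_const_bound[where B="real (card A)"])
         (use assms(1) in \<open>auto intro!: card_mono\<close>)
  qed (use assms(2) in auto)
  finally show ?thesis by simp
qed

lemma prod_if_const:
  assumes "finite A"
  shows "(\<Prod>s\<in>A. if P s then a else 1) = (a::real) ^ card {s\<in>A. P s}"
  using assms by (simp add: prod.If_cases Int_def)

text \<open>Markov's inequality for the generating function of the number of nontrivial coordinates: for small
\<open>x\<close> the right hand side is an exponential with small rate, which a fixed exponential gain can
absorb.\<close>

lemma card_few_nontrivial: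
  assumes A: "finite A" and C: "finite C" and x: "0 < x" "x \<le> 1"
  shows "real (card {e\<in>PiE A (\<lambda>_. C). card {r\<in>A. e r \<noteq> u} \<le> T}) \<le> (1 / x) ^ T * (1 + x * real (card C)) ^ card A"
proof -
  let ?P = "PiE A (\<lambda>_. C)"
  have finP: "finite ?P" using A C by (intro finite_PiE) auto
  have "real (card {e\<in>?P. card {r\<in>A. e r \<noteq> u} \<le> T}) = (\<Sum>e\<in>{e\<in>?P. card {r\<in>A. e r \<noteq> u} \<le> T}. 1)"
    by simp
  also have "\<dots> \<le> (\<Sum>e\<in>{e\<in>?P. card {r\<in>A. e r \<noteq> u} \<le> T}. (1 / x) ^ T * x ^ card {r\<in>A. e r \<noteq> u})"
  proof (rule sum_mono)
    fix e assume e: "e \<in> {e\<in>?P. card {r\<in>A. e r \<noteq> u} \<le> T}"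
    have "x ^ T \<le> x ^ card {r\<in>A. e r \<noteq> u}" using e x by (intro power_decreasing) auto
    then show "1 \<le> (1 / x) ^ T * x ^ card {r\<in>A. e r \<noteq> u}" using x by (simp add: power_one_over field_simps)
  qed
  also have "\<dots> \<le> (\<Sum>e\<in>?P. (1 / x) ^ T * x ^ card {r\<in>A. e r \<noteq> u})"
    using finP x by (intro sum_mono2) auto
  also have "\<dots> = (1 / x) ^ T * (\<Sum>e\<in>?P. \<Prod>r\<in>A. if e r \<noteq> u then x else 1)"
    unfolding prod_if_const[OF A] by (simp add: sum_distrib_left)
  also have "(\<Sum>e\<in>?P. \<Prod>r\<in>A. if e r \<noteq> u then x else 1) = (\<Prod>r\<in>A. \<Sum>v\<in>C. if v \<noteq> u then x else 1)"
    using A C by (subst prod_sum_PiE) auto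
  also have "\<dots> = (\<Sum>v\<in>C. if v \<noteq> u then x else 1) ^ card A" by simp
  also have "(1 / x) ^ T * \<dots> \<le> (1 / x) ^ T * (1 + x * real (card C)) ^ card A"
  proof (intro mult_left_mono power_mono)
    have "(\<Sum>v\<in>C. if v \<noteq> u then x else 1) \<le> (\<Sum>v\<in>C. (if v = u then 1 else 0) + x)"
      using x by (intro sum_mono) auto
    also have "\<dots> = (if u \<in> C then 1 else 0) + x * real (card C)"
      using C by (simp add: sum.distrib)
    finally show "(\<Sum>v\<in>C. if v \<noteq> u then x else 1) \<le> 1 + x * real (card C)" by (smt (verit))
  qed (use x in \<open>auto intro!: sum_nonneg\<close>)
  finally show ?thesis .
qed

text \<open>The matrix with blocks \<open>I\<close> and \<open>J\<close>, with a deterministic diagonal \<open>c\<close>: off the diagonal, column \<open>s\<close>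
is supported on the block that does not contain \<open>s\<close>. The threshold \<open>w\<close> for heavy values comes with
the relative error \<open>\<eta>\<close> of \<open>t\<close> rounds of mixing, and \<open>m\<close> is the margin by which the non-units in one
block are fewer than the positions in the other.\<close>

locale block_model = torsion_model +
  fixes I J :: "'i set" and c :: "'i \<Rightarrow> int" and \<mu> :: "'i \<Rightarrow> 'i \<Rightarrow> int pmf" and w t m :: nat and \<eta> :: real
  assumes finIJ: "finite I" "finite J" and disj: "I \<inter> J = {}"
    and bal: "\<And>s r. s \<in> I \<Longrightarrow> r \<in> J \<Longrightarrow> bal_pmf p q \<epsilon> (\<mu> s r)" "\<And>s r. s \<in> J \<Longrightarrow> r \<in> I \<Longrightarrow> bal_pmf p q \<epsilon> (\<mu> s r)"
    and few: "card {s\<in>I. int p dvd c s} + m \<le> card J" "card {s\<in>J. int p dvd c s} + m \<le> card I"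
    and wt: "t * q \<le> w" and eta: "\<eta> = q * rate ^ t" "\<eta> \<le> 1"
begin

text \<open>With subgroups \<open>K1\<close> and \<open>K2\<close> attached to the blocks \<open>I\<close> and \<open>J\<close>, each position has its own
subgroup and the subgroup of the opposite block; the latter contains the word of its column, up to
the exceptional positions.\<close>

definition opp :: "'i \<Rightarrow> 'i set" where "opp s = (if s \<in> I then J else I)"
definition own :: "'a set \<Rightarrow> 'a set \<Rightarrow> 'i \<Rightarrow> 'a set" where "own K1 K2 s = (if s \<in> I then K1 else K2)"
definition oth :: "'a set \<Rightarrow> 'a set \<Rightarrow> 'i \<Rightarrow> 'a set" where "oth K1 K2 s = (if s \<in> I then K2 else K1)"

definition col_prob :: "('i \<Rightarrow> 'a) \<Rightarrow> 'i \<Rightarrow> real" where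
  "col_prob F s = pmf (word_pmf G (opp s) F (\<mu> s)) (inv (F s [^] c s))"

definition ker_prob :: "('i \<Rightarrow> 'a) \<Rightarrow> real" where
  "ker_prob F = (\<Prod>s\<in>I \<union> J. col_prob F s)"

definition \<zeta> :: real where "\<zeta> = (1 + \<eta>) ^ card (carrier G)"
definition \<theta> :: real where "\<theta> = max (1/2) (1 - \<epsilon>)"

definition exc :: "'a set \<Rightarrow> 'a set \<Rightarrow> ('i \<Rightarrow> 'a) \<Rightarrow> 'i \<Rightarrow> 'i set" where
  "exc K1 K2 e s = {r\<in>opp s. e r \<notin> oth K1 K2 s}"

text \<open>The exceptional part \<open>e\<close> of a tuple is trivial wherever the tuple takes a value in the subgroup of
its block; \<open>f\<close> is the remaining part at the position \<open>s\<close> of the column. For fixed \<open>e\<close> the bound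
involves \<open>f\<close> at position \<open>s\<close> only, which is what makes the sum over all such parts factor.\<close>

definition col_bound :: "'a set \<Rightarrow> 'a set \<Rightarrow> ('i \<Rightarrow> 'a) \<Rightarrow> 'i \<Rightarrow> 'a \<Rightarrow> real" where
  "col_bound K1 K2 e s f = \<zeta> * (measure_pmf.prob (Pi_pmf (exc K1 K2 e s) 0 (\<mu> s))
      {x. word G (exc K1 K2 e s) e x \<otimes> (f \<otimes> e s) [^] c s \<in> oth K1 K2 s} / card (oth K1 K2 s))"

lemma eta_nonneg: "0 \<le> \<eta>" using eta rate by simp
lemma zeta_ge_1: "1 \<le> \<zeta>" unfolding \<zeta>_def using eta_nonneg by (intro one_le_power) auto
lemma theta: "1/2 \<le> \<theta>" "1 - \<epsilon> \<le> \<theta>" "\<theta> < 1" "0 < \<theta>" unfolding \<theta>_def using eps by auto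

lemma opp: "s \<in> I \<union> J \<Longrightarrow> finite (opp s)" "s \<in> I \<union> J \<Longrightarrow> opp s \<subseteq> I \<union> J"
  "s \<in> I \<union> J \<Longrightarrow> r \<in> opp s \<Longrightarrow> bal_pmf p q \<epsilon> (\<mu> s r)" "s \<in> I \<union> J \<Longrightarrow> m \<le> card (opp s)"
  "s \<in> I \<union> J \<Longrightarrow> r \<in> I \<union> J \<Longrightarrow> r \<in> opp s \<longleftrightarrow> s \<in> opp r"
  using finIJ bal few disj by (auto simp: opp_def split: if_splits)

lemma own_oth: assumes "s \<in> I \<union> J" "r \<in> opp s" shows "own K1 K2 r = oth K1 K2 s"
  using assms disj by (auto simp: own_def oth_def opp_def split: if_splits)

lemma card_subgroup_pos: "subgroup K G \<Longrightarrow> card K > 0"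
  using fin by (metis card_gt_0_iff empty_iff finite_subset subgroup.one_closed subgroup.subset)

lemma finite_subgroup: "subgroup K G \<Longrightarrow> finite K"
  using fin by (metis finite_subset subgroup.subset)

lemma word_bounds:
  assumes F: "F \<in> I \<union> J \<rightarrow> carrier G" and s: "s \<in> I \<union> J" and K: "K = heavy_span w (opp s) F"
    and E: "E = {r\<in>opp s. F r \<notin> K}"
    and nu: "\<nu> = measure_pmf.prob (Pi_pmf E 0 (\<mu> s)) {x. word G E F x \<otimes> F s [^] c s \<in> K} / card K"
  shows "(1 - \<eta>) ^ card (carrier G) * \<nu> \<le> col_prob F s" "col_prob F s \<le> \<zeta> * \<nu>"
proof -
  have Fs: "F s \<in> carrier G" using F s by auto
  then have i: "inv (F s [^] c s) \<in> carrier G" by simp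
  have Fo: "F \<in> opp s \<rightarrow> carrier G" using F opp(2)[OF s] by auto
  have nu': "\<nu> = measure_pmf.prob (Pi_pmf E 0 (\<mu> s)) {x. word G E F x \<otimes> inv (inv (F s [^] c s)) \<in> K} / card K"
    using Fs by (simp add: nu)
  note * = word_heavy_bounds[OF opp(1)[OF s] Fo opp(3)[OF s] i wt eta K E nu']
  show "(1 - \<eta>) ^ card (carrier G) * \<nu> \<le> col_prob F s" unfolding col_prob_def by (rule *(1))
  show "col_prob F s \<le> \<zeta> * \<nu>" unfolding col_prob_def \<zeta>_def by (rule *(2))
qed

lemma col_prob_le_col_bound:
  assumes F: "F \<in> I \<union> J \<rightarrow> carrier G" and s: "s \<in> I \<union> J"
    and K: "K1 = heavy_span w I F" "K2 = heavy_span w J F"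
    and e: "\<And>r. r \<in> I \<union> J \<Longrightarrow> e r = (if F r \<in> own K1 K2 r then \<one> else F r)"
    and f: "F s = f \<otimes> e s"
  shows "col_prob F s \<le> col_bound K1 K2 e s f"
proof -
  have oth: "oth K1 K2 s = heavy_span w (opp s) F" by (auto simp: oth_def opp_def K)
  have sub: "subgroup (oth K1 K2 s) G" unfolding oth by (rule heavy_span_subgroup)
  have e': "e r \<in> oth K1 K2 s \<longleftrightarrow> F r \<in> oth K1 K2 s" if "r \<in> opp s" for r
    using e[of r] own_oth[OF s that] opp(2)[OF s] that subgroup.one_closed[OF sub] by (auto split: if_splits)
  have E: "exc K1 K2 e s = {r\<in>opp s. F r \<notin> oth K1 K2 s}" using e' by (auto simp: exc_def)
  have ew: "word G (exc K1 K2 e s) F x = word G (exc K1 K2 e s) e x" for x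
  proof (rule word_cong)
    show "F \<in> exc K1 K2 e s \<rightarrow> carrier G" using F opp(2)[OF s] by (auto simp: exc_def)
    show "F r = e r" if "r \<in> exc K1 K2 e s" for r
      using that e[of r] own_oth[OF s, of r] opp(2)[OF s] unfolding E by auto
  qed simp
  show ?thesis
    using word_bounds(2)[OF F s oth E refl] unfolding col_bound_def ew f[symmetric] .
qed

lemma sum_col_bound:
  assumes K: "subgroup K1 G" "subgroup K2 G" and s: "s \<in> I \<union> J" and e: "e \<in> I \<union> J \<rightarrow> carrier G"
  shows "(\<Sum>f\<in>own K1 K2 s. col_bound K1 K2 e s f) \<le>
     \<zeta> * ((if int p dvd c s then card (own K1 K2 s) else card (K1 \<inter> K2)) / card (oth K1 K2 s))"
    and "exc K1 K2 e s \<noteq> {} \<Longrightarrow>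
     (\<Sum>f\<in>own K1 K2 s. col_bound K1 K2 e s f) \<le> \<zeta> * ((1 - \<epsilon>) * card (own K1 K2 s) / card (oth K1 K2 s))"
proof -
  let ?E = "exc K1 K2 e s"
  have ow: "subgroup (own K1 K2 s) G" "subgroup (oth K1 K2 s) G" using K by (auto simp: own_def oth_def)
  interpret ow: subgroup "own K1 K2 s" G by (rule ow)
  have es: "e s \<in> carrier G" using e s by auto
  have eE: "e \<in> ?E \<rightarrow> carrier G" using e opp(2)[OF s] by (auto simp: exc_def)
  have finE: "finite ?E" using opp(1)[OF s] by (simp add: exc_def)
  have i: "own K1 K2 s \<inter> oth K1 K2 s = K1 \<inter> K2" by (auto simp: own_def oth_def)
  let ?p = "\<lambda>f. measure_pmf.prob (Pi_pmf ?E 0 (\<mu> s)) {x. word G ?E e x \<otimes> (f \<otimes> e s) [^] c s \<in> oth K1 K2 s}"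
  have S: "(\<Sum>f\<in>own K1 K2 s. col_bound K1 K2 e s f) = \<zeta> * ((\<Sum>f\<in>own K1 K2 s. ?p f) / card (oth K1 K2 s))"
    by (simp add: col_bound_def sum_distrib_left sum_divide_distrib)
  have "(\<Sum>f\<in>own K1 K2 s. ?p f) \<le> (if int p dvd c s then card (own K1 K2 s) else card (K1 \<inter> K2))"
  proof (rule sum_prob_le)
    fix x
    have eq: "word G ?E e x \<otimes> (f \<otimes> e s) [^] c s = word G ?E e x \<otimes> e s [^] c s \<otimes> f [^] c s" if "f \<in> own K1 K2 s" for f
      using that es eE by (simp add: int_pow_distrib m_ac)
    have "{f\<in>own K1 K2 s. word G ?E e x \<otimes> (f \<otimes> e s) [^] c s \<in> oth K1 K2 s} =
      {f\<in>own K1 K2 s. word G ?E e x \<otimes> e s [^] c s \<otimes> f [^] c s \<in> oth K1 K2 s}" using eq by auto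
    then show "real (card {f\<in>own K1 K2 s. word G ?E e x \<otimes> (f \<otimes> e s) [^] c s \<in> oth K1 K2 s})
       \<le> real (if int p dvd c s then card (own K1 K2 s) else card (K1 \<inter> K2))"
      using card_power_solutions[OF ow, of "word G ?E e x \<otimes> e s [^] c s" "c s"] es eE i by auto
  qed (rule finite_subgroup[OF ow(1)])
  then show "(\<Sum>f\<in>own K1 K2 s. col_bound K1 K2 e s f) \<le>
     \<zeta> * ((if int p dvd c s then card (own K1 K2 s) else card (K1 \<inter> K2)) / card (oth K1 K2 s))"
    unfolding S using zeta_ge_1 by (intro mult_left_mono divide_right_mono) auto
  assume "exc K1 K2 e s \<noteq> {}"
  then obtain r where r: "r \<in> ?E" by auto
  have "?p f \<le> 1 - \<epsilon>" if "f \<in> own K1 K2 s" for f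
  proof (rule prob_word_in_coset[OF finE eE _ r _ ow(2)])
    show "bal_pmf p q \<epsilon> (\<mu> s r)" if "r \<in> ?E" for r using that opp(3)[OF s] by (simp add: exc_def)
    show "e r \<notin> oth K1 K2 s" using r by (simp add: exc_def)
    show "(f \<otimes> e s) [^] c s \<in> carrier G" using that es by simp
  qed
  then have "(\<Sum>f\<in>own K1 K2 s. ?p f) \<le> (\<Sum>f\<in>own K1 K2 s. 1 - \<epsilon>)" by (rule sum_mono)
  then show "(\<Sum>f\<in>own K1 K2 s. col_bound K1 K2 e s f) \<le> \<zeta> * ((1 - \<epsilon>) * card (own K1 K2 s) / card (oth K1 K2 s))"
    unfolding S using zeta_ge_1 by (intro mult_left_mono divide_right_mono) (auto simp: mult.commute)
qed

text \<open>If \<open>K1 = K2\<close>, some value \<open>e r\<close> lies outside this subgroup, and every column of the block opposite to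
\<open>r\<close> loses a factor \<open>1 - \<epsilon>\<close>. Otherwise one of \<open>u = |K1 \<inter> K2| / |K1|\<close> and \<open>v = |K1 \<inter> K2| / |K2|\<close> is at
most \<open>1/2\<close>; a column in \<open>I\<close> contributes \<open>v\<close>, or \<open>v / u\<close> if its diagonal entry is a non-unit, and the
columns in \<open>J\<close> contribute symmetrically, so that \<open>m\<close> factors \<open>u\<close> and \<open>m\<close> factors \<open>v\<close> survive.\<close>

lemma prod_sum_col_bound:
  assumes K: "subgroup K1 G" "subgroup K2 G" and e: "e \<in> I \<union> J \<rightarrow> carrier G"
    and ne: "K1 \<noteq> K2 \<or> (\<exists>r\<in>I \<union> J. e r \<notin> own K1 K2 r)"
  shows "(\<Prod>s\<in>I \<union> J. \<Sum>f\<in>own K1 K2 s. col_bound K1 K2 e s f) \<le> \<zeta> ^ card (I \<union> J) * \<theta> ^ m"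
proof -
  have nn: "0 \<le> (\<Sum>f\<in>own K1 K2 s. col_bound K1 K2 e s f)" for s
    using zeta_ge_1 by (intro sum_nonneg) (auto simp: col_bound_def)
  note pos = card_subgroup_pos[OF K(1)] card_subgroup_pos[OF K(2)]
  have KK: "subgroup (K1 \<inter> K2) G" using subgroups_Inter_pair K by blast
  note pos = pos card_subgroup_pos[OF KK]
  show ?thesis
  proof (cases "K1 = K2")
    case True
    then obtain r where r: "r \<in> I \<union> J" "e r \<notin> own K1 K2 r" using ne by auto
    have "(\<Sum>f\<in>own K1 K2 s. col_bound K1 K2 e s f) \<le> \<zeta> * (if s \<in> opp r then 1 - \<epsilon> else 1)" if s: "s \<in> I \<union> J" for s
    proof (cases "s \<in> opp r")
      case sr: True
      then have rs: "r \<in> opp s" using opp(5)[OF r(1) s] by simp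
      have "exc K1 K2 e s \<noteq> {}" using rs r(2) own_oth[OF s rs, of K1 K2] by (auto simp: exc_def)
      from sum_col_bound(2)[OF K s e this] show ?thesis using sr pos True by (simp add: own_def oth_def)
    next
      case sr: False
      from sum_col_bound(1)[OF K s e] show ?thesis using sr pos True
        by (simp add: own_def oth_def split: if_splits)
    qed
    then have "(\<Prod>s\<in>I \<union> J. \<Sum>f\<in>own K1 K2 s. col_bound K1 K2 e s f) \<le> (\<Prod>s\<in>I \<union> J. \<zeta> * (if s \<in> opp r then 1 - \<epsilon> else 1))"
      by (intro prod_mono conjI nn)
    also have "\<dots> = \<zeta> ^ card (I \<union> J) * (1 - \<epsilon>) ^ card {s\<in>I \<union> J. s \<in> opp r}"
      unfolding prod.distrib using finIJ by (subst prod_if_const) auto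
    also have "{s\<in>I \<union> J. s \<in> opp r} = opp r" using opp(2)[OF r(1)] by auto
    also have "\<zeta> ^ card (I \<union> J) * (1 - \<epsilon>) ^ card (opp r) \<le> \<zeta> ^ card (I \<union> J) * \<theta> ^ m"
    proof (intro mult_left_mono)
      have "(1 - \<epsilon>) ^ card (opp r) \<le> \<theta> ^ card (opp r)" using theta eps by (intro power_mono) auto
      also have "\<dots> \<le> \<theta> ^ m" using theta opp(4)[OF r(1)] by (intro power_decreasing) auto
      finally show "(1 - \<epsilon>) ^ card (opp r) \<le> \<theta> ^ m" .
    qed (use zeta_ge_1 in auto)
    finally show ?thesis .
  next
    case False
    define u v where "u = real (card (K1 \<inter> K2)) / card K1" and "v = real (card (K1 \<inter> K2)) / card K2"
    have uv0: "u > 0" "v > 0" using pos by (auto simp: u_def v_def)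
    have le1: "u \<le> 1" "v \<le> 1" using pos finite_subgroup[OF K(1)] finite_subgroup[OF K(2)]
      by (auto simp: u_def v_def divide_le_eq intro!: card_mono)
    have half: "u \<le> 1/2 \<or> v \<le> 1/2"
    proof -
      have "K1 \<inter> K2 \<subset> K1 \<or> K1 \<inter> K2 \<subset> K2" using False by auto
      then have "2 * card (K1 \<inter> K2) \<le> card K1 \<or> 2 * card (K1 \<inter> K2) \<le> card K2"
        using two_card_subgroup_le[OF KK K(1)] two_card_subgroup_le[OF KK K(2)] finite_subgroup K by blast
      then have "2 * real (card (K1 \<inter> K2)) \<le> real (card K1) \<or> 2 * real (card (K1 \<inter> K2)) \<le> real (card K2)" by linarith
      then show ?thesis using pos by (auto simp: u_def v_def divide_le_eq)
    qed
    have "(\<Prod>s\<in>I \<union> J. \<Sum>f\<in>own K1 K2 s. col_bound K1 K2 e s f) \<le>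
       (\<Prod>s\<in>I \<union> J. \<zeta> * (if s \<in> I then (if int p dvd c s then 1 / u else 1) * v else (if int p dvd c s then 1 / v else 1) * u))"
    proof (intro prod_mono conjI nn)
      fix s assume s: "s \<in> I \<union> J"
      show "(\<Sum>f\<in>own K1 K2 s. col_bound K1 K2 e s f) \<le> \<zeta> * (if s \<in> I then (if int p dvd c s then 1 / u else 1) * v else (if int p dvd c s then 1 / v else 1) * u)"
        using sum_col_bound(1)[OF K s e] pos by (auto simp: own_def oth_def u_def v_def split: if_splits)
    qed
    also have "\<dots> = \<zeta> ^ card (I \<union> J) * ((\<Prod>s\<in>I. (if int p dvd c s then 1 / u else 1) * v) * (\<Prod>s\<in>J. (if int p dvd c s then 1 / v else 1) * u))"
    proof -
      let ?g = "\<lambda>s. if s \<in> I then (if int p dvd c s then 1 / u else 1) * v else (if int p dvd c s then 1 / v else 1) * u"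
      have "(\<Prod>s\<in>I \<union> J. \<zeta> * ?g s) = (\<Prod>s\<in>I \<union> J. \<zeta>) * (\<Prod>s\<in>I \<union> J. ?g s)" by (rule prod.distrib)
      also have "(\<Prod>s\<in>I \<union> J. ?g s) = (\<Prod>s\<in>I. ?g s) * (\<Prod>s\<in>J. ?g s)"
        by (rule prod.union_disjoint[OF finIJ disj])
      also have "(\<Prod>s\<in>I. ?g s) = (\<Prod>s\<in>I. (if int p dvd c s then 1 / u else 1) * v)"
        by (rule prod.cong) auto
      also have "(\<Prod>s\<in>J. ?g s) = (\<Prod>s\<in>J. (if int p dvd c s then 1 / v else 1) * u)"
        using disj by (intro prod.cong) auto
      finally show ?thesis by simp
    qed
    also have "(\<Prod>s\<in>I. (if int p dvd c s then 1 / u else 1) * v) = (1 / u) ^ card {s\<in>I. int p dvd c s} * v ^ card I"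
      unfolding prod.distrib using finIJ by (simp add: prod_if_const)
    also have "(\<Prod>s\<in>J. (if int p dvd c s then 1 / v else 1) * u) = (1 / v) ^ card {s\<in>J. int p dvd c s} * u ^ card J"
      unfolding prod.distrib using finIJ by (simp add: prod_if_const)
    also have "(1 / u) ^ card {s\<in>I. int p dvd c s} * v ^ card I * ((1 / v) ^ card {s\<in>J. int p dvd c s} * u ^ card J)
      = u ^ (card J - card {s\<in>I. int p dvd c s}) * v ^ (card I - card {s\<in>J. int p dvd c s})"
      using uv0 few by (simp add: power_diff power_one_over field_simps)
    also have "\<zeta> ^ card (I \<union> J) * \<dots> \<le> \<zeta> ^ card (I \<union> J) * \<theta> ^ m"
    proof (intro mult_left_mono)
      let ?a = "card J - card {s\<in>I. int p dvd c s}" and ?b = "card I - card {s\<in>J. int p dvd c s}"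
      have ab: "m \<le> ?a" "m \<le> ?b" using few by auto
      have "u ^ ?a * v ^ ?b \<le> u ^ m * v ^ m" using ab uv0 le1 by (intro mult_mono power_decreasing) auto
      also have "\<dots> = (u * v) ^ m" by (simp add: power_mult_distrib)
      also have "\<dots> \<le> \<theta> ^ m"
      proof (intro power_mono)
        have "u * v \<le> 1/2" using half
        proof
          assume "u \<le> 1/2"
          then have "u * v \<le> 1/2 * 1" using uv0 le1 by (intro mult_mono) auto
          then show ?thesis by simp
        next
          assume "v \<le> 1/2"
          then have "u * v \<le> 1 * (1/2)" using uv0 le1 by (intro mult_mono) auto
          then show ?thesis by simp
        qed
        then show "u * v \<le> \<theta>" using theta by linarith
      qed (use uv0 in auto)
      finally show "u ^ ?a * v ^ ?b \<le> \<theta> ^ m" .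
    qed (use zeta_ge_1 in auto)
    finally show ?thesis .
  qed
qed

end

definition generating_tuples :: "('a, 'b) monoid_scheme \<Rightarrow> 'i set \<Rightarrow> ('i \<Rightarrow> 'a) set" where
  "generating_tuples G A = {F\<in>PiE A (\<lambda>_. carrier G). generate G (F ` A) = carrier G}"

lemma finite_generating_tuples:
  "finite A \<Longrightarrow> finite (carrier G) \<Longrightarrow> finite (generating_tuples G A)"
  by (rule finite_subset[of _ "PiE A (\<lambda>_. carrier G)"]) (auto simp: generating_tuples_def intro: finite_PiE)

context block_model begin

definition K1of :: "('i \<Rightarrow> 'a) \<Rightarrow> 'a set" where "K1of F = heavy_span w I F"
definition K2of :: "('i \<Rightarrow> 'a) \<Rightarrow> 'a set" where "K2of F = heavy_span w J F"

abbreviation gen_tuples :: "('i \<Rightarrow> 'a) set" where "gen_tuples \<equiv> generating_tuples G (I \<union> J)"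

lemmas gen_tuples_def = generating_tuples_def[of G "I \<union> J"]

lemma finite_gen_tuples: "finite gen_tuples"
  using finIJ fin by (intro finite_generating_tuples) auto

lemma ker_prob_nonneg: "0 \<le> ker_prob F"
  unfolding ker_prob_def by (intro prod_nonneg) (auto simp: col_prob_def)

text \<open>If the heavy values of both blocks generate \<open>G\<close>, no position is exceptional and every column event
has probability \<open>1 / |G|\<close> up to the mixing error.\<close>

lemma main_term_bounds:
  assumes F: "F \<in> I \<union> J \<rightarrow> carrier G" and K: "K1of F = carrier G" "K2of F = carrier G"
  defines "gN \<equiv> (1 / real (card (carrier G))) ^ card (I \<union> J)"
  shows "(1 - \<eta>) ^ (card (carrier G) * card (I \<union> J)) * gN \<le> ker_prob F"
    and "ker_prob F \<le> (1 + \<eta>) ^ (card (carrier G) * card (I \<union> J)) * gN"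
proof -
  have col: "(1 - \<eta>) ^ card (carrier G) * (1 / real (card (carrier G))) \<le> col_prob F s \<and>
       col_prob F s \<le> (1 + \<eta>) ^ card (carrier G) * (1 / real (card (carrier G)))" if s: "s \<in> I \<union> J" for s
  proof -
    have K': "carrier G = heavy_span w (opp s) F" using K by (auto simp: K1of_def K2of_def opp_def)
    have E: "{} = {r\<in>opp s. F r \<notin> carrier G}" using F opp(2)[OF s] by auto
    have Fs: "F s \<in> carrier G" using F s by auto
    have nu: "1 / real (card (carrier G)) = measure_pmf.prob (Pi_pmf {} 0 (\<mu> s)) {x. word G {} F x \<otimes> F s [^] c s \<in> carrier G} / card (carrier G)"
      using Fs by (simp add: word_def)
    show ?thesis using word_bounds[OF F s K' E nu] unfolding \<zeta>_def by simp
  qed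
  have 1: "(\<Prod>s\<in>I \<union> J. (1 - \<eta>) ^ card (carrier G) * (1 / real (card (carrier G)))) \<le> ker_prob F"
    unfolding ker_prob_def using col eta by (intro prod_mono) auto
  then show "(1 - \<eta>) ^ (card (carrier G) * card (I \<union> J)) * gN \<le> ker_prob F"
    by (simp only: prod_constant power_mult_distrib gN_def power_mult)
  have 2: "ker_prob F \<le> (\<Prod>s\<in>I \<union> J. (1 + \<eta>) ^ card (carrier G) * (1 / real (card (carrier G))))"
    unfolding ker_prob_def using col by (intro prod_mono) (auto simp: col_prob_def)
  then show "ker_prob F \<le> (1 + \<eta>) ^ (card (carrier G) * card (I \<union> J)) * gN"
    by (simp only: prod_constant power_mult_distrib gN_def power_mult)
qed

lemma main_terms_sum:
  defines "gN \<equiv> (1 / real (card (carrier G))) ^ card (I \<union> J)"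
  shows "(\<Sum>F\<in>{F\<in>gen_tuples. K1of F = carrier G \<and> K2of F = carrier G}. \<bar>ker_prob F - gN\<bar>)
    \<le> (1 + \<eta>) ^ (card (carrier G) * card (I \<union> J)) - 1"
proof -
  let ?M = "card (carrier G) * card (I \<union> J)"
  let ?A = "{F\<in>gen_tuples. K1of F = carrier G \<and> K2of F = carrier G}"
  have gN: "0 \<le> gN" by (simp add: gN_def)
  have up0: "1 + ?M * \<eta> \<le> (1 + \<eta>) ^ ?M"
    using Bernoulli_inequality[of \<eta> ?M] eta_nonneg by simp
  have lo0: "1 - ?M * \<eta> \<le> (1 - \<eta>) ^ ?M"
    using Bernoulli_inequality[of "-\<eta>" ?M] eta by simp
  have "\<bar>ker_prob F - gN\<bar> \<le> ((1 + \<eta>) ^ ?M - 1) * gN" if F: "F \<in> ?A" for F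
  proof -
    have F': "F \<in> I \<union> J \<rightarrow> carrier G" using F by (auto simp: gen_tuples_def)
    note b = main_term_bounds[OF F', folded gN_def]
    have "(1 - ?M * \<eta>) * gN \<le> ker_prob F"
      using b(1) F mult_right_mono[OF lo0 gN] by auto
    moreover have "?M * \<eta> * gN \<le> ((1 + \<eta>) ^ ?M - 1) * gN" using up0 gN by (intro mult_right_mono) auto
    moreover have "ker_prob F \<le> (1 + \<eta>) ^ ?M * gN" using b(2) F by auto
    ultimately show ?thesis by (simp add: abs_le_iff algebra_simps)
  qed
  then have "(\<Sum>F\<in>?A. \<bar>ker_prob F - gN\<bar>) \<le> (\<Sum>F\<in>?A. ((1 + \<eta>) ^ ?M - 1) * gN)" by (rule sum_mono)
  also have "\<dots> = card ?A * gN * ((1 + \<eta>) ^ ?M - 1)" by simp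
  also have "\<dots> \<le> 1 * ((1 + \<eta>) ^ ?M - 1)"
  proof (intro mult_right_mono)
    have "card ?A \<le> card (PiE (I \<union> J) (\<lambda>_. carrier G))"
      using finIJ fin by (intro card_mono finite_PiE) (auto simp: gen_tuples_def)
    also have "\<dots> = card (carrier G) ^ card (I \<union> J)" using finIJ by (simp add: card_PiE)
    finally have "real (card ?A) * gN \<le> real (card (carrier G) ^ card (I \<union> J)) * gN"
      using gN by (intro mult_right_mono) auto
    also have "\<dots> = 1" using card_carrier_pos by (simp add: gN_def power_one_over)
    finally show "real (card ?A) * gN \<le> 1" .
    show "0 \<le> (1 + \<eta>) ^ ?M - 1" using eta_nonneg by (simp add: one_le_power)
  qed
  finally show ?thesis by simp
qed

text \<open>Every tuple in this sum is a product \<open>f e\<close> with \<open>f\<close> in the subgroups \<open>K1\<close> and \<open>K2\<close> generated by its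
heavy values and \<open>e\<close> nontrivial at few positions only. Summing over all choices of \<open>K1\<close>, \<open>K2\<close>, \<open>e\<close>
and \<open>f\<close>, the sum over \<open>f\<close> is a product over the columns, and there are few choices of \<open>e\<close>. Since
the tuple generates \<open>G\<close>, equal proper subgroups \<open>K1\<close> and \<open>K2\<close> force a value of \<open>e\<close> outside them.\<close>

lemma minor_terms_sum:
  fixes x :: real
  defines "g \<equiv> card (carrier G)" and "N \<equiv> card (I \<union> J)"
  assumes x: "0 < x" "x \<le> 1"
  shows "(\<Sum>F\<in>{F\<in>gen_tuples. \<not> (K1of F = carrier G \<and> K2of F = carrier G)}. ker_prob F + (1 / real g) ^ N)
    \<le> 4 ^ g * ((1 / x) ^ (2 * g * w) * (1 + x * g) ^ N * (\<zeta> ^ N + 1) * \<theta> ^ m)"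
proof -
  let ?A = "{F\<in>gen_tuples. \<not> (K1of F = carrier G \<and> K2of F = carrier G)}"
  define SS where "SS = {(K1, K2). subgroup K1 G \<and> subgroup K2 G \<and> \<not> (K1 = carrier G \<and> K2 = carrier G)}"
  define EE where "EE = (\<lambda>(K1, K2). {e\<in>PiE (I \<union> J) (\<lambda>_. carrier G). card {r\<in>I \<union> J. e r \<noteq> \<one>} \<le> 2 * g * w \<and>
      (K1 \<noteq> K2 \<or> (\<exists>r\<in>I \<union> J. e r \<notin> own K1 K2 r))})"
  define FF where "FF = (\<lambda>(K1, K2). PiE (I \<union> J) (own K1 K2))"
  define B where "B = (\<lambda>((K1, K2), e, f). (\<Prod>s\<in>I \<union> J. col_bound K1 K2 e s (f s)) + (1 / real g) ^ N)"
  \<comment> \<open>The map that recovers a tuple from its decomposition.\<close>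
  define \<iota> where "\<iota> = (\<lambda>(KK :: 'a set \<times> 'a set, e, f). \<lambda>r\<in>I \<union> J. f r \<otimes> e r)"
  have finU: "finite (I \<union> J)" using finIJ by simp
  have finSS: "finite SS"
    by (rule finite_subset[of _ "Pow (carrier G) \<times> Pow (carrier G)"]) (use fin in \<open>auto simp: SS_def dest: subgroup.subset\<close>)
  have finP: "finite (PiE (I \<union> J) (\<lambda>_. carrier G))" using finU fin by (intro finite_PiE) auto
  have finE: "finite (EE KK)" for KK using finP by (auto simp: EE_def split: prod.split)
  have finF: "finite (FF KK)" if "KK \<in> SS" for KK
    using that finU finite_subgroup by (auto simp: FF_def SS_def own_def intro!: finite_PiE split: prod.splits)
  have B0: "0 \<le> B y" for y
    unfolding B_def using zeta_ge_1 by (auto simp: col_bound_def split: prod.split intro!: add_nonneg_nonneg prod_nonneg)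
  have "(\<Sum>F\<in>?A. ker_prob F + (1 / real g) ^ N) \<le> (\<Sum>y\<in>(SIGMA KK:SS. EE KK \<times> FF KK). B y)"
  proof (rule sum_le_included[where i=\<iota>])
    show "finite ?A" using finite_gen_tuples by simp
    show "finite (SIGMA KK:SS. EE KK \<times> FF KK)" using finSS finE finF by (intro finite_SigmaI finite_cartesian_product) auto
    show "\<forall>y\<in>(SIGMA KK:SS. EE KK \<times> FF KK). 0 \<le> B y" using B0 by blast
    show "\<forall>F\<in>?A. \<exists>y\<in>(SIGMA KK:SS. EE KK \<times> FF KK). \<iota> y = F \<and> ker_prob F + (1 / real g) ^ N \<le> B y"
    proof
      fix F assume F: "F \<in> ?A"
      define K1 K2 where "K1 = K1of F" and "K2 = K2of F"
      have sub: "subgroup K1 G" "subgroup K2 G" unfolding K1_def K2_def K1of_def K2of_def by (rule heavy_span_subgroup)+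
      have FP: "F \<in> PiE (I \<union> J) (\<lambda>_. carrier G)" using F by (auto simp: gen_tuples_def)
      then have F': "F \<in> I \<union> J \<rightarrow> carrier G" by auto
      have ow: "subgroup (own K1 K2 r) G" for r using sub by (simp add: own_def)
      define e where "e = (\<lambda>r\<in>I \<union> J. if F r \<in> own K1 K2 r then \<one> else F r)"
      define f where "f = (\<lambda>r\<in>I \<union> J. if F r \<in> own K1 K2 r then F r else \<one>)"
      have Ffe: "F r = f r \<otimes> e r" if r: "r \<in> I \<union> J" for r
      proof -
        have "F r \<in> carrier G" using F' r by (rule funcset_mem)
        then show ?thesis using r by (simp add: f_def e_def)
      qed
      have SSin: "(K1, K2) \<in> SS" using sub F by (auto simp: SS_def K1_def K2_def)
      have fF: "f \<in> FF (K1, K2)" using subgroup.one_closed[OF ow] by (auto simp: FF_def f_def)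
      have eP: "e \<in> PiE (I \<union> J) (\<lambda>_. carrier G)" using F' by (auto simp: e_def)
      have ecard: "card {r\<in>I \<union> J. e r \<noteq> \<one>} \<le> 2 * g * w"
      proof -
        have "{r\<in>I \<union> J. e r \<noteq> \<one>} \<subseteq> {r\<in>I. F r \<notin> K1} \<union> {r\<in>J. F r \<notin> K2}"
          using disj by (auto simp: e_def own_def split: if_splits)
        then have "card {r\<in>I \<union> J. e r \<noteq> \<one>} \<le> card {r\<in>I. F r \<notin> K1} + card {r\<in>J. F r \<notin> K2}"
          using finIJ by (intro order_trans[OF card_mono card_Un_le]) auto
        also have "\<dots> \<le> g * w + g * w"
          unfolding K1_def K2_def K1of_def K2of_def g_def
          using finIJ F' by (intro add_mono card_outside_heavy_span) auto
        finally show ?thesis by simp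
      qed
      have ex: "K1 \<noteq> K2 \<or> (\<exists>r\<in>I \<union> J. e r \<notin> own K1 K2 r)"
      proof (rule ccontr)
        assume "\<not> ?thesis"
        then have eq: "K1 = K2" and all: "\<And>r. r \<in> I \<union> J \<Longrightarrow> e r \<in> own K1 K2 r" by auto
        have "F r \<in> K1" if "r \<in> I \<union> J" for r
          using all[OF that] that eq by (auto simp: e_def own_def split: if_splits)
        then have "generate G (F ` (I \<union> J)) \<subseteq> K1" using sub(1) by (intro generate_subgroup_incl) auto
        then have "K1 = carrier G" using F subgroup.subset[OF sub(1)] by (auto simp: gen_tuples_def)
        with eq F show False by (auto simp: K1_def K2_def)
      qed
      have inS: "((K1, K2), e, f) \<in> (SIGMA KK:SS. EE KK \<times> FF KK)"
        using SSin fF eP ecard ex by (simp add: EE_def)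
      moreover have "\<iota> ((K1, K2), e, f) = F"
        unfolding \<iota>_def using Ffe PiE_arb[OF FP] by (auto simp: restrict_def)
      moreover have "ker_prob F + (1 / real g) ^ N \<le> B ((K1, K2), e, f)"
      proof -
        have "ker_prob F \<le> (\<Prod>s\<in>I \<union> J. col_bound K1 K2 e s (f s))"
          unfolding ker_prob_def
        proof (intro prod_mono conjI)
          fix s assume s: "s \<in> I \<union> J"
          show "0 \<le> col_prob F s" by (simp add: col_prob_def)
          show "col_prob F s \<le> col_bound K1 K2 e s (f s)"
          proof (rule col_prob_le_col_bound[where f="f s", OF F' s])
            show "F s = f s \<otimes> e s" by (rule Ffe[OF s])
          qed (auto simp: K1_def K2_def K1of_def K2of_def e_def)
        qed
        then show ?thesis by (simp add: B_def)
      qed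
      ultimately show "\<exists>y\<in>(SIGMA KK:SS. EE KK \<times> FF KK). \<iota> y = F \<and> ker_prob F + (1 / real g) ^ N \<le> B y" by blast
    qed
  qed
  also have "\<dots> = (\<Sum>KK\<in>SS. \<Sum>y\<in>EE KK \<times> FF KK. B (KK, y))"
    using sum.Sigma[OF finSS, of "\<lambda>KK. EE KK \<times> FF KK" "\<lambda>KK y. B (KK, y)"] finE finF by simp
  also have "\<dots> = (\<Sum>KK\<in>SS. \<Sum>e\<in>EE KK. \<Sum>f\<in>FF KK. B (KK, e, f))"
    by (simp add: sum.cartesian_product)
  also have "\<dots> \<le> (\<Sum>KK\<in>SS. \<Sum>e\<in>EE KK. (\<zeta> ^ N + 1) * \<theta> ^ m)"
  proof (intro sum_mono)
    fix KK e assume KK: "KK \<in> SS" and e: "e \<in> EE KK"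
    obtain K1 K2 where K: "KK = (K1, K2)" by (cases KK)
    have sub: "subgroup K1 G" "subgroup K2 G" and ne: "\<not> (K1 = carrier G \<and> K2 = carrier G)" using KK by (auto simp: K SS_def)
    have e': "e \<in> I \<union> J \<rightarrow> carrier G" "K1 \<noteq> K2 \<or> (\<exists>r\<in>I \<union> J. e r \<notin> own K1 K2 r)" using e by (auto simp: EE_def K)
    have finow: "finite (own K1 K2 s)" for s using finite_subgroup sub by (simp add: own_def)
    have "(\<Sum>f\<in>FF KK. B (KK, e, f)) = (\<Sum>f\<in>PiE (I \<union> J) (own K1 K2). \<Prod>s\<in>I \<union> J. col_bound K1 K2 e s (f s))
        + (\<Sum>f\<in>PiE (I \<union> J) (own K1 K2). (1 / real g) ^ N)"
      by (simp add: FF_def B_def K sum.distrib)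
    also have "(\<Sum>f\<in>PiE (I \<union> J) (own K1 K2). \<Prod>s\<in>I \<union> J. col_bound K1 K2 e s (f s)) =
      (\<Prod>s\<in>I \<union> J. \<Sum>f\<in>own K1 K2 s. col_bound K1 K2 e s f)"
      using finU finow by (subst prod_sum_PiE) auto
    also have "\<dots> \<le> \<zeta> ^ N * \<theta> ^ m" unfolding N_def by (rule prod_sum_col_bound[OF sub e'])
    also have "(\<Sum>f\<in>PiE (I \<union> J) (own K1 K2). (1 / real g) ^ N) = (\<Prod>s\<in>I \<union> J. card (own K1 K2 s) * (1 / real g))"
      using finU by (simp add: card_PiE prod_dividef N_def power_one_over)
    also have "\<dots> = (\<Prod>s\<in>I. card (own K1 K2 s) * (1 / real g)) * (\<Prod>s\<in>J. card (own K1 K2 s) * (1 / real g))"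
      by (rule prod.union_disjoint[OF finIJ disj])
    also have "\<dots> = (real (card K1) / g) ^ card I * (real (card K2) / g) ^ card J"
      using disj by (subst prod.cong[OF refl, of J _ "\<lambda>s. real (card K2) / g"], force simp: own_def) (simp add: own_def)
    also have "\<dots> \<le> \<theta> ^ m"
    proof -
      have g0: "g > 0" using card_carrier_pos by (simp add: g_def)
      have le1: "real (card K) / g \<le> 1" if "subgroup K G" for K
        using g0 that fin by (auto simp: g_def divide_le_eq intro!: card_mono subgroup.subset)
      have half: "real (card K) / g \<le> 1/2" if "subgroup K G" "K \<noteq> carrier G" for K
      proof -
        have "2 * card K \<le> card (carrier G)"
          using that fin subgroup.subset[OF that(1)] by (intro two_card_subgroup_le subgroup_self) auto
        then show ?thesis using g0 by (simp add: g_def divide_le_eq)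
      qed
      have pw: "(1/2 :: real) ^ l \<le> \<theta> ^ m" if "m \<le> l" for l
      proof -
        have "(1/2 :: real) ^ l \<le> (1/2) ^ m" using that by (intro power_decreasing) auto
        also have "\<dots> \<le> \<theta> ^ m" using theta by (intro power_mono) auto
        finally show ?thesis .
      qed
      have mm: "m \<le> card I" "m \<le> card J" using few by auto
      show ?thesis
      proof (cases "K1 = carrier G")
        case False
        have "(real (card K1) / g) ^ card I * (real (card K2) / g) ^ card J \<le> (1/2) ^ card I * 1"
          using half[OF sub(1) False] le1[OF sub(2)] by (intro mult_mono power_mono power_le_one) auto
        then show ?thesis using pw[OF mm(1)] by simp
      next
        case True
        then have "(real (card K1) / g) ^ card I * (real (card K2) / g) ^ card J \<le> 1 * (1/2) ^ card J"
          using half[OF sub(2)] ne le1[OF sub(1)] by (intro mult_mono power_mono power_le_one) auto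
        then show ?thesis using pw[OF mm(2)] by simp
      qed
    qed
    finally show "(\<Sum>f\<in>FF KK. B (KK, e, f)) \<le> (\<zeta> ^ N + 1) * \<theta> ^ m" by (simp add: algebra_simps)
  qed
  also have "\<dots> \<le> (\<Sum>KK\<in>SS. (1 / x) ^ (2 * g * w) * (1 + x * g) ^ N * ((\<zeta> ^ N + 1) * \<theta> ^ m))"
  proof (rule sum_mono)
    fix KK assume "KK \<in> SS"
    have "real (card (EE KK)) \<le> real (card {e\<in>PiE (I \<union> J) (\<lambda>_. carrier G). card {r\<in>I \<union> J. e r \<noteq> \<one>} \<le> 2 * g * w})"
      using finP by (auto simp: EE_def split: prod.split intro!: card_mono)
    also have "\<dots> \<le> (1 / x) ^ (2 * g * w) * (1 + x * g) ^ N"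
      unfolding g_def N_def by (rule card_few_nontrivial[OF finU fin x])
    finally have "real (card (EE KK)) * ((\<zeta> ^ N + 1) * \<theta> ^ m) \<le> (1 / x) ^ (2 * g * w) * (1 + x * g) ^ N * ((\<zeta> ^ N + 1) * \<theta> ^ m)"
      using zeta_ge_1 theta by (intro mult_right_mono) auto
    then show "(\<Sum>e\<in>EE KK. (\<zeta> ^ N + 1) * \<theta> ^ m) \<le> (1 / x) ^ (2 * g * w) * (1 + x * g) ^ N * ((\<zeta> ^ N + 1) * \<theta> ^ m)"
      by simp
  qed
  also have "\<dots> = real (card SS) * ((1 / x) ^ (2 * g * w) * (1 + x * g) ^ N * ((\<zeta> ^ N + 1) * \<theta> ^ m))" by simp
  also have "\<dots> \<le> 4 ^ g * ((1 / x) ^ (2 * g * w) * (1 + x * g) ^ N * ((\<zeta> ^ N + 1) * \<theta> ^ m))"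
  proof (intro mult_right_mono)
    have "card SS \<le> card (Pow (carrier G) \<times> Pow (carrier G))"
      using fin by (intro card_mono) (auto simp: SS_def dest: subgroup.subset)
    also have "\<dots> = 2 ^ g * 2 ^ g" using fin by (simp add: card_cartesian_product card_Pow g_def)
    also have "\<dots> = 4 ^ g" by (simp flip: power_mult_distrib)
    finally show "real (card SS) \<le> 4 ^ g" by (metis of_nat_le_iff of_nat_numeral of_nat_power)
    show "0 \<le> (1 / x) ^ (2 * g * w) * (1 + x * g) ^ N * ((\<zeta> ^ N + 1) * \<theta> ^ m)"
      using x zeta_ge_1 theta by (intro mult_nonneg_nonneg zero_le_power add_nonneg_nonneg) auto
  qed
  finally show ?thesis by (simp add: mult.assoc)
qed

lemma total_deviation:
  fixes x :: real
  defines "g \<equiv> card (carrier G)" and "N \<equiv> card (I \<union> J)"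
  assumes x: "0 < x" "x \<le> 1"
  shows "(\<Sum>F\<in>gen_tuples. \<bar>ker_prob F - (1 / real g) ^ N\<bar>)
    \<le> ((1 + \<eta>) ^ (g * N) - 1) + 4 ^ g * ((1 / x) ^ (2 * g * w) * (1 + x * g) ^ N * ((1 + \<eta>) ^ (g * N) + 1) * \<theta> ^ m)"
proof -
  let ?M = "{F\<in>gen_tuples. K1of F = carrier G \<and> K2of F = carrier G}"
  let ?A = "{F\<in>gen_tuples. \<not> (K1of F = carrier G \<and> K2of F = carrier G)}"
  let ?d = "\<lambda>F. \<bar>ker_prob F - (1 / real g) ^ N\<bar>"
  have "gen_tuples = ?M \<union> ?A" by auto
  then have "sum ?d gen_tuples = sum ?d (?M \<union> ?A)" by simp
  also have "\<dots> = sum ?d ?M + sum ?d ?A"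
    using finite_gen_tuples by (intro sum.union_disjoint) auto
  also have "sum ?d ?A \<le> (\<Sum>F\<in>?A. ker_prob F + (1 / real g) ^ N)"
  proof (rule sum_mono)
    show "?d F \<le> ker_prob F + (1 / real g) ^ N" for F
      using ker_prob_nonneg[of F] zero_le_power[of "1 / real g" N] by (simp add: abs_le_iff)
  qed
  also have "\<dots> \<le> 4 ^ g * ((1 / x) ^ (2 * g * w) * (1 + x * g) ^ N * (\<zeta> ^ N + 1) * \<theta> ^ m)"
    unfolding g_def N_def by (rule minor_terms_sum[OF x])
  also have "\<zeta> ^ N = (1 + \<eta>) ^ (g * N)" by (simp add: \<zeta>_def g_def power_mult)
  also have "sum ?d ?M \<le> (1 + \<eta>) ^ (g * N) - 1" unfolding g_def N_def by (rule main_terms_sum)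
  finally show ?thesis by simp
qed

end

section \<open>Vanishing of the total deviation\<close>

definition kernel_prob :: "('a, 'b) monoid_scheme \<Rightarrow> 'i set \<Rightarrow> 'i set \<Rightarrow> ('i \<Rightarrow> int) \<Rightarrow> ('i \<Rightarrow> 'i \<Rightarrow> int pmf) \<Rightarrow> ('i \<Rightarrow> 'a) \<Rightarrow> real" where
  "kernel_prob G I J c \<mu> F =
    (\<Prod>s\<in>I \<union> J. pmf (word_pmf G (if s \<in> I then J else I) F (\<mu> s)) (inv\<^bsub>G\<^esub> (F s [^]\<^bsub>G\<^esub> c s)))"

text \<open>In each block, the diagonal entries divisible by \<open>p\<close> are fewer than the positions in the other block,
with a margin proportional to \<open>n\<close>.\<close>

definition sparse_diag :: "nat \<Rightarrow> real \<Rightarrow> nat \<Rightarrow> 'i set \<Rightarrow> 'i set \<Rightarrow> ('i \<Rightarrow> int) \<Rightarrow> bool" where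
  "sparse_diag p \<kappa> n I J c \<longleftrightarrow>
     real (card {s\<in>I. int p dvd c s}) + \<kappa> * n \<le> card J \<and> real (card {s\<in>J. int p dvd c s}) + \<kappa> * n \<le> card I"

lemma exp_decay_bound_tendsto_0:
  fixes \<rho> \<delta> a b L C :: real and \<eta> :: "nat \<Rightarrow> real"
  assumes \<rho>: "0 < \<rho>" "\<rho> < 1" and \<delta>: "\<delta> > 0" and L: "L > 0" and a: "a \<ge> 0"
  defines "\<eta> \<equiv> \<lambda>n::nat. a * \<rho> powr (\<delta> * n)"
  shows "(\<lambda>n. (exp (b * (n * \<eta> n)) - 1) + C * (exp (- L * n) * (exp (b * (n * \<eta> n)) + 1))) \<longlonglongrightarrow> 0"
    and "(\<lambda>n. n * \<eta> n) \<longlonglongrightarrow> 0"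
proof -
  define z where "z = \<rho> powr \<delta>"
  have z: "0 < z" using \<rho> by (simp add: z_def)
  have z1: "z < 1"
  proof -
    have "\<rho> powr \<delta> < \<rho> powr 0" by (rule powr_less_mono') (use \<rho> \<delta> in auto)
    then show ?thesis using \<rho> by (simp add: z_def)
  qed
  have zn: "\<rho> powr (\<delta> * n) = z ^ n" for n :: nat
  proof -
    have "z ^ n = z powr n" by (rule powr_realpow[OF z, symmetric])
    also have "\<dots> = \<rho> powr (\<delta> * n)" unfolding z_def by (rule powr_powr)
    finally show ?thesis ..
  qed
  have "(\<lambda>n. a * (real n * z ^ n)) \<longlonglongrightarrow> a * 0"
    using z z1 by (intro tendsto_mult tendsto_const powser_times_n_limit_0) auto
  then show lim: "(\<lambda>n. n * \<eta> n) \<longlonglongrightarrow> 0" by (simp add: \<eta>_def zn ac_simps)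
  have ex: "(\<lambda>n::nat. exp (- L * n)) \<longlonglongrightarrow> 0"
  proof -
    have "(\<lambda>n::nat. exp (-L) ^ n) \<longlonglongrightarrow> 0" using L by (intro LIMSEQ_realpow_zero) auto
    then show ?thesis by (simp add: exp_of_nat_mult[symmetric] mult.commute)
  qed
  have "(\<lambda>n. (exp (b * (n * \<eta> n)) - 1) + C * (exp (- L * n) * (exp (b * (n * \<eta> n)) + 1)))
      \<longlonglongrightarrow> (exp (b * 0) - 1) + C * (0 * (exp (b * 0) + 1))"
    by (intro tendsto_intros lim ex)
  then show "(\<lambda>n. (exp (b * (n * \<eta> n)) - 1) + C * (exp (- L * n) * (exp (b * (n * \<eta> n)) + 1))) \<longlonglongrightarrow> 0" by simp
qed

text \<open>The threshold for heavy values is a small multiple \<open>\<delta> n\<close> of \<open>n\<close>. This is enough for the mixing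
error to decay exponentially, while the number of exceptional parts grows at most like
\<open>exp (L / 2 * n)\<close>, where \<open>exp (- L * n)\<close> is the gain from a margin of \<open>\<kappa> n\<close>. The bound is uniform
in the blocks, the diagonal and the laws of the entries.\<close>

lemma (in torsion_model) deviation_vanishes:
  assumes \<kappa>: "\<kappa> > 0" and e: "e > 0"
  shows "\<forall>\<^sub>F n in sequentially. \<forall>(I :: 'i set) J c \<mu>.
     finite I \<longrightarrow> finite J \<longrightarrow> I \<inter> J = {} \<longrightarrow> card I \<le> n \<longrightarrow> card J \<le> n \<longrightarrow> sparse_diag p \<kappa> n I J c \<longrightarrow>
     (\<forall>s\<in>I. \<forall>r\<in>J. bal_pmf p q \<epsilon> (\<mu> s r) \<and> bal_pmf p q \<epsilon> (\<mu> r s)) \<longrightarrow>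
     (\<Sum>F\<in>generating_tuples G (I \<union> J). \<bar>kernel_prob G I J c \<mu> F - (1 / card (carrier G)) ^ card (I \<union> J)\<bar>) \<le> e"
proof -
  define g where "g = real (card (carrier G))"
  have g: "g > 0" using card_carrier_pos by (simp add: g_def)
  define th where "th = max (1/2) (1 - \<epsilon>)"
  have th: "0 < th" "th < 1" using eps by (auto simp: th_def)
  define L where "L = - \<kappa> * ln th"
  have L: "L > 0" using \<kappa> th by (simp add: L_def mult_pos_neg)
  \<comment> \<open>Then \<open>(1 + x g) ^ (2 n)\<close> is at most \<open>exp (L / 4 * n)\<close>.\<close>
  define x where "x = min 1 (L / (8 * g))"
  have x: "0 < x" "x \<le> 1" using L g by (auto simp: x_def)
  have "x * g \<le> L / (8 * g) * g" using g by (intro mult_right_mono) (auto simp: x_def)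
  then have xg: "x * g \<le> L / 8" using g by simp
  define lam where "lam = ln (1 / x)"
  have lam: "lam \<ge> 0" using x by (simp add: lam_def)
  \<comment> \<open>Then \<open>(1 / x) ^ (2 g \<delta> n)\<close> is at most \<open>exp (L / 4 * n)\<close>.\<close>
  define \<delta> where "\<delta> = L / (8 * g * (lam + 1))"
  have \<delta>: "\<delta> > 0" using L g lam by (simp add: \<delta>_def)
  define w where "w n = nat \<lceil>\<delta> * n\<rceil>" for n :: nat
  have w: "\<delta> * n \<le> w n" "w n \<le> \<delta> * n + 1" for n :: nat
    using \<delta> by (auto simp: w_def of_nat_nat intro: real_nat_ceiling_ge)
  define t where "t n = w n div q" for n
  have q0: "q > 0" using q_ge_2 by simp
  have t: "\<delta> * n / q - 1 \<le> t n" for n :: nat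
  proof -
    have "w n < q * (t n + 1)" unfolding t_def using dividend_less_times_div[OF q0, of "w n"] by simp
    then have "real (w n) \<le> real (q * (t n + 1))" by (simp only: of_nat_le_iff less_imp_le)
    then show ?thesis using w(1)[of n] q0 by (simp add: field_simps)
  qed
  define \<rho> where "\<rho> = max (1/2) rate"
  have \<rho>: "0 < \<rho>" "\<rho> < 1" using rate by (auto simp: \<rho>_def)
  define \<eta> where "\<eta> n = q * rate ^ t n" for n
  define h where "h n = (q / \<rho>) * \<rho> powr (\<delta> / q * n)" for n :: nat
  have \<eta>h: "\<eta> n \<le> h n" for n
  proof -
    have "rate ^ t n \<le> \<rho> ^ t n" using rate by (intro power_mono) (auto simp: \<rho>_def)
    also have "\<dots> = \<rho> powr (t n)" using \<rho> by (simp add: powr_realpow)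
    also have "\<dots> \<le> \<rho> powr (\<delta> * n / q - 1)" using t[of n] \<rho> by (intro powr_mono') auto
    also have "\<dots> = \<rho> powr (\<delta> / q * n) / \<rho>" using \<rho> by (simp add: powr_diff)
    finally have "q * rate ^ t n \<le> q * (\<rho> powr (\<delta> / q * n) / \<rho>)" by (intro mult_left_mono) auto
    then show ?thesis by (simp add: \<eta>_def h_def)
  qed
  have \<eta>0: "0 \<le> \<eta> n" for n using rate by (simp add: \<eta>_def)
  define C where "C = 4 ^ card (carrier G) * exp (2 * g * lam)"
  define D where "D n = (exp (2 * g * (n * h n)) - 1) + C * (exp (- (L / 2) * n) * (exp (2 * g * (n * h n)) + 1))" for n :: nat
  have D0: "D \<longlonglongrightarrow> 0"
    unfolding D_def h_def using \<rho> \<delta> q0 L by (intro exp_decay_bound_tendsto_0(1)) auto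
  have hn0: "(\<lambda>n. n * h n) \<longlonglongrightarrow> 0"
    unfolding h_def using \<rho> \<delta> q0 L by (intro exp_decay_bound_tendsto_0(2)[of _ _ 1]) auto
  have ev: "\<forall>\<^sub>F n in sequentially. n \<ge> 1 \<and> n * h n < 1 \<and> D n < e"
    using eventually_ge_at_top[of "1::nat"] order_tendstoD(2)[OF hn0, of 1] order_tendstoD(2)[OF D0 e]
    by (intro eventually_conj) auto
  then show ?thesis
  proof eventually_elim
    case (elim n)
    show ?case
    proof (intro allI impI)
      fix I J :: "'i set" and c \<mu>
      assume IJ: "finite I" "finite J" "I \<inter> J = {}" "card I \<le> n" "card J \<le> n" and sp: "sparse_diag p \<kappa> n I J c"
        and bal: "\<forall>s\<in>I. \<forall>r\<in>J. bal_pmf p q \<epsilon> (\<mu> s r) \<and> bal_pmf p q \<epsilon> (\<mu> r s)"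
      define m where "m = nat \<lceil>\<kappa> * n\<rceil>"
      have few: "card {s\<in>I. int p dvd c s} + m \<le> card J" "card {s\<in>J. int p dvd c s} + m \<le> card I"
      proof -
        have "a + m \<le> b" if "real a + \<kappa> * n \<le> real b" for a b :: nat
        proof -
          have "\<kappa> * n \<le> real_of_int (int b - int a)" using that by simp
          then have "\<lceil>\<kappa> * n\<rceil> \<le> int b - int a" by (simp only: ceiling_le_iff)
          moreover have "real a \<le> real b" using that \<kappa> by (smt (verit) mult_nonneg_nonneg of_nat_0_le_iff)
          ultimately show ?thesis unfolding m_def by linarith
        qed
        then show "card {s\<in>I. int p dvd c s} + m \<le> card J" "card {s\<in>J. int p dvd c s} + m \<le> card I"
          using sp by (auto simp: sparse_diag_def)
      qed
      have "\<eta> n \<le> n * h n" using elim \<eta>h[of n] \<eta>0[of n] mult_right_mono[of 1 "real n" "h n"] by linarith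
      then have \<eta>1: "\<eta> n \<le> 1" using elim by linarith
      have tw: "t n * q \<le> w n" by (simp add: t_def)
      interpret B: block_model G p k q \<epsilon> I J c \<mu> "w n" "t n" m "\<eta> n"
        by unfold_locales (use IJ bal few \<eta>1 tw in \<open>auto simp: \<eta>_def\<close>)
      let ?N = "card (I \<union> J)"
      have N: "real ?N \<le> 2 * n" using IJ card_Un_le[of I J] by linarith
      have kp: "kernel_prob G I J c \<mu> F = B.ker_prob F" for F
        by (simp add: kernel_prob_def B.ker_prob_def B.col_prob_def B.opp_def cong: prod.cong if_cong)
      have "(\<Sum>F\<in>generating_tuples G (I \<union> J). \<bar>kernel_prob G I J c \<mu> F - (1 / g) ^ ?N\<bar>)
        \<le> ((1 + \<eta> n) ^ (card (carrier G) * ?N) - 1) + 4 ^ card (carrier G) *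
          ((1 / x) ^ (2 * card (carrier G) * w n) * (1 + x * g) ^ ?N * ((1 + \<eta> n) ^ (card (carrier G) * ?N) + 1) * B.\<theta> ^ m)"
        unfolding kp g_def by (rule B.total_deviation[OF x])
      also have "\<dots> \<le> (exp (2 * g * (n * h n)) - 1) + 4 ^ card (carrier G) *
         (exp (2 * g * lam + L / 4 * n) * exp (L / 4 * n) * (exp (2 * g * (n * h n)) + 1) * exp (- L * n))"
      proof -
        have A: "(1 + \<eta> n) ^ (card (carrier G) * ?N) \<le> exp (2 * g * (n * h n))"
        proof -
          have "(1 + \<eta> n) ^ (card (carrier G) * ?N) \<le> exp (\<eta> n) ^ (card (carrier G) * ?N)"
            using \<eta>0 by (intro power_mono exp_ge_add_one_self) (auto intro: add_nonneg_nonneg)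
          also have "\<dots> = exp (g * ?N * \<eta> n)" by (simp add: exp_of_nat_mult[symmetric] g_def)
          also have "\<dots> \<le> exp (g * (2 * n) * h n)"
            using g N \<eta>h[of n] \<eta>0[of n] by (intro exp_le_cancel_iff[THEN iffD2] mult_mono) auto
          finally show ?thesis by (simp add: ac_simps)
        qed
        have B: "(1 / x) ^ (2 * card (carrier G) * w n) \<le> exp (2 * g * lam + L / 4 * n)"
        proof -
          have "(1 / x) ^ (2 * card (carrier G) * w n) = exp lam ^ (2 * card (carrier G) * w n)"
            using x by (simp add: lam_def)
          also have "\<dots> = exp (2 * g * lam * w n)" by (simp add: exp_of_nat_mult[symmetric] g_def ac_simps)
          also have "\<dots> \<le> exp (2 * g * lam * (\<delta> * n + 1))"
            using g lam w(2)[of n] by (intro exp_le_cancel_iff[THEN iffD2] mult_left_mono) auto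
          also have "2 * g * lam * (\<delta> * n + 1) \<le> 2 * g * lam + L / 4 * n"
          proof -
            have "2 * g * lam * (L / (8 * g * y)) = L / 4 * (lam / y)" if "y > 0" for y
              using g that by (simp add: field_simps)
            then have "2 * g * lam * \<delta> = L / 4 * (lam / (lam + 1))" using lam by (simp add: \<delta>_def)
            also have "\<dots> \<le> L / 4 * 1" using L lam by (intro mult_left_mono) auto
            finally have "2 * g * lam * \<delta> * n \<le> L / 4 * n" by (intro mult_right_mono) auto
            then show ?thesis by (simp add: algebra_simps)
          qed
          finally show ?thesis by simp
        qed
        have C: "(1 + x * g) ^ ?N \<le> exp (L / 4 * n)"
        proof -
          have "(1 + x * g) ^ ?N \<le> exp (x * g) ^ ?N"
            using x g by (intro power_mono exp_ge_add_one_self) (auto intro: add_nonneg_nonneg)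
          also have "\<dots> = exp (?N * (x * g))" by (simp add: exp_of_nat_mult[symmetric])
          also have "\<dots> \<le> exp (2 * n * (L / 8))"
            using N xg x g by (intro exp_le_cancel_iff[THEN iffD2] mult_mono) auto
          finally show ?thesis by simp
        qed
        have E: "B.\<theta> ^ m \<le> exp (- L * n)"
        proof -
          have "B.\<theta> ^ m = th powr m" using th by (simp add: B.\<theta>_def th_def powr_realpow)
          also have "\<dots> \<le> th powr (\<kappa> * n)" using th by (intro powr_mono') (auto simp: m_def intro: real_nat_ceiling_ge)
          also have "\<dots> = exp (- L * n)" using th by (simp add: powr_def L_def)
          finally show ?thesis .
        qed
        have pos: "0 \<le> B.\<theta>" "0 \<le> (1 + \<eta> n) ^ (card (carrier G) * ?N)" "0 \<le> (1 / x) ^ (2 * card (carrier G) * w n)" "0 \<le> (1 + x * g) ^ ?N"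
          using B.theta \<eta>0[of n] x g by auto
        show ?thesis
          using A B C E pos by (intro add_mono mult_mono diff_mono mult_nonneg_nonneg add_nonneg_nonneg) auto
      qed
      also have "\<dots> = D n"
      proof -
        have "exp (2 * g * lam + L / 4 * n) * exp (L / 4 * n) * exp (- L * n) = exp (2 * g * lam) * exp (- (L / 2) * n)"
          by (simp add: exp_add[symmetric] algebra_simps)
        then show ?thesis by (simp add: D_def C_def mult.assoc mult.left_commute mult.commute)
      qed
      also have "\<dots> \<le> e" using elim by simp
      finally show "(\<Sum>F\<in>generating_tuples G (I \<union> J). \<bar>kernel_prob G I J c \<mu> F - (1 / card (carrier G)) ^ ?N\<bar>) \<le> e"
        by (simp add: g_def)
    qed
  qed
qed

section \<open>Bonferroni inequalities for the lattice of subgroups\<close>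

lemma (in group) subgroup_card_dvd:
  assumes "subgroup B G" "subgroup A G" "B \<subseteq> A"
  shows "card B dvd card A"
proof -
  interpret A: group "G\<lparr>carrier := A\<rparr>" by (rule subgroup.subgroup_is_group[OF assms(2) is_group])
  have "subgroup B (G\<lparr>carrier := A\<rparr>)" using assms by (intro subgroup_incl) auto
  from A.lagrange[OF this] show ?thesis by (simp add: order_def) (metis dvd_triv_right)
qed

lemma (in group) nat_pow_int_pow:
  "x \<in> carrier G \<Longrightarrow> x [^] (int n * t) = (x [^] (n::nat)) [^] (t::int)"
  using int_pow_pow[of x "int n" t] by (simp add: int_pow_int)

lemma (in group) subgroup_nat_pow_closed:
  "subgroup K G \<Longrightarrow> x \<in> K \<Longrightarrow> x [^] (n::nat) \<in> K"
  using subgroup_int_pow_closed[of K x "int n"] by (simp add: int_pow_int)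

lemma (in comm_group) generate_insert_form:
  assumes B: "subgroup B G" and x: "x \<in> carrier G" and n: "n > 0" "x [^] (n::nat) \<in> B"
  shows "generate G (insert x B) = (\<lambda>(i, b). x [^] i \<otimes> b) ` ({0..<int n} \<times> B)"
proof -
  interpret B: subgroup B G by fact
  let ?D = "(\<lambda>(i, b). x [^] i \<otimes> b) ` ({0..<int n} \<times> B)"
  have in_D: "x [^] (i::int) \<otimes> b \<in> ?D" if "b \<in> B" for i b
  proof -
    have xn: "(x [^] n) [^] (i div int n) \<in> B" by (rule subgroup_int_pow_closed[OF B n(2)])
    have "x [^] i = x [^] (i mod int n + int n * (i div int n))" by simp
    also have "\<dots> = x [^] (i mod int n) \<otimes> x [^] (int n * (i div int n))" by (rule int_pow_mult[OF x])
    also have "x [^] (int n * (i div int n)) = (x [^] n) [^] (i div int n)"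
      by (rule nat_pow_int_pow[OF x])
    finally have "x [^] i \<otimes> b = x [^] (i mod int n) \<otimes> ((x [^] n) [^] (i div int n) \<otimes> b)"
      using x that by (simp add: m_assoc)
    moreover have "(x [^] n) [^] (i div int n) \<otimes> b \<in> B" using xn that by simp
    ultimately show ?thesis using n(1) by auto
  qed
  have sub: "subgroup ?D G"
  proof
    show "?D \<subseteq> carrier G" using x by auto
    show "\<one> \<in> ?D" using in_D[of \<one> 0] by simp
    fix y z assume "y \<in> ?D" "z \<in> ?D"
    then obtain i b j d where y: "y = x [^] (i::int) \<otimes> b" "b \<in> B" and z: "z = x [^] (j::int) \<otimes> d" "d \<in> B" by auto
    have "y \<otimes> z = x [^] (i + j) \<otimes> (b \<otimes> d)"
      using y z x by (simp add: int_pow_mult m_ac)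
    then show "y \<otimes> z \<in> ?D" using in_D[of "b \<otimes> d" "i + j"] y z by simp
  next
    fix y assume "y \<in> ?D"
    then obtain i b where y: "y = x [^] (i::int) \<otimes> b" "b \<in> B" by auto
    then have "inv y = x [^] (- i) \<otimes> inv b" using x by (simp add: inv_mult int_pow_neg)
    then show "inv y \<in> ?D" using in_D[of "inv b" "- i"] y by simp
  qed
  show ?thesis
  proof
    have "x \<in> ?D" using in_D[of \<one> 1] x by simp
    moreover have "B \<subseteq> ?D" using in_D[of _ 0] by auto
    ultimately show "generate G (insert x B) \<subseteq> ?D" using sub by (intro generate_subgroup_incl) auto
    have gs: "subgroup (generate G (insert x B)) G" using x B.subset by (intro generate_is_subgroup) auto
    have xg: "x \<in> generate G (insert x B)" by (rule generate.incl) simp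
    have bg: "b \<in> generate G (insert x B)" if "b \<in> B" for b using that by (intro generate.incl) simp
    show "?D \<subseteq> generate G (insert x B)"
      using subgroup_int_pow_closed[OF gs xg] bg subgroup.m_closed[OF gs] by auto
  qed
qed

lemma (in comm_group) card_generate_insert:
  assumes B: "subgroup B G" "finite B" and x: "x \<in> carrier G" "x \<notin> B" and p: "prime p" "x [^] (p::nat) \<in> B"
  shows "card (generate G (insert x B)) = p * card B"
proof -
  interpret B: subgroup B G by fact
  have p0: "p > 0" using p by (simp add: prime_gt_0_nat)
  have key: "i = j" if ij: "i \<in> {0..<int p}" "j \<in> {0..<int p}" "x [^] i \<otimes> inv (x [^] j) \<in> B" for i j :: int
  proof (rule ccontr)
    assume "i \<noteq> j"
    have "\<not> int p dvd (i - j)"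
    proof
      assume "int p dvd (i - j)"
      then have "i mod int p = j mod int p" by (simp add: mod_eq_dvd_iff)
      with ij(1,2) \<open>i \<noteq> j\<close> show False by simp
    qed
    then have "coprime (i - j) (int p)" using p by (simp add: prime_imp_coprime coprime_commute)
    then obtain s t where st: "s * (i - j) + t * int p = 1" using bezout_int[of "i - j" "int p"] by (auto simp: coprime_iff_gcd_eq_1)
    have xij: "x [^] (i - j) \<in> B" using ij(3) x by (simp add: int_pow_diff)
    have "x = x [^] ((i - j) * s + int p * t)" using st x by (simp add: mult.commute)
    also have "\<dots> = x [^] ((i - j) * s) \<otimes> x [^] (int p * t)" by (rule int_pow_mult[OF x(1)])
    also have "x [^] ((i - j) * s) = (x [^] (i - j)) [^] s" using x by (simp add: int_pow_pow)
    also have "x [^] (int p * t) = (x [^] p) [^] t" by (rule nat_pow_int_pow[OF x(1)])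
    finally have xe: "x = (x [^] (i - j)) [^] s \<otimes> (x [^] p) [^] t" .
    have "(x [^] (i - j)) [^] s \<in> B" "(x [^] p) [^] t \<in> B"
      using subgroup_int_pow_closed[OF B(1)] xij p(2) by auto
    then have "(x [^] (i - j)) [^] s \<otimes> (x [^] p) [^] t \<in> B" by (rule B.m_closed)
    then have "x \<in> B" by (rule ssubst[OF xe, of "\<lambda>y. y \<in> B"])
    with x show False by simp
  qed
  have "inj_on (\<lambda>(i, b). x [^] i \<otimes> b) ({0..<int p} \<times> B)"
  proof (rule inj_onI, clarify)
    fix i b j d assume H: "i \<in> {0..<int p}" "j \<in> {0..<int p}" "b \<in> B" "d \<in> B" "x [^] i \<otimes> b = x [^] j \<otimes> d"
    have c: "x [^] i \<in> carrier G" "x [^] j \<in> carrier G" "b \<in> carrier G" "d \<in> carrier G" using x H by auto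
    have "x [^] i = x [^] j \<otimes> d \<otimes> inv b" using H(5) c by (metis inv_solve_right m_closed)
    then have "x [^] i \<otimes> inv (x [^] j) = d \<otimes> inv b" using c by (simp add: m_ac)
    then have e: "i = j" using key[OF H(1,2)] H by simp
    moreover have "b = d" using H(5) c unfolding e by simp
    ultimately show "i = j \<and> b = d" by simp
  qed
  then have "card (generate G (insert x B)) = card ({0..<int p} \<times> B)"
    unfolding generate_insert_form[OF B(1) x(1) p0 p(2)] by (rule card_image)
  then show ?thesis by (simp add: card_cartesian_product)
qed

text \<open>Linear independence and span modulo \<open>B\<close>, for subgroups \<open>A\<close> in which every \<open>p\<close>-th power lies in \<open>B\<close>:
then \<open>A / B\<close> is a vector space over the field with \<open>p\<close> elements.\<close>

fun indep_list :: "('a, 'b) monoid_scheme \<Rightarrow> 'a set \<Rightarrow> 'a list \<Rightarrow> bool" where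
  "indep_list G B [] = True"
| "indep_list G B (x # xs) = (x \<notin> B \<and> indep_list G (generate G (insert x B)) xs)"

fun span_list :: "('a, 'b) monoid_scheme \<Rightarrow> 'a set \<Rightarrow> 'a list \<Rightarrow> 'a set" where
  "span_list G B [] = B"
| "span_list G B (x # xs) = span_list G (generate G (insert x B)) xs"

lemma (in comm_group) span_list:
  assumes "subgroup B G" "subgroup A G" "finite A" "B \<subseteq> A" "\<And>a. a \<in> A \<Longrightarrow> a [^] (p::nat) \<in> B" "prime p"
    and "set xs \<subseteq> A" "indep_list G B xs"
  shows "subgroup (span_list G B xs) G" "B \<subseteq> span_list G B xs" "set xs \<subseteq> span_list G B xs" "span_list G B xs \<subseteq> A"
    "card (span_list G B xs) = p ^ length xs * card B"
proof -
  have "subgroup (span_list G B xs) G \<and> B \<subseteq> span_list G B xs \<and> set xs \<subseteq> span_list G B xs \<and> span_list G B xs \<subseteq> A \<and>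
    card (span_list G B xs) = p ^ length xs * card B"
    using assms
  proof (induction xs arbitrary: B)
    case (Cons x xs)
    define B' where "B' = generate G (insert x B)"
    have Bc: "B \<subseteq> carrier G" "A \<subseteq> carrier G" "x \<in> A"
      using subgroup.subset[OF Cons.prems(1)] subgroup.subset[OF Cons.prems(2)] Cons.prems(7) by auto
    then have xc: "x \<in> carrier G" by auto
    have B': "subgroup B' G" unfolding B'_def using Bc xc by (intro generate_is_subgroup) auto
    have BB': "B \<subseteq> B'" "x \<in> B'" unfolding B'_def by (auto intro: generate.incl)
    have B'A: "B' \<subseteq> A" unfolding B'_def using Bc Cons.prems by (intro generate_subgroup_incl) auto
    have c: "card B' = p * card B" unfolding B'_def
      using Cons.prems Bc xc finite_subset[of B A] by (intro card_generate_insert) auto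
    have "subgroup (span_list G B' xs) G \<and> B' \<subseteq> span_list G B' xs \<and> set xs \<subseteq> span_list G B' xs \<and> span_list G B' xs \<subseteq> A \<and>
       card (span_list G B' xs) = p ^ length xs * card B'"
      using Cons.prems B' B'A BB' by (intro Cons.IH) (auto simp: B'_def)
    then show ?case using BB' c by (auto simp: B'_def[symmetric])
  qed auto
  then show "subgroup (span_list G B xs) G" "B \<subseteq> span_list G B xs" "set xs \<subseteq> span_list G B xs" "span_list G B xs \<subseteq> A"
    "card (span_list G B xs) = p ^ length xs * card B" by auto
qed

lemma (in comm_group) card_indep_lists:
  assumes "subgroup B G" "subgroup A G" "finite A" "B \<subseteq> A" "\<And>a. a \<in> A \<Longrightarrow> a [^] (p::nat) \<in> B" "prime p"
    and "card A = p ^ d * card B"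
  shows "real (card {xs. length xs = j \<and> set xs \<subseteq> A \<and> indep_list G B xs}) = real (card B) ^ j * (\<Prod>i<j. real p ^ d - real p ^ i)"
  using assms
proof (induction j arbitrary: B d)
  case 0
  have "{xs. length xs = 0 \<and> set xs \<subseteq> A \<and> indep_list G B xs} = {[]}" by auto
  then show ?case by simp
next
  case (Suc j)
  let ?L = "\<lambda>j B. {xs. length xs = j \<and> set xs \<subseteq> A \<and> indep_list G B xs}"
  have finB: "finite B" using Suc.prems finite_subset by auto
  have B0: "card B > 0" using finB subgroup.one_closed[OF Suc.prems(1)] by (auto simp: card_gt_0_iff)
  have p1: "p > 1" by (rule prime_gt_1_nat[OF Suc.prems(6)])
  have finL: "finite (?L j B)" for j B
    by (rule finite_subset[OF _ finite_lists_length_eq[OF \<open>finite A\<close>, of j]]) auto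
  have L: "?L (Suc j) B = (\<Union>x\<in>A - B. (\<lambda>xs. x # xs) ` ?L j (generate G (insert x B)))"
  proof safe
    fix xs assume "length xs = Suc j" "set xs \<subseteq> A" "indep_list G B xs"
    then show "xs \<in> (\<Union>x\<in>A - B. (\<lambda>xs. x # xs) ` ?L j (generate G (insert x B)))"
      by (cases xs) auto
  qed auto
  have "real (card (?L (Suc j) B)) = (\<Sum>x\<in>A - B. real (card ((\<lambda>xs. x # xs) ` ?L j (generate G (insert x B)))))"
    unfolding L using Suc.prems finL by (subst card_UN_disjoint) auto
  also have "\<dots> = (\<Sum>x\<in>A - B. real (card (?L j (generate G (insert x B)))))"
    by (intro sum.cong refl arg_cong[where f=real] card_image) auto
  also have "\<dots> = (\<Sum>x\<in>A - B. real (card B) ^ j * (\<Prod>i<j. real p ^ d - real p ^ Suc i))"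
  proof (rule sum.cong[OF refl])
    fix x assume x: "x \<in> A - B"
    define B' where "B' = generate G (insert x B)"
    have Bc: "B \<subseteq> carrier G" "A \<subseteq> carrier G" "x \<in> carrier G"
      using subgroup.subset[OF Suc.prems(1)] subgroup.subset[OF Suc.prems(2)] x by auto
    have B': "subgroup B' G" unfolding B'_def using Bc by (intro generate_is_subgroup) auto
    have BB': "B \<subseteq> B'" unfolding B'_def by (auto intro: generate.incl)
    have B'A: "B' \<subseteq> A" unfolding B'_def using Bc Suc.prems x by (intro generate_subgroup_incl) auto
    have c: "card B' = p * card B" unfolding B'_def
      using Suc.prems Bc finB x by (intro card_generate_insert) auto
    have "d \<noteq> 0"
    proof
      assume "d = 0"
      then have "B = A" using Suc.prems by (intro card_subset_eq) auto
      then show False using x by auto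
    qed
    then obtain d' where d: "d = Suc d'" by (cases d) auto
    have "real (card (?L j B')) = real (card B') ^ j * (\<Prod>i<j. real p ^ d' - real p ^ i)"
      using Suc.prems B' B'A BB' c d by (intro Suc.IH) auto
    also have "\<dots> = real (card B) ^ j * (\<Prod>i<j. real p ^ d - real p ^ Suc i)"
    proof -
      have "(\<Prod>i<j. real p ^ d - real p ^ Suc i) = (\<Prod>i<j. real p * (real p ^ d' - real p ^ i))"
        by (simp add: d algebra_simps)
      also have "\<dots> = real p ^ j * (\<Prod>i<j. real p ^ d' - real p ^ i)" by (simp add: prod.distrib)
      finally show ?thesis using c by (simp add: power_mult_distrib)
    qed
    finally show "real (card (?L j (generate G (insert x B)))) = real (card B) ^ j * (\<Prod>i<j. real p ^ d - real p ^ Suc i)"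
      by (simp add: B'_def)
  qed
  also have "\<dots> = real (card (A - B)) * (real (card B) ^ j * (\<Prod>i<j. real p ^ d - real p ^ Suc i))" by simp
  also have "real (card (A - B)) = real (card B) * (real p ^ d - 1)"
  proof -
    have "real (card (A - B)) = real (card A) - real (card B)"
      using finB Suc.prems(3,4) card_mono[OF Suc.prems(3,4)] by (simp add: card_Diff_subset of_nat_diff)
    then show ?thesis using Suc.prems by (simp add: algebra_simps)
  qed
  also have "real (card B) * (real p ^ d - 1) * (real (card B) ^ j * (\<Prod>i<j. real p ^ d - real p ^ Suc i))
     = real (card B) ^ Suc j * (\<Prod>i<Suc j. real p ^ d - real p ^ i)"
    by (simp add: prod.lessThan_Suc_shift del: prod.lessThan_Suc)
  finally show ?case .
qed

lemma prod_power_diff: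
  assumes "p \<ge> 2" "j \<le> d"
  shows "(\<Prod>i<j. real p ^ d - real p ^ i) = real p ^ (j choose 2) * (qfac p d / qfac p (d - j))"
proof -
  have "(\<Prod>i<j. real p ^ d - real p ^ i) = (\<Prod>i<j. real p ^ i * (real p ^ (d - i) - 1))"
    using assms by (intro prod.cong) (auto simp: algebra_simps simp flip: power_add)
  also have "\<dots> = real p ^ (j choose 2) * (\<Prod>i<j. real p ^ (d - i) - 1)"
    by (simp add: prod.distrib flip: power_sum sum_lessThan_id_choose)
  finally show ?thesis using qfac_quotient[OF assms] by simp
qed

text \<open>Every subgroup of the given order is the span of the independent lists of length \<open>j\<close> in it, and an
independent list has only one span. Counting the lists in \<open>A\<close> in two ways gives the number.\<close>

lemma (in comm_group) card_intermediate_subgroups: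
  assumes AB: "subgroup B G" "subgroup A G" "finite A" "B \<subseteq> A" "\<And>a. a \<in> A \<Longrightarrow> a [^] (p::nat) \<in> B" "prime p"
    and d: "card A = p ^ d * card B" and j: "j \<le> d"
  shows "real (card {N. subgroup N G \<and> B \<subseteq> N \<and> N \<subseteq> A \<and> card N = p ^ j * card B}) = qbinom p d j"
proof -
  let ?S = "{N. subgroup N G \<and> B \<subseteq> N \<and> N \<subseteq> A \<and> card N = p ^ j * card B}"
  let ?L = "\<lambda>A. {xs. length xs = j \<and> set xs \<subseteq> A \<and> indep_list G B xs}"
  have p2: "p \<ge> 2" using AB by (simp add: prime_ge_2_nat)
  have finB: "finite B" using AB finite_subset by auto
  have B0: "card B > 0" using finB subgroup.one_closed[OF AB(1)] by (auto simp: card_gt_0_iff)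
  have finS: "finite ?S" by (rule finite_subset[of _ "Pow A"]) (use AB in auto)
  have finL: "finite (?L N)" if "N \<subseteq> A" for N
    by (rule finite_subset[OF _ finite_lists_length_eq[OF \<open>finite A\<close>, of j]]) (use that in auto)
  have U: "?L A = (\<Union>N\<in>?S. ?L N)"
  proof safe
    fix xs assume xs: "set xs \<subseteq> A" "indep_list G B xs" "j = length xs"
    note sp = span_list[OF AB xs(1,2)]
    show "xs \<in> (\<Union>N\<in>{N. subgroup N G \<and> B \<subseteq> N \<and> N \<subseteq> A \<and> card N = p ^ length xs * card B}. {ys. length ys = length xs \<and> set ys \<subseteq> N \<and> indep_list G B ys})"
      using sp xs by (intro UN_I[of "span_list G B xs"]) auto
  qed auto
  have disj: "?L N \<inter> ?L N' = {}" if N: "N \<in> ?S" "N' \<in> ?S" "N \<noteq> N'" for N N'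
  proof (rule ccontr)
    assume "?L N \<inter> ?L N' \<noteq> {}"
    then obtain xs where xs: "length xs = j" "set xs \<subseteq> N" "set xs \<subseteq> N'" "indep_list G B xs" by auto
    have eq: "span_list G B xs = N" if N: "N \<in> ?S" "set xs \<subseteq> N" for N
    proof (rule card_subset_eq)
      show fN: "finite N" using N AB finite_subset by auto
      have "subgroup N G" "B \<subseteq> N" "\<And>a. a \<in> N \<Longrightarrow> a [^] p \<in> B" using N AB by auto
      note sp = span_list[OF AB(1) this(1) fN this(2,3) AB(6) N(2) xs(4)]
      show "span_list G B xs \<subseteq> N" "card (span_list G B xs) = card N" using sp N xs by auto
    qed
    show False using eq[OF N(1) xs(2)] eq[OF N(2) xs(3)] N(3) by simp
  qed
  have "real (card (?L A)) = (\<Sum>N\<in>?S. real (card (?L N)))"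
    unfolding U using finS finL disj by (subst card_UN_disjoint) auto
  also have "\<dots> = (\<Sum>N\<in>?S. real (card B) ^ j * (\<Prod>i<j. real p ^ j - real p ^ i))"
  proof (rule sum.cong[OF refl])
    fix N assume N: "N \<in> ?S"
    then have "finite N" using AB finite_subset by auto
    then show "real (card (?L N)) = real (card B) ^ j * (\<Prod>i<j. real p ^ j - real p ^ i)"
      using N AB by (intro card_indep_lists) auto
  qed
  also have "\<dots> = real (card ?S) * (real (card B) ^ j * (\<Prod>i<j. real p ^ j - real p ^ i))" by simp
  finally have "real (card B) ^ j * (\<Prod>i<j. real p ^ d - real p ^ i) = real (card ?S) * (real (card B) ^ j * (\<Prod>i<j. real p ^ j - real p ^ i))"
    using card_indep_lists[OF AB d, of j] by simp
  then have "(\<Prod>i<j. real p ^ d - real p ^ i) = real (card ?S) * (\<Prod>i<j. real p ^ j - real p ^ i)"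
    using B0 by simp
  then have "real p ^ (j choose 2) * (qfac p d / qfac p (d - j)) = real (card ?S) * (real p ^ (j choose 2) * qfac p j)"
    using prod_power_diff[OF p2 j] prod_power_diff[OF p2 order_refl, of j] by simp
  then have "qfac p d / qfac p (d - j) = real (card ?S) * qfac p j"
    unfolding mult.left_commute[of "real (card ?S)"] mult_cancel_left using p2 by simp
  then have "real (card ?S) = qfac p d / qfac p (d - j) / qfac p j" using qfac_pos[OF p2, of j] by simp
  then show ?thesis using j by (simp add: qbinom_def mult.commute)
qed

lemma (in comm_group) card_subgroups_of_index:
  assumes AB: "subgroup B G" "subgroup A G" "finite A" "B \<subseteq> A" "\<And>a. a \<in> A \<Longrightarrow> a [^] (p::nat) \<in> B" "prime p"
    and d: "card A = p ^ d * card B"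
  shows "real (card {N. subgroup N G \<and> B \<subseteq> N \<and> N \<subseteq> A \<and> card A = p ^ r * card N}) = qbinom p d r"
proof -
  have p2: "p \<ge> 2" using AB by (simp add: prime_ge_2_nat)
  have finB: "finite B" using AB finite_subset by auto
  have B0: "card B > 0" using finB subgroup.one_closed[OF AB(1)] by (auto simp: card_gt_0_iff)
  show ?thesis
  proof (cases "r \<le> d")
    case True
    have eq: "card A = p ^ r * card N \<longleftrightarrow> card N = p ^ (d - r) * card B" for N
    proof -
      have "p ^ d = p ^ r * p ^ (d - r)" using True by (simp flip: power_add)
      then show ?thesis using p2 by (auto simp: d)
    qed
    show ?thesis unfolding eq
      using card_intermediate_subgroups[OF AB d, of "d - r"] qbinom_sym[OF True, of p] by simp
  next
    case False
    have e: "{N. subgroup N G \<and> B \<subseteq> N \<and> N \<subseteq> A \<and> card A = p ^ r * card N} = {}"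
    proof safe
      fix N assume N: "B \<subseteq> N" "N \<subseteq> A" "card A = p ^ r * card N"
      have "card B \<le> card N" using N AB finite_subset[of N A] by (intro card_mono) auto
      then have "p ^ r * card B \<le> p ^ d * card B" using N d by (metis mult_le_mono2)
      then have "p ^ r \<le> p ^ d" using B0 by simp
      then show "N \<in> {}" using False p2 by (simp add: power_le_imp_le_exp)
    qed
    show ?thesis unfolding e using False by (simp add: qbinom_def)
  qed
qed

text \<open>The subgroups \<open>N\<close> between \<open>Q\<close> and \<open>A\<close> for which \<open>A / N\<close> is elementary abelian of rank \<open>r\<close>.\<close>

definition index_subgroups :: "('a, 'b) monoid_scheme \<Rightarrow> nat \<Rightarrow> 'a set \<Rightarrow> 'a set \<Rightarrow> nat \<Rightarrow> 'a set set" where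
  "index_subgroups G p Q A r =
     {N. subgroup N G \<and> Q \<subseteq> N \<and> N \<subseteq> A \<and> (\<forall>a\<in>A. a [^]\<^bsub>G\<^esub> p \<in> N) \<and> card A = p ^ r * card N}"

lemma (in comm_group) subgroup_mult_powers:
  assumes Q: "subgroup Q G" and A: "subgroup A G"
  shows "subgroup {u \<otimes> a [^] (n::nat) | u a. u \<in> Q \<and> a \<in> A} G"
proof -
  interpret Q: subgroup Q G by fact
  interpret A: subgroup A G by fact
  show ?thesis
  proof
    show "{u \<otimes> a [^] n | u a. u \<in> Q \<and> a \<in> A} \<subseteq> carrier G" by auto
    have "\<one> = \<one> \<otimes> \<one> [^] n" by simp
    then show "\<one> \<in> {u \<otimes> a [^] n | u a. u \<in> Q \<and> a \<in> A}" using Q.one_closed A.one_closed by blast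
    fix x y assume "x \<in> {u \<otimes> a [^] n | u a. u \<in> Q \<and> a \<in> A}" "y \<in> {u \<otimes> a [^] n | u a. u \<in> Q \<and> a \<in> A}"
    then obtain u a v b where *: "x = u \<otimes> a [^] n" "u \<in> Q" "a \<in> A" "y = v \<otimes> b [^] n" "v \<in> Q" "b \<in> A" by auto
    have "x \<otimes> y = (u \<otimes> v) \<otimes> (a \<otimes> b) [^] n"
      using * by (simp add: nat_pow_distrib m_ac)
    then show "x \<otimes> y \<in> {u \<otimes> a [^] n | u a. u \<in> Q \<and> a \<in> A}" using * by blast
  next
    fix x assume "x \<in> {u \<otimes> a [^] n | u a. u \<in> Q \<and> a \<in> A}"
    then obtain u a where *: "x = u \<otimes> a [^] n" "u \<in> Q" "a \<in> A" by auto
    have "inv x = inv u \<otimes> (inv a) [^] n" using * by (simp add: inv_mult nat_pow_inv)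
    then show "inv x \<in> {u \<otimes> a [^] n | u a. u \<in> Q \<and> a \<in> A}" using * by blast
  qed
qed

text \<open>The nongenerator property of the Frattini subgroup: substituting the relation into itself turns the
\<open>p\<close>-th powers into \<open>p ^ M\<close>-th powers.\<close>

lemma (in comm_group) mult_powers_eq_imp_eq:
  assumes Q: "subgroup Q G" and A: "subgroup A G" "Q \<subseteq> A" and pM: "\<And>a. a \<in> A \<Longrightarrow> a [^] (p ^ M :: nat) = \<one>"
    and gen: "\<And>a. a \<in> A \<Longrightarrow> \<exists>u\<in>Q. \<exists>b\<in>A. a = u \<otimes> b [^] (p::nat)"
  shows "Q = A"
proof -
  interpret Q: subgroup Q G by fact
  interpret A: subgroup A G by fact
  have it: "\<exists>u\<in>Q. \<exists>b\<in>A. a = u \<otimes> b [^] (p ^ i :: nat)" if "a \<in> A" for a i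
    using that
  proof (induction i arbitrary: a)
    case 0
    then have "a = \<one> \<otimes> a [^] (p ^ 0 :: nat)" by simp
    then show ?case using 0 Q.one_closed by blast
  next
    case (Suc i)
    then obtain u b where ub: "u \<in> Q" "b \<in> A" "a = u \<otimes> b [^] (p ^ i :: nat)" by blast
    obtain v d where vd: "v \<in> Q" "d \<in> A" "b = v \<otimes> d [^] p" using gen[OF ub(2)] by blast
    have "a = (u \<otimes> v [^] (p ^ i :: nat)) \<otimes> d [^] (p ^ Suc i :: nat)"
      using ub vd by (simp add: nat_pow_distrib nat_pow_pow m_assoc mult.commute)
    moreover have "u \<otimes> v [^] (p ^ i :: nat) \<in> Q" using ub vd by (simp add: subgroup_nat_pow_closed[OF Q])
    ultimately show ?case using vd by blast
  qed
  have "a \<in> Q" if aA: "a \<in> A" for a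
  proof -
    obtain u b where "u \<in> Q" "b \<in> A" "a = u \<otimes> b [^] (p ^ M :: nat)" using it[OF aA, of M] by blast
    then show ?thesis using pM by simp
  qed
  then show ?thesis using A(2) by auto
qed

text \<open>The subgroups counted here are those between \<open>B = Q A\<^sup>p\<close> and \<open>A\<close>, and \<open>A / B\<close> is a vector space of
some dimension \<open>d\<close>. If \<open>d = 0\<close>, then \<open>Q = A\<close> and only the term \<open>r = 0\<close> is nonzero. Otherwise
\<open>Q \<noteq> A\<close>, and the alternating sum of Gaussian binomial coefficients has the sign of its last term.\<close>

lemma (in comm_group) bonferroni_subgroup:
  assumes fin: "finite (carrier G)" and ord: "order G = p ^ M" and p: "prime p"
    and Q: "subgroup Q G" and A: "subgroup A G"
  shows "(-1) ^ R * ((\<Sum>r\<le>R. (-1) ^ r * real p ^ (r choose 2) * real (card (index_subgroups G p Q A r))) - of_bool (Q = A)) \<ge> 0"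
proof (cases "Q \<subseteq> A")
  case False
  then have "index_subgroups G p Q A r = {}" for r by (auto simp: index_subgroups_def)
  then show ?thesis using False by auto
next
  case QA: True
  interpret Q: subgroup Q G by fact
  interpret A: subgroup A G by fact
  have p2: "p \<ge> 2" using p by (simp add: prime_ge_2_nat)
  \<comment> \<open>A subgroup lies over \<open>Q\<close> with elementary abelian quotient of \<open>A\<close> exactly if it contains \<open>B\<close>.\<close>
  define B where "B = {u \<otimes> a [^] p | u a. u \<in> Q \<and> a \<in> A}"
  have B: "subgroup B G" unfolding B_def by (rule subgroup_mult_powers[OF Q A])
  have finA: "finite A" using fin A.subset finite_subset by auto
  have QB: "Q \<subseteq> B"
  proof
    fix u assume u: "u \<in> Q"
    then have "u = u \<otimes> \<one> [^] p" by simp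
    then show "u \<in> B" unfolding B_def using u A.one_closed by blast
  qed
  have AB: "a [^] p \<in> B" if a: "a \<in> A" for a
  proof -
    have "a [^] p = \<one> \<otimes> a [^] p" using a by simp
    then show ?thesis unfolding B_def using a Q.one_closed by blast
  qed
  have BA: "B \<subseteq> A" unfolding B_def using QA by (auto intro!: A.m_closed subgroup_nat_pow_closed[OF A])
  have iff: "Q \<subseteq> N \<and> N \<subseteq> A \<and> (\<forall>a\<in>A. a [^] p \<in> N) \<longleftrightarrow> B \<subseteq> N \<and> N \<subseteq> A" if N: "subgroup N G" for N
    using QB AB subgroup.m_closed[OF N] by (auto simp: B_def)
  have idx: "index_subgroups G p Q A r = {N. subgroup N G \<and> B \<subseteq> N \<and> N \<subseteq> A \<and> card A = p ^ r * card N}" for r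
    unfolding index_subgroups_def using iff by blast
  obtain d where d: "card A = p ^ d * card B"
  proof -
    have "card A dvd p ^ M" "card B dvd card A"
      using subgroup_card_dvd[OF A subgroup_self] subgroup_card_dvd[OF B A BA] A.subset ord by (auto simp: order_def)
    then obtain a b where ab: "card A = p ^ a" "card B = p ^ b"
      using divides_primepow_nat[OF p] dvd_trans by metis
    have "b \<le> a" using \<open>card B dvd card A\<close> ab p2 by (simp add: dvd_power_iff_le)
    then have "card A = p ^ (a - b) * card B" using ab by (simp flip: power_add)
    then show thesis by (rule that)
  qed
  have cnt: "real (card (index_subgroups G p Q A r)) = qbinom p d r" for r
    unfolding idx by (rule card_subgroups_of_index[OF B A finA BA AB p d])
  show ?thesis
  proof (cases d)
    case 0
    have "card A = card B" using d 0 by simp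
    then have "B = A" using BA finA by (intro card_subset_eq) auto
    then have gen: "\<exists>u\<in>Q. \<exists>b\<in>A. a = u \<otimes> b [^] p" if "a \<in> A" for a using that unfolding B_def by blast
    have "a [^] (p ^ M :: nat) = \<one>" if "a \<in> A" for a
      using power_order_eq_one[OF fin, of a] ord that by (simp add: order_def)
    then have "Q = A" using mult_powers_eq_imp_eq[OF Q A QA _ gen] by blast
    moreover have "(\<Sum>r\<le>R. (-1) ^ r * real p ^ (r choose 2) * qbinom p 0 r) = 1"
    proof -
      have "(\<Sum>r\<le>R. (-1) ^ r * real p ^ (r choose 2) * qbinom p 0 r) = (\<Sum>r\<in>{0}. (-1) ^ r * real p ^ (r choose 2) * qbinom p 0 r)"
        by (rule sum.mono_neutral_right) (auto simp: qbinom_def)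
      also have "\<dots> = 1" using p2 by (simp add: numeral_2_eq_2)
      finally show ?thesis .
    qed
    ultimately show ?thesis unfolding cnt 0 by simp
  next
    case (Suc d')
    have "Q \<noteq> A"
    proof
      assume "Q = A"
      then have "card A = card B" using QB BA by auto
      moreover have "card B > 0" using finite_subset[OF BA finA] subgroup.one_closed[OF B] by (auto simp: card_gt_0_iff)
      ultimately have "p ^ d = 1" using d by simp
      then show False using p2 Suc by simp
    qed
    then have "(-1) ^ R * ((\<Sum>r\<le>R. (-1) ^ r * real p ^ (r choose 2) * real (card (index_subgroups G p Q A r))) - of_bool (Q = A))
      = ((-1) ^ R * (-1) ^ R) * real p ^ (Suc R choose 2) * qbinom p d' R"
      using qbinom_alternating_partial_sum[OF p2, of d' R] by (simp add: cnt Suc)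
    also have "\<dots> = real p ^ (Suc R choose 2) * qbinom p d' R" by (simp flip: power_add)
    finally show ?thesis using qbinom_nonneg[OF p2] by simp
  qed
qed

section \<open>Vectors of residues and surjections onto finite groups\<close>

definition modvec :: "nat \<Rightarrow> nat \<Rightarrow> (nat \<Rightarrow> int) monoid" where
  "modvec q N = product_group {..<N} (\<lambda>_. integer_mod_group q)"

definition std_vec :: "nat \<Rightarrow> nat \<Rightarrow> nat \<Rightarrow> int" where
  "std_vec N r = (\<lambda>i\<in>{..<N}. if i = r then 1 else 0)"

definition word_ker :: "nat \<Rightarrow> nat \<Rightarrow> ('a, 'b) monoid_scheme \<Rightarrow> (nat \<Rightarrow> 'a) \<Rightarrow> (nat \<Rightarrow> int) set" where
  "word_ker q N H F = {v\<in>carrier (modvec q N). word H {..<N} F v = \<one>\<^bsub>H\<^esub>}"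

lemma comm_group_modvec: "comm_group (modvec q N)"
  unfolding modvec_def
proof (rule group.group_comm_groupI)
  show "group (product_group {..<N} (\<lambda>_. integer_mod_group q))" by simp
  fix x y assume "x \<in> carrier (product_group {..<N} (\<lambda>_. integer_mod_group q))" "y \<in> carrier (product_group {..<N} (\<lambda>_. integer_mod_group q))"
  show "x \<otimes>\<^bsub>product_group {..<N} (\<lambda>_. integer_mod_group q)\<^esub> y = y \<otimes>\<^bsub>product_group {..<N} (\<lambda>_. integer_mod_group q)\<^esub> x"
    by (simp add: add.commute)
qed

context
  fixes q N :: nat
  assumes q: "q \<ge> 2"
begin

interpretation V: comm_group "modvec q N" by (rule comm_group_modvec)

lemma carrier_modvec: "carrier (modvec q N) = PiE {..<N} (\<lambda>_. {0..<int q})"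
  using q by (simp add: modvec_def carrier_integer_mod_group)

lemma finite_carrier_modvec: "finite (carrier (modvec q N))"
  unfolding carrier_modvec by (intro finite_PiE) auto

lemma order_modvec: "order (modvec q N) = q ^ N"
  unfolding order_def carrier_modvec by (simp add: card_PiE)

lemma mult_modvec: "v \<otimes>\<^bsub>modvec q N\<^esub> w = (\<lambda>r\<in>{..<N}. (v r + w r) mod int q)"
  by (simp add: modvec_def)

lemma one_modvec: "\<one>\<^bsub>modvec q N\<^esub> = (\<lambda>r\<in>{..<N}. 0)"
  by (simp add: modvec_def)

lemma pow_modvec: "v [^]\<^bsub>modvec q N\<^esub> (t::nat) = (\<lambda>r\<in>{..<N}. (int t * v r) mod int q)"
proof (induction t)
  case 0
  then show ?case by (simp add: one_modvec)
next
  case (Suc t)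
  show ?case unfolding V.nat_pow_Suc Suc.IH mult_modvec
    by (rule restrict_ext) (simp add: mod_simps algebra_simps)
qed

lemma std_vec_closed: "std_vec N r \<in> carrier (modvec q N)"
  using q by (auto simp: std_vec_def carrier_modvec)

lemma modvec_exponent: "v \<in> carrier (modvec q N) \<Longrightarrow> v [^]\<^bsub>modvec q N\<^esub> q = \<one>\<^bsub>modvec q N\<^esub>"
  by (simp add: pow_modvec one_modvec)

lemma word_hom:
  assumes H: "comm_group H" "\<And>x. x \<in> carrier H \<Longrightarrow> x [^]\<^bsub>H\<^esub> q = \<one>\<^bsub>H\<^esub>" and F: "F \<in> {..<N} \<rightarrow> carrier H"
  shows "word H {..<N} F \<in> hom (modvec q N) H"
proof (rule homI)
  interpret H: comm_group H by fact
  show "word H {..<N} F v \<in> carrier H" for v using F by simp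
  fix v w assume "v \<in> carrier (modvec q N)" "w \<in> carrier (modvec q N)"
  have Fr: "F r \<in> carrier H" if "r < N" for r using F that by auto
  have "word H {..<N} F (v \<otimes>\<^bsub>modvec q N\<^esub> w) = finprod H (\<lambda>r. F r [^]\<^bsub>H\<^esub> v r \<otimes>\<^bsub>H\<^esub> F r [^]\<^bsub>H\<^esub> w r) {..<N}"
    unfolding word_def
  proof (rule H.finprod_cong')
    fix r assume "r \<in> {..<N}"
    then have r: "r < N" by simp
    have "F r [^]\<^bsub>H\<^esub> ((v r + w r) mod int q) = F r [^]\<^bsub>H\<^esub> (v r + w r)"
      by (rule H.int_pow_mod[OF Fr[OF r] H(2)[OF Fr[OF r]]])
    then show "F r [^]\<^bsub>H\<^esub> (v \<otimes>\<^bsub>modvec q N\<^esub> w) r = F r [^]\<^bsub>H\<^esub> v r \<otimes>\<^bsub>H\<^esub> F r [^]\<^bsub>H\<^esub> w r"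
      using r Fr[OF r] by (simp add: mult_modvec H.int_pow_mult)
  qed (use Fr in auto)
  also have "\<dots> = word H {..<N} F v \<otimes>\<^bsub>H\<^esub> word H {..<N} F w"
    unfolding word_def by (rule H.finprod_multf) (use Fr in auto)
  finally show "word H {..<N} F (v \<otimes>\<^bsub>modvec q N\<^esub> w) = word H {..<N} F v \<otimes>\<^bsub>H\<^esub> word H {..<N} F w" .
qed

lemma word_std_vec:
  assumes H: "comm_group H" and F: "F \<in> {..<N} \<rightarrow> carrier H" and r: "r < N"
  shows "word H {..<N} F (std_vec N r) = F r"
proof -
  interpret H: comm_group H by fact
  have Fr: "F i \<in> carrier H" if "i < N" for i using F that by auto
  have "word H {..<N} F (std_vec N r) = finprod H (\<lambda>i. if r = i then F i else \<one>\<^bsub>H\<^esub>) {..<N}"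
    unfolding word_def by (rule H.finprod_cong') (auto simp: std_vec_def Fr)
  also have "\<dots> = F r" using F r by (intro H.finprod_singleton) auto
  finally show ?thesis .
qed

lemma hom_eq_word:
  assumes H: "comm_group H" and \<psi>: "\<psi> \<in> hom (modvec q N) H" and v: "v \<in> carrier (modvec q N)"
  shows "\<psi> v = word H {..<N} (\<lambda>r. \<psi> (std_vec N r)) v"
proof -
  interpret H: comm_group H by fact
  interpret h: group_hom "modvec q N" H \<psi>
    using \<psi> by (simp add: group_hom_def group_hom_axioms_def V.is_group H.is_group)
  have Fc: "(\<lambda>r. \<psi> (std_vec N r)) \<in> A \<rightarrow> carrier H" for A using std_vec_closed by simp
  define tr where "tr n = (\<lambda>i\<in>{..<N}. if i < n then v i else 0)" for n
  have vP: "v \<in> PiE {..<N} (\<lambda>_. {0..<int q})" using v carrier_modvec by simp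
  have vb: "0 \<le> v i" "v i < int q" if "i < N" for i using PiE_mem[OF vP, of i] that by auto
  have tr: "tr n \<in> carrier (modvec q N)" for n
    unfolding tr_def carrier_modvec restrict_PiE_iff using vb q by simp
  have "\<psi> (tr n) = word H {..<n} (\<lambda>r. \<psi> (std_vec N r)) v" if "n \<le> N" for n
    using that
  proof (induction n)
    case 0
    have "tr 0 = \<one>\<^bsub>modvec q N\<^esub>" by (simp add: tr_def one_modvec)
    then show ?case by (simp add: word_def)
  next
    case (Suc n)
    have vn: "v n = int (nat (v n))" using vb[of n] Suc.prems by simp
    have "tr (Suc n) = std_vec N n [^]\<^bsub>modvec q N\<^esub> nat (v n) \<otimes>\<^bsub>modvec q N\<^esub> tr n"
      unfolding pow_modvec mult_modvec tr_def
      by (rule restrict_ext) (use Suc.prems vb in \<open>auto simp: std_vec_def less_Suc_eq\<close>)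
    then have "\<psi> (tr (Suc n)) = \<psi> (std_vec N n) [^]\<^bsub>H\<^esub> nat (v n) \<otimes>\<^bsub>H\<^esub> \<psi> (tr n)"
      using std_vec_closed tr by (simp add: h.hom_nat_pow)
    also have "\<psi> (std_vec N n) [^]\<^bsub>H\<^esub> nat (v n) = \<psi> (std_vec N n) [^]\<^bsub>H\<^esub> v n"
      by (subst vn) (simp only: int_pow_int)
    also have "\<psi> (tr n) = word H {..<n} (\<lambda>r. \<psi> (std_vec N r)) v" using Suc by simp
    also have "\<psi> (std_vec N n) [^]\<^bsub>H\<^esub> v n \<otimes>\<^bsub>H\<^esub> word H {..<n} (\<lambda>r. \<psi> (std_vec N r)) v = word H (insert n {..<n}) (\<lambda>r. \<psi> (std_vec N r)) v"
      by (rule H.word_insert[symmetric]) (use Fc in auto)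
    also have "insert n {..<n} = {..<Suc n}" by auto
    finally show ?case .
  qed
  from this[of N] have "\<psi> (tr N) = word H {..<N} (\<lambda>r. \<psi> (std_vec N r)) v" by simp
  moreover have "tr N = v" using PiE_arb[OF vP] by (auto simp: tr_def fun_eq_iff restrict_def)
  ultimately show ?thesis by simp
qed

lemma word_surj:
  assumes H: "comm_group H" "\<And>x. x \<in> carrier H \<Longrightarrow> x [^]\<^bsub>H\<^esub> q = \<one>\<^bsub>H\<^esub>" and F: "F \<in> generating_tuples H {..<N}"
  shows "word H {..<N} F ` carrier (modvec q N) = carrier H"
proof -
  interpret H: comm_group H by fact
  have Fc: "F \<in> {..<N} \<rightarrow> carrier H" and g: "generate H (F ` {..<N}) = carrier H" using F by (auto simp: generating_tuples_def)
  note hom = word_hom[OF H Fc]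
  interpret h: group_hom "modvec q N" H "word H {..<N} F"
    using hom by (simp add: group_hom_def group_hom_axioms_def V.is_group H.is_group)
  have sub: "subgroup (word H {..<N} F ` carrier (modvec q N)) H" by (rule h.img_is_subgroup)
  have "F r \<in> word H {..<N} F ` carrier (modvec q N)" if "r < N" for r
    using word_std_vec[OF H(1) Fc that] std_vec_closed by (metis imageI)
  then have "generate H (F ` {..<N}) \<subseteq> word H {..<N} F ` carrier (modvec q N)"
    using sub by (intro H.generate_subgroup_incl) auto
  then show ?thesis using g subgroup.subset[OF sub] by auto
qed

lemma hom_std_vec_generating:
  assumes H: "comm_group H" and \<psi>: "\<psi> \<in> hom (modvec q N) H" and surj: "\<psi> ` carrier (modvec q N) = carrier H"
  shows "(\<lambda>r\<in>{..<N}. \<psi> (std_vec N r)) \<in> generating_tuples H {..<N}"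
    and "word_ker q N H (\<lambda>r\<in>{..<N}. \<psi> (std_vec N r)) = {v\<in>carrier (modvec q N). \<psi> v = \<one>\<^bsub>H\<^esub>}"
    and "v \<in> carrier (modvec q N) \<Longrightarrow> word H {..<N} (\<lambda>r\<in>{..<N}. \<psi> (std_vec N r)) v = \<psi> v"
proof -
  interpret H: comm_group H by fact
  let ?F = "\<lambda>r\<in>{..<N}. \<psi> (std_vec N r)"
  have c: "\<psi> (std_vec N r) \<in> carrier H" for r using \<psi> std_vec_closed by (auto simp: hom_def)
  then have Fc: "?F \<in> PiE {..<N} (\<lambda>_. carrier H)" by auto
  have w: "word H {..<N} ?F v = \<psi> v" if "v \<in> carrier (modvec q N)" for v
  proof -
    have "word H {..<N} ?F v = word H {..<N} (\<lambda>r. \<psi> (std_vec N r)) v"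
      by (rule H.word_cong) (use c in auto)
    then show ?thesis using hom_eq_word[OF H \<psi> that] by simp
  qed
  then show "v \<in> carrier (modvec q N) \<Longrightarrow> word H {..<N} ?F v = \<psi> v" .
  show "word_ker q N H ?F = {v\<in>carrier (modvec q N). \<psi> v = \<one>\<^bsub>H\<^esub>}" using w by (auto simp: word_ker_def)
  have gs: "subgroup (generate H (?F ` {..<N})) H" using c by (intro H.generate_is_subgroup) auto
  have "\<psi> v \<in> generate H (?F ` {..<N})" if "v \<in> carrier (modvec q N)" for v
    using w[OF that] H.word_in_subgroup[OF gs, of "{..<N}" ?F v] by (auto intro: generate.incl)
  then have "\<psi> ` carrier (modvec q N) \<subseteq> generate H (?F ` {..<N})" by blast
  then have "carrier H \<subseteq> generate H (?F ` {..<N})" unfolding surj .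
  then show "?F \<in> generating_tuples H {..<N}" using Fc subgroup.subset[OF gs] by (auto simp: generating_tuples_def)
qed

end

lemma hom_factor:
  assumes V: "group V" and G: "group G" and H: "group H" and f: "f \<in> hom V G" and surj: "f ` carrier V = carrier G"
    and h: "h \<in> hom V H" and ker: "\<And>v. v \<in> carrier V \<Longrightarrow> f v = \<one>\<^bsub>G\<^esub> \<Longrightarrow> h v = \<one>\<^bsub>H\<^esub>"
  obtains \<sigma> where "\<sigma> \<in> hom G H" "\<sigma> \<in> extensional (carrier G)" "\<And>v. v \<in> carrier V \<Longrightarrow> \<sigma> (f v) = h v"
proof -
  interpret V: group V by fact
  interpret f: group_hom V G f using f V G by (simp add: group_hom_def group_hom_axioms_def)
  interpret h: group_hom V H h using h V H by (simp add: group_hom_def group_hom_axioms_def)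
  define \<sigma> where "\<sigma> = (\<lambda>g\<in>carrier G. h (SOME v. v \<in> carrier V \<and> f v = g))"
  have \<sigma>: "\<sigma> (f v) = h v" if v: "v \<in> carrier V" for v
  proof -
    define w where "w = (SOME w. w \<in> carrier V \<and> f w = f v)"
    have "w \<in> carrier V \<and> f w = f v" unfolding w_def by (rule someI[of _ v]) (use v in auto)
    then have w: "w \<in> carrier V" "f w = f v" by auto
    have "f (w \<otimes>\<^bsub>V\<^esub> inv\<^bsub>V\<^esub> v) = \<one>\<^bsub>G\<^esub>" using w v by simp
    then have "h (w \<otimes>\<^bsub>V\<^esub> inv\<^bsub>V\<^esub> v) = \<one>\<^bsub>H\<^esub>" using ker w v by simp
    then have "h w \<otimes>\<^bsub>H\<^esub> inv\<^bsub>H\<^esub> h v = \<one>\<^bsub>H\<^esub>" using w v by simp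
    then have "h w \<otimes>\<^bsub>H\<^esub> inv\<^bsub>H\<^esub> h v \<otimes>\<^bsub>H\<^esub> h v = h v" using v by simp
    then have "h w = h v" using w v by (simp add: h.H.m_assoc)
    then show ?thesis using v by (simp add: \<sigma>_def w_def)
  qed
  show thesis
  proof (rule that[OF _ _ \<sigma>])
    show "\<sigma> \<in> extensional (carrier G)" by (simp add: \<sigma>_def)
    show "\<sigma> \<in> hom G H"
    proof (rule homI)
      fix x assume "x \<in> carrier G"
      then obtain v where "v \<in> carrier V" "x = f v" using surj by auto
      then show "\<sigma> x \<in> carrier H" using \<sigma> by simp
    next
      fix x y assume "x \<in> carrier G" "y \<in> carrier G"
      then have "x \<in> f ` carrier V" "y \<in> f ` carrier V" using surj by auto
      then obtain v w where vw: "v \<in> carrier V" "x = f v" "w \<in> carrier V" "y = f w" by blast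
      then have xy: "x \<otimes>\<^bsub>G\<^esub> y = f (v \<otimes>\<^bsub>V\<^esub> w)" by simp
      have "\<sigma> (x \<otimes>\<^bsub>G\<^esub> y) = h (v \<otimes>\<^bsub>V\<^esub> w)" unfolding xy by (rule \<sigma>) (use vw in simp)
      then show "\<sigma> (x \<otimes>\<^bsub>G\<^esub> y) = \<sigma> x \<otimes>\<^bsub>H\<^esub> \<sigma> y" using vw \<sigma> by simp
    qed
  qed
qed

text \<open>If two surjections have the same kernel, they differ by an automorphism of \<open>G\<close>, and every
automorphism arises in this way.\<close>

lemma card_generating_with_kernel:
  assumes q: "q \<ge> 2" and G: "comm_group G" "finite (carrier G)" "\<And>x. x \<in> carrier G \<Longrightarrow> x [^]\<^bsub>G\<^esub> q = \<one>\<^bsub>G\<^esub>"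
    and Q: "subgroup Q (modvec q N)"
  shows "card {F\<in>generating_tuples G {..<N}. word_ker q N G F = Q} = (if modvec q N Mod Q \<cong> G then card (auto G) else 0)"
proof -
  interpret V: comm_group "modvec q N" by (rule comm_group_modvec)
  interpret G: comm_group G by fact
  have Qn: "Q \<lhd> modvec q N" using Q by (simp add: V.normal_iff_subgroup)
  let ?V = "modvec q N"
  let ?S = "{F\<in>generating_tuples G {..<N}. word_ker q N G F = Q}"
  have iso: "?V Mod Q \<cong> G" if F: "F \<in> ?S" for F
  proof -
    have Fg: "F \<in> generating_tuples G {..<N}" and K: "word_ker q N G F = Q" using F by auto
    then have Fc: "F \<in> {..<N} \<rightarrow> carrier G" by (auto simp: generating_tuples_def)
    interpret h: group_hom ?V G "word G {..<N} F"
      using word_hom[OF q G(1,3) Fc] by (simp add: group_hom_def group_hom_axioms_def V.is_group G.is_group)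
    have "kernel ?V G (word G {..<N} F) = Q" using K by (simp add: kernel_def word_ker_def)
    then show ?thesis using h.FactGroup_iso[OF word_surj[OF q G(1,3) Fg]] by simp
  qed
  show ?thesis
  proof (cases "?V Mod Q \<cong> G")
    case False
    then have e: "?S = {}" using iso by blast
    show ?thesis unfolding e using False by simp
  next
    case True
    then obtain \<theta> where \<theta>: "\<theta> \<in> iso (?V Mod Q) G" by (auto simp: is_iso_def)
    define \<psi> where "\<psi> v = \<theta> (Q #>\<^bsub>?V\<^esub> v)" for v
    have QG: "group (?V Mod Q)" using Qn by (rule normal.factorgroup_is_group)
    have \<psi>h: "\<psi> \<in> hom ?V G"
    proof -
      have "\<theta> \<circ> (\<lambda>a. Q #>\<^bsub>?V\<^esub> a) \<in> hom ?V G"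
        using normal.r_coset_hom_Mod[OF Qn] \<theta> by (intro hom_compose) (auto simp: iso_def)
      then show ?thesis by (simp add: \<psi>_def[abs_def] o_def)
    qed
    have \<psi>s: "\<psi> ` carrier ?V = carrier G"
    proof -
      have "\<psi> ` carrier ?V = \<theta> ` carrier (?V Mod Q)" by (simp add: carrier_FactGroup \<psi>_def image_image)
      then show ?thesis using \<theta> by (simp add: iso_def bij_betw_def)
    qed
    have \<psi>k: "\<psi> v = \<one>\<^bsub>G\<^esub> \<longleftrightarrow> v \<in> Q" if v: "v \<in> carrier ?V" for v
    proof -
      have vc: "Q #>\<^bsub>?V\<^esub> v \<in> carrier (?V Mod Q)" using v by (auto simp: carrier_FactGroup)
      have one: "\<theta> Q = \<one>\<^bsub>G\<^esub>" using hom_one[of \<theta> "?V Mod Q" G] \<theta> QG G.is_group by (simp add: iso_def)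
      have Qc: "Q \<in> carrier (?V Mod Q)" using monoid.one_closed[OF group.is_monoid[OF QG]] by simp
      have "\<psi> v = \<one>\<^bsub>G\<^esub> \<longleftrightarrow> \<theta> (Q #>\<^bsub>?V\<^esub> v) = \<theta> Q" using one by (simp add: \<psi>_def)
      also have "\<dots> \<longleftrightarrow> Q #>\<^bsub>?V\<^esub> v = Q"
      proof -
        have "inj_on \<theta> (carrier (?V Mod Q))" using \<theta> by (simp add: iso_def bij_betw_def)
        then show ?thesis using vc Qc by (rule inj_on_eq_iff)
      qed
      also have "\<dots> \<longleftrightarrow> v \<in> Q" using V.coset_join1[OF _ v Q] V.coset_join2[OF v Q] by blast
      finally show ?thesis .
    qed
    define \<Phi> where "\<Phi> \<sigma> = (\<lambda>r\<in>{..<N}. \<sigma> (\<psi> (std_vec N r)))" for \<sigma> :: "'a \<Rightarrow> 'a"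
    have comp: "(\<lambda>v. \<sigma> (\<psi> v)) \<in> hom ?V G" "(\<lambda>v. \<sigma> (\<psi> v)) ` carrier ?V = carrier G" if "\<sigma> \<in> auto G" for \<sigma>
    proof -
      have "\<sigma> \<in> hom G G" "bij_betw \<sigma> (carrier G) (carrier G)" using that by (auto simp: auto_def Bij_def)
      then show "(\<lambda>v. \<sigma> (\<psi> v)) \<in> hom ?V G" "(\<lambda>v. \<sigma> (\<psi> v)) ` carrier ?V = carrier G"
        using hom_compose[OF \<psi>h, of \<sigma> G] \<psi>s
        by (simp_all add: o_def bij_betw_def flip: image_image[of \<sigma> \<psi>])
    qed
    have "bij_betw \<Phi> (auto G) ?S"
    proof (rule bij_betwI')
      fix \<sigma> \<tau> assume st: "\<sigma> \<in> auto G" "\<tau> \<in> auto G"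
      show "(\<Phi> \<sigma> = \<Phi> \<tau>) = (\<sigma> = \<tau>)"
      proof
        assume eq: "\<Phi> \<sigma> = \<Phi> \<tau>"
        have eqg: "\<sigma> g = \<tau> g" if g: "g \<in> carrier G" for g
        proof -
          from g \<psi>s have "g \<in> \<psi> ` carrier ?V" by simp
          then obtain v where v: "v \<in> carrier ?V" "g = \<psi> v" by blast
          have "\<sigma> (\<psi> v) = word G {..<N} (\<Phi> \<sigma>) v"
            unfolding \<Phi>_def by (rule hom_std_vec_generating(3)[OF q G(1) comp[OF st(1)] v(1), symmetric])
          also have "\<dots> = word G {..<N} (\<Phi> \<tau>) v" by (simp only: eq)
          also have "\<dots> = \<tau> (\<psi> v)"
            unfolding \<Phi>_def by (rule hom_std_vec_generating(3)[OF q G(1) comp[OF st(2)] v(1)])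
          finally show ?thesis by (simp only: v(2))
        qed
        have "\<sigma> \<in> extensional (carrier G)" "\<tau> \<in> extensional (carrier G)" using st by (auto simp: auto_def Bij_def)
        then show "\<sigma> = \<tau>" using eqg by (rule extensionalityI)
      qed simp
    next
      fix \<sigma> assume s: "\<sigma> \<in> auto G"
      have "{v\<in>carrier ?V. \<sigma> (\<psi> v) = \<one>\<^bsub>G\<^esub>} = Q"
      proof -
        have sh: "\<sigma> \<in> hom G G" "inj_on \<sigma> (carrier G)" using s by (auto simp: auto_def Bij_def bij_betw_def)
        have "\<sigma> x = \<one>\<^bsub>G\<^esub> \<longleftrightarrow> x = \<one>\<^bsub>G\<^esub>" if "x \<in> carrier G" for x
          using inj_on_eq_iff[OF sh(2) that G.one_closed] hom_one[OF sh(1) G.is_group G.is_group] by simp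
        moreover have "\<psi> v \<in> carrier G" if "v \<in> carrier ?V" for v using \<psi>s that by auto
        ultimately show ?thesis using \<psi>k subgroup.subset[OF Q] by auto
      qed
      then show "\<Phi> \<sigma> \<in> ?S"
        using hom_std_vec_generating(1,2)[OF q G(1) comp[OF s]] by (simp add: \<Phi>_def)
    next
      fix F assume F: "F \<in> ?S"
      have Fg: "F \<in> generating_tuples G {..<N}" and K: "word_ker q N G F = Q" using F by auto
      have FP: "F \<in> PiE {..<N} (\<lambda>_. carrier G)" using Fg by (simp add: generating_tuples_def)
      then have Fc: "F \<in> {..<N} \<rightarrow> carrier G" by auto
      note wh = word_hom[OF q G(1,3) Fc]
      note ws = word_surj[OF q G(1,3) Fg]
      interpret wf: group_hom ?V G "word G {..<N} F" using wh by (simp add: group_hom_def group_hom_axioms_def V.is_group G.is_group)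
      interpret pf: group_hom ?V G \<psi> using \<psi>h by (simp add: group_hom_def group_hom_axioms_def V.is_group G.is_group)
      have wk: "word G {..<N} F v = \<one>\<^bsub>G\<^esub> \<longleftrightarrow> v \<in> Q" if "v \<in> carrier ?V" for v
        using K that by (auto simp: word_ker_def)
      have kk: "word G {..<N} F v = \<one>\<^bsub>G\<^esub>" if "v \<in> carrier ?V" "\<psi> v = \<one>\<^bsub>G\<^esub>" for v
        using wk[OF that(1)] \<psi>k[OF that(1)] that(2) by simp
      obtain \<sigma> where \<sigma>: "\<sigma> \<in> hom G G" "\<sigma> \<in> extensional (carrier G)" "\<And>v. v \<in> carrier ?V \<Longrightarrow> \<sigma> (\<psi> v) = word G {..<N} F v"
        using hom_factor[OF V.is_group G.is_group G.is_group \<psi>h \<psi>s wh kk] by blast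
      have "\<sigma> ` carrier G = carrier G"
      proof -
        have "\<sigma> ` carrier G = (\<lambda>v. \<sigma> (\<psi> v)) ` carrier ?V" unfolding \<psi>s[symmetric] image_image ..
        also have "\<dots> = word G {..<N} F ` carrier ?V" using \<sigma>(3) by (intro image_cong) auto
        finally show ?thesis using ws by simp
      qed
      then have "bij_betw \<sigma> (carrier G) (carrier G)"
        using G(2) by (simp add: bij_betw_def eq_card_imp_inj_on)
      then have "\<sigma> \<in> auto G" using \<sigma> by (simp add: auto_def Bij_def)
      moreover have "\<Phi> \<sigma> = F"
      proof
        fix r show "\<Phi> \<sigma> r = F r"
          using \<sigma>(3)[OF std_vec_closed[OF q]] word_std_vec[OF q G(1) Fc, of r] PiE_arb[OF FP, of r] by (simp add: \<Phi>_def)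
      qed
      ultimately show "\<exists>\<sigma>\<in>auto G. F = \<Phi> \<sigma>" by blast
    qed
    then have "card (auto G) = card ?S" by (rule bij_betw_same_card)
    then show ?thesis using True by simp
  qed
qed

lemma card_word_ker:
  assumes q: "q \<ge> 2" and H: "comm_group H" "\<And>x. x \<in> carrier H \<Longrightarrow> x [^]\<^bsub>H\<^esub> q = \<one>\<^bsub>H\<^esub>" and F: "F \<in> generating_tuples H {..<N}"
  shows "subgroup (word_ker q N H F) (modvec q N)"
    and "card (carrier (modvec q N)) = card (carrier H) * card (word_ker q N H F)"
proof -
  interpret V: comm_group "modvec q N" by (rule comm_group_modvec)
  interpret H: comm_group H by fact
  have Fc: "F \<in> {..<N} \<rightarrow> carrier H" using F by (auto simp: generating_tuples_def)
  interpret h: group_hom "modvec q N" H "word H {..<N} F"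
    using word_hom[OF q H Fc] by (simp add: group_hom_def group_hom_axioms_def V.is_group H.is_group)
  have K: "kernel (modvec q N) H (word H {..<N} F) = word_ker q N H F" by (simp add: kernel_def word_ker_def)
  show sub: "subgroup (word_ker q N H F) (modvec q N)" using h.subgroup_kernel unfolding K .
  have "card (carrier (modvec q N Mod word_ker q N H F)) = card (carrier H)"
    using iso_same_card[OF h.FactGroup_iso[OF word_surj[OF q H F]]] unfolding K .
  moreover have "card (carrier (modvec q N Mod word_ker q N H F)) * card (word_ker q N H F) = order (modvec q N)"
    using V.lagrange[OF sub] by (simp add: FactGroup_def)
  ultimately show "card (carrier (modvec q N)) = card (carrier H) * card (word_ker q N H F)" by (simp add: order_def)
qed

lemma card_p_torsion_residues:
  assumes p: "p > 0" and k: "k \<ge> 1"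
  shows "card {x\<in>{0..<int (p ^ k)}. (int p * x) mod int (p ^ k) = 0} = p"
    and "\<And>x. (int p * x) mod int (p ^ k) = 0 \<Longrightarrow> int (p ^ (k - 1)) dvd x"
proof -
  define m where "m = int (p ^ (k - 1))"
  have "p ^ k = p * p ^ (k - 1)" using k by (simp flip: power_Suc)
  then have pk: "int (p ^ k) = int p * m" unfolding m_def by (metis of_nat_mult)
  have m0: "m > 0" using p by (simp add: m_def)
  have iff: "(int p * x) mod (int p * m) = 0 \<longleftrightarrow> m dvd x" for x
    using p by (simp add: mod_eq_0_iff_dvd)
  show "\<And>x. (int p * x) mod int (p ^ k) = 0 \<Longrightarrow> int (p ^ (k - 1)) dvd x"
    unfolding pk iff m_def[symmetric] .
  have "{x\<in>{0..<int p * m}. m dvd x} = (\<lambda>j. m * j) ` {0..<int p}"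
  proof safe
    fix x assume x: "x \<in> {0..<int p * m}" "m dvd x"
    then obtain j where j: "x = m * j" by blast
    have "0 \<le> j" using x(1) j m0 by (simp add: zero_le_mult_iff)
    moreover have "m * j < m * int p" using x(1) j by (simp add: mult.commute)
    then have "j < int p" using m0 by (simp only: mult_less_cancel_left_pos)
    ultimately show "x \<in> (\<lambda>j. m * j) ` {0..<int p}" unfolding j by (intro imageI) simp
  next
    fix j assume j: "j \<in> {0..<int p}"
    have "m * j < m * int p" using j m0 by (intro mult_strict_left_mono) auto
    then show "m * j \<in> {0..<int p * m}" using j m0 by (simp add: mult.commute)
  qed simp
  then have "card {x\<in>{0..<int p * m}. m dvd x} = card ((\<lambda>j. m * j) ` {0..<int p})" by simp
  also have "\<dots> = p" using m0 by (subst card_image) (auto simp: inj_on_def)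
  finally show "card {x\<in>{0..<int (p ^ k)}. (int p * x) mod int (p ^ k) = 0} = p"
    unfolding pk iff .
qed

text \<open>Let \<open>A\<close> be the kernel of \<open>F\<close>. All elements of order \<open>p\<close> of \<open>V = (Z/q)\<^sup>N\<close> are multiples of
\<open>p ^ (k - 1)\<close> and hence lie in \<open>A\<close>. So the \<open>p\<close>-th power map on \<open>A\<close> has a kernel of order \<open>p ^ N\<close>, and
\<open>A\<close> modulo \<open>p\<close>-th powers has dimension \<open>N\<close>. This is why \<open>G\<close> is required to be killed by \<open>p ^ (k - 1)\<close>
already.\<close>

lemma card_index_subgroups_word_ker:
  assumes p: "prime p" and k: "k \<ge> 1" and q: "q = p ^ k" "q \<ge> 2"
    and G: "comm_group G" "\<And>x. x \<in> carrier G \<Longrightarrow> x [^]\<^bsub>G\<^esub> (p ^ (k - 1)) = \<one>\<^bsub>G\<^esub>" and F: "F \<in> generating_tuples G {..<N}"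
  shows "real (card (index_subgroups (modvec q N) p {\<one>\<^bsub>modvec q N\<^esub>} (word_ker q N G F) r)) = qbinom p N r"
proof -
  interpret V: comm_group "modvec q N" by (rule comm_group_modvec)
  interpret G: comm_group G by fact
  have p0: "p > 0" using p by (simp add: prime_gt_0_nat)
  have G': "x [^]\<^bsub>G\<^esub> q = \<one>\<^bsub>G\<^esub>" if "x \<in> carrier G" for x
  proof -
    have "q = p ^ (k - 1) * p" using k q by (simp flip: power_Suc2)
    then show ?thesis using G.nat_pow_pow[OF that, of "p ^ (k - 1)" p] G(2)[OF that] by simp
  qed
  let ?V = "modvec q N"
  define A where "A = word_ker q N G F"
  have A: "subgroup A ?V" unfolding A_def by (rule card_word_ker(1)[OF q(2) G(1) G' F])
  interpret A: subgroup A ?V by fact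
  have finA: "finite A" using finite_carrier_modvec[OF q(2)] A.subset finite_subset by auto
  have Fr: "F r \<in> carrier G" if "r < N" for r using F that by (auto simp: generating_tuples_def)
  define B where "B = (\<lambda>a. a [^]\<^bsub>?V\<^esub> p) ` A"
  have B: "subgroup B ?V"
  proof -
    have "B = (\<lambda>a. \<one>\<^bsub>?V\<^esub> \<otimes>\<^bsub>?V\<^esub> a [^]\<^bsub>?V\<^esub> p) ` A" unfolding B_def by (intro image_cong) auto
    also have "\<dots> = {u \<otimes>\<^bsub>?V\<^esub> a [^]\<^bsub>?V\<^esub> p | u a. u \<in> {\<one>\<^bsub>?V\<^esub>} \<and> a \<in> A}" by blast
    finally have "B = {u \<otimes>\<^bsub>?V\<^esub> a [^]\<^bsub>?V\<^esub> p | u a. u \<in> {\<one>\<^bsub>?V\<^esub>} \<and> a \<in> A}" .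
    then show ?thesis using V.subgroup_mult_powers[OF V.triv_subgroup A, of p] by simp
  qed
  define T where "T = {t\<in>carrier ?V. t [^]\<^bsub>?V\<^esub> p = \<one>\<^bsub>?V\<^esub>}"
  have TP: "T = PiE {..<N} (\<lambda>_. {x\<in>{0..<int q}. (int p * x) mod int q = 0})"
  proof (rule Set.set_eqI)
    fix t
    have "t [^]\<^bsub>?V\<^esub> p = \<one>\<^bsub>?V\<^esub> \<longleftrightarrow> (\<forall>r<N. (int p * t r) mod int q = 0)"
      unfolding pow_modvec[OF q(2)] one_modvec[OF q(2)] by (auto simp: fun_eq_iff restrict_def)
    then show "t \<in> T \<longleftrightarrow> t \<in> PiE {..<N} (\<lambda>_. {x\<in>{0..<int q}. (int p * x) mod int q = 0})"
      unfolding T_def carrier_modvec[OF q(2)] by (auto simp: PiE_iff)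
  qed
  have cT: "card T = p ^ N"
    unfolding TP using card_p_torsion_residues(1)[OF p0 k] by (simp add: card_PiE q(1))
  have TA: "T \<subseteq> A"
  proof
    fix t assume t: "t \<in> T"
    have "F r [^]\<^bsub>G\<^esub> t r = \<one>\<^bsub>G\<^esub>" if r: "r < N" for r
    proof -
      have "(int p * t r) mod int (p ^ k) = 0" using t r unfolding TP q(1) by (auto simp: PiE_iff)
      then have "int (p ^ (k - 1)) dvd t r" by (rule card_p_torsion_residues(2)[OF p0 k])
      then obtain j where j: "t r = int (p ^ (k - 1)) * j" by (rule dvdE)
      show ?thesis unfolding j G.nat_pow_int_pow[OF Fr[OF r]] using G(2)[OF Fr[OF r]] by simp
    qed
    then have "word G {..<N} F t = \<one>\<^bsub>G\<^esub>" unfolding word_def by (intro G.finprod_one_eqI) auto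
    moreover have "t \<in> carrier ?V" using t unfolding T_def by blast
    ultimately show "t \<in> A" unfolding A_def word_ker_def by blast
  qed
  have fib: "card {a\<in>A. a [^]\<^bsub>?V\<^esub> p = b} = p ^ N" if b: "b \<in> B" for b
  proof -
    obtain a0 where a0: "a0 \<in> A" "b = a0 [^]\<^bsub>?V\<^esub> p" using b unfolding B_def by blast
    have "{a\<in>A. a [^]\<^bsub>?V\<^esub> p = b} = (\<lambda>t. a0 \<otimes>\<^bsub>?V\<^esub> t) ` T"
    proof safe
      fix a assume a: "a \<in> A" "b = a [^]\<^bsub>?V\<^esub> p"
      have ac: "a \<in> carrier ?V" "a0 \<in> carrier ?V" using a a0 by auto
      have "(inv\<^bsub>?V\<^esub> a0 \<otimes>\<^bsub>?V\<^esub> a) [^]\<^bsub>?V\<^esub> p = \<one>\<^bsub>?V\<^esub>"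
        using ac a a0 by (simp add: V.nat_pow_distrib V.nat_pow_inv)
      then have "inv\<^bsub>?V\<^esub> a0 \<otimes>\<^bsub>?V\<^esub> a \<in> T" using ac by (simp add: T_def)
      moreover have "a = a0 \<otimes>\<^bsub>?V\<^esub> (inv\<^bsub>?V\<^esub> a0 \<otimes>\<^bsub>?V\<^esub> a)" using ac by (simp add: V.m_assoc[symmetric])
      ultimately show "a \<in> (\<lambda>t. a0 \<otimes>\<^bsub>?V\<^esub> t) ` T" by blast
    next
      fix t assume t: "t \<in> T"
      then show "a0 \<otimes>\<^bsub>?V\<^esub> t \<in> A" using TA a0 by auto
      show "(a0 \<otimes>\<^bsub>?V\<^esub> t) [^]\<^bsub>?V\<^esub> p = b" using t a0 A.subset by (auto simp: T_def V.nat_pow_distrib)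
    qed
    also have "card \<dots> = card T" using a0 A.subset by (intro card_image) (auto simp: inj_on_def T_def)
    finally show ?thesis using cT by simp
  qed
  have cA: "card A = p ^ N * card B"
  proof -
    have "card A = (\<Sum>b\<in>B. card {a\<in>A. a [^]\<^bsub>?V\<^esub> p = b})"
      unfolding B_def using sum.image_gen[OF finA, of "\<lambda>_. 1::nat" "\<lambda>a. a [^]\<^bsub>?V\<^esub> p"] by simp
    then show ?thesis using fib by simp
  qed
  have BA: "B \<subseteq> A" unfolding B_def using V.subgroup_nat_pow_closed[OF A] by auto
  have idx: "index_subgroups ?V p {\<one>\<^bsub>?V\<^esub>} A r = {N. subgroup N ?V \<and> B \<subseteq> N \<and> N \<subseteq> A \<and> card A = p ^ r * card N}"
    unfolding index_subgroups_def B_def image_subset_iff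
    by (rule Collect_cong) (use subgroup.one_closed[of _ ?V] in blast)
  show ?thesis
    unfolding A_def[symmetric] idx
    by (rule V.card_subgroups_of_index[OF B A finA BA _ p cA]) (auto simp: B_def)
qed

section \<open>Finitely many representatives of the groups of a given order\<close>

text \<open>Groups given by a multiplication table on an initial segment of the natural numbers. They form a
finite set that represents all isomorphism types, so that statements about every group of order
\<open>h\<close> become finitely many statements about groups of one fixed type.\<close>

definition table_group :: "nat \<Rightarrow> (nat \<times> nat \<Rightarrow> nat) \<Rightarrow> nat \<Rightarrow> nat monoid" where
  "table_group h T u = \<lparr>carrier = {0..<h}, monoid.mult = (\<lambda>x y. T (x, y)), one = u\<rparr>"

definition table_groups :: "nat \<Rightarrow> nat \<Rightarrow> nat monoid set" where
  "table_groups q h = {H \<in> (\<lambda>(T, u). table_group h T u) ` (PiE ({0..<h} \<times> {0..<h}) (\<lambda>_. {0..<h}) \<times> {0..<h}).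
      comm_group H \<and> (\<forall>x\<in>carrier H. x [^]\<^bsub>H\<^esub> q = \<one>\<^bsub>H\<^esub>)}"

lemma finite_table_groups: "finite (table_groups q h)"
proof -
  have "finite (PiE ({0..<h} \<times> {0..<h}) (\<lambda>_. {0..<h}) \<times> {0..<h})"
    by (intro finite_cartesian_product finite_PiE) auto
  from finite_imageI[OF this] show ?thesis unfolding table_groups_def by (rule rev_finite_subset) blast
qed

lemma table_groupsD:
  assumes "H \<in> table_groups q h"
  shows "comm_group H" "carrier H = {0..<h}" "\<And>x. x \<in> carrier H \<Longrightarrow> x [^]\<^bsub>H\<^esub> q = \<one>\<^bsub>H\<^esub>"
  using assms by (auto simp: table_groups_def table_group_def)

lemma iso_to_table_group:
  assumes Q: "comm_group Q" and card: "finite (carrier Q)" "card (carrier Q) = h"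
    and exp: "\<And>x. x \<in> carrier Q \<Longrightarrow> x [^]\<^bsub>Q\<^esub> q = \<one>\<^bsub>Q\<^esub>"
  obtains H \<beta> where "H \<in> table_groups q h" "\<beta> \<in> iso Q H"
proof -
  interpret Q: comm_group Q by fact
  obtain \<beta> where \<beta>: "bij_betw \<beta> (carrier Q) {0..<h}"
    using ex_bij_betw_finite_nat[OF card(1)] card(2) by auto
  define \<gamma> where "\<gamma> = inv_into (carrier Q) \<beta>"
  have \<gamma>: "\<gamma> (\<beta> x) = x" if "x \<in> carrier Q" for x using \<beta> that by (simp add: \<gamma>_def bij_betw_def)
  have \<gamma>c: "\<gamma> y \<in> carrier Q" if "y \<in> {0..<h}" for y
    using \<beta> that unfolding \<gamma>_def by (metis bij_betw_imp_surj_on inv_into_into)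
  have \<beta>c: "\<beta> x \<in> {0..<h}" if "x \<in> carrier Q" for x using \<beta> that by (metis bij_betwE)
  define T where "T = (\<lambda>z\<in>{0..<h} \<times> {0..<h}. \<beta> (\<gamma> (fst z) \<otimes>\<^bsub>Q\<^esub> \<gamma> (snd z)))"
  define H where "H = table_group h T (\<beta> \<one>\<^bsub>Q\<^esub>)"
  have iso: "\<beta> \<in> iso Q H"
    unfolding iso_def
  proof safe
    show "\<beta> \<in> hom Q H"
      using \<beta>c \<gamma> by (intro homI) (auto simp: H_def table_group_def T_def)
    show "bij_betw \<beta> (carrier Q) (carrier H)" using \<beta> by (simp add: H_def table_group_def)
  qed
  have "comm_group (H\<lparr>one := \<beta> \<one>\<^bsub>Q\<^esub>\<rparr>)" by (rule Q.iso_imp_img_comm_group[OF iso])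
  then have cg: "comm_group H" by (simp add: H_def table_group_def)
  interpret H: comm_group H by (rule cg)
  interpret b: group_hom Q H \<beta> using iso by (simp add: group_hom_def group_hom_axioms_def iso_def Q.is_group H.is_group)
  have "x [^]\<^bsub>H\<^esub> q = \<one>\<^bsub>H\<^esub>" if "x \<in> carrier H" for x
  proof -
    have "x \<in> \<beta> ` carrier Q" using that iso by (simp add: iso_def bij_betw_def)
    then obtain y where y: "y \<in> carrier Q" "x = \<beta> y" by blast
    then have "x [^]\<^bsub>H\<^esub> q = \<beta> (y [^]\<^bsub>Q\<^esub> q)" by (simp add: b.hom_nat_pow)
    then show ?thesis using exp[OF y(1)] by simp
  qed
  moreover have "H \<in> (\<lambda>(T, u). table_group h T u) ` (PiE ({0..<h} \<times> {0..<h}) (\<lambda>_. {0..<h}) \<times> {0..<h})"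
  proof (rule image_eqI)
    show "H = (case (T, \<beta> \<one>\<^bsub>Q\<^esub>) of (T, u) \<Rightarrow> table_group h T u)" by (simp only: H_def prod.case)
    have "T \<in> PiE ({0..<h} \<times> {0..<h}) (\<lambda>_. {0..<h})"
      unfolding T_def restrict_PiE_iff
    proof
      fix z assume "z \<in> {0..<h} \<times> {0..<h}"
      then have "fst z \<in> {0..<h}" "snd z \<in> {0..<h}" by auto
      then show "\<beta> (\<gamma> (fst z) \<otimes>\<^bsub>Q\<^esub> \<gamma> (snd z)) \<in> {0..<h}" by (intro \<beta>c Q.m_closed \<gamma>c)
    qed
    then show "(T, \<beta> \<one>\<^bsub>Q\<^esub>) \<in> PiE ({0..<h} \<times> {0..<h}) (\<lambda>_. {0..<h}) \<times> {0..<h}"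
      using \<beta>c[OF Q.one_closed] by (rule SigmaI)
  qed
  ultimately have "H \<in> table_groups q h" unfolding table_groups_def using cg by blast
  then show thesis using iso by (rule that)
qed

lemma subgroup_is_word_ker:
  assumes q: "q \<ge> 2" and N: "subgroup Q (modvec q N)" and card: "card (carrier (modvec q N)) = h * card Q"
  obtains H F where "H \<in> table_groups q h" "F \<in> generating_tuples H {..<N}" "word_ker q N H F = Q"
proof -
  interpret V: comm_group "modvec q N" by (rule comm_group_modvec)
  let ?V = "modvec q N"
  have Qn: "Q \<lhd> ?V" using N by (simp add: V.normal_iff_subgroup)
  have cg: "comm_group (?V Mod Q)" by (rule V.abelian_FactGroup[OF N])
  interpret Q: comm_group "?V Mod Q" by (rule cg)
  have finV: "finite (carrier ?V)" by (rule finite_carrier_modvec[OF q])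
  have fin: "finite (carrier (?V Mod Q))" using finV by (simp add: carrier_FactGroup)
  have "finite Q" using finV subgroup.subset[OF N] finite_subset by auto
  then have Q0: "card Q > 0" using subgroup.one_closed[OF N] by (auto simp: card_gt_0_iff)
  have "card (carrier (?V Mod Q)) * card Q = h * card Q"
    using V.lagrange[OF N] card by (simp add: FactGroup_def order_def)
  then have ch: "card (carrier (?V Mod Q)) = h" using Q0 by simp
  have exp: "x [^]\<^bsub>?V Mod Q\<^esub> q = \<one>\<^bsub>?V Mod Q\<^esub>" if x: "x \<in> carrier (?V Mod Q)" for x
  proof -
    obtain v where v: "v \<in> carrier ?V" "x = Q #>\<^bsub>?V\<^esub> v" using x unfolding carrier_FactGroup by blast
    have "x [^]\<^bsub>?V Mod Q\<^esub> q = Q #>\<^bsub>?V\<^esub> (v [^]\<^bsub>?V\<^esub> q)"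
      using normal.FactGroup_pow[OF Qn v(1), of q] v(2) by simp
    also have "\<dots> = \<one>\<^bsub>?V Mod Q\<^esub>" using modvec_exponent[OF q v(1)] V.coset_mult_one[OF subgroup.subset[OF N]] by simp
    finally show ?thesis .
  qed
  obtain H \<beta> where H: "H \<in> table_groups q h" "\<beta> \<in> iso (?V Mod Q) H"
    using iso_to_table_group[OF cg fin ch exp] by blast
  note Hc = table_groupsD[OF H(1)]
  interpret H: comm_group H by (rule Hc(1))
  define \<psi> where "\<psi> v = \<beta> (Q #>\<^bsub>?V\<^esub> v)" for v
  have \<psi>h: "\<psi> \<in> hom ?V H"
  proof -
    have "\<beta> \<circ> (\<lambda>a. Q #>\<^bsub>?V\<^esub> a) \<in> hom ?V H"
      using normal.r_coset_hom_Mod[OF Qn] H(2) by (intro hom_compose) (auto simp: iso_def)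
    then show ?thesis by (simp add: \<psi>_def[abs_def] o_def)
  qed
  have \<psi>s: "\<psi> ` carrier ?V = carrier H"
  proof -
    have "\<psi> ` carrier ?V = \<beta> ` carrier (?V Mod Q)" by (simp add: carrier_FactGroup \<psi>_def image_image)
    then show ?thesis using H(2) by (simp add: iso_def bij_betw_def)
  qed
  have \<psi>k: "\<psi> v = \<one>\<^bsub>H\<^esub> \<longleftrightarrow> v \<in> Q" if v: "v \<in> carrier ?V" for v
  proof -
    have vc: "Q #>\<^bsub>?V\<^esub> v \<in> carrier (?V Mod Q)" using v by (auto simp: carrier_FactGroup)
    have one: "\<beta> Q = \<one>\<^bsub>H\<^esub>" using hom_one[of \<beta> "?V Mod Q" H] H(2) Q.is_group H.is_group by (simp add: iso_def)
    have Qc: "Q \<in> carrier (?V Mod Q)" using Q.one_closed by simp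
    have "\<psi> v = \<one>\<^bsub>H\<^esub> \<longleftrightarrow> \<beta> (Q #>\<^bsub>?V\<^esub> v) = \<beta> Q" using one by (simp add: \<psi>_def)
    also have "\<dots> \<longleftrightarrow> Q #>\<^bsub>?V\<^esub> v = Q"
    proof -
      have "inj_on \<beta> (carrier (?V Mod Q))" using H(2) by (simp add: iso_def bij_betw_def)
      then show ?thesis using vc Qc by (rule inj_on_eq_iff)
    qed
    also have "\<dots> \<longleftrightarrow> v \<in> Q" using V.coset_join1[OF _ v N] V.coset_join2[OF v N] by blast
    finally show ?thesis .
  qed
  show thesis
  proof (rule that[OF H(1)])
    show "(\<lambda>r\<in>{..<N}. \<psi> (std_vec N r)) \<in> generating_tuples H {..<N}"
      by (rule hom_std_vec_generating(1)[OF q Hc(1) \<psi>h \<psi>s])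
    show "word_ker q N H (\<lambda>r\<in>{..<N}. \<psi> (std_vec N r)) = Q"
      unfolding hom_std_vec_generating(2)[OF q Hc(1) \<psi>h \<psi>s] using \<psi>k subgroup.subset[OF N] by blast
  qed
qed

text \<open>A subgroup \<open>L\<close> of index \<open>p ^ r\<close> in the kernel of \<open>F\<close> is the kernel of a surjection onto a group \<open>H\<close>
of order \<open>h\<close>, and \<open>F\<close> factors through it. The factor is a map from \<open>H\<close> to \<open>G\<close>, for which there are
at most \<open>|G| ^ h\<close> possibilities.\<close>

lemma pair_sum_le_table_sum:
  fixes \<rho> :: "(nat \<Rightarrow> int) set \<Rightarrow> real"
  assumes q: "q \<ge> 2" and G: "comm_group G" "finite (carrier G)" "\<And>x. x \<in> carrier G \<Longrightarrow> x [^]\<^bsub>G\<^esub> q = \<one>\<^bsub>G\<^esub>"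
    and h: "h = card (carrier G) * p ^ r"
  shows "(\<Sum>F\<in>generating_tuples G {..<N}. \<Sum>L\<in>index_subgroups (modvec q N) p {\<one>\<^bsub>modvec q N\<^esub>} (word_ker q N G F) r. \<bar>\<rho> L - z\<bar>)
    \<le> card (carrier G) ^ h * (\<Sum>H\<in>table_groups q h. \<Sum>F\<in>generating_tuples H {..<N}. \<bar>\<rho> (word_ker q N H F) - z\<bar>)"
proof -
  interpret V: comm_group "modvec q N" by (rule comm_group_modvec)
  interpret G: comm_group G by fact
  let ?V = "modvec q N"
  let ?I = "\<lambda>F. index_subgroups ?V p {\<one>\<^bsub>?V\<^esub>} (word_ker q N G F) r"
  define S where "S = Sigma (generating_tuples G {..<N}) ?I"
  define U where "U = PiE {0..<h} (\<lambda>_. carrier G)"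
  define T where "T = (SIGMA H:table_groups q h. generating_tuples H {..<N} \<times> U)"
  define i where "i = (\<lambda>(H :: nat monoid, F :: nat \<Rightarrow> nat, u :: nat \<Rightarrow> 'a). ((\<lambda>s\<in>{..<N}. u (F s)), word_ker q N H F))"
  define g where "g = (\<lambda>(H :: nat monoid, F, u :: nat \<Rightarrow> 'a). \<bar>\<rho> (word_ker q N H F) - z\<bar>)"
  have finI: "finite (?I F)" for F
    by (rule finite_subset[of _ "Pow (carrier ?V)"])
       (auto simp: index_subgroups_def finite_carrier_modvec[OF q] dest: subgroup.subset)
  have fing: "finite (generating_tuples G {..<N})" using G(2) by (intro finite_generating_tuples) auto
  have fingH: "finite (generating_tuples H {..<N})" if "H \<in> table_groups q h" for H
    using table_groupsD(2)[OF that] by (intro finite_generating_tuples) auto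
  have finU: "finite U" unfolding U_def using G(2) by (intro finite_PiE) auto
  have "(\<Sum>F\<in>generating_tuples G {..<N}. \<Sum>L\<in>?I F. \<bar>\<rho> L - z\<bar>) = (\<Sum>y\<in>S. \<bar>\<rho> (snd y) - z\<bar>)"
    unfolding S_def using fing finI by (subst sum.Sigma) (auto simp: case_prod_unfold)
  also have "\<dots> \<le> (\<Sum>y\<in>T. g y)"
  proof (rule sum_le_included[where i=i])
    show "finite S" unfolding S_def using fing finI by auto
    show "finite T" unfolding T_def using finite_table_groups fingH finU by (intro finite_SigmaI finite_cartesian_product) auto
    show "\<forall>y\<in>T. 0 \<le> g y" by (auto simp: g_def)
    show "\<forall>x\<in>S. \<exists>y\<in>T. i y = x \<and> \<bar>\<rho> (snd x) - z\<bar> \<le> g y"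
    proof
      fix x assume "x \<in> S"
      then obtain F L where x: "x = (F, L)" and F: "F \<in> generating_tuples G {..<N}" and L: "L \<in> ?I F"
        by (auto simp: S_def)
      have Ls: "subgroup L ?V" and LA: "L \<subseteq> word_ker q N G F" and cL: "card (word_ker q N G F) = p ^ r * card L"
        using L by (auto simp: index_subgroups_def)
      have FP: "F \<in> PiE {..<N} (\<lambda>_. carrier G)" using F by (simp add: generating_tuples_def)
      then have Fc: "F \<in> {..<N} \<rightarrow> carrier G" by auto
      have "card (carrier ?V) = h * card L"
        using card_word_ker(2)[OF q G(1,3) F] cL h by simp
      then obtain H F' where H: "H \<in> table_groups q h" and F': "F' \<in> generating_tuples H {..<N}" and K: "word_ker q N H F' = L"
        using subgroup_is_word_ker[OF q Ls] by blast
      note Hc = table_groupsD[OF H]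
      interpret H: comm_group H by (rule Hc(1))
      have F'c: "F' \<in> {..<N} \<rightarrow> carrier H" using F' by (auto simp: generating_tuples_def)
      have kk: "word G {..<N} F v = \<one>\<^bsub>G\<^esub>" if "v \<in> carrier ?V" "word H {..<N} F' v = \<one>\<^bsub>H\<^esub>" for v
      proof -
        have "v \<in> word_ker q N H F'" using that by (simp add: word_ker_def)
        then have "v \<in> word_ker q N G F" using K LA by blast
        then show ?thesis by (simp add: word_ker_def)
      qed
      obtain \<sigma> where \<sigma>: "\<sigma> \<in> hom H G" "\<sigma> \<in> extensional (carrier H)" "\<And>v. v \<in> carrier ?V \<Longrightarrow> \<sigma> (word H {..<N} F' v) = word G {..<N} F v"
        using hom_factor[OF V.is_group H.is_group G.is_group word_hom[OF q Hc(1,3) F'c] word_surj[OF q Hc(1,3) F'] word_hom[OF q G(1,3) Fc] kk]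
        by blast
      have "\<sigma> \<in> U" using \<sigma>(1,2) Hc(2) by (auto simp: U_def hom_def PiE_def)
      moreover have "(\<lambda>s\<in>{..<N}. \<sigma> (F' s)) = F"
      proof
        fix s show "(\<lambda>s\<in>{..<N}. \<sigma> (F' s)) s = F s"
          using \<sigma>(3)[OF std_vec_closed[OF q], of s] word_std_vec[OF q G(1) Fc, of s] word_std_vec[OF q Hc(1) F'c, of s] PiE_arb[OF FP, of s]
          by (cases "s < N") auto
      qed
      ultimately show "\<exists>y\<in>T. i y = x \<and> \<bar>\<rho> (snd x) - z\<bar> \<le> g y"
        using H F' K x by (intro bexI[of _ "(H, F', \<sigma>)"]) (auto simp: T_def i_def g_def)
    qed
  qed
  also have "\<dots> = (\<Sum>H\<in>table_groups q h. \<Sum>y\<in>generating_tuples H {..<N} \<times> U. g (H, y))"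
    unfolding T_def using sum.Sigma[OF finite_table_groups[of q h], of "\<lambda>H. generating_tuples H {..<N} \<times> U" "\<lambda>H y. g (H, y)"] fingH finU
    by simp
  also have "\<dots> = (\<Sum>H\<in>table_groups q h. \<Sum>F\<in>generating_tuples H {..<N}. \<Sum>u\<in>U. g (H, F, u))"
    by (simp add: sum.cartesian_product)
  also have "\<dots> = (\<Sum>H\<in>table_groups q h. \<Sum>F\<in>generating_tuples H {..<N}. card U * \<bar>\<rho> (word_ker q N H F) - z\<bar>)"
    by (simp add: g_def)
  also have "card U = card (carrier G) ^ h" by (simp add: U_def card_PiE)
  finally show ?thesis by (simp add: sum_distrib_left)
qed

section \<open>Cokernels of p-adic matrices modulo a power of p\<close>

lemma carrier_padic:
  "x \<in> carrier (padic_int p) \<longleftrightarrow> (\<forall>k. 0 \<le> x k \<and> x k < int p ^ k \<and> x (Suc k) mod int p ^ k = x k)"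
  by (auto simp: padic_int_def)

lemma padic_mod:
  assumes "x \<in> carrier (padic_int p)" "j \<le> l"
  shows "x l mod int p ^ j = x j"
  using assms(2)
proof (induction l rule: dec_induct)
  case base
  then show ?case using assms(1) by (simp add: carrier_padic)
next
  case (step l)
  have "x (Suc l) mod int p ^ j = (x (Suc l) mod int p ^ l) mod int p ^ j"
    using step.hyps by (simp add: mod_mod_cancel le_imp_power_dvd)
  also have "x (Suc l) mod int p ^ l = x l" using assms(1) by (simp add: carrier_padic)
  finally show ?case using step.IH by simp
qed

lemma padic_of_residues:
  assumes "p > 0" "\<And>l. f (Suc l) mod int p ^ l = f l mod int p ^ l"
  shows "(\<lambda>l. f l mod int p ^ l) \<in> carrier (padic_int p)"
  using assms by (auto simp: carrier_padic mod_mod_cancel)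

lemma padic_ops:
  "x \<otimes>\<^bsub>padic_int p\<^esub> y = (\<lambda>k. (x k * y k) mod int p ^ k)"
  "x \<oplus>\<^bsub>padic_int p\<^esub> y = (\<lambda>k. (x k + y k) mod int p ^ k)"
  "\<zero>\<^bsub>padic_int p\<^esub> = (\<lambda>k. 0)"
  by (simp_all add: padic_int_def)

lemma finsum_padic:
  assumes p: "p > 0" and A: "finite A" "f \<in> A \<rightarrow> carrier (padic_int p)"
  shows "(\<Oplus>\<^bsub>padic_int p\<^esub>i\<in>A. f i) = (\<lambda>l. (\<Sum>i\<in>A. f i l) mod int p ^ l)"
  using A
proof (induction A)
  case empty
  interpret R: cring "padic_int p" using p by (rule padic_int_cring)
  show ?case by (simp add: padic_ops)
next
  case (insert a A)
  interpret R: cring "padic_int p" using p by (rule padic_int_cring)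
  have "(\<Oplus>\<^bsub>padic_int p\<^esub>i\<in>insert a A. f i) = f a \<oplus>\<^bsub>padic_int p\<^esub> (\<Oplus>\<^bsub>padic_int p\<^esub>i\<in>A. f i)"
    using insert by (intro R.finsum_insert) auto
  then show ?case using insert by (simp add: padic_ops mod_simps)
qed

locale padic_matrix =
  fixes p k N :: nat and M :: "padic mat"
  assumes prime: "prime p" and k: "k \<ge> 1" and M: "M \<in> carrier_mat N N"
    and entries: "\<And>i j. i < N \<Longrightarrow> j < N \<Longrightarrow> M $$ (i, j) \<in> carrier (padic_int p)"
begin

abbreviation "W \<equiv> padic_vectors p N"
abbreviation "V \<equiv> modvec (p ^ k) N"
abbreviation "im_M \<equiv> padic_mult_vec p M ` carrier W"

definition col :: "nat \<Rightarrow> nat \<Rightarrow> int" where "col s = (\<lambda>r\<in>{..<N}. (M $$ (r, s)) k)"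
text \<open>The subgroup generated by the columns modulo \<open>p ^ k\<close>, which is the image of the matrix modulo
\<open>p ^ k\<close>.\<close>

definition Q :: "(nat \<Rightarrow> int) set" where "Q = generate V (col ` {..<N})"
definition red :: "(nat \<Rightarrow> padic) \<Rightarrow> nat \<Rightarrow> int" where "red v = (\<lambda>r\<in>{..<N}. v r k)"

lemma p0: "p > 0" using prime by (simp add: prime_gt_0_nat)

lemma q2: "p ^ k \<ge> 2"
proof -
  have p2: "p \<ge> 2" using prime by (simp add: prime_ge_2_nat)
  have "p ^ 1 \<le> p ^ k" using p2 k by (intro power_increasing) auto
  then show ?thesis using p2 by simp
qed

lemma W: "comm_group W"
proof -
  interpret R: cring "padic_int p" using p0 by (rule padic_int_cring)
  show ?thesis unfolding padic_vectors_def
  proof (rule group.group_comm_groupI)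
    show "group (product_group {..<N} (\<lambda>_. add_monoid (padic_int p)))" using R.a_group by simp
    fix x y assume "x \<in> carrier (product_group {..<N} (\<lambda>_. add_monoid (padic_int p)))" "y \<in> carrier (product_group {..<N} (\<lambda>_. add_monoid (padic_int p)))"
    show "x \<otimes>\<^bsub>product_group {..<N} (\<lambda>_. add_monoid (padic_int p))\<^esub> y = y \<otimes>\<^bsub>product_group {..<N} (\<lambda>_. add_monoid (padic_int p))\<^esub> x"
      by (simp add: padic_ops add.commute)
  qed
qed

sublocale W: comm_group W by (rule W)
sublocale V: comm_group V by (rule comm_group_modvec)

lemma carrier_W: "carrier W = PiE {..<N} (\<lambda>_. carrier (padic_int p))"
  by (simp add: padic_vectors_def)

lemma mult_W: "v \<otimes>\<^bsub>W\<^esub> w = (\<lambda>r\<in>{..<N}. \<lambda>l. (v r l + w r l) mod int p ^ l)"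
  by (simp add: padic_vectors_def padic_ops)

lemma W_mem: "v \<in> carrier W \<Longrightarrow> r < N \<Longrightarrow> v r \<in> carrier (padic_int p)"
  by (auto simp: carrier_W)

lemma W_eqI:
  assumes "v \<in> carrier W" "w \<in> carrier W" "\<And>r l. r < N \<Longrightarrow> v r l = w r l"
  shows "v = w"
proof (rule PiE_ext)
  show "v \<in> PiE {..<N} (\<lambda>_. carrier (padic_int p))" "w \<in> PiE {..<N} (\<lambda>_. carrier (padic_int p))"
    using assms(1,2) by (simp_all add: carrier_W)
qed (use assms(3) in auto)

lemma mult_vec: "v \<in> carrier W \<Longrightarrow> padic_mult_vec p M v = (\<lambda>r\<in>{..<N}. \<lambda>l. (\<Sum>s<N. (M $$ (r, s)) l * v s l) mod int p ^ l)"
proof -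
  assume v: "v \<in> carrier W"
  interpret R: cring "padic_int p" using p0 by (rule padic_int_cring)
  have "(\<Oplus>\<^bsub>padic_int p\<^esub>j\<in>{..<N}. M $$ (r, j) \<otimes>\<^bsub>padic_int p\<^esub> v j) = (\<lambda>l. (\<Sum>s<N. (M $$ (r, s)) l * v s l) mod int p ^ l)" if "r < N" for r
  proof -
    have "(\<Oplus>\<^bsub>padic_int p\<^esub>j\<in>{..<N}. M $$ (r, j) \<otimes>\<^bsub>padic_int p\<^esub> v j) = (\<lambda>l. (\<Sum>s<N. (M $$ (r, s) \<otimes>\<^bsub>padic_int p\<^esub> v s) l) mod int p ^ l)"
      by (rule finsum_padic[OF p0]) (use W_mem[OF v] entries[OF that] in auto)
    then show ?thesis by (simp add: padic_ops mod_sum_eq)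
  qed
  then show ?thesis using M by (auto simp: padic_mult_vec_def intro!: restrict_ext)
qed

lemma mult_vec_closed: "v \<in> carrier W \<Longrightarrow> padic_mult_vec p M v \<in> carrier W"
proof -
  assume v: "v \<in> carrier W"
  have "(\<lambda>l. (\<Sum>s<N. (M $$ (r, s)) l * v s l) mod int p ^ l) \<in> carrier (padic_int p)" if r: "r < N" for r
  proof (rule padic_of_residues[OF p0])
    fix l
    have "(\<Sum>s<N. (M $$ (r, s)) (Suc l) * v s (Suc l)) mod int p ^ l =
      (\<Sum>s<N. ((M $$ (r, s)) (Suc l) mod int p ^ l) * (v s (Suc l) mod int p ^ l)) mod int p ^ l"
      by (subst (1 2) mod_sum_eq[symmetric]) (simp add: mod_mult_eq)
    also have "\<dots> = (\<Sum>s<N. (M $$ (r, s)) l * v s l) mod int p ^ l"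
      using padic_mod[OF entries[OF r], of _ l "Suc l"] padic_mod[OF W_mem[OF v], of _ l "Suc l"] by simp
    finally show "(\<Sum>s<N. (M $$ (r, s)) (Suc l) * v s (Suc l)) mod int p ^ l = (\<Sum>s<N. (M $$ (r, s)) l * v s l) mod int p ^ l" .
  qed
  then show ?thesis unfolding mult_vec[OF v] carrier_W by auto
qed

lemma mult_vec_hom: "padic_mult_vec p M \<in> hom W W"
proof (rule homI)
  fix v w assume vw: "v \<in> carrier W" "w \<in> carrier W"
  then have "v \<otimes>\<^bsub>W\<^esub> w \<in> carrier W" by simp
  note mvw = mult_vec[OF this]
  have eq: "(\<Sum>s<N. (M $$ (r, s)) l * (v \<otimes>\<^bsub>W\<^esub> w) s l) mod int p ^ l =
      ((\<Sum>s<N. (M $$ (r, s)) l * v s l) mod int p ^ l + (\<Sum>s<N. (M $$ (r, s)) l * w s l) mod int p ^ l) mod int p ^ l" for r l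
  proof -
    have "[(\<Sum>s<N. (M $$ (r, s)) l * (v \<otimes>\<^bsub>W\<^esub> w) s l) = (\<Sum>s<N. (M $$ (r, s)) l * (v s l + w s l))] (mod int p ^ l)"
      by (intro cong_sum cong_mult cong_refl) (simp add: mult_W cong_def)
    also have "(\<Sum>s<N. (M $$ (r, s)) l * (v s l + w s l)) = (\<Sum>s<N. (M $$ (r, s)) l * v s l) + (\<Sum>s<N. (M $$ (r, s)) l * w s l)"
      by (simp only: distrib_left sum.distrib)
    finally show ?thesis by (simp only: cong_def mod_add_eq)
  qed
  show "padic_mult_vec p M (v \<otimes>\<^bsub>W\<^esub> w) = padic_mult_vec p M v \<otimes>\<^bsub>W\<^esub> padic_mult_vec p M w"
    unfolding mvw mult_vec[OF vw(1)] mult_vec[OF vw(2)] eq unfolding mult_W by (rule restrict_ext) simp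
qed (rule mult_vec_closed)

lemma im_M_subgroup: "subgroup im_M W"
proof -
  interpret h: group_hom W W "padic_mult_vec p M"
    using mult_vec_hom by (simp add: group_hom_def group_hom_axioms_def W.is_group)
  show ?thesis by (rule h.img_is_subgroup)
qed

lemma red_hom: "red \<in> hom W V"
proof (rule homI)
  fix v assume "v \<in> carrier W"
  then show "red v \<in> carrier V"
    using W_mem unfolding red_def carrier_modvec[OF q2] restrict_PiE_iff by (auto simp: carrier_padic)
next
  fix v w assume "v \<in> carrier W" "w \<in> carrier W"
  show "red (v \<otimes>\<^bsub>W\<^esub> w) = red v \<otimes>\<^bsub>V\<^esub> red w"
    unfolding red_def mult_W mult_modvec[OF q2] by (rule restrict_ext) simp
qed

sublocale red: group_hom W V red
  using red_hom by (simp add: group_hom_def group_hom_axioms_def W.is_group V.is_group)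

definition lift :: "(nat \<Rightarrow> int) \<Rightarrow> nat \<Rightarrow> padic" where "lift x = (\<lambda>r\<in>{..<N}. \<lambda>l. x r mod int p ^ l)"

lemma lift_closed: "lift x \<in> carrier W"
  unfolding lift_def carrier_W restrict_PiE_iff by (auto intro: padic_of_residues[OF p0])

lemma red_lift: "w \<in> carrier V \<Longrightarrow> red (lift w) = w"
proof -
  assume "w \<in> carrier V"
  then have w: "w \<in> PiE {..<N} (\<lambda>_. {0..<int (p ^ k)})" by (simp only: carrier_modvec[OF q2])
  show ?thesis
  proof
    fix r show "red (lift w) r = w r"
      using PiE_mem[OF w, of r] PiE_arb[OF w, of r] by (simp add: red_def lift_def)
  qed
qed

lemma finprod_V:
  assumes "finite A" "f \<in> A \<rightarrow> carrier V"
  shows "finprod V f A = (\<lambda>r\<in>{..<N}. (\<Sum>s\<in>A. f s r) mod int (p ^ k))"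
  using assms
proof (induction A)
  case empty
  show ?case by (simp add: one_modvec[OF q2])
next
  case (insert a A)
  have "finprod V f (insert a A) = f a \<otimes>\<^bsub>V\<^esub> finprod V f A" using insert by (intro V.finprod_insert) auto
  also have "\<dots> = (\<lambda>r\<in>{..<N}. (\<Sum>s\<in>insert a A. f s r) mod int (p ^ k))"
    using insert unfolding mult_modvec[OF q2] by (intro restrict_ext) (auto simp: mod_simps)
  finally show ?case .
qed

lemma col_closed: "s < N \<Longrightarrow> col s \<in> carrier V"
  using entries unfolding col_def carrier_modvec[OF q2] restrict_PiE_iff by (auto simp: carrier_padic)

lemma Q_subgroup: "subgroup Q V"
  unfolding Q_def using col_closed by (intro V.generate_is_subgroup) auto

lemma red_image: "red ` im_M = Q"
proof
  show "red ` im_M \<subseteq> Q"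
  proof safe
    fix v assume v: "v \<in> carrier W"
    have nn: "v s k = int (nat (v s k))" if "s < N" for s
      using W_mem[OF v that] by (simp add: carrier_padic)
    have "red (padic_mult_vec p M v) = finprod V (\<lambda>s. col s [^]\<^bsub>V\<^esub> nat (v s k)) {..<N}"
    proof -
      have "finprod V (\<lambda>s. col s [^]\<^bsub>V\<^esub> nat (v s k)) {..<N} = (\<lambda>r\<in>{..<N}. (\<Sum>s<N. (col s [^]\<^bsub>V\<^esub> nat (v s k)) r) mod int (p ^ k))"
        by (rule finprod_V) (use col_closed in auto)
      also have "\<dots> = red (padic_mult_vec p M v)"
        unfolding mult_vec[OF v] red_def
      proof (rule restrict_ext)
        fix r assume r: "r \<in> {..<N}"
        have "(col s [^]\<^bsub>V\<^esub> nat (v s k)) r = ((M $$ (r, s)) k * v s k) mod int (p ^ k)" if "s < N" for s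
          using r nn[OF that] unfolding pow_modvec[OF q2] by (simp add: col_def mult.commute)
        then have "(\<Sum>s<N. (col s [^]\<^bsub>V\<^esub> nat (v s k)) r) mod int (p ^ k) = (\<Sum>s<N. ((M $$ (r, s)) k * v s k) mod int (p ^ k)) mod int (p ^ k)"
          by simp
        also have "\<dots> = (\<Sum>s<N. (M $$ (r, s)) k * v s k) mod int (p ^ k)" by (rule mod_sum_eq)
        finally show "(\<Sum>s<N. (col s [^]\<^bsub>V\<^esub> nat (v s k)) r) mod int (p ^ k) = (\<lambda>r\<in>{..<N}. \<lambda>l. (\<Sum>s<N. (M $$ (r, s)) l * v s l) mod int p ^ l) r k"
          using r by simp
      qed
      finally show ?thesis ..
    qed
    also have "\<dots> = word V {..<N} col (\<lambda>s. int (nat (v s k)))" by (simp only: word_def int_pow_int)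
    also have "\<dots> \<in> Q"
      by (rule V.word_in_subgroup[OF Q_subgroup]) (auto simp: Q_def intro: generate.incl)
    finally show "red (padic_mult_vec p M v) \<in> Q" .
  qed
  have "subgroup (red ` im_M) V" by (rule red.subgroup_img_is_subgroup[OF im_M_subgroup])
  moreover have "col s \<in> red ` im_M" if s: "s < N" for s
  proof -
    define e where "e = lift (\<lambda>r. if r = s then 1 else 0)"
    have e: "e \<in> carrier W" unfolding e_def by (rule lift_closed)
    have "col s = red (padic_mult_vec p M e)"
      unfolding mult_vec[OF e] red_def col_def
    proof (rule restrict_ext)
      fix r assume r: "r \<in> {..<N}"
      have "(\<Sum>j<N. (M $$ (r, j)) k * e j k) = (\<Sum>j<N. if j = s then (M $$ (r, j)) k * (1 mod int p ^ k) else 0)"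
        by (intro sum.cong refl) (simp add: e_def lift_def)
      also have "\<dots> = (M $$ (r, s)) k * (1 mod int p ^ k)" using s by simp
      finally have "(\<Sum>j<N. (M $$ (r, j)) k * e j k) mod int p ^ k = (M $$ (r, s)) k mod int p ^ k"
        by (simp add: mod_mult_right_eq)
      also have "\<dots> = (M $$ (r, s)) k" using entries[of r s] r s by (simp add: carrier_padic)
      finally show "(M $$ (r, s)) k = (\<lambda>r\<in>{..<N}. \<lambda>l. (\<Sum>s<N. (M $$ (r, s)) l * e s l) mod int p ^ l) r k"
        using r by simp
    qed
    then show ?thesis using e by blast
  qed
  ultimately show "Q \<subseteq> red ` im_M" unfolding Q_def by (intro V.generate_subgroup_incl) auto
qed

text \<open>One step of the Nakayama argument. If \<open>y\<close> lies in the image of the matrix modulo \<open>p ^ k\<close>, then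
\<open>y - M v\<close> is divisible by \<open>p ^ k\<close> for some \<open>v\<close>, say \<open>y - M v = p (p ^ (k - 1) z)\<close>. Since
multiplication by \<open>p ^ (k - 1)\<close> maps into the image modulo \<open>p ^ k\<close>, the vector
\<open>y' = p ^ (k - 1) z\<close> again satisfies the hypothesis.\<close>

lemma descent_step:
  assumes kill: "\<And>w. w \<in> carrier V \<Longrightarrow> w [^]\<^bsub>V\<^esub> (p ^ (k - 1)) \<in> Q"
    and y: "y \<in> carrier W" "red y \<in> Q"
  shows "\<exists>v y'. v \<in> carrier W \<and> y' \<in> carrier W \<and> red y' \<in> Q \<and>
    (\<forall>r<N. \<forall>l. [y r l = (\<Sum>s<N. (M $$ (r, s)) l * v s l) + int p * y' r l] (mod int p ^ l))"
proof -
  obtain v where v: "v \<in> carrier W" "red y = red (padic_mult_vec p M v)"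
    using y(2) unfolding red_image[symmetric] by blast
  define m where "m = padic_mult_vec p M v"
  have m: "m \<in> carrier W" unfolding m_def by (rule mult_vec_closed[OF v(1)])
  have ml: "m r l = (\<Sum>s<N. (M $$ (r, s)) l * v s l) mod int p ^ l" if "r < N" for r l
    unfolding m_def mult_vec[OF v(1)] using that by simp
  define d where "d r l = (y r l - m r l) mod int p ^ l" for r l
  \<comment> \<open>Division by \<open>p ^ k\<close> costs \<open>k\<close> digits, hence the shift of the index.\<close>
  define z where "z = (\<lambda>r\<in>{..<N}. \<lambda>l. d r (l + k) div int p ^ k)"
  have dmod: "d r l mod int p ^ j = d r j" if "r < N" "j \<le> l" for r j l
  proof -
    have "d r l mod int p ^ j = (y r l - m r l) mod int p ^ j"
      unfolding d_def using that by (simp add: mod_mod_cancel le_imp_power_dvd)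
    also have "\<dots> = (y r l mod int p ^ j - m r l mod int p ^ j) mod int p ^ j" by (simp add: mod_diff_eq)
    finally show ?thesis using padic_mod[OF W_mem[OF y(1)]] padic_mod[OF W_mem[OF m]] that by (simp add: d_def)
  qed
  have dk: "d r k = 0" if "r < N" for r
  proof -
    have "red y r = red m r" using v by (simp add: m_def)
    then show ?thesis using that by (simp add: red_def d_def)
  qed
  have dz: "d r (l + k) = int p ^ k * z r l" if "r < N" for r l
  proof -
    have "d r (l + k) mod int p ^ k = 0" using dmod[OF that, of k "l + k"] dk[OF that] by simp
    then show ?thesis using that by (auto simp: z_def dvd_eq_mod_eq_0)
  qed
  have pk: "int p ^ k > 0" for k using p0 by simp
  have z: "z \<in> carrier W"
    unfolding carrier_W
  proof (rule PiE_I)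
    fix r assume "r \<in> {..<N}"
    then have r: "r < N" by simp
    show "z r \<in> carrier (padic_int p)"
      unfolding carrier_padic
    proof (intro allI conjI)
      fix l
      have b: "0 \<le> d r (l + k)" "d r (l + k) < int p ^ (l + k)"
        unfolding d_def by (rule pos_mod_sign[OF pk], rule pos_mod_bound[OF pk])
      then show "0 \<le> z r l" unfolding dz[OF r] using pk[of k] by (simp add: zero_le_mult_iff not_le)
      have "int p ^ k * z r l < int p ^ k * int p ^ l" using b(2) dz[OF r, of l] by (simp add: power_add mult.commute)
      then show "z r l < int p ^ l" using pk[of k] by (simp only: mult_less_cancel_left_pos)
      have "int p ^ k * (z r (Suc l) mod int p ^ l) = (int p ^ k * z r (Suc l)) mod (int p ^ k * int p ^ l)"
        by (rule mult_mod_right)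
      also have "int p ^ k * z r (Suc l) = d r (Suc l + k)" by (rule dz[OF r, symmetric])
      also have "int p ^ k * int p ^ l = int p ^ (l + k)" by (simp only: power_add mult.commute)
      also have "d r (Suc l + k) mod int p ^ (l + k) = d r (l + k)" by (rule dmod[OF r]) simp
      also have "d r (l + k) = int p ^ k * z r l" by (rule dz[OF r])
      finally show "z r (Suc l) mod int p ^ l = z r l" using p0 by simp
    qed
  qed (simp add: z_def)
  define y' where "y' = z [^]\<^bsub>W\<^esub> (p ^ (k - 1))"
  have powW: "(z [^]\<^bsub>W\<^esub> (n::nat)) r l = (int n * z r l) mod int p ^ l" if "r < N" for n r l
  proof (induction n)
    case 0
    have "\<one>\<^bsub>W\<^esub> r l = 0" using that by (simp add: padic_vectors_def padic_ops)
    then show ?case by simp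
  next
    case (Suc n)
    have "(z [^]\<^bsub>W\<^esub> Suc n) r l = ((z [^]\<^bsub>W\<^esub> n) r l + z r l) mod int p ^ l" using that by (simp add: mult_W)
    then show ?case unfolding Suc.IH by (simp add: mod_simps algebra_simps)
  qed
  have y': "y' \<in> carrier W" using z by (simp add: y'_def)
  have "red y' = red z [^]\<^bsub>V\<^esub> (p ^ (k - 1))" unfolding y'_def using z by (simp add: red.hom_nat_pow)
  then have ry': "red y' \<in> Q" using kill z by simp
  have "[y r l = (\<Sum>s<N. (M $$ (r, s)) l * v s l) + int p * y' r l] (mod int p ^ l)" if r: "r < N" for r l
  proof -
    have ppk: "int p * int (p ^ (k - 1)) = int p ^ k" using k by (simp flip: power_Suc)
    have "[int p * y' r l = int p * (int (p ^ (k - 1)) * z r l)] (mod int p ^ l)"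
      unfolding y'_def powW[OF r] by (intro cong_mult cong_refl) (simp add: cong_def)
    also have "int p * (int (p ^ (k - 1)) * z r l) = d r (l + k)" unfolding dz[OF r] ppk[symmetric] by simp
    also have "[d r (l + k) = d r l] (mod int p ^ l)" using dmod[OF r, of l "l + k"] by (simp add: cong_def d_def)
    also have "[d r l = y r l - m r l] (mod int p ^ l)" by (simp add: cong_def d_def)
    finally have 1: "[int p * y' r l = y r l - m r l] (mod int p ^ l)" .
    have 2: "[(\<Sum>s<N. (M $$ (r, s)) l * v s l) = m r l] (mod int p ^ l)" unfolding ml[OF r] by (simp add: cong_def)
    have "[(\<Sum>s<N. (M $$ (r, s)) l * v s l) + int p * y' r l = m r l + (y r l - m r l)] (mod int p ^ l)"
      by (rule cong_add[OF 2 1])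
    then show ?thesis by (simp add: cong_sym_eq)
  qed
  then show ?thesis using v(1) y' ry' by blast
qed

text \<open>Iterating the descent gives \<open>y = M (v\<^sub>0 + p v\<^sub>1 + p\<^sup>2 v\<^sub>2 + \<dots>)\<close>, a series that converges \<open>p\<close>-adically.\<close>

lemma red_preimage:
  assumes kill: "\<And>w. w \<in> carrier V \<Longrightarrow> w [^]\<^bsub>V\<^esub> (p ^ (k - 1)) \<in> Q"
    and y: "y \<in> carrier W" "red y \<in> Q"
  shows "y \<in> im_M"
proof -
  define S where "S = {y\<in>carrier W. red y \<in> Q}"
  have "\<forall>y\<in>S. \<exists>vy. fst vy \<in> carrier W \<and> snd vy \<in> S \<and>
    (\<forall>r<N. \<forall>l. [y r l = (\<Sum>s<N. (M $$ (r, s)) l * fst vy s l) + int p * snd vy r l] (mod int p ^ l))"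
  proof
    fix y assume "y \<in> S"
    then have "y \<in> carrier W" "red y \<in> Q" by (auto simp: S_def)
    from descent_step[OF kill this] obtain v y' where vy: "v \<in> carrier W" "y' \<in> carrier W" "red y' \<in> Q"
      "\<forall>r<N. \<forall>l. [y r l = (\<Sum>s<N. (M $$ (r, s)) l * v s l) + int p * y' r l] (mod int p ^ l)" by blast
    then show "\<exists>vy. fst vy \<in> carrier W \<and> snd vy \<in> S \<and>
      (\<forall>r<N. \<forall>l. [y r l = (\<Sum>s<N. (M $$ (r, s)) l * fst vy s l) + int p * snd vy r l] (mod int p ^ l))"
      by (intro exI[of _ "(v, y')"]) (simp add: S_def)
  qed
  from bchoice[OF this] obtain f where f0: "\<forall>y\<in>S. fst (f y) \<in> carrier W \<and> snd (f y) \<in> S \<and>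
    (\<forall>r<N. \<forall>l. [y r l = (\<Sum>s<N. (M $$ (r, s)) l * fst (f y) s l) + int p * snd (f y) r l] (mod int p ^ l))" ..
  have f: "fst (f y) \<in> carrier W" "snd (f y) \<in> S"
    "r < N \<Longrightarrow> [y r l = (\<Sum>s<N. (M $$ (r, s)) l * fst (f y) s l) + int p * snd (f y) r l] (mod int p ^ l)" if "y \<in> S" for y r l
    using bspec[OF f0 that] by blast+
  define ys where "ys i = ((\<lambda>y. snd (f y)) ^^ i) y" for i
  define vs where "vs i = fst (f (ys i))" for i
  have ys: "ys i \<in> S" for i
  proof (induction i)
    case 0
    then show ?case using y by (simp add: ys_def S_def)
  next
    case (Suc i)
    then show ?case using f(2)[of "ys i"] by (simp add: ys_def)
  qed
  have vs: "vs i \<in> carrier W" for i using f(1)[OF ys] by (simp add: vs_def)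
  have partial: "[y r l = (\<Sum>s<N. (M $$ (r, s)) l * (\<Sum>i<j. int p ^ i * vs i s l)) + int p ^ j * ys j r l] (mod int p ^ l)" if r: "r < N" for r l j
  proof (induction j)
    case 0
    then show ?case by (simp add: ys_def)
  next
    case (Suc j)
    have "[ys j r l = (\<Sum>s<N. (M $$ (r, s)) l * vs j s l) + int p * ys (Suc j) r l] (mod int p ^ l)"
      using f(3)[OF ys[of j] r, of l] by (simp add: vs_def ys_def)
    then have "[(\<Sum>s<N. (M $$ (r, s)) l * (\<Sum>i<j. int p ^ i * vs i s l)) + int p ^ j * ys j r l =
      (\<Sum>s<N. (M $$ (r, s)) l * (\<Sum>i<j. int p ^ i * vs i s l)) + int p ^ j * ((\<Sum>s<N. (M $$ (r, s)) l * vs j s l) + int p * ys (Suc j) r l)] (mod int p ^ l)"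
      by (intro cong_add cong_mult cong_refl)
    from cong_trans[OF Suc.IH this] show ?case
      by (simp add: distrib_left sum.distrib sum_distrib_left algebra_simps)
  qed
  define v where "v = (\<lambda>s\<in>{..<N}. \<lambda>l. (\<Sum>i<l. int p ^ i * vs i s l) mod int p ^ l)"
  have v: "v \<in> carrier W"
    unfolding v_def carrier_W restrict_PiE_iff
  proof
    fix s assume "s \<in> {..<N}"
    then have s: "s < N" by simp
    show "(\<lambda>l. (\<Sum>i<l. int p ^ i * vs i s l) mod int p ^ l) \<in> carrier (padic_int p)"
    proof (rule padic_of_residues[OF p0])
      fix l
      have "[(\<Sum>i<Suc l. int p ^ i * vs i s (Suc l)) = (\<Sum>i<l. int p ^ i * vs i s (Suc l)) + 0] (mod int p ^ l)"
        unfolding sum.lessThan_Suc by (intro cong_add cong_refl) (simp add: cong_def)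
      also have "[(\<Sum>i<l. int p ^ i * vs i s (Suc l)) + 0 = (\<Sum>i<l. int p ^ i * vs i s l)] (mod int p ^ l)"
      proof -
        have "[vs i s (Suc l) = vs i s l] (mod int p ^ l)" for i
          using padic_mod[OF W_mem[OF vs s], of l "Suc l" i] padic_mod[OF W_mem[OF vs s], of l l i] by (simp add: cong_def)
        then show ?thesis unfolding add_0_right by (intro cong_sum cong_mult cong_refl)
      qed
      finally show "(\<Sum>i<Suc l. int p ^ i * vs i s (Suc l)) mod int p ^ l = (\<Sum>i<l. int p ^ i * vs i s l) mod int p ^ l"
        by (simp add: cong_def)
    qed
  qed
  have "padic_mult_vec p M v = y"
  proof (rule W_eqI[OF mult_vec_closed[OF v] y(1)])
    fix r l assume r: "r < N"
    have "[(\<Sum>s<N. (M $$ (r, s)) l * v s l) = (\<Sum>s<N. (M $$ (r, s)) l * (\<Sum>i<l. int p ^ i * vs i s l))] (mod int p ^ l)"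
      by (intro cong_sum cong_mult cong_refl) (simp add: v_def cong_def)
    also have "[(\<Sum>s<N. (M $$ (r, s)) l * (\<Sum>i<l. int p ^ i * vs i s l)) = (\<Sum>s<N. (M $$ (r, s)) l * (\<Sum>i<l. int p ^ i * vs i s l)) + int p ^ l * ys l r l] (mod int p ^ l)"
      by (simp add: cong_def)
    also have "[(\<Sum>s<N. (M $$ (r, s)) l * (\<Sum>i<l. int p ^ i * vs i s l)) + int p ^ l * ys l r l = y r l] (mod int p ^ l)"
      by (rule cong_sym[OF partial[OF r]])
    finally have "padic_mult_vec p M v r l = y r l mod int p ^ l" unfolding mult_vec[OF v] using r by (simp add: cong_def)
    then show "padic_mult_vec p M v r l = y r l" using padic_mod[OF W_mem[OF y(1) r], of l l] by simp
  qed
  then show ?thesis using v by blast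
qed

lemma coker_iso_Mod:
  assumes kill: "\<And>w. w \<in> carrier V \<Longrightarrow> w [^]\<^bsub>V\<^esub> (p ^ (k - 1)) \<in> Q"
  shows "coker p M \<cong> V Mod Q"
proof -
  have Qn: "Q \<lhd> V" using Q_subgroup by (simp add: V.normal_iff_subgroup)
  have VQ: "group (V Mod Q)" using Qn by (rule normal.factorgroup_is_group)
  define h where "h y = Q #>\<^bsub>V\<^esub> red y" for y
  have hh: "h \<in> hom W (V Mod Q)"
  proof -
    have "(\<lambda>a. Q #>\<^bsub>V\<^esub> a) \<circ> red \<in> hom W (V Mod Q)"
      using normal.r_coset_hom_Mod[OF Qn] red_hom by (intro hom_compose) auto
    then show ?thesis by (simp add: h_def[abs_def] o_def)
  qed
  interpret h: group_hom W "V Mod Q" h using hh VQ by (simp add: group_hom_def group_hom_axioms_def W.is_group)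
  have "h ` carrier W = carrier (V Mod Q)"
  proof -
    have "red ` carrier W = carrier V"
    proof
      show "carrier V \<subseteq> red ` carrier W"
      proof
        fix w assume "w \<in> carrier V"
        then have "w = red (lift w)" by (simp add: red_lift)
        then show "w \<in> red ` carrier W" using lift_closed by (rule image_eqI)
      qed
    qed auto
    then show ?thesis by (simp add: h_def[abs_def] carrier_FactGroup image_image[symmetric, of "\<lambda>a. Q #>\<^bsub>V\<^esub> a" red])
  qed
  then have "W Mod kernel W (V Mod Q) h \<cong> V Mod Q" by (rule h.FactGroup_iso)
  moreover have "kernel W (V Mod Q) h = im_M"
  proof
    show "kernel W (V Mod Q) h \<subseteq> im_M"
    proof
      fix y assume "y \<in> kernel W (V Mod Q) h"
      then have y: "y \<in> carrier W" "Q #>\<^bsub>V\<^esub> red y = Q" by (auto simp: kernel_def h_def)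
      have "red y \<in> Q" by (rule V.coset_join1[OF y(2) _ Q_subgroup]) (use y(1) in simp)
      then show "y \<in> im_M" using red_preimage[OF kill y(1)] by blast
    qed
    show "im_M \<subseteq> kernel W (V Mod Q) h"
    proof
      fix y assume y: "y \<in> im_M"
      then have yW: "y \<in> carrier W" using subgroup.subset[OF im_M_subgroup] by blast
      have "red y \<in> Q" using y red_image by blast
      then have "Q #>\<^bsub>V\<^esub> red y = Q" using V.coset_join2[OF _ Q_subgroup] yW by simp
      then show "y \<in> kernel W (V Mod Q) h" using yW by (simp add: kernel_def h_def)
    qed
  qed
  ultimately show ?thesis using M by (simp add: coker_def)
qed

text \<open>If either quotient is isomorphic to \<open>G\<close>, then \<open>p ^ (k - 1)\<close> kills \<open>V / Q\<close>, and the two quotients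
are isomorphic.\<close>

lemma coker_iso_iff:
  assumes G: "group G" "\<And>x. x \<in> carrier G \<Longrightarrow> x [^]\<^bsub>G\<^esub> (p ^ (k - 1)) = \<one>\<^bsub>G\<^esub>"
  shows "coker p M \<cong> G \<longleftrightarrow> V Mod Q \<cong> G"
proof -
  interpret G: group G by fact
  have torsion: "x [^]\<^bsub>H\<^esub> (p ^ (k - 1)) = \<one>\<^bsub>H\<^esub>" if H: "group H" "H \<cong> G" "x \<in> carrier H" for H :: "'z monoid" and x
  proof -
    obtain \<theta> where \<theta>: "\<theta> \<in> iso H G" using H(2) by (auto simp: is_iso_def)
    interpret H: group H by fact
    interpret t: group_hom H G \<theta> using \<theta> by (simp add: group_hom_def group_hom_axioms_def iso_def H.is_group G.is_group)
    have "\<theta> (x [^]\<^bsub>H\<^esub> (p ^ (k - 1))) = \<theta> \<one>\<^bsub>H\<^esub>" using G(2)[of "\<theta> x"] H(3) by (simp add: t.hom_nat_pow)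
    note te = this
    have inj: "inj_on \<theta> (carrier H)" using \<theta> by (simp add: iso_def bij_betw_def)
    show ?thesis by (rule inj_onD[OF inj te]) (use H(3) in simp_all)
  qed
  have Qn: "Q \<lhd> V" using Q_subgroup by (simp add: V.normal_iff_subgroup)
  have VQ: "group (V Mod Q)" using Qn by (rule normal.factorgroup_is_group)
  have In: "im_M \<lhd> W" using im_M_subgroup by (simp add: W.normal_iff_subgroup)
  have WI: "group (W Mod im_M)" using In by (rule normal.factorgroup_is_group)
  have ck: "coker p M = W Mod im_M" using M by (simp add: coker_def)
  have "coker p M \<cong> V Mod Q" if "coker p M \<cong> G \<or> V Mod Q \<cong> G"
  proof (rule coker_iso_Mod)
    fix w assume w: "w \<in> carrier V"
    from that show "w [^]\<^bsub>V\<^esub> (p ^ (k - 1)) \<in> Q"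
    proof
      assume iso: "V Mod Q \<cong> G"
      have "Q #>\<^bsub>V\<^esub> w \<in> carrier (V Mod Q)" using w by (auto simp: carrier_FactGroup)
      from torsion[OF VQ iso this] have "Q #>\<^bsub>V\<^esub> (w [^]\<^bsub>V\<^esub> (p ^ (k - 1))) = Q"
        using normal.FactGroup_pow[OF Qn w, of "p ^ (k - 1)"] by simp
      then show ?thesis using V.coset_join1[OF _ _ Q_subgroup] w by blast
    next
      assume "coker p M \<cong> G"
      then have iso: "W Mod im_M \<cong> G" by (simp add: ck)
      let ?l = "lift w"
      have "im_M #>\<^bsub>W\<^esub> ?l \<in> carrier (W Mod im_M)" using lift_closed by (auto simp: carrier_FactGroup)
      from torsion[OF WI iso this] have "im_M #>\<^bsub>W\<^esub> (?l [^]\<^bsub>W\<^esub> (p ^ (k - 1))) = im_M"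
        using normal.FactGroup_pow[OF In lift_closed[of w], of "p ^ (k - 1)"] by simp
      then have "?l [^]\<^bsub>W\<^esub> (p ^ (k - 1)) \<in> im_M" using W.coset_join1[OF _ _ im_M_subgroup] lift_closed by blast
      then have "red (?l [^]\<^bsub>W\<^esub> (p ^ (k - 1))) \<in> Q" using red_image by blast
      then show ?thesis using lift_closed w by (simp add: red.hom_nat_pow red_lift)
    qed
  qed
  moreover have "coker p M \<cong> G \<longleftrightarrow> V Mod Q \<cong> G" if i: "coker p M \<cong> V Mod Q"
  proof
    assume "V Mod Q \<cong> G"
    with i show "coker p M \<cong> G" by (rule iso_trans)
  next
    assume c: "coker p M \<cong> G"
    have "V Mod Q \<cong> coker p M" using group.iso_sym[OF WI] i by (simp add: ck)
    then show "V Mod Q \<cong> G" using c by (rule iso_trans)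
  qed
  ultimately show ?thesis by blast
qed

end

section \<open>From inclusion probabilities to the distribution of the quotient\<close>

text \<open>A tuple that does not generate lies in one of finitely many proper subgroups, each of which has at
most half the order of \<open>G\<close>.\<close>

lemma card_generating_tuples_ratio:
  assumes G: "comm_group G" "finite (carrier G)"
  shows "(\<lambda>N. real (card (generating_tuples G {..<N})) / real (card (carrier G)) ^ N) \<longlonglongrightarrow> 1"
proof -
  interpret G: comm_group G by fact
  define g where "g = card (carrier G)"
  have g: "g > 0" using G(2) G.one_closed by (auto simp: g_def card_gt_0_iff)
  define SS where "SS = {B. subgroup B G \<and> B \<noteq> carrier G}"
  have finSS: "finite SS" by (rule finite_subset[of _ "Pow (carrier G)"]) (use G in \<open>auto simp: SS_def dest: subgroup.subset\<close>)
  have lo: "1 - real (card SS) * (1/2) ^ N \<le> real (card (generating_tuples G {..<N})) / real g ^ N" for N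
  proof -
    let ?P = "PiE {..<N} (\<lambda>_. carrier G)"
    have finP: "finite ?P" using G(2) by (intro finite_PiE) auto
    have sub: "?P \<subseteq> generating_tuples G {..<N} \<union> (\<Union>B\<in>SS. PiE {..<N} (\<lambda>_. B))"
    proof
      fix F assume F: "F \<in> ?P"
      define B where "B = generate G (F ` {..<N})"
      have Fc: "F ` {..<N} \<subseteq> carrier G" using F by auto
      have B: "subgroup B G" unfolding B_def by (rule G.generate_is_subgroup[OF Fc])
      have "F \<in> PiE {..<N} (\<lambda>_. B)" using F by (auto simp: B_def PiE_iff intro: generate.incl)
      then show "F \<in> generating_tuples G {..<N} \<union> (\<Union>B\<in>SS. PiE {..<N} (\<lambda>_. B))"
        using F B by (cases "B = carrier G") (auto simp: generating_tuples_def B_def SS_def)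
    qed
    have finB: "finite (PiE {..<N} (\<lambda>_. B))" "real (card (PiE {..<N} (\<lambda>_. B))) \<le> (real g / 2) ^ N" if "B \<in> SS" for B
    proof -
      have "finite B" using that G(2) finite_subset by (auto simp: SS_def dest: subgroup.subset)
      then show "finite (PiE {..<N} (\<lambda>_. B))" by (intro finite_PiE) auto
      have "2 * card B \<le> g" unfolding g_def
        using that G(2) by (intro G.two_card_subgroup_le G.subgroup_self) (auto simp: SS_def dest: subgroup.subset)
      then have "real (card B) \<le> real g / 2" by linarith
      then show "real (card (PiE {..<N} (\<lambda>_. B))) \<le> (real g / 2) ^ N" by (simp add: card_PiE power_mono)
    qed
    have fing: "finite (generating_tuples G {..<N})" using G(2) by (intro finite_generating_tuples) auto
    have "g ^ N = card ?P" by (simp add: card_PiE g_def)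
    also have "\<dots> \<le> card (generating_tuples G {..<N} \<union> (\<Union>B\<in>SS. PiE {..<N} (\<lambda>_. B)))"
      using fing finSS finB by (intro card_mono sub) auto
    also have "\<dots> \<le> card (generating_tuples G {..<N}) + (\<Sum>B\<in>SS. card (PiE {..<N} (\<lambda>_. B)))"
      by (rule order_trans[OF card_Un_le add_left_mono[OF card_UN_le[OF finSS]]])
    finally have "real (g ^ N) \<le> real (card (generating_tuples G {..<N}) + (\<Sum>B\<in>SS. card (PiE {..<N} (\<lambda>_. B))))"
      by (simp only: of_nat_le_iff)
    also have "\<dots> = real (card (generating_tuples G {..<N})) + (\<Sum>B\<in>SS. real (card (PiE {..<N} (\<lambda>_. B))))" by simp
    also have "(\<Sum>B\<in>SS. real (card (PiE {..<N} (\<lambda>_. B)))) \<le> (\<Sum>B\<in>SS. (real g / 2) ^ N)"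
      by (intro sum_mono finB)
    finally have "real g ^ N \<le> real (card (generating_tuples G {..<N})) + real (card SS) * (real g / 2) ^ N" by simp
    then have "real g ^ N / real g ^ N \<le> (real (card (generating_tuples G {..<N})) + real (card SS) * (real g / 2) ^ N) / real g ^ N"
      by (intro divide_right_mono) auto
    then show ?thesis using g by (simp add: add_divide_distrib power_divide)
  qed
  have up: "real (card (generating_tuples G {..<N})) / real g ^ N \<le> 1" for N
  proof -
    have "card (generating_tuples G {..<N}) \<le> card (PiE {..<N} (\<lambda>_. carrier G))"
      using G(2) by (intro card_mono finite_PiE) (auto simp: generating_tuples_def)
    also have "\<dots> = g ^ N" by (simp add: card_PiE g_def)
    finally have "real (card (generating_tuples G {..<N})) \<le> real (g ^ N)" by (simp only: of_nat_le_iff)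
    then show ?thesis using g by (simp add: divide_le_eq)
  qed
  have "(\<lambda>N. 1 - real (card SS) * (1/2) ^ N) \<longlonglongrightarrow> 1 - real (card SS) * 0"
    by (intro tendsto_intros LIMSEQ_realpow_zero) auto
  then have lim: "(\<lambda>N. 1 - real (card SS) * (1/2) ^ N) \<longlonglongrightarrow> 1" by simp
  show ?thesis unfolding g_def[symmetric]
    by (rule tendsto_sandwich[OF _ _ lim tendsto_const]) (use lo up in auto)
qed

lemma sum_of_bool_card:
  "finite A \<Longrightarrow> (\<Sum>x\<in>A. of_bool (P x)) = real (card {x\<in>A. P x})"
  by (simp add: of_bool_def sum.If_cases Int_def)

locale target_group =
  fixes p k q :: nat and G :: "('g, 'r) monoid_scheme"
  assumes prime: "prime p" and k: "k \<ge> 1" and q: "q = p ^ k" and G: "comm_group G" "finite (carrier G)"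
    and G_torsion: "\<And>x. x \<in> carrier G \<Longrightarrow> x [^]\<^bsub>G\<^esub> (p ^ (k - 1)) = \<one>\<^bsub>G\<^esub>"
begin

sublocale G: comm_group G by (rule G(1))

lemma p2: "p \<ge> 2" using prime by (simp add: prime_ge_2_nat)

lemma q2: "q \<ge> 2"
proof -
  have "p ^ 1 \<le> p ^ k" using p2 k by (intro power_increasing) auto
  then show ?thesis using p2 q by simp
qed

lemma G_exponent: "x \<in> carrier G \<Longrightarrow> x [^]\<^bsub>G\<^esub> q = \<one>\<^bsub>G\<^esub>"
proof -
  assume x: "x \<in> carrier G"
  have "q = p ^ (k - 1) * p" using k q by (simp flip: power_Suc2)
  then show ?thesis using G.nat_pow_pow[OF x, of "p ^ (k - 1)" p] G_torsion[OF x] by simp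
qed

abbreviation epis :: "nat \<Rightarrow> (nat \<Rightarrow> 'g) set" where "epis N \<equiv> generating_tuples G {..<N}"
abbreviation "kers N F r \<equiv> index_subgroups (modvec q N) p {\<one>\<^bsub>modvec q N\<^esub>} (word_ker q N G F) r"

lemma finite_epis: "finite (epis N)" by (rule finite_generating_tuples[OF finite_lessThan G(2)])

lemma finite_kers: "finite (index_subgroups (modvec q N) p Q A r)"
  by (rule finite_subset[of _ "Pow (carrier (modvec q N))"])
     (auto simp: index_subgroups_def finite_carrier_modvec[OF q2] dest: subgroup.subset)

lemma bonferroni_expectation:
  fixes D :: "'y pmf" and Q :: "'y \<Rightarrow> (nat \<Rightarrow> int) set"
  assumes D: "finite (set_pmf D)" and Q: "\<And>y. subgroup (Q y) (modvec q N)"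
  shows "0 \<le> (-1) ^ R * ((\<Sum>r\<le>R. (-1) ^ r * real p ^ (r choose 2) *
       (\<Sum>F\<in>epis N. \<Sum>L\<in>kers N F r. measure_pmf.prob D {y. Q y \<subseteq> L}))
     - real (card (auto G)) * measure_pmf.prob D {y. modvec q N Mod Q y \<cong> G})"
proof -
  interpret V: comm_group "modvec q N" by (rule comm_group_modvec)
  let ?V = "modvec q N"
  let ?f = "\<lambda>y. (-1) ^ R * ((\<Sum>r\<le>R. (-1) ^ r * real p ^ (r choose 2) *
       (\<Sum>F\<in>epis N. \<Sum>L\<in>kers N F r. indicat_real {y. Q y \<subseteq> L} y))
     - real (card (auto G)) * indicat_real {y. ?V Mod Q y \<cong> G} y)"
  have "0 \<le> ?f y" for y
  proof -
    have aut: "real (card (auto G)) * indicat_real {y. ?V Mod Q y \<cong> G} y = (\<Sum>F\<in>epis N. of_bool (Q y = word_ker q N G F))"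
    proof -
      have "real (card (auto G)) * indicat_real {y. ?V Mod Q y \<cong> G} y = real (card {F\<in>epis N. word_ker q N G F = Q y})"
        using card_generating_with_kernel[OF q2 G G_exponent Q[of y]] by (auto simp: indicator_def)
      also have "\<dots> = (\<Sum>F\<in>epis N. of_bool (Q y = word_ker q N G F))"
        unfolding sum_of_bool_card[OF finite_epis] by (simp only: eq_commute)
      finally show ?thesis .
    qed
    have cnt: "(\<Sum>L\<in>kers N F r. indicat_real {y. Q y \<subseteq> L} y) = real (card (index_subgroups ?V p (Q y) (word_ker q N G F) r))" for F r
    proof -
      have "index_subgroups ?V p (Q y) (word_ker q N G F) r = {L\<in>kers N F r. Q y \<subseteq> L}"
        using subgroup.one_closed[of _ ?V] unfolding index_subgroups_def by blast
      then show ?thesis using finite_kers by (simp add: indicator_def sum.If_cases Int_def)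
    qed
    have "?f y = (\<Sum>F\<in>epis N. (-1) ^ R * ((\<Sum>r\<le>R. (-1) ^ r * real p ^ (r choose 2) *
        real (card (index_subgroups ?V p (Q y) (word_ker q N G F) r))) - of_bool (Q y = word_ker q N G F)))"
      unfolding aut cnt by (subst sum_distrib_left[symmetric], subst sum_subtractf, subst sum.swap) (simp add: sum_distrib_left)
    also have "\<dots> \<ge> 0"
    proof (rule sum_nonneg)
      fix F assume F: "F \<in> epis N"
      have "order ?V = p ^ (k * N)" using order_modvec[OF q2, of N] q by (simp add: power_mult)
      then show "0 \<le> (-1) ^ R * ((\<Sum>r\<le>R. (-1) ^ r * real p ^ (r choose 2) *
        real (card (index_subgroups ?V p (Q y) (word_ker q N G F) r))) - of_bool (Q y = word_ker q N G F))"
        by (intro V.bonferroni_subgroup[OF finite_carrier_modvec[OF q2] _ prime Q card_word_ker(1)[OF q2 G(1) G_exponent F]])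
    qed
    finally show ?thesis .
  qed
  then have "0 \<le> measure_pmf.expectation D ?f" by (intro Bochner_Integration.integral_nonneg) auto
  also have "measure_pmf.expectation D ?f = (-1) ^ R * ((\<Sum>r\<le>R. (-1) ^ r * real p ^ (r choose 2) *
       (\<Sum>F\<in>epis N. \<Sum>L\<in>kers N F r. measure_pmf.prob D {y. Q y \<subseteq> L}))
     - real (card (auto G)) * measure_pmf.prob D {y. ?V Mod Q y \<cong> G})"
  proof -
    have int: "integrable (measure_pmf D) f" for f :: "'y \<Rightarrow> real" by (rule integrable_measure_pmf_finite[OF D])
    show ?thesis
      by (simp only: Bochner_Integration.integral_sum[OF int] integral_mult_right_zero Bochner_Integration.integral_diff[OF int int])
         simp
  qed
  finally show ?thesis .
qed

lemma pairs_ratio_limit: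
  "(\<lambda>N. real (card (epis N)) * qbinom p N r * (1 / (real (card (carrier G)) * real p ^ r)) ^ N)
     \<longlonglongrightarrow> 1 / (real p ^ (r choose 2) * qfac p r)"
proof -
  have "(\<lambda>N. (real (card (epis N)) / real (card (carrier G)) ^ N) * (qbinom p N r / real p ^ (r * N)))
     \<longlonglongrightarrow> 1 * (1 / (real p ^ (r choose 2) * qfac p r))"
    by (intro tendsto_mult card_generating_tuples_ratio[OF G] qbinom_limit[OF p2])
  then show ?thesis by (simp add: power_mult_distrib power_divide power_mult)
qed

definition euler :: real where "euler = (\<Prod>j. 1 - 1 / real p ^ Suc j)"

text \<open>The Bonferroni inequalities for an even and an odd number of terms enclose the probability. Once
both truncations of Euler's series are close to the limit, only the finitely many terms up to \<open>R\<close>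
need to be close to their values for exactly uniform columns. The distribution \<open>D\<close> and the random
subgroup \<open>Q\<close> are arbitrary.\<close>

lemma cokernel_prob_limit:
  assumes e: "e > 0"
  obtains R \<delta> N0 where "\<delta> > 0" "\<And>N (D :: 'y pmf) Q. N \<ge> N0 \<Longrightarrow> finite (set_pmf D) \<Longrightarrow> (\<And>y. subgroup (Q y) (modvec q N)) \<Longrightarrow>
      (\<And>r. r \<le> R \<Longrightarrow> (\<Sum>H\<in>table_groups q (card (carrier G) * p ^ r). \<Sum>F\<in>generating_tuples H {..<N}.
          \<bar>measure_pmf.prob D {y. Q y \<subseteq> word_ker q N H F} - (1 / real (card (carrier G) * p ^ r)) ^ N\<bar>) \<le> \<delta>) \<Longrightarrow>
      \<bar>real (card (auto G)) * measure_pmf.prob D {y. modvec q N Mod Q y \<cong> G} - euler\<bar> \<le> e"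
proof -
  \<comment> \<open>The truncations of the series of Euler.\<close>
  define S where "S R = (\<Sum>r\<le>R. (-1) ^ r / qfac p r)" for R
  have "S \<longlonglongrightarrow> euler"
  proof -
    have "(\<lambda>R. \<Sum>r<Suc R. (-1) ^ r / qfac p r) \<longlonglongrightarrow> euler"
      using euler_series[OF p2] unfolding sums_def euler_def by (rule LIMSEQ_Suc)
    then show ?thesis by (simp add: S_def[abs_def] lessThan_Suc_atMost)
  qed
  then obtain R0 where R0: "\<And>R. R \<ge> R0 \<Longrightarrow> \<bar>S R - euler\<bar> < e / 2"
    using LIMSEQ_D[of S euler "e / 2"] e by (auto simp: real_norm_def)
  \<comment> \<open>An odd number, preceded by the even number \<open>2 * R0\<close>.\<close>
  define R where "R = 2 * R0 + 1"
  define g where "g = card (carrier G)"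
  \<comment> \<open>The factor by which an error \<open>\<delta>\<close> in every term is amplified in the truncated series.\<close>
  define M where "M = (\<Sum>r\<le>R. real p ^ (r choose 2) * (real g ^ (g * p ^ r) + 1))"
  have M: "M > 0"
  proof -
    have "0 < real p ^ (r choose 2) * (real g ^ (g * p ^ r) + 1)" for r
      using p2 by (intro mult_pos_pos add_nonneg_pos) auto
    then show ?thesis unfolding M_def by (intro sum_pos) auto
  qed
  define \<delta> where "\<delta> = e / (2 * M)"
  have \<delta>: "\<delta> > 0" using e M by (simp add: \<delta>_def)
  have "\<forall>\<^sub>F N in sequentially. \<forall>r\<in>{..R}. \<bar>real (card (epis N)) * qbinom p N r * (1 / (real g * real p ^ r)) ^ N - 1 / (real p ^ (r choose 2) * qfac p r)\<bar> < \<delta>"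
  proof (rule eventually_ball_finite)
    show "\<forall>r\<in>{..R}. \<forall>\<^sub>F N in sequentially. \<bar>real (card (epis N)) * qbinom p N r * (1 / (real g * real p ^ r)) ^ N - 1 / (real p ^ (r choose 2) * qfac p r)\<bar> < \<delta>"
      using pairs_ratio_limit \<delta> unfolding g_def tendsto_iff dist_real_def by blast
  qed simp
  then obtain N0 where N0: "\<And>N r. N \<ge> N0 \<Longrightarrow> r \<le> R \<Longrightarrow>
      \<bar>real (card (epis N)) * qbinom p N r * (1 / (real g * real p ^ r)) ^ N - 1 / (real p ^ (r choose 2) * qfac p r)\<bar> < \<delta>"
    unfolding eventually_sequentially by auto
  show thesis
  proof (rule that[OF \<delta>, of N0 R])
    fix N and D :: "'y pmf" and Q
    assume N: "N \<ge> N0" and D: "finite (set_pmf D)" and Q: "\<And>y. subgroup (Q y) (modvec q N)"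
      and X: "\<And>r. r \<le> R \<Longrightarrow> (\<Sum>H\<in>table_groups q (card (carrier G) * p ^ r). \<Sum>F\<in>generating_tuples H {..<N}.
          \<bar>measure_pmf.prob D {y. Q y \<subseteq> word_ker q N H F} - (1 / real (card (carrier G) * p ^ r)) ^ N\<bar>) \<le> \<delta>"
    define ET where "ET r = (\<Sum>F\<in>epis N. \<Sum>L\<in>kers N F r. measure_pmf.prob D {y. Q y \<subseteq> L})" for r
    define T where "T R' = (\<Sum>r\<le>R'. (-1) ^ r * real p ^ (r choose 2) * ET r)" for R'
    define P where "P = real (card (auto G)) * measure_pmf.prob D {y. modvec q N Mod Q y \<cong> G}"
    have ET: "real p ^ (r choose 2) * \<bar>ET r - 1 / (real p ^ (r choose 2) * qfac p r)\<bar> \<le> real p ^ (r choose 2) * (real g ^ (g * p ^ r) + 1) * \<delta>" if r: "r \<le> R" for r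
    proof -
      define z where "z = (1 / real (g * p ^ r)) ^ N"
      have "(\<Sum>F\<in>epis N. \<Sum>L\<in>kers N F r. z) = real (card (epis N)) * qbinom p N r * z"
        using card_index_subgroups_word_ker[OF prime k q q2 G(1) G_torsion] by simp
      then have "\<bar>ET r - real (card (epis N)) * qbinom p N r * z\<bar> = \<bar>\<Sum>F\<in>epis N. \<Sum>L\<in>kers N F r. measure_pmf.prob D {y. Q y \<subseteq> L} - z\<bar>"
        by (simp add: ET_def sum_subtractf)
      also have "\<dots> \<le> (\<Sum>F\<in>epis N. \<Sum>L\<in>kers N F r. \<bar>measure_pmf.prob D {y. Q y \<subseteq> L} - z\<bar>)"
        by (intro order_trans[OF sum_abs] sum_mono sum_abs)
      also have "\<dots> \<le> real (g ^ (g * p ^ r)) * (\<Sum>H\<in>table_groups q (g * p ^ r). \<Sum>F\<in>generating_tuples H {..<N}.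
          \<bar>measure_pmf.prob D {y. Q y \<subseteq> word_ker q N H F} - z\<bar>)"
        unfolding g_def by (rule pair_sum_le_table_sum[OF q2 G G_exponent refl])
      also have "\<dots> \<le> real (g ^ (g * p ^ r)) * \<delta>"
        using X[OF r] unfolding z_def g_def by (intro mult_left_mono) auto
      finally have 1: "\<bar>ET r - real (card (epis N)) * qbinom p N r * z\<bar> \<le> real g ^ (g * p ^ r) * \<delta>" by simp
      have 2: "\<bar>real (card (epis N)) * qbinom p N r * z - 1 / (real p ^ (r choose 2) * qfac p r)\<bar> \<le> \<delta>"
        using N0[OF N r] by (simp add: z_def)
      have "\<bar>ET r - 1 / (real p ^ (r choose 2) * qfac p r)\<bar> \<le> (real g ^ (g * p ^ r) + 1) * \<delta>"
        using 1 2 unfolding distrib_right by linarith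
      then show ?thesis by (simp add: mult.assoc mult_left_mono)
    qed
    have TS: "\<bar>T R' - S R'\<bar> \<le> e / 2" if R': "R' \<le> R" for R'
    proof -
      have "T R' - S R' = (\<Sum>r\<le>R'. (-1) ^ r * (real p ^ (r choose 2) * (ET r - 1 / (real p ^ (r choose 2) * qfac p r))))"
        unfolding T_def S_def sum_subtractf[symmetric]
        by (rule sum.cong[OF refl]) (use p2 in \<open>simp add: algebra_simps\<close>)
      also have "\<bar>\<dots>\<bar> \<le> (\<Sum>r\<le>R'. real p ^ (r choose 2) * \<bar>ET r - 1 / (real p ^ (r choose 2) * qfac p r)\<bar>)"
        by (rule order_trans[OF sum_abs]) (simp add: abs_mult power_abs)
      also have "\<dots> \<le> (\<Sum>r\<le>R'. real p ^ (r choose 2) * (real g ^ (g * p ^ r) + 1) * \<delta>)"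
        using ET R' by (intro sum_mono) auto
      also have "\<dots> \<le> (\<Sum>r\<le>R. real p ^ (r choose 2) * (real g ^ (g * p ^ r) + 1) * \<delta>)"
        using R' \<delta> by (intro sum_mono2) (auto intro!: mult_nonneg_nonneg add_nonneg_nonneg)
      also have "\<dots> = M * \<delta>" by (simp add: M_def sum_distrib_right)
      also have "\<dots> = e / 2" using M by (simp add: \<delta>_def)
      finally show ?thesis .
    qed
    have bon: "0 \<le> (-1) ^ R' * (T R' - P)" for R'
      unfolding T_def ET_def P_def by (rule bonferroni_expectation[OF D Q])
    have "0 \<le> T (2 * R0) - P" using bon[of "2 * R0"] by simp
    moreover have "\<bar>T (2 * R0) - S (2 * R0)\<bar> \<le> e / 2" by (rule TS) (simp add: R_def)
    moreover have "\<bar>S (2 * R0) - euler\<bar> < e / 2" by (rule R0) simp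
    moreover have "T R - P \<le> 0" using bon[of R] by (simp add: R_def)
    moreover have "\<bar>T R - S R\<bar> \<le> e / 2" by (rule TS) simp
    moreover have "\<bar>S R - euler\<bar> < e / 2" by (rule R0) (simp add: R_def)
    ultimately show "\<bar>real (card (auto G)) * measure_pmf.prob D {y. modvec q N Mod Q y \<cong> G} - euler\<bar> \<le> e"
      unfolding P_def[symmetric] by linarith
  qed
qed

end

section \<open>Independent families of coordinates\<close>

lemma prob_Pi_pmf_blocks:
  assumes "finite S" "\<And>s. s \<in> S \<Longrightarrow> finite (C s)" "disjoint_family_on C S"
    and "\<And>s x y. s \<in> S \<Longrightarrow> (\<And>e. e \<in> C s \<Longrightarrow> x e = y e) \<Longrightarrow> R s x \<longleftrightarrow> R s y"
  shows "measure_pmf.prob (Pi_pmf (\<Union>s\<in>S. C s) d \<mu>) {y. \<forall>s\<in>S. R s y} = (\<Prod>s\<in>S. measure_pmf.prob (Pi_pmf (C s) d \<mu>) {y. R s y})"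
  using assms
proof (induction S)
  case empty
  then show ?case by simp
next
  case (insert a S)
  let ?U = "\<Union>s\<in>S. C s"
  have dis: "C a \<inter> ?U = {}" using disjoint_family_onD[OF insert.prems(2)] insert.hyps(2) by fastforce
  have dis': "C a \<inter> C s = {}" if "s \<in> S" for s using dis that by auto
  have fin: "finite (C a)" "finite ?U" using insert.hyps(1) insert.prems(1) by auto
  have Ra: "R a (\<lambda>e. if e \<in> C a then f e else g e) \<longleftrightarrow> R a f" for f g
    by (rule insert.prems(3)) auto
  have Rs: "R s (\<lambda>e. if e \<in> C a then f e else g e) \<longleftrightarrow> R s g" if "s \<in> S" for f g s
  proof (rule insert.prems(3))
    show "s \<in> insert a S" using that by (rule insertI2)
    show "(if e \<in> C a then f e else g e) = g e" if "e \<in> C s" for e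
      using dis'[OF \<open>s \<in> S\<close>] that by (metis disjoint_iff)
  qed
  have "measure_pmf.prob (Pi_pmf (\<Union>s\<in>insert a S. C s) d \<mu>) {y. \<forall>s\<in>insert a S. R s y}
     = measure_pmf.prob (pair_pmf (Pi_pmf (C a) d \<mu>) (Pi_pmf ?U d \<mu>)) {z. R a (fst z) \<and> (\<forall>s\<in>S. R s (snd z))}"
  proof -
    let ?g = "\<lambda>z. \<lambda>e. if e \<in> C a then fst z e else snd z e"
    have R1: "R a (?g z) \<longleftrightarrow> R a (fst z)" for z using Ra[of "fst z" "snd z"] .
    have R2: "R s (?g z) \<longleftrightarrow> R s (snd z)" if "s \<in> S" for s z using Rs[OF that, of "fst z" "snd z"] .
    have "(\<forall>s\<in>insert a S. R s (?g z)) \<longleftrightarrow> R a (fst z) \<and> (\<forall>s\<in>S. R s (snd z))" for z using R1[of z] R2[of _ z] by blast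
    then have "?g -` {y. \<forall>s\<in>insert a S. R s y} = {z. R a (fst z) \<and> (\<forall>s\<in>S. R s (snd z))}" by (simp only: vimage_def mem_Collect_eq)
    moreover have "Pi_pmf (\<Union>s\<in>insert a S. C s) d \<mu> = map_pmf ?g (pair_pmf (Pi_pmf (C a) d \<mu>) (Pi_pmf ?U d \<mu>))"
      using Pi_pmf_union[OF fin dis, of d \<mu>] by (simp only: UN_insert case_prod_unfold)
    ultimately show ?thesis by (simp only: measure_map_pmf)
  qed
  also have "\<dots> = (\<integral>f. measure_pmf.prob (Pi_pmf ?U d \<mu>) {g. R a f \<and> (\<forall>s\<in>S. R s g)} \<partial>measure_pmf (Pi_pmf (C a) d \<mu>))"
    by (rule prob_pair_pmf)
  also have "\<dots> = (\<integral>f. indicat_real {f. R a f} f * measure_pmf.prob (Pi_pmf ?U d \<mu>) {g. \<forall>s\<in>S. R s g} \<partial>measure_pmf (Pi_pmf (C a) d \<mu>))"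
    by (intro Bochner_Integration.integral_cong) (auto simp: indicator_def)
  also have "\<dots> = measure_pmf.prob (Pi_pmf (C a) d \<mu>) {f. R a f} * measure_pmf.prob (Pi_pmf ?U d \<mu>) {g. \<forall>s\<in>S. R s g}"
    by simp
  also have "measure_pmf.prob (Pi_pmf ?U d \<mu>) {g. \<forall>s\<in>S. R s g} = (\<Prod>s\<in>S. measure_pmf.prob (Pi_pmf (C s) d \<mu>) {y. R s y})"
  proof (rule insert.IH)
    show "disjoint_family_on C S" using insert.prems(2) by (rule disjoint_family_on_mono[OF subset_insertI])
    show "R s x \<longleftrightarrow> R s y" if "s \<in> S" "\<And>e. e \<in> C s \<Longrightarrow> x e = y e" for s x y
      by (rule insert.prems(3)) (use that in auto)
  qed (use insert.prems(1) in simp)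
  finally show ?case using insert.hyps by simp
qed

lemma Pi_pmf_reindex:
  fixes h :: "'a \<Rightarrow> 'b" and d :: 'c
  assumes "finite A" "inj_on h A"
  shows "map_pmf (\<lambda>y r. if r \<in> A then y (h r) else d) (Pi_pmf (h ` A) d \<mu>) = Pi_pmf A d (\<lambda>r. \<mu> (h r))"
  using assms
proof (induction A)
  case empty
  then show ?case by simp
next
  case (insert a A)
  have ha: "h a \<notin> h ` A" using insert.hyps(2) insert.prems by (auto simp only: inj_on_insert Diff_insert_absorb)
  let ?T = "\<lambda>B (y :: 'b \<Rightarrow> 'c) r. if r \<in> B then y (h r) else d"
  let ?P = "pair_pmf (\<mu> (h a)) (Pi_pmf (h ` A) d \<mu>)"
  have hr: "h r \<noteq> h a" if "r \<in> A" for r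
  proof
    assume "h r = h a"
    then have "h a \<in> h ` A" using imageI[OF that, of h] by (simp only:)
    then show False using ha by (simp only:)
  qed
  have e: "?T (insert a A) (f(h a := x)) = (?T A f)(a := x)" for f x
  proof (rule ext)
    fix r
    show "?T (insert a A) (f(h a := x)) r = ((?T A f)(a := x)) r"
    proof (cases "r = a")
      case False
      then show ?thesis using hr[of r] by (cases "r \<in> A") (simp_all only: fun_upd_apply insert_iff if_False if_True simp_thms)
    qed (simp only: fun_upd_apply insertI1 if_True simp_thms)
  qed
  have "Pi_pmf (h ` insert a A) d \<mu> = map_pmf (\<lambda>(x, f). f(h a := x)) ?P"
    unfolding image_insert by (rule Pi_pmf_insert[OF finite_imageI[OF insert.hyps(1)] ha])
  then have "map_pmf (?T (insert a A)) (Pi_pmf (h ` insert a A) d \<mu>)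
      = map_pmf (?T (insert a A) \<circ> (\<lambda>(x, f). f(h a := x))) ?P"
    by (simp only: pmf.map_comp)
  also have "?T (insert a A) \<circ> (\<lambda>(x, f). f(h a := x)) = (\<lambda>(x, f). f(a := x)) \<circ> (\<lambda>z. (fst z, ?T A (snd z)))"
  proof
    show "(?T (insert a A) \<circ> (\<lambda>(x, f). f(h a := x))) z = ((\<lambda>(x, f). f(a := x)) \<circ> (\<lambda>z. (fst z, ?T A (snd z)))) z" for z
      using e[of "snd z" "fst z"] by (cases z) (simp only: o_apply case_prod_conv fst_conv snd_conv)
  qed
  also have "map_pmf \<dots> ?P = map_pmf (\<lambda>(x, f). f(a := x)) (map_pmf (\<lambda>z. (fst z, ?T A (snd z))) ?P)"
    by (simp only: pmf.map_comp)
  also have "map_pmf (\<lambda>z. (fst z, ?T A (snd z))) (pair_pmf (\<mu> (h a)) (Pi_pmf (h ` A) d \<mu>))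
      = pair_pmf (\<mu> (h a)) (map_pmf (?T A) (Pi_pmf (h ` A) d \<mu>))"
    unfolding pair_map_pmf2 by (rule map_pmf_cong[OF refl]) (simp add: apsnd_def map_prod_def case_prod_unfold)
  also have "map_pmf (?T A) (Pi_pmf (h ` A) d \<mu>) = Pi_pmf A d (\<lambda>r. \<mu> (h r))"
    by (rule insert.IH[OF inj_on_subset[OF insert.prems subset_insertI]])
  also have "map_pmf (\<lambda>(x, f). f(a := x)) (pair_pmf (\<mu> (h a)) (Pi_pmf A d (\<lambda>r. \<mu> (h r)))) = Pi_pmf (insert a A) d (\<lambda>r. \<mu> (h r))"
    by (rule Pi_pmf_insert[OF insert.hyps, symmetric])
  finally show ?case .
qed

lemma prob_Pi_pmf_reindex:
  assumes "finite A" "inj_on h A" "\<And>x y. (\<And>r. r \<in> A \<Longrightarrow> x r = y r) \<Longrightarrow> Q x \<longleftrightarrow> Q y"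
  shows "measure_pmf.prob (Pi_pmf (h ` A) d \<mu>) {y. Q (\<lambda>r. y (h r))} = measure_pmf.prob (Pi_pmf A d (\<lambda>r. \<mu> (h r))) {x. Q x}"
proof -
  have "Q (\<lambda>r. if r \<in> A then y (h r) else d) \<longleftrightarrow> Q (\<lambda>r. y (h r))" for y by (rule assms(3)) auto
  then show ?thesis unfolding Pi_pmf_reindex[OF assms(1,2), symmetric] by (simp add: vimage_def)
qed

text \<open>The number of successes is binomially distributed, so this is Hoeffding's inequality.\<close>

lemma prob_many_successes:
  fixes \<pi> \<delta> :: real
  assumes A: "finite A" and \<pi>: "0 \<le> \<pi>" "\<pi> \<le> 1" and law: "\<And>a. a \<in> A \<Longrightarrow> measure_pmf.prob (\<mu> a) {v. P v} = \<pi>"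
    and d: "0 \<le> \<delta>"
  shows "measure_pmf.prob (Pi_pmf A d \<mu>) {y. real (card {a\<in>A. P (y a)}) \<ge> card A * \<pi> + \<delta>} \<le> (if A = {} then 1 else exp (- 2 * \<delta>\<^sup>2 / card A))"
proof (cases "A = {}")
  case False
  then have cA: "card A > 0" using A by (simp add: card_gt_0_iff)
  have b: "map_pmf P (\<mu> a) = bernoulli_pmf \<pi>" if "a \<in> A" for a
  proof (rule pmf_eqI)
    have T: "pmf (map_pmf P (\<mu> a)) True = \<pi>" using law[OF that] by (simp add: pmf_map vimage_def)
    have F: "pmf (map_pmf P (\<mu> a)) False = 1 - pmf (map_pmf P (\<mu> a)) True"
      using sum_pmf_eq_1[OF finite subset_UNIV, of "map_pmf P (\<mu> a)"] by (simp only: UNIV_bool) simp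
    show "pmf (map_pmf P (\<mu> a)) i = pmf (bernoulli_pmf \<pi>) i" for i using T F \<pi> by (cases i) auto
  qed
  have "map_pmf (\<lambda>y a. P (y a)) (Pi_pmf A d \<mu>) = Pi_pmf A (P d) (\<lambda>a. map_pmf P (\<mu> a))"
    using Pi_pmf_map[OF A refl, of P d \<mu>] by (simp add: o_def)
  also have "\<dots> = Pi_pmf A (P d) (\<lambda>_. bernoulli_pmf \<pi>)" using b by (intro Pi_pmf_cong) auto
  finally have m: "map_pmf (\<lambda>y a. P (y a)) (Pi_pmf A d \<mu>) = Pi_pmf A (P d) (\<lambda>_. bernoulli_pmf \<pi>)" .
  have "map_pmf (\<lambda>y. card {a\<in>A. P (y a)}) (Pi_pmf A d \<mu>) = map_pmf (\<lambda>f. card {a\<in>A. f a}) (map_pmf (\<lambda>y a. P (y a)) (Pi_pmf A d \<mu>))"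
    by (simp add: pmf.map_comp o_def)
  also have "\<dots> = binomial_pmf (card A) \<pi>"
    unfolding m using binomial_pmf_altdef'[OF A refl, of \<pi> "P d"] \<pi> by simp
  finally have bin: "binomial_pmf (card A) \<pi> = map_pmf (\<lambda>y. card {a\<in>A. P (y a)}) (Pi_pmf A d \<mu>)" ..
  interpret binomial_distribution "card A" \<pi> by unfold_locales (use \<pi> in auto)
  have "measure_pmf.prob (binomial_pmf (card A) \<pi>) {x. real x \<ge> card A * \<pi> + \<delta>} \<le> exp (- 2 * \<delta>\<^sup>2 / card A)"
    by (rule prob_ge[OF cA d])
  then show ?thesis using False unfolding bin by (simp add: vimage_def)
qed simp

section \<open>Residues of the block matrix\<close>

definition opp_block :: "nat \<Rightarrow> nat \<Rightarrow> nat \<Rightarrow> nat set" where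
  "opp_block n1 n2 s = (if s < n1 then {n1..<n1 + n2} else {..<n1})"

definition off_entry :: "nat \<Rightarrow> nat \<Rightarrow> nat \<Rightarrow> entry" where
  "off_entry n1 s r = (if s < n1 then EntryB s (r - n1) else EntryA r (s - n1))"

definition diag_entry :: "nat \<Rightarrow> nat \<Rightarrow> entry" where
  "diag_entry n1 s = (if s < n1 then EntryC s else EntryD (s - n1))"

definition off_entries :: "nat \<Rightarrow> nat \<Rightarrow> entry set" where
  "off_entries n1 n2 = (\<Union>s\<in>{..<n1 + n2}. off_entry n1 s ` opp_block n1 n2 s)"

definition diag_entries :: "nat \<Rightarrow> nat \<Rightarrow> entry set" where
  "diag_entries n1 n2 = diag_entry n1 ` {..<n1 + n2}"

definition res_col :: "nat \<Rightarrow> nat \<Rightarrow> nat \<Rightarrow> (entry \<Rightarrow> int) \<Rightarrow> nat \<Rightarrow> nat \<Rightarrow> int" where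
  "res_col q n1 n2 y s = (\<lambda>r\<in>{..<n1 + n2}.
     (if r = s then y (diag_entry n1 s) else if r \<in> opp_block n1 n2 s then y (off_entry n1 s r) else 0) mod int q)"

text \<open>The image modulo \<open>q\<close> of the block matrix whose entries have the residues \<open>y\<close>.\<close>

definition res_image :: "nat \<Rightarrow> nat \<Rightarrow> nat \<Rightarrow> (entry \<Rightarrow> int) \<Rightarrow> (nat \<Rightarrow> int) set" where
  "res_image q n1 n2 y = generate (modvec q (n1 + n2)) (res_col q n1 n2 y ` {..<n1 + n2})"

lemma entry_set_split:
  "entry_set n1 n2 = off_entries n1 n2 \<union> diag_entries n1 n2" "off_entries n1 n2 \<inter> diag_entries n1 n2 = {}"
  "finite (off_entries n1 n2)" "finite (diag_entries n1 n2)"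
proof -
  have A: "EntryA i j \<in> off_entries n1 n2 \<longleftrightarrow> i < n1 \<and> j < n2" for i j
  proof
    assume "i < n1 \<and> j < n2"
    then have "EntryA i j = off_entry n1 (n1 + j) i" "i \<in> opp_block n1 n2 (n1 + j)" "n1 + j \<in> {..<n1 + n2}"
      by (auto simp: off_entry_def opp_block_def)
    then show "EntryA i j \<in> off_entries n1 n2" unfolding off_entries_def by blast
  qed (auto simp: off_entries_def off_entry_def opp_block_def split: if_splits)
  have B: "EntryB i j \<in> off_entries n1 n2 \<longleftrightarrow> i < n1 \<and> j < n2" for i j
  proof
    assume "i < n1 \<and> j < n2"
    then have "EntryB i j = off_entry n1 i (n1 + j)" "n1 + j \<in> opp_block n1 n2 i" "i \<in> {..<n1 + n2}"
      by (auto simp: off_entry_def opp_block_def)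
    then show "EntryB i j \<in> off_entries n1 n2" unfolding off_entries_def by blast
  qed (auto simp: off_entries_def off_entry_def opp_block_def split: if_splits)
  have CD: "EntryC i \<notin> off_entries n1 n2" "EntryD i \<notin> off_entries n1 n2" for i
    by (auto simp: off_entries_def off_entry_def split: if_splits)
  have C: "EntryC i \<in> diag_entries n1 n2 \<longleftrightarrow> i < n1" for i
  proof
    assume "i < n1"
    then have "EntryC i = diag_entry n1 i" "i \<in> {..<n1 + n2}" by (auto simp: diag_entry_def)
    then show "EntryC i \<in> diag_entries n1 n2" unfolding diag_entries_def by blast
  qed (auto simp: diag_entries_def diag_entry_def split: if_splits)
  have D: "EntryD j \<in> diag_entries n1 n2 \<longleftrightarrow> j < n2" for j
  proof
    assume "j < n2"
    then have "EntryD j = diag_entry n1 (n1 + j)" "n1 + j \<in> {..<n1 + n2}" by (auto simp: diag_entry_def)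
    then show "EntryD j \<in> diag_entries n1 n2" unfolding diag_entries_def by blast
  qed (auto simp: diag_entries_def diag_entry_def split: if_splits)
  have AB: "EntryA i j \<notin> diag_entries n1 n2" "EntryB i j \<notin> diag_entries n1 n2" for i j
    by (auto simp: diag_entries_def diag_entry_def split: if_splits)
  have E: "e \<in> entry_set n1 n2 \<longleftrightarrow> e \<in> off_entries n1 n2 \<or> e \<in> diag_entries n1 n2" for e
    by (cases e) (auto simp: entry_set_def A B C D AB CD)
  then show "entry_set n1 n2 = off_entries n1 n2 \<union> diag_entries n1 n2" by blast
  have "\<not> (e \<in> off_entries n1 n2 \<and> e \<in> diag_entries n1 n2)" for e
    by (cases e) (auto simp: A B C D AB CD)
  then show "off_entries n1 n2 \<inter> diag_entries n1 n2 = {}" by blast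
  show "finite (off_entries n1 n2)" by (auto simp: off_entries_def opp_block_def)
  show "finite (diag_entries n1 n2)" by (auto simp: diag_entries_def)
qed

lemma opp_block_props:
  "finite (opp_block n1 n2 s)" "s \<notin> opp_block n1 n2 s" "s < n1 + n2 \<Longrightarrow> opp_block n1 n2 s \<subseteq> {..<n1 + n2}"
  by (auto simp: opp_block_def)

lemma off_entry_eqD:
  assumes "r \<in> opp_block n1 n2 s" "r' \<in> opp_block n1 n2 s'" "off_entry n1 s r = off_entry n1 s' r'"
  shows "s = s' \<and> r = r'"
proof (cases "s < n1"; cases "s' < n1")
  assume "s < n1" "s' < n1"
  then show ?thesis using assms by (auto simp: off_entry_def opp_block_def)
next
  assume "\<not> s < n1" "\<not> s' < n1"
  then show ?thesis using assms by (auto simp: off_entry_def opp_block_def)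
qed (use assms in \<open>simp_all add: off_entry_def\<close>)

lemma off_entry_inj: "inj_on (off_entry n1 s) (opp_block n1 n2 s)"
  using off_entry_eqD by (intro inj_onI) blast

lemma off_entry_disjoint: "disjoint_family_on (\<lambda>s. off_entry n1 s ` opp_block n1 n2 s) {..<n1 + n2}"
  unfolding disjoint_family_on_def using off_entry_eqD[of _ n1 n2] by blast

lemma res_col_closed: "q \<ge> 2 \<Longrightarrow> res_col q n1 n2 y s \<in> carrier (modvec q (n1 + n2))"
  unfolding res_col_def carrier_modvec restrict_PiE_iff by auto

lemma res_image_subgroup: "q \<ge> 2 \<Longrightarrow> subgroup (res_image q n1 n2 y) (modvec q (n1 + n2))"
proof -
  assume q: "q \<ge> 2"
  interpret V: comm_group "modvec q (n1 + n2)" by (rule comm_group_modvec)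
  show ?thesis unfolding res_image_def using res_col_closed[OF q] by (intro V.generate_is_subgroup) auto
qed

lemma word_res_col:
  assumes H: "comm_group H" "\<And>x. x \<in> carrier H \<Longrightarrow> x [^]\<^bsub>H\<^esub> q = \<one>\<^bsub>H\<^esub>"
    and F: "F \<in> {..<n1 + n2} \<rightarrow> carrier H" and s: "s < n1 + n2"
  shows "word H {..<n1 + n2} F (res_col q n1 n2 y s) =
    word H (opp_block n1 n2 s) F (\<lambda>r. y (off_entry n1 s r)) \<otimes>\<^bsub>H\<^esub> F s [^]\<^bsub>H\<^esub> y (diag_entry n1 s)"
proof -
  interpret H: comm_group H by fact
  let ?O = "opp_block n1 n2 s" and ?N = "{..<n1 + n2}"
  define x where "x r = (if r = s then y (diag_entry n1 s) else if r \<in> ?O then y (off_entry n1 s r) else 0)" for r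
  define Rest where "Rest = ?N - insert s ?O"
  have Fr: "F r \<in> carrier H" if "r \<in> ?N" for r using F that by (rule funcset_mem)
  have O: "?O \<subseteq> ?N" "finite ?O" "s \<notin> ?O" using opp_block_props s by auto
  have split: "?N = ?O \<union> insert s Rest" "?O \<inter> insert s Rest = {}" "finite Rest" "s \<notin> Rest"
    using O s by (auto simp: Rest_def)
  have "word H ?N F (res_col q n1 n2 y s) = word H ?N F x"
    unfolding word_def
  proof (rule H.finprod_cong')
    fix r assume r: "r \<in> ?N"
    have "F r [^]\<^bsub>H\<^esub> (x r mod int q) = F r [^]\<^bsub>H\<^esub> x r" by (rule H.int_pow_mod[OF Fr[OF r] H(2)[OF Fr[OF r]]])
    then show "F r [^]\<^bsub>H\<^esub> res_col q n1 n2 y s r = F r [^]\<^bsub>H\<^esub> x r" using r by (simp add: res_col_def x_def)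
  qed (use Fr in auto)
  also have "\<dots> = word H (?O \<union> insert s Rest) F x" using split(1) by simp
  also have "\<dots> = word H ?O F x \<otimes>\<^bsub>H\<^esub> word H (insert s Rest) F x"
    using split F O s by (intro H.word_Un) auto
  also have "word H (insert s Rest) F x = F s [^]\<^bsub>H\<^esub> x s \<otimes>\<^bsub>H\<^esub> word H Rest F x"
    using split Fr s by (intro H.word_insert) (auto simp: Rest_def)
  also have "word H Rest F x = \<one>\<^bsub>H\<^esub>"
    unfolding word_def by (rule H.finprod_one_eqI) (auto simp: Rest_def x_def)
  also have "word H ?O F x = word H ?O F (\<lambda>r. y (off_entry n1 s r))"
    using O Fr by (intro H.word_cong) (auto simp: x_def)
  also have "x s = y (diag_entry n1 s)" by (simp add: x_def)
  finally show ?thesis using Fr s by simp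
qed

lemma res_image_le_word_ker:
  assumes q: "q \<ge> 2" and H: "comm_group H" "\<And>x. x \<in> carrier H \<Longrightarrow> x [^]\<^bsub>H\<^esub> q = \<one>\<^bsub>H\<^esub>"
    and F: "F \<in> generating_tuples H {..<n1 + n2}"
  shows "res_image q n1 n2 y \<subseteq> word_ker q (n1 + n2) H F \<longleftrightarrow>
    (\<forall>s\<in>{..<n1 + n2}. word H (opp_block n1 n2 s) F (\<lambda>r. y (off_entry n1 s r)) \<otimes>\<^bsub>H\<^esub> F s [^]\<^bsub>H\<^esub> y (diag_entry n1 s) = \<one>\<^bsub>H\<^esub>)"
proof -
  interpret V: comm_group "modvec q (n1 + n2)" by (rule comm_group_modvec)
  have Fc: "F \<in> {..<n1 + n2} \<rightarrow> carrier H" using F by (auto simp: generating_tuples_def)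
  have K: "subgroup (word_ker q (n1 + n2) H F) (modvec q (n1 + n2))" by (rule card_word_ker(1)[OF q H F])
  have "res_image q n1 n2 y \<subseteq> word_ker q (n1 + n2) H F \<longleftrightarrow> res_col q n1 n2 y ` {..<n1 + n2} \<subseteq> word_ker q (n1 + n2) H F"
  proof
    assume "res_image q n1 n2 y \<subseteq> word_ker q (n1 + n2) H F"
    then show "res_col q n1 n2 y ` {..<n1 + n2} \<subseteq> word_ker q (n1 + n2) H F"
      unfolding res_image_def by (blast intro: generate.incl)
  next
    assume "res_col q n1 n2 y ` {..<n1 + n2} \<subseteq> word_ker q (n1 + n2) H F"
    then show "res_image q n1 n2 y \<subseteq> word_ker q (n1 + n2) H F"
      unfolding res_image_def by (rule V.generate_subgroup_incl[OF _ K])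
  qed
  also have "\<dots> \<longleftrightarrow> (\<forall>s\<in>{..<n1 + n2}. word H {..<n1 + n2} F (res_col q n1 n2 y s) = \<one>\<^bsub>H\<^esub>)"
    using res_col_closed[OF q] by (auto simp: word_ker_def)
  also have "\<dots> \<longleftrightarrow> (\<forall>s\<in>{..<n1 + n2}. word H (opp_block n1 n2 s) F (\<lambda>r. y (off_entry n1 s r)) \<otimes>\<^bsub>H\<^esub> F s [^]\<^bsub>H\<^esub> y (diag_entry n1 s) = \<one>\<^bsub>H\<^esub>)"
    using word_res_col[OF H Fc, of _ y] by (intro ball_cong refl) simp
  finally show ?thesis .
qed

text \<open>The columns involve disjoint families of entries, so the event is an intersection of independent
column events, each of which prescribes the value of a word.\<close>

lemma prob_res_image_le_word_ker:
  fixes law :: "entry \<Rightarrow> int pmf" and cd :: "entry \<Rightarrow> int"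
  assumes q: "q \<ge> 2" and H: "comm_group H" "\<And>x. x \<in> carrier H \<Longrightarrow> x [^]\<^bsub>H\<^esub> q = \<one>\<^bsub>H\<^esub>"
    and F: "F \<in> generating_tuples H {..<n1 + n2}"
  shows "measure_pmf.prob (Pi_pmf (off_entries n1 n2) 0 law)
      {y. res_image q n1 n2 (\<lambda>e. if e \<in> off_entries n1 n2 then y e else cd e) \<subseteq> word_ker q (n1 + n2) H F} =
    kernel_prob H {..<n1} {n1..<n1 + n2} (\<lambda>s. cd (diag_entry n1 s)) (\<lambda>s r. law (off_entry n1 s r)) F"
proof -
  interpret H: comm_group H by fact
  let ?O = "opp_block n1 n2"
  have Fr: "F r \<in> carrier H" if "r < n1 + n2" for r using F that by (auto simp: generating_tuples_def)
  have FO: "F \<in> ?O s \<rightarrow> carrier H" if "s < n1 + n2" for s using Fr opp_block_props(3)[OF that] by auto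
  define Rx where "Rx s x \<longleftrightarrow> word H (?O s) F x \<otimes>\<^bsub>H\<^esub> F s [^]\<^bsub>H\<^esub> cd (diag_entry n1 s) = \<one>\<^bsub>H\<^esub>" for s x
  have Rx_cong: "Rx s x \<longleftrightarrow> Rx s x'" if "s < n1 + n2" "\<And>r. r \<in> ?O s \<Longrightarrow> x r = x' r" for s x x'
    unfolding Rx_def using H.word_cong[OF FO[OF that(1)] refl, of x x'] that(2) by simp
  have off: "off_entry n1 s r \<in> off_entries n1 n2" if "s < n1 + n2" "r \<in> ?O s" for s r
    using that unfolding off_entries_def by blast
  have diag: "diag_entry n1 s \<notin> off_entries n1 n2" if "s < n1 + n2" for s
    using that entry_set_split(2)[of n1 n2] unfolding diag_entries_def by blast
  have ev: "res_image q n1 n2 (\<lambda>e. if e \<in> off_entries n1 n2 then y e else cd e) \<subseteq> word_ker q (n1 + n2) H F \<longleftrightarrow>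
      (\<forall>s\<in>{..<n1 + n2}. Rx s (\<lambda>r. y (off_entry n1 s r)))" for y
  proof -
    let ?z = "\<lambda>e. if e \<in> off_entries n1 n2 then y e else cd e"
    have "word H (?O s) F (\<lambda>r. ?z (off_entry n1 s r)) = word H (?O s) F (\<lambda>r. y (off_entry n1 s r))" if s: "s < n1 + n2" for s
      by (rule H.word_cong[OF FO[OF s]]) (use off[OF s] in auto)
    then show ?thesis unfolding Rx_def using diag res_image_le_word_ker[OF q H F, of ?z] by simp
  qed
  have "measure_pmf.prob (Pi_pmf (off_entries n1 n2) 0 law) {y. \<forall>s\<in>{..<n1 + n2}. Rx s (\<lambda>r. y (off_entry n1 s r))}
    = (\<Prod>s\<in>{..<n1 + n2}. measure_pmf.prob (Pi_pmf (off_entry n1 s ` ?O s) 0 law) {y. Rx s (\<lambda>r. y (off_entry n1 s r))})"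
    unfolding off_entries_def
  proof (rule prob_Pi_pmf_blocks[OF _ _ off_entry_disjoint])
    show "finite (off_entry n1 s ` ?O s)" for s using opp_block_props(1) by simp
    fix s and x y :: "entry \<Rightarrow> int" assume "s \<in> {..<n1 + n2}" "\<And>e. e \<in> off_entry n1 s ` ?O s \<Longrightarrow> x e = y e"
    then show "Rx s (\<lambda>r. x (off_entry n1 s r)) = Rx s (\<lambda>r. y (off_entry n1 s r))" by (intro Rx_cong) auto
  qed simp
  also have "\<dots> = (\<Prod>s\<in>{..<n1} \<union> {n1..<n1 + n2}. pmf (word_pmf H (if s \<in> {..<n1} then {n1..<n1 + n2} else {..<n1}) F (\<lambda>r. law (off_entry n1 s r)))
       (inv\<^bsub>H\<^esub> (F s [^]\<^bsub>H\<^esub> cd (diag_entry n1 s))))"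
  proof (rule prod.cong)
    show "{..<n1 + n2} = {..<n1} \<union> {n1..<n1 + n2}" by auto
    fix s assume "s \<in> {..<n1} \<union> {n1..<n1 + n2}"
    then have s: "s < n1 + n2" by auto
    have "measure_pmf.prob (Pi_pmf (off_entry n1 s ` ?O s) 0 law) {y. Rx s (\<lambda>r. y (off_entry n1 s r))}
      = measure_pmf.prob (Pi_pmf (?O s) 0 (\<lambda>r. law (off_entry n1 s r))) {x. Rx s x}"
      by (rule prob_Pi_pmf_reindex[OF opp_block_props(1) off_entry_inj Rx_cong[OF s]])
    also have "{x. Rx s x} = word H (?O s) F -` {inv\<^bsub>H\<^esub> (F s [^]\<^bsub>H\<^esub> cd (diag_entry n1 s))}"
    proof -
      have "Rx s x \<longleftrightarrow> word H (?O s) F x = inv\<^bsub>H\<^esub> (F s [^]\<^bsub>H\<^esub> cd (diag_entry n1 s))" for x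
      proof -
        have w: "word H (?O s) F x \<in> carrier H" "F s [^]\<^bsub>H\<^esub> cd (diag_entry n1 s) \<in> carrier H" using FO[OF s] Fr[OF s] by auto
        show ?thesis unfolding Rx_def using w by (metis H.inv_equality H.l_inv)
      qed
      then show ?thesis by auto
    qed
    finally show "measure_pmf.prob (Pi_pmf (off_entry n1 s ` ?O s) 0 law) {y. Rx s (\<lambda>r. y (off_entry n1 s r))} =
      pmf (word_pmf H (if s \<in> {..<n1} then {n1..<n1 + n2} else {..<n1}) F (\<lambda>r. law (off_entry n1 s r)))
       (inv\<^bsub>H\<^esub> (F s [^]\<^bsub>H\<^esub> cd (diag_entry n1 s)))"
      by (simp add: word_pmf_def pmf_map opp_block_def)
  qed
  finally show ?thesis by (simp only: ev kernel_prob_def)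
qed

section \<open>Laws of the residues of p-adic random variables\<close>

lemma residue_measurable: "(\<lambda>x. x k) \<in> measurable (padic_borel p) (count_space UNIV)"
  unfolding measurable_count_space_eq_countable[OF countableI_type[of "UNIV :: int set"]]
proof (intro conjI ballI)
  fix v :: int
  have "(\<lambda>x :: padic. x k) \<in> borel_measurable borel"
    by (intro borel_measurable_continuous_onI continuous_on_product_coordinates)
  then have "(\<lambda>x :: padic. x k) -` {v} \<inter> space borel \<in> sets borel" by (rule measurable_sets) simp
  then have "(\<lambda>x :: padic. x k) -` {v} \<in> sets borel" by simp
  then show "(\<lambda>x. x k) -` {v} \<inter> space (padic_borel p) \<in> sets (padic_borel p)"
    unfolding padic_borel_def sets_restrict_space space_restrict_space by auto
qed simp

lemma space_padic_borel: "space (padic_borel p) = carrier (padic_int p)"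
  by (simp add: padic_borel_def space_restrict_space)

lemma prob_space_countable_pmf:
  fixes Y :: "'w \<Rightarrow> 'v :: countable"
  assumes "prob_space M" "Y \<in> measurable M (count_space UNIV)"
  obtains \<mu> where "\<And>P. measure_pmf.prob \<mu> {v. P v} = measure M {\<omega> \<in> space M. P (Y \<omega>)}"
proof -
  let ?D = "distr M (count_space UNIV) Y"
  interpret M: prob_space M by fact
  interpret D: prob_space ?D by (rule M.prob_space_distr[OF assms(2)])
  have ae: "AE x in ?D. measure ?D {x} \<noteq> 0"
  proof -
    have "\<exists>S. countable S \<and> (AE x in ?D. x \<in> S)" by (intro exI[of _ UNIV]) auto
    then show ?thesis by (subst D.AE_support_countable) auto
  qed
  then have pmf: "measure_pmf (Abs_pmf ?D) = ?D"
    by (intro Abs_pmf_inverse) (auto intro: D.prob_space_axioms)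
  show thesis
  proof (rule that[of "Abs_pmf ?D"])
    fix P
    have "measure ?D {v. P v} = measure M (Y -` {v. P v} \<inter> space M)" by (rule measure_distr[OF assms(2)]) simp
    also have "Y -` {v. P v} \<inter> space M = {\<omega> \<in> space M. P (Y \<omega>)}" by auto
    finally show "measure_pmf.prob (Abs_pmf ?D) {v. P v} = measure M {\<omega> \<in> space M. P (Y \<omega>)}" unfolding pmf .
  qed
qed

text \<open>The residues take finitely many values, so an event that depends on them is a finite disjoint union
of events that fix all residues, and for these independence gives a product.\<close>

lemma joint_residue_law:
  fixes X :: "'e \<Rightarrow> 'w \<Rightarrow> padic" and law :: "'e \<Rightarrow> int pmf"
  assumes M: "prob_space M" and ind: "prob_space.indep_vars M (\<lambda>_. padic_borel p) X E"
    and E: "finite E" "E \<noteq> {}" and p: "p > 0"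
    and law: "\<And>e P. e \<in> E \<Longrightarrow> measure_pmf.prob (law e) {v. P v} = measure M {\<omega> \<in> space M. P (X e \<omega> k)}"
    and range: "\<And>e. e \<in> E \<Longrightarrow> set_pmf (law e) \<subseteq> {0..<int (p ^ k)}"
    and Q: "\<And>x y. (\<And>e. e \<in> E \<Longrightarrow> x e = y e) \<Longrightarrow> Q x \<longleftrightarrow> Q y"
  shows "measure M {\<omega> \<in> space M. Q (\<lambda>e. X e \<omega> k)} = measure_pmf.prob (Pi_pmf E 0 law) {y. Q y}"
proof -
  interpret M: prob_space M by fact
  have rv: "X e \<in> measurable M (padic_borel p)" if "e \<in> E" for e
    using ind that unfolding M.indep_vars_def by auto
  have X: "X e \<omega> \<in> carrier (padic_int p)" if "e \<in> E" "\<omega> \<in> space M" for e \<omega>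
    using measurable_space[OF rv[OF that(1)] that(2)] by (simp add: space_padic_borel)
  define Y where "Y = PiE_dflt E 0 (\<lambda>_. {0..<int (p ^ k)})"
  have finY: "finite Y" unfolding Y_def by (intro finite_PiE_dflt E) auto
  define Ev where "Ev y = (\<Inter>e\<in>E. X e -` {x \<in> carrier (padic_int p). x k = y e} \<inter> space M)" for y
  have Ev: "\<omega> \<in> Ev y \<longleftrightarrow> \<omega> \<in> space M \<and> (\<forall>e\<in>E. X e \<omega> k = y e)" for \<omega> y
    using X E(2) by (auto simp: Ev_def)
  have sets: "{x \<in> carrier (padic_int p). x k = v} \<in> sets (padic_borel p)" for v
  proof -
    have "(\<lambda>x. x k) -` {v} \<inter> space (padic_borel p) \<in> sets (padic_borel p)"
      by (rule measurable_sets[OF residue_measurable]) simp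
    moreover have "(\<lambda>x. x k) -` {v} \<inter> space (padic_borel p) = {x \<in> carrier (padic_int p). x k = v}"
      by (auto simp: space_padic_borel)
    ultimately show ?thesis by simp
  qed
  have Ev_sets: "Ev y \<in> M.events" for y
    unfolding Ev_def by (intro sets.finite_INT E measurable_sets[OF rv sets])
  have prob_Ev: "measure M (Ev y) = pmf (Pi_pmf E 0 law) y" if "y \<in> Y" for y
  proof -
    have "measure M (Ev y) = (\<Prod>e\<in>E. measure M (X e -` {x \<in> carrier (padic_int p). x k = y e} \<inter> space M))"
      unfolding Ev_def by (rule M.indep_varsD_finite[OF ind E(2,1) sets])
    also have "\<dots> = (\<Prod>e\<in>E. pmf (law e) (y e))"
    proof (rule prod.cong[OF refl])
      fix e assume e: "e \<in> E"
      have "X e -` {x \<in> carrier (padic_int p). x k = y e} \<inter> space M = {\<omega> \<in> space M. X e \<omega> k = y e}"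
        using X[OF e] by auto
      then show "measure M (X e -` {x \<in> carrier (padic_int p). x k = y e} \<inter> space M) = pmf (law e) (y e)"
        using law[OF e, of "\<lambda>v. v = y e"] by (simp add: measure_pmf_single)
    qed
    also have "\<dots> = pmf (Pi_pmf E 0 law) y"
      using that by (intro pmf_Pi'[symmetric] E) (auto simp: Y_def PiE_dflt_def)
    finally show ?thesis .
  qed
  have disj: "disjoint_family_on Ev {y \<in> Y. Q y}"
    unfolding disjoint_family_on_def
  proof (intro ballI impI)
    fix y z assume yz: "y \<in> {y \<in> Y. Q y}" "z \<in> {y \<in> Y. Q y}" "y \<noteq> z"
    have "y = z" if "\<omega> \<in> Ev y" "\<omega> \<in> Ev z" for \<omega>
    proof
      fix e show "y e = z e"
        using that yz by (cases "e \<in> E") (auto simp: Ev Y_def PiE_dflt_def)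
    qed
    then show "Ev y \<inter> Ev z = {}" using yz(3) by blast
  qed
  have "{\<omega> \<in> space M. Q (\<lambda>e. X e \<omega> k)} = (\<Union>y\<in>{y \<in> Y. Q y}. Ev y)"
  proof (intro equalityI subsetI)
    fix \<omega> assume \<omega>: "\<omega> \<in> {\<omega> \<in> space M. Q (\<lambda>e. X e \<omega> k)}"
    define y where "y e = (if e \<in> E then X e \<omega> k else 0)" for e
    have "y \<in> Y" using X \<omega> by (auto simp: Y_def PiE_dflt_def y_def carrier_padic)
    moreover have "Q y" using \<omega> Q[of "\<lambda>e. X e \<omega> k" y] by (simp add: y_def)
    moreover have "\<omega> \<in> Ev y" using \<omega> by (simp add: Ev y_def)
    ultimately show "\<omega> \<in> (\<Union>y\<in>{y \<in> Y. Q y}. Ev y)" by blast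
  next
    fix \<omega> assume "\<omega> \<in> (\<Union>y\<in>{y \<in> Y. Q y}. Ev y)"
    then obtain y where "Q y" "\<omega> \<in> Ev y" by blast
    then show "\<omega> \<in> {\<omega> \<in> space M. Q (\<lambda>e. X e \<omega> k)}" using Q[of "\<lambda>e. X e \<omega> k" y] by (simp add: Ev)
  qed
  also have "measure M \<dots> = (\<Sum>y\<in>{y \<in> Y. Q y}. measure M (Ev y))"
    using finY Ev_sets by (intro M.finite_measure_finite_Union disj) auto
  also have "\<dots> = (\<Sum>y\<in>{y \<in> Y. Q y}. pmf (Pi_pmf E 0 law) y)" using prob_Ev by (intro sum.cong) auto
  also have "\<dots> = measure_pmf.prob (Pi_pmf E 0 law) {y \<in> Y. Q y}"
    using finY by (intro measure_measure_pmf_finite[symmetric]) auto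
  also have "\<dots> = measure_pmf.prob (Pi_pmf E 0 law) {y. Q y}"
  proof (rule measure_pmf.finite_measure_eq_AE)
    have "set_pmf (Pi_pmf E 0 law) \<subseteq> Y"
      using set_Pi_pmf_subset'[OF E(1), of 0 law] range unfolding Y_def PiE_dflt_def by fastforce
    then show "AE y in measure_pmf (Pi_pmf E 0 law). (y \<in> {y \<in> Y. Q y}) = (y \<in> {y. Q y})"
      by (auto simp: AE_measure_pmf_iff)
  qed auto
  finally show ?thesis .
qed

lemma balanced_residue_law:
  assumes p: "p > 0" and k: "k \<ge> 1" and eps: "\<epsilon> < 1" and bal: "balanced p \<epsilon> M x"
    and law: "\<And>P. measure_pmf.prob \<mu> {v. P v} = measure M {\<omega> \<in> space M. P (x \<omega> k)}"
    and range: "set_pmf \<mu> \<subseteq> {0..<int (p ^ k)}"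
  shows "bal_pmf p (p ^ k) \<epsilon> \<mu>"
  unfolding bal_pmf_def
proof (intro conjI allI range)
  fix a :: int
  have X: "x \<omega> \<in> carrier (padic_int p)" if "\<omega> \<in> space M" for \<omega>
    using bal measurable_space[of x M "padic_borel p" \<omega>] that by (simp add: balanced_def space_padic_borel)
  have m: "x \<omega> k mod int p = x \<omega> 1" "0 \<le> x \<omega> 1" "x \<omega> 1 < int p" if "\<omega> \<in> space M" for \<omega>
    using padic_mod[OF X[OF that] k] X[OF that, unfolded carrier_padic, rule_format, of 1] by simp_all
  have eq: "measure_pmf.prob \<mu> {v. v mod int p = a} = measure M {\<omega> \<in> space M. x \<omega> 1 = a}"
    unfolding law using m by (intro arg_cong[where f = "measure M"]) auto
  show "measure_pmf.prob \<mu> {v. v mod int p = a} \<le> 1 - \<epsilon>"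
  proof (cases "0 \<le> a \<and> a < int p")
    case True
    have "{\<omega> \<in> space M. x \<omega> 1 = a} = {\<omega> \<in> space M. [x \<omega> 1 = a] (mod int p)}"
      using m(2,3) True by (auto simp: cong_def)
    then show ?thesis using bal unfolding eq balanced_def by (simp add: less_imp_le)
  next
    case False
    then have empty: "{\<omega> \<in> space M. x \<omega> 1 = a} = {}" using m by auto
    show ?thesis unfolding eq empty using eps by simp
  qed
qed

text \<open>The \<open>p\<close> residue classes modulo \<open>p\<close> are translates of each other and have the same measure.\<close>

lemma haar_prob_dvd:
  assumes p: "p > 0" and k: "k \<ge> 1" and M: "prob_space M" and x: "haar_uniform p M x"
  shows "measure M {\<omega> \<in> space M. int p dvd x \<omega> k} = 1 / real p"
proof -
  interpret R: cring "padic_int p" by (rule padic_int_cring[OF p])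
  let ?R = "padic_int p"
  define \<mu> where "\<mu> = distr M (padic_borel p) x"
  have xm: "x \<in> measurable M (padic_borel p)" using x by (simp add: haar_uniform_def)
  interpret \<mu>: prob_space \<mu> unfolding \<mu>_def by (rule prob_space.prob_space_distr[OF M xm])
  have sets\<mu>: "sets \<mu> = sets (padic_borel p)" "space \<mu> = carrier ?R" by (simp_all add: \<mu>_def space_padic_borel)
  have haar: "\<forall>t\<in>carrier ?R. \<forall>S\<in>sets \<mu>. emeasure \<mu> ((\<lambda>z. t \<oplus>\<^bsub>?R\<^esub> z) ` S) = emeasure \<mu> S"
    using x unfolding haar_uniform_def padic_haar_def \<mu>_def[symmetric] by (elim conjE)
  define B where "B a = {z \<in> carrier ?R. z 1 = a}" for a
  have B: "B a \<in> sets \<mu>" for a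
  proof -
    have "(\<lambda>x. x 1) -` {a} \<inter> space (padic_borel p) \<in> sets (padic_borel p)"
      by (rule measurable_sets[OF residue_measurable]) simp
    moreover have "(\<lambda>x. x 1) -` {a} \<inter> space (padic_borel p) = B a" by (auto simp: space_padic_borel B_def)
    ultimately show ?thesis by (simp add: sets\<mu>)
  qed
  have eqB: "measure \<mu> (B a) = measure \<mu> (B 0)" if a: "0 \<le> a" "a < int p" for a
  proof -
    define t where "t = (\<lambda>l. a mod int p ^ l)"
    have t: "t \<in> carrier ?R" unfolding t_def by (rule padic_of_residues[OF p]) simp
    have t1: "t 1 = a" using a by (simp add: t_def)
    have add1: "(t \<oplus>\<^bsub>?R\<^esub> w) 1 = (a + w 1) mod int p" for w
      by (simp only: padic_ops t1 power_one_right)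
    have "(\<lambda>z. t \<oplus>\<^bsub>?R\<^esub> z) ` B 0 = B a"
    proof (intro equalityI subsetI)
      fix z assume "z \<in> (\<lambda>z. t \<oplus>\<^bsub>?R\<^esub> z) ` B 0"
      then show "z \<in> B a" using t a add1 by (auto simp: B_def)
    next
      fix z assume z: "z \<in> B a"
      define w where "w = (\<ominus>\<^bsub>?R\<^esub> t) \<oplus>\<^bsub>?R\<^esub> z"
      have zc: "z \<in> carrier ?R" "z 1 = a" using z by (auto simp: B_def)
      have w: "w \<in> carrier ?R" using t zc by (simp add: w_def)
      have tw: "t \<oplus>\<^bsub>?R\<^esub> w = z" unfolding w_def using t zc by (simp add: R.a_assoc[symmetric] R.r_neg)
      have w1: "0 \<le> w 1" "w 1 < int p" using w[unfolded carrier_padic, rule_format, of 1] by simp_all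
      have "(a + w 1) mod int p = a mod int p" using add1[of w] tw zc(2) a by simp
      then have "int p dvd (a + w 1) - a" by (simp only: mod_eq_dvd_iff)
      then have "int p dvd w 1" by simp
      then have "w 1 = 0" using w1 zdvd_imp_le[of "int p" "w 1"] by (cases "w 1 = 0") auto
      then show "z \<in> (\<lambda>z. t \<oplus>\<^bsub>?R\<^esub> z) ` B 0" using tw w by (auto simp: B_def image_iff)
    qed
    then have "emeasure \<mu> (B a) = emeasure \<mu> (B 0)"
      using haar[rule_format, OF t B[of 0]] by simp
    then show ?thesis by (simp add: measure_def)
  qed
  have "1 = measure \<mu> (space \<mu>)" by (simp add: \<mu>.prob_space)
  also have "space \<mu> = (\<Union>a\<in>{0..<int p}. B a)"
  proof -
    have "z 1 \<in> {0..<int p}" if "z \<in> carrier ?R" for z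
      using that[unfolded carrier_padic, rule_format, of 1] by simp
    then show ?thesis unfolding sets\<mu>(2) B_def by blast
  qed
  also have "measure \<mu> \<dots> = (\<Sum>a\<in>{0..<int p}. measure \<mu> (B a))"
  proof (rule \<mu>.finite_measure_finite_Union)
    show "disjoint_family_on B {0..<int p}" unfolding disjoint_family_on_def B_def by blast
    show "B ` {0..<int p} \<subseteq> sets \<mu>" using B by (rule image_subsetI)
  qed (rule finite_atLeastLessThan_int)
  also have "\<dots> = (\<Sum>a\<in>{0..<int p}. measure \<mu> (B 0))"
    by (intro sum.cong refl eqB) simp_all
  also have "\<dots> = real p * measure \<mu> (B 0)" by simp
  finally have "measure \<mu> (B 0) = 1 / real p" using p by (simp add: field_simps)
  also have "measure \<mu> (B 0) = measure M (x -` B 0 \<inter> space M)"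
    unfolding \<mu>_def using B[of 0] by (intro measure_distr[OF xm]) (simp add: sets\<mu>)
  also have "x -` B 0 \<inter> space M = {\<omega> \<in> space M. int p dvd x \<omega> k}"
  proof -
    have "x \<omega> \<in> B 0 \<longleftrightarrow> int p dvd x \<omega> k" if "\<omega> \<in> space M" for \<omega>
    proof -
      have c: "x \<omega> \<in> carrier ?R" using measurable_space[OF xm that] by (simp add: space_padic_borel)
      have "x \<omega> k mod int p = x \<omega> 1" using padic_mod[OF c k] by simp
      then show ?thesis using c by (auto simp: B_def dvd_eq_mod_eq_0)
    qed
    then show ?thesis by auto
  qed
  finally show ?thesis by simp
qed

section \<open>The cokernel for a fixed sparse diagonal\<close>

text \<open>The estimates that are needed concern finitely many ranks \<open>r\<close> and, for each of them, the finitely many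
table groups of order \<open>|G| p ^ r\<close>, so \<open>deviation_vanishes\<close> applies to all of them simultaneously.\<close>

lemma (in target_group) block_cokernel_prob:
  assumes \<kappa>: "\<kappa> > 0" and \<epsilon>: "0 < \<epsilon>" "\<epsilon> < 1" and e: "e > 0"
  shows "\<forall>\<^sub>F n in sequentially. \<forall>n2 (law :: entry \<Rightarrow> int pmf) cd. n2 \<le> n \<longrightarrow>
     (\<forall>x\<in>off_entries n n2. bal_pmf p q \<epsilon> (law x)) \<longrightarrow>
     sparse_diag p \<kappa> n {..<n} {n..<n + n2} (\<lambda>s. cd (diag_entry n s)) \<longrightarrow>
     \<bar>real (card (auto G)) * measure_pmf.prob (Pi_pmf (off_entries n n2) 0 law)
        {y. modvec q (n + n2) Mod res_image q n n2 (\<lambda>e. if e \<in> off_entries n n2 then y e else cd e) \<cong> G} - euler\<bar> \<le> e"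
proof -
  obtain R \<delta> N0 where \<delta>: "\<delta> > 0" and lim: "\<And>N (D :: (entry \<Rightarrow> int) pmf) Q. N \<ge> N0 \<Longrightarrow> finite (set_pmf D) \<Longrightarrow> (\<And>y. subgroup (Q y) (modvec q N)) \<Longrightarrow>
      (\<And>r. r \<le> R \<Longrightarrow> (\<Sum>H\<in>table_groups q (card (carrier G) * p ^ r). \<Sum>F\<in>generating_tuples H {..<N}.
          \<bar>measure_pmf.prob D {y. Q y \<subseteq> word_ker q N H F} - (1 / real (card (carrier G) * p ^ r)) ^ N\<bar>) \<le> \<delta>) \<Longrightarrow>
      \<bar>real (card (auto G)) * measure_pmf.prob D {y. modvec q N Mod Q y \<cong> G} - euler\<bar> \<le> e"
  proof (rule cokernel_prob_limit[OF e, where 'y = "entry \<Rightarrow> int"])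
    fix R N0 :: nat and \<delta> :: real
    assume 1: "\<delta> > 0" and 2: "\<And>N (D :: (entry \<Rightarrow> int) pmf) Q. N \<ge> N0 \<Longrightarrow> finite (set_pmf D) \<Longrightarrow> (\<And>y. subgroup (Q y) (modvec q N)) \<Longrightarrow>
      (\<And>r. r \<le> R \<Longrightarrow> (\<Sum>H\<in>table_groups q (card (carrier G) * p ^ r). \<Sum>F\<in>generating_tuples H {..<N}.
          \<bar>measure_pmf.prob D {y. Q y \<subseteq> word_ker q N H F} - (1 / real (card (carrier G) * p ^ r)) ^ N\<bar>) \<le> \<delta>) \<Longrightarrow>
      \<bar>real (card (auto G)) * measure_pmf.prob D {y. modvec q N Mod Q y \<cong> G} - euler\<bar> \<le> e"
    show thesis by (rule that[OF 1 2])
  qed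
  define T where "T r = table_groups q (card (carrier G) * p ^ r)" for r
  have finT: "finite (T r)" for r unfolding T_def by (rule finite_table_groups)
  define S where "S n n2 law cd H = (\<Sum>F\<in>generating_tuples H ({..<n} \<union> {n..<n + n2}).
      \<bar>kernel_prob H {..<n} {n..<n + n2} (\<lambda>s. cd (diag_entry n s)) (\<lambda>s r. law (off_entry n s r)) F -
       (1 / real (card (carrier H))) ^ card ({..<n} \<union> {n..<n + n2})\<bar>)"
    for n n2 and law :: "entry \<Rightarrow> int pmf" and cd :: "entry \<Rightarrow> int" and H :: "nat monoid"
  have "\<forall>\<^sub>F n in sequentially. \<forall>r\<in>{..R}. \<forall>H\<in>T r. \<forall>n2 law cd. n2 \<le> n \<longrightarrow>
     (\<forall>x\<in>off_entries n n2. bal_pmf p q \<epsilon> (law x)) \<longrightarrow>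
     sparse_diag p \<kappa> n {..<n} {n..<n + n2} (\<lambda>s. cd (diag_entry n s)) \<longrightarrow> S n n2 law cd H \<le> \<delta> / (card (T r) + 1)"
  proof (intro eventually_ball_finite finite_atMost finT ballI)
    fix r H assume H: "H \<in> T r"
    note H' = table_groupsD[OF H[unfolded T_def]]
    interpret H: comm_group H by (rule H'(1))
    interpret tm: torsion_model H p k q \<epsilon>
      using H' prime q k \<epsilon> by unfold_locales auto
    have pos: "\<delta> / (card (T r) + 1) > 0" using \<delta> by (simp add: add_pos_nonneg)
    show "\<forall>\<^sub>F n in sequentially. \<forall>n2 law cd. n2 \<le> n \<longrightarrow>
     (\<forall>x\<in>off_entries n n2. bal_pmf p q \<epsilon> (law x)) \<longrightarrow>
     sparse_diag p \<kappa> n {..<n} {n..<n + n2} (\<lambda>s. cd (diag_entry n s)) \<longrightarrow> S n n2 law cd H \<le> \<delta> / (card (T r) + 1)"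
      using tm.deviation_vanishes[OF \<kappa> pos, where 'i = nat]
    proof eventually_elim
      case (elim n)
      show ?case
      proof (intro allI impI)
        fix n2 and law :: "entry \<Rightarrow> int pmf" and cd :: "entry \<Rightarrow> int"
        assume n2: "n2 \<le> n" and bal: "\<forall>x\<in>off_entries n n2. bal_pmf p q \<epsilon> (law x)"
          and sp: "sparse_diag p \<kappa> n {..<n} {n..<n + n2} (\<lambda>s. cd (diag_entry n s))"
        have off: "off_entry n s r \<in> off_entries n n2" if "s < n + n2" "r \<in> opp_block n n2 s" for s r
          using that unfolding off_entries_def by blast
        show "S n n2 law cd H \<le> \<delta> / (card (T r) + 1)"
          unfolding S_def
        proof (rule elim[rule_format])
          fix s r assume "s \<in> {..<n}" "r \<in> {n..<n + n2}"
          then show "bal_pmf p q \<epsilon> (law (off_entry n s r)) \<and> bal_pmf p q \<epsilon> (law (off_entry n r s))"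
            using bal by (auto intro!: bspec[OF bal] off simp: opp_block_def)
        qed (use n2 sp in auto)
      qed
    qed
  qed
  moreover have "\<forall>\<^sub>F n in sequentially. n \<ge> N0" by (rule eventually_ge_at_top)
  ultimately show ?thesis
  proof eventually_elim
    case (elim n)
    show ?case
    proof (intro allI impI)
      fix n2 and law :: "entry \<Rightarrow> int pmf" and cd :: "entry \<Rightarrow> int"
      assume n2: "n2 \<le> n" and bal: "\<forall>x\<in>off_entries n n2. bal_pmf p q \<epsilon> (law x)"
        and sp: "sparse_diag p \<kappa> n {..<n} {n..<n + n2} (\<lambda>s. cd (diag_entry n s))"
      let ?D = "Pi_pmf (off_entries n n2) 0 law" and ?c = "card (carrier G)"
      let ?Q = "\<lambda>y. res_image q n n2 (\<lambda>e. if e \<in> off_entries n n2 then y e else cd e)"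
      have N: "{..<n} \<union> {n..<n + n2} = {..<n + n2}" by auto
      show "\<bar>real (card (auto G)) * measure_pmf.prob ?D {y. modvec q (n + n2) Mod ?Q y \<cong> G} - euler\<bar> \<le> e"
      proof (rule lim)
        show "n + n2 \<ge> N0" using elim by simp
        have "set_pmf ?D \<subseteq> PiE_dflt (off_entries n n2) 0 (\<lambda>_. {0..<int q})"
          using set_Pi_pmf_subset'[OF entry_set_split(3), of n n2 0 law] bal
          unfolding PiE_dflt_def bal_pmf_def by fastforce
        then show "finite (set_pmf ?D)" by (rule finite_subset) (intro finite_PiE_dflt entry_set_split(3) finite_atLeastLessThan_int)
        show "subgroup (?Q y) (modvec q (n + n2))" for y by (rule res_image_subgroup[OF q2])
        fix r assume r: "r \<le> R"
        have "(\<Sum>F\<in>generating_tuples H {..<n + n2}. \<bar>measure_pmf.prob ?D {y. ?Q y \<subseteq> word_ker q (n + n2) H F} - (1 / real (?c * p ^ r)) ^ (n + n2)\<bar>)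
          \<le> \<delta> / (card (T r) + 1)" if H: "H \<in> T r" for H
        proof -
          note H' = table_groupsD[OF H[unfolded T_def]]
          have "(\<Sum>F\<in>generating_tuples H {..<n + n2}. \<bar>measure_pmf.prob ?D {y. ?Q y \<subseteq> word_ker q (n + n2) H F} - (1 / real (?c * p ^ r)) ^ (n + n2)\<bar>)
            = S n n2 law cd H"
            unfolding S_def N
          proof (rule sum.cong[OF refl])
            fix F assume F: "F \<in> generating_tuples H {..<n + n2}"
            show "\<bar>measure_pmf.prob ?D {y. ?Q y \<subseteq> word_ker q (n + n2) H F} - (1 / real (?c * p ^ r)) ^ (n + n2)\<bar> =
              \<bar>kernel_prob H {..<n} {n..<n + n2} (\<lambda>s. cd (diag_entry n s)) (\<lambda>s r. law (off_entry n s r)) F - (1 / real (card (carrier H))) ^ card {..<n + n2}\<bar>"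
            proof -
              have "measure_pmf.prob ?D {y. ?Q y \<subseteq> word_ker q (n + n2) H F} =
                kernel_prob H {..<n} {n..<n + n2} (\<lambda>s. cd (diag_entry n s)) (\<lambda>s r. law (off_entry n s r)) F"
                by (rule prob_res_image_le_word_ker[OF q2 H'(1,3) F])
              moreover have "card (carrier H) = ?c * p ^ r" "card {..<n + n2} = n + n2" by (simp_all add: H'(2))
              ultimately show ?thesis by (simp only:)
            qed
          qed
          also have "\<dots> \<le> \<delta> / (card (T r) + 1)" using elim(1) r H n2 bal sp by blast
          finally show ?thesis .
        qed
        then have "(\<Sum>H\<in>T r. \<Sum>F\<in>generating_tuples H {..<n + n2}. \<bar>measure_pmf.prob ?D {y. ?Q y \<subseteq> word_ker q (n + n2) H F} - (1 / real (?c * p ^ r)) ^ (n + n2)\<bar>)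
          \<le> (\<Sum>H\<in>T r. \<delta> / (card (T r) + 1))" by (intro sum_mono)
        also have "\<dots> = \<delta> * (real (card (T r)) / (real (card (T r)) + 1))" by (simp add: ac_simps)
        also have "\<dots> \<le> \<delta> * 1" using \<delta> by (intro mult_left_mono) auto
        finally show "(\<Sum>H\<in>table_groups q (?c * p ^ r). \<Sum>F\<in>generating_tuples H {..<n + n2}.
          \<bar>measure_pmf.prob ?D {y. ?Q y \<subseteq> word_ker q (n + n2) H F} - (1 / real (?c * p ^ r)) ^ (n + n2)\<bar>) \<le> \<delta>"
          by (simp only: T_def mult_1_right)
      qed
    qed
  qed
qed

section \<open>Sparsity of a random diagonal\<close>

lemma res_image_cong:
  assumes "\<And>e. e \<in> entry_set n1 n2 \<Longrightarrow> y e = y' e"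
  shows "res_image q n1 n2 y = res_image q n1 n2 y'"
proof -
  have "res_col q n1 n2 y s = res_col q n1 n2 y' s" if s: "s < n1 + n2" for s
  proof -
    have d: "y (diag_entry n1 s) = y' (diag_entry n1 s)"
      using s by (intro assms) (simp add: entry_set_split(1) diag_entries_def)
    have o: "y (off_entry n1 s r) = y' (off_entry n1 s r)" if "r \<in> opp_block n1 n2 s" for r
      using s that unfolding entry_set_split(1) off_entries_def by (intro assms) (auto simp: entry_set_split(1) off_entries_def)
    show ?thesis unfolding res_col_def by (rule restrict_ext) (simp add: d o)
  qed
  then have "res_col q n1 n2 y ` {..<n1 + n2} = res_col q n1 n2 y' ` {..<n1 + n2}" by (intro image_cong refl) simp
  then show ?thesis unfolding res_image_def by (simp only:)
qed

lemma diag_entry_inj: "inj_on (diag_entry n1) {..<n1 + n2}"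
proof (rule inj_onI)
  fix s t assume "diag_entry n1 s = diag_entry n1 t"
  then show "s = t" by (cases "s < n1"; cases "t < n1") (simp_all add: diag_entry_def)
qed

lemma prob_many_divisible:
  assumes p: "p > 0" and S: "S \<subseteq> {..<n1 + n2}" "S \<noteq> {}" and t: "0 \<le> t"
    and law: "\<And>x. x \<in> diag_entries n1 n2 \<Longrightarrow> measure_pmf.prob (law x) {v. int p dvd v} = 1 / real p"
  shows "measure_pmf.prob (Pi_pmf (diag_entries n1 n2) 0 law)
    {g. real (card {s\<in>S. int p dvd g (diag_entry n1 s)}) \<ge> real (card S) * (1 / real p) + t} \<le> exp (- 2 * t\<^sup>2 / card S)"
proof -
  let ?A = "diag_entry n1 ` S" and ?D = "diag_entries n1 n2"
  have A: "?A \<subseteq> ?D" using S by (auto simp: diag_entries_def)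
  have finA: "finite ?A" using A entry_set_split(4) by (rule finite_subset)
  have inj: "inj_on (diag_entry n1) S" using diag_entry_inj S(1) by (rule inj_on_subset)
  have cA: "card ?A = card S" by (rule card_image[OF inj])
  have cnt: "card {s\<in>S. int p dvd g (diag_entry n1 s)} = card {a\<in>?A. int p dvd g a}" for g :: "entry \<Rightarrow> int"
  proof -
    have "{a\<in>?A. int p dvd g a} = diag_entry n1 ` {s\<in>S. int p dvd g (diag_entry n1 s)}" by blast
    moreover have "inj_on (diag_entry n1) {s\<in>S. int p dvd g (diag_entry n1 s)}" using inj by (rule inj_on_subset) blast
    ultimately show ?thesis by (simp only: card_image)
  qed
  have "measure_pmf.prob (Pi_pmf ?D 0 law) {g. real (card {a\<in>?A. int p dvd g a}) \<ge> card ?A * (1 / real p) + t}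
      = measure_pmf.prob (Pi_pmf ?A 0 law) {g. real (card {a\<in>?A. int p dvd g a}) \<ge> card ?A * (1 / real p) + t}"
  proof (rule Pi_pmf_prob_subset[OF entry_set_split(4) A])
    fix g h :: "entry \<Rightarrow> int" assume "\<And>a. a \<in> ?A \<Longrightarrow> g a = h a"
    then have "{a\<in>?A. int p dvd g a} = {a\<in>?A. int p dvd h a}"
      by (intro Collect_cong conj_cong refl) (simp only:)
    then show "(card ?A * (1 / real p) + t \<le> real (card {a\<in>?A. int p dvd g a})) =
      (card ?A * (1 / real p) + t \<le> real (card {a\<in>?A. int p dvd h a}))" by (simp only:)
  qed
  also have "\<dots> \<le> (if ?A = {} then 1 else exp (- 2 * t\<^sup>2 / card ?A))"
    by (rule prob_many_successes[OF finA]) (use p t A law in auto)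
  finally show ?thesis using S(2) unfolding cnt cA by simp
qed

text \<open>The first block has about \<open>n / p\<close> entries divisible by \<open>p\<close>, which is less than \<open>\<alpha> n \<le> n2\<close> by
\<open>2 \<kappa> n\<close>. The second block has at most about \<open>n / p\<close> of them, and \<open>\<alpha> n \<le> n\<close>. Half of this
distance is left as the margin, the other half is the deviation in Hoeffding's inequality.\<close>

lemma prob_not_sparse_diag:
  assumes p: "p > 0" and \<alpha>: "1 / real p < \<alpha>" "\<alpha> \<le> 1" and n: "n \<ge> 1" "\<alpha> * real n \<le> real n2" "n2 \<le> n"
    and law: "\<And>x. x \<in> diag_entries n n2 \<Longrightarrow> measure_pmf.prob (law x) {v. int p dvd v} = 1 / real p"
  defines "\<kappa> \<equiv> (\<alpha> - 1 / real p) / 2"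
  shows "measure_pmf.prob (Pi_pmf (diag_entries n n2) 0 law)
    {g. \<not> sparse_diag p \<kappa> n {..<n} {n..<n + n2} (\<lambda>s. g (diag_entry n s))} \<le> 2 * exp (- 2 * \<kappa>\<^sup>2 * real n)"
proof -
  let ?D = "Pi_pmf (diag_entries n n2) 0 law"
  let ?B = "\<lambda>S. {g. real (card {s\<in>S. int p dvd g (diag_entry n s)}) \<ge> real (card S) * (1 / real p) + \<kappa> * real n}"
  have \<kappa>: "\<kappa> > 0" using \<alpha> by (simp add: \<kappa>_def)
  have a: "\<alpha> = 1 / real p + 2 * \<kappa>" by (simp add: \<kappa>_def field_simps)
  have an: "\<alpha> * real n = real n * (1 / real p) + 2 * (\<kappa> * real n)" by (simp add: a algebra_simps)
  have n2: "n2 > 0"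
  proof -
    have "0 < 1 / real p" using p by simp
    then have "0 < \<alpha>" using \<alpha>(1) by linarith
    then have "0 < \<alpha> * real n" using n(1) by (intro mult_pos_pos) auto
    then show ?thesis using n(2) by linarith
  qed
  have bad: "{g. \<not> sparse_diag p \<kappa> n {..<n} {n..<n + n2} (\<lambda>s. g (diag_entry n s))} \<subseteq> ?B {..<n} \<union> ?B {n..<n + n2}"
  proof
    fix g assume "g \<in> {g. \<not> sparse_diag p \<kappa> n {..<n} {n..<n + n2} (\<lambda>s. g (diag_entry n s))}"
    then have "real (card {s\<in>{..<n}. int p dvd g (diag_entry n s)}) + \<kappa> * n > real n2 \<or>
      real (card {s\<in>{n..<n + n2}. int p dvd g (diag_entry n s)}) + \<kappa> * n > real n"
      by (simp add: sparse_diag_def not_le)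
    moreover have "real n2 * (1 / real p) \<le> real n * (1 / real p)" using n(3) p by (intro mult_right_mono) auto
    moreover have "\<alpha> * real n \<le> 1 * real n" using \<alpha>(2) by (rule mult_right_mono) simp
    ultimately have "real (card {s\<in>{..<n}. int p dvd g (diag_entry n s)}) \<ge> real n * (1 / real p) + \<kappa> * real n \<or>
      real (card {s\<in>{n..<n + n2}. int p dvd g (diag_entry n s)}) \<ge> real n2 * (1 / real p) + \<kappa> * real n"
      using an n(2) by linarith
    then show "g \<in> ?B {..<n} \<union> ?B {n..<n + n2}" by simp
  qed
  have tail: "measure_pmf.prob ?D (?B S) \<le> exp (- 2 * \<kappa>\<^sup>2 * real n)"
    if S: "S \<subseteq> {..<n + n2}" "S \<noteq> {}" "card S \<le> n" for S
  proof -
    have "finite S" using S(1) by (rule finite_subset) simp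
    then have cS: "card S > 0" using S(2) by (simp add: card_gt_0_iff)
    have "measure_pmf.prob ?D (?B S) \<le> exp (- 2 * (\<kappa> * real n)\<^sup>2 / card S)"
      by (rule prob_many_divisible[OF p S(1,2) _ law]) (use \<kappa> in auto)
    also have "- 2 * (\<kappa> * real n)\<^sup>2 / card S \<le> - 2 * \<kappa>\<^sup>2 * real n"
    proof -
      have "\<kappa>\<^sup>2 * real n * real (card S) \<le> \<kappa>\<^sup>2 * real n * real n" using S(3) by (intro mult_left_mono) auto
      then have "\<kappa>\<^sup>2 * real n \<le> (\<kappa> * real n)\<^sup>2 / card S"
        using cS by (simp add: pos_le_divide_eq power2_eq_square ac_simps)
      then show ?thesis by simp
    qed
    finally show ?thesis by simp
  qed
  have "measure_pmf.prob ?D {g. \<not> sparse_diag p \<kappa> n {..<n} {n..<n + n2} (\<lambda>s. g (diag_entry n s))}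
    \<le> measure_pmf.prob ?D (?B {..<n} \<union> ?B {n..<n + n2})"
    by (rule measure_pmf.finite_measure_mono[OF bad]) simp
  also have "\<dots> \<le> measure_pmf.prob ?D (?B {..<n}) + measure_pmf.prob ?D (?B {n..<n + n2})"
    by (rule measure_Un_le) simp_all
  also have "\<dots> \<le> exp (- 2 * \<kappa>\<^sup>2 * real n) + exp (- 2 * \<kappa>\<^sup>2 * real n)"
  proof (rule add_mono)
    show "measure_pmf.prob ?D (?B {..<n}) \<le> exp (- 2 * \<kappa>\<^sup>2 * real n)"
      by (rule tail) (use n(1) in \<open>auto simp: lessThan_empty_iff\<close>)
    show "measure_pmf.prob ?D (?B {n..<n + n2}) \<le> exp (- 2 * \<kappa>\<^sup>2 * real n)"
      by (rule tail) (use n(3) n2 in auto)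
  qed
  finally show ?thesis by simp
qed

text \<open>Conditioning on the first component; outside the good event the error is bounded trivially, by the
largest possible value of the scaled probability and its target.\<close>

lemma prob_pair_pmf_mixture_bound:
  fixes A L e :: real
  assumes A: "A \<ge> 0" and good: "\<And>x. Good x \<Longrightarrow> \<bar>A * measure_pmf.prob N {y. Q x y} - L\<bar> \<le> e"
    and e: "e \<ge> 0"
  shows "\<bar>A * measure_pmf.prob (pair_pmf M N) {z. Q (fst z) (snd z)} - L\<bar> \<le> e + (A + \<bar>L\<bar>) * measure_pmf.prob M {x. \<not> Good x}"
proof -
  let ?f = "\<lambda>x. measure_pmf.prob N {y. Q x y}" and ?b = "indicat_real {x. \<not> Good x}"
  have int1: "integrable (measure_pmf M) ?f" by (rule measure_pmf.integrable_const_bound[of _ 1]) auto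
  have int2: "integrable (measure_pmf M) (\<lambda>x. A * ?f x - L)" using int1 by auto
  have int3: "integrable (measure_pmf M) ?b" by (rule measure_pmf.integrable_const_bound[of _ 1]) (auto simp: indicator_def)
  have bound: "\<bar>A * ?f x - L\<bar> \<le> e + (A + \<bar>L\<bar>) * ?b x" for x
  proof (cases "Good x")
    case False
    have "A * ?f x \<le> A * 1" by (rule mult_left_mono[OF measure_pmf.prob_le_1 A])
    moreover have "0 \<le> A * ?f x" using A by simp
    ultimately have "\<bar>A * ?f x - L\<bar> \<le> A + \<bar>L\<bar>" by linarith
    then show ?thesis using e False by simp
  qed (use good in simp)
  have "A * measure_pmf.prob (pair_pmf M N) {z. Q (fst z) (snd z)} - L = (\<integral>x. A * ?f x - L \<partial>measure_pmf M)"
    unfolding prob_pair_pmf using int1 by simp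
  also have "\<bar>\<dots>\<bar> \<le> (\<integral>x. \<bar>A * ?f x - L\<bar> \<partial>measure_pmf M)" by (rule integral_abs_bound)
  also have "\<dots> \<le> (\<integral>x. e + (A + \<bar>L\<bar>) * ?b x \<partial>measure_pmf M)"
    using int2 int3 bound by (intro integral_mono) auto
  also have "\<dots> = e + (A + \<bar>L\<bar>) * measure_pmf.prob M {x. \<not> Good x}" using int3 by simp
  finally show ?thesis .
qed

section \<open>The limit distribution of the cokernel\<close>

lemma block_matrix_props:
  fixes a b c d \<omega> and p n1 n2 :: nat
  defines "M \<equiv> block_matrix p n1 n2 (\<lambda>i j. a i j \<omega>) (\<lambda>i j. b i j \<omega>) (\<lambda>i. c i \<omega>) (\<lambda>j. d j \<omega>)"
  shows "M \<in> carrier_mat (n1 + n2) (n1 + n2)"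
    and "r < n1 + n2 \<Longrightarrow> s < n1 + n2 \<Longrightarrow> M $$ (r, s) =
      (if r = s then case_entry a b c d (diag_entry n1 s) \<omega>
       else if r \<in> opp_block n1 n2 s then case_entry a b c d (off_entry n1 s r) \<omega> else \<zero>\<^bsub>padic_int p\<^esub>)"
proof -
  show "M \<in> carrier_mat (n1 + n2) (n1 + n2)" unfolding M_def block_matrix_def by (rule four_block_carrier_mat) auto
  assume "r < n1 + n2" "s < n1 + n2"
  then show "M $$ (r, s) =
      (if r = s then case_entry a b c d (diag_entry n1 s) \<omega>
       else if r \<in> opp_block n1 n2 s then case_entry a b c d (off_entry n1 s r) \<omega> else \<zero>\<^bsub>padic_int p\<^esub>)"
    unfolding M_def block_matrix_def
    by (cases "r < n1"; cases "s < n1") (auto simp: diag_entry_def off_entry_def opp_block_def)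
qed

lemma off_entries_cases:
  assumes "x \<in> off_entries n1 n2"
  obtains i j where "i < n1" "j < n2" "x = EntryA i j \<or> x = EntryB i j"
proof -
  obtain s r where sr: "s < n1 + n2" "r \<in> opp_block n1 n2 s" "x = off_entry n1 s r"
    using assms unfolding off_entries_def by blast
  show thesis
  proof (cases "s < n1")
    case True
    then show thesis using sr by (intro that[of s "r - n1"]) (auto simp: opp_block_def off_entry_def)
  next
    case False
    then show thesis using sr by (intro that[of r "s - n1"]) (auto simp: opp_block_def off_entry_def)
  qed
qed

lemma diag_entries_cases:
  assumes "x \<in> diag_entries n1 n2"
  obtains i where "i < n1" "x = EntryC i" | j where "j < n2" "x = EntryD j"
proof -
  obtain s where s: "s < n1 + n2" "x = diag_entry n1 s" using assms unfolding diag_entries_def by blast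
  show thesis
  proof (cases "s < n1")
    case True
    then show thesis using s by (intro that(1)[of s]) (auto simp: diag_entry_def)
  next
    case False
    then show thesis using s by (intro that(2)[of "s - n1"]) (auto simp: diag_entry_def)
  qed
qed

lemma (in target_group) random_block_residue_law:
  assumes entries: "random_block_entries p \<epsilon> n1 n2 \<Omega> a b c d" and \<epsilon>: "\<epsilon> < 1" and n1: "n1 \<ge> 1"
  obtains law :: "entry \<Rightarrow> int pmf" where
    "\<And>x. x \<in> off_entries n1 n2 \<Longrightarrow> bal_pmf p q \<epsilon> (law x)"
    "\<And>x. x \<in> diag_entries n1 n2 \<Longrightarrow> measure_pmf.prob (law x) {v. int p dvd v} = 1 / real p"
    "measure \<Omega> {\<omega> \<in> space \<Omega>. coker p (block_matrix p n1 n2 (\<lambda>i j. a i j \<omega>) (\<lambda>i j. b i j \<omega>) (\<lambda>i. c i \<omega>) (\<lambda>j. d j \<omega>)) \<cong> G}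
     = measure_pmf.prob (Pi_pmf (entry_set n1 n2) 0 law) {y. modvec q (n1 + n2) Mod res_image q n1 n2 y \<cong> G}"
proof -
  let ?X = "case_entry a b c d" and ?E = "entry_set n1 n2" and ?N = "n1 + n2"
  have M: "prob_space \<Omega>" and ind: "prob_space.indep_vars \<Omega> (\<lambda>_. padic_borel p) ?X ?E"
    using entries by (simp_all add: random_block_entries_def)
  interpret M: prob_space \<Omega> by fact
  have p0: "p > 0" using p2 by simp
  have finE: "finite ?E" using entry_set_split by simp
  have E0: "?E \<noteq> {}"
  proof -
    have "EntryC 0 \<in> ?E" using n1 by (simp add: entry_set_def)
    then show ?thesis by blast
  qed
  have rv: "?X x \<in> measurable \<Omega> (padic_borel p)" if "x \<in> ?E" for x
    using ind that unfolding M.indep_vars_def by auto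
  have X: "?X x \<omega> \<in> carrier (padic_int p)" if "x \<in> ?E" "\<omega> \<in> space \<Omega>" for x \<omega>
    using measurable_space[OF rv[OF that(1)] that(2)] by (simp add: space_padic_borel)
  have X_range: "?X x \<omega> k \<in> {0..<int q}" if "x \<in> ?E" "\<omega> \<in> space \<Omega>" for x \<omega>
    using X[OF that, unfolded carrier_padic, rule_format, of k] by (simp add: q)
  have ex: "\<exists>\<mu>. \<forall>P. measure_pmf.prob \<mu> {v. P v} = measure \<Omega> {\<omega> \<in> space \<Omega>. P (?X x \<omega> k)}" if "x \<in> ?E" for x
  proof -
    have "(\<lambda>\<omega>. ?X x \<omega> k) \<in> measurable \<Omega> (count_space UNIV)"
      by (rule measurable_compose[OF rv[OF that] residue_measurable])
    then show ?thesis by (rule prob_space_countable_pmf[OF M]) (intro exI allI)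
  qed
  then obtain law where law: "\<And>x P. x \<in> ?E \<Longrightarrow> measure_pmf.prob (law x) {v. P v} = measure \<Omega> {\<omega> \<in> space \<Omega>. P (?X x \<omega> k)}"
    by metis
  have range: "set_pmf (law x) \<subseteq> {0..<int q}" if x: "x \<in> ?E" for x
  proof
    fix v assume "v \<in> set_pmf (law x)"
    then have "measure_pmf.prob (law x) {u. u = v} \<noteq> 0" by (simp add: measure_pmf_single set_pmf_iff)
    then have "{\<omega> \<in> space \<Omega>. ?X x \<omega> k = v} \<noteq> {}" unfolding law[OF x] by (metis measure_empty)
    then show "v \<in> {0..<int q}" using X_range[OF x] by blast
  qed
  have off: "x \<in> ?E" if "x \<in> off_entries n1 n2" for x using that entry_set_split(1) by blast
  have diag: "x \<in> ?E" if "x \<in> diag_entries n1 n2" for x using that entry_set_split(1) by blast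
  show thesis
  proof (rule that)
    fix x assume x: "x \<in> off_entries n1 n2"
    have "balanced p \<epsilon> \<Omega> (?X x)"
      using x entries by (elim off_entries_cases) (auto simp: random_block_entries_def)
    note bal = this
    show "bal_pmf p q \<epsilon> (law x)" unfolding q
      by (rule balanced_residue_law[OF p0 k \<epsilon> bal law[OF off[OF x]]]) (rule range[OF off[OF x], unfolded q])
  next
    fix x assume x: "x \<in> diag_entries n1 n2"
    have "haar_uniform p \<Omega> (?X x)"
      using x entries by (elim diag_entries_cases) (auto simp: random_block_entries_def)
    then show "measure_pmf.prob (law x) {v. int p dvd v} = 1 / real p"
      unfolding law[OF diag[OF x]] by (rule haar_prob_dvd[OF p0 k M])
  next
    have iff: "coker p (block_matrix p n1 n2 (\<lambda>i j. a i j \<omega>) (\<lambda>i j. b i j \<omega>) (\<lambda>i. c i \<omega>) (\<lambda>j. d j \<omega>)) \<cong> G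
        \<longleftrightarrow> modvec q ?N Mod res_image q n1 n2 (\<lambda>e. ?X e \<omega> k) \<cong> G" if \<omega>: "\<omega> \<in> space \<Omega>" for \<omega>
    proof -
      let ?M = "block_matrix p n1 n2 (\<lambda>i j. a i j \<omega>) (\<lambda>i j. b i j \<omega>) (\<lambda>i. c i \<omega>) (\<lambda>j. d j \<omega>)"
      have dE: "diag_entry n1 s \<in> ?E" if "s < ?N" for s using that by (intro diag) (simp add: diag_entries_def)
      have oE: "off_entry n1 s r \<in> ?E" if "s < ?N" "r \<in> opp_block n1 n2 s" for s r
        using that by (intro off) (auto simp: off_entries_def)
      have zero: "\<zero>\<^bsub>padic_int p\<^esub> \<in> carrier (padic_int p)" using p0 by (simp add: carrier_padic padic_ops)
      interpret pm: padic_matrix p k ?N ?M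
      proof
        show "?M \<in> carrier_mat ?N ?N" by (rule block_matrix_props(1))
        show "?M $$ (i, j) \<in> carrier (padic_int p)" if "i < ?N" "j < ?N" for i j
          unfolding block_matrix_props(2)[OF that] using that dE oE X \<omega> zero by simp
      qed (use prime k in auto)
      have "pm.col s = res_col q n1 n2 (\<lambda>e. ?X e \<omega> k) s" if s: "s < ?N" for s
        unfolding pm.col_def res_col_def
      proof (rule restrict_ext)
        fix r assume r: "r \<in> {..<?N}"
        have m: "(?X e \<omega> k) mod int q = ?X e \<omega> k" if "e \<in> ?E" for e using X_range[OF that \<omega>] by simp
        show "(?M $$ (r, s)) k = (if r = s then ?X (diag_entry n1 s) \<omega> k
          else if r \<in> opp_block n1 n2 s then ?X (off_entry n1 s r) \<omega> k else 0) mod int q"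
          using r s m[OF dE[OF s]] m[OF oE[OF s]] by (simp add: block_matrix_props(2) padic_ops)
      qed
      then have "pm.col ` {..<?N} = res_col q n1 n2 (\<lambda>e. ?X e \<omega> k) ` {..<?N}" by (intro image_cong refl) simp
      then have "pm.Q = res_image q n1 n2 (\<lambda>e. ?X e \<omega> k)" unfolding pm.Q_def res_image_def q by (simp only:)
      then show ?thesis using pm.coker_iso_iff[OF G.is_group G_torsion] unfolding q by (simp only:)
    qed
    have "measure \<Omega> {\<omega> \<in> space \<Omega>. coker p (block_matrix p n1 n2 (\<lambda>i j. a i j \<omega>) (\<lambda>i j. b i j \<omega>) (\<lambda>i. c i \<omega>) (\<lambda>j. d j \<omega>)) \<cong> G}
      = measure \<Omega> {\<omega> \<in> space \<Omega>. modvec q ?N Mod res_image q n1 n2 (\<lambda>e. ?X e \<omega> k) \<cong> G}"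
      by (intro arg_cong[where f = "measure \<Omega>"] Collect_cong conj_cong refl iff)
    also have "\<dots> = measure_pmf.prob (Pi_pmf ?E 0 law) {y. modvec q ?N Mod res_image q n1 n2 y \<cong> G}"
    proof (rule joint_residue_law[OF M ind finE E0 p0 law])
      show "set_pmf (law e) \<subseteq> {0..<int (p ^ k)}" if "e \<in> ?E" for e using range[OF that] by (simp only: q)
      show "(modvec q ?N Mod res_image q n1 n2 x \<cong> G) = (modvec q ?N Mod res_image q n1 n2 y \<cong> G)"
        if "\<And>e. e \<in> ?E \<Longrightarrow> x e = y e" for x y
        using res_image_cong[of n1 n2 x y q, OF that] by (simp only:)
    qed
    finally show "measure \<Omega> {\<omega> \<in> space \<Omega>. coker p (block_matrix p n1 n2 (\<lambda>i j. a i j \<omega>) (\<lambda>i j. b i j \<omega>) (\<lambda>i. c i \<omega>) (\<lambda>j. d j \<omega>)) \<cong> G}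
     = measure_pmf.prob (Pi_pmf ?E 0 law) {y. modvec q ?N Mod res_image q n1 n2 y \<cong> G}" .
  qed
qed

text \<open>Conditioning on the diagonal entries, which are independent of the other ones.\<close>

lemma (in target_group) prob_residue_cokernel_bound:
  fixes law :: "entry \<Rightarrow> int pmf"
  assumes e: "e \<ge> 0"
    and sparse: "\<And>cd. sparse_diag p \<kappa> n {..<n} {n..<n + n2} (\<lambda>s. cd (diag_entry n s)) \<Longrightarrow>
      \<bar>real (card (auto G)) * measure_pmf.prob (Pi_pmf (off_entries n n2) 0 law)
        {y. modvec q (n + n2) Mod res_image q n n2 (\<lambda>e. if e \<in> off_entries n n2 then y e else cd e) \<cong> G} - euler\<bar> \<le> e"
  shows "\<bar>real (card (auto G)) * measure_pmf.prob (Pi_pmf (entry_set n n2) 0 law)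
        {y. modvec q (n + n2) Mod res_image q n n2 y \<cong> G} - euler\<bar>
    \<le> e + (real (card (auto G)) + \<bar>euler\<bar>) * measure_pmf.prob (Pi_pmf (diag_entries n n2) 0 law)
        {g. \<not> sparse_diag p \<kappa> n {..<n} {n..<n + n2} (\<lambda>s. g (diag_entry n s))}"
proof -
  let ?O = "off_entries n n2" and ?D = "diag_entries n n2"
  let ?iso = "\<lambda>y. modvec q (n + n2) Mod res_image q n n2 y \<cong> G"
  have E: "entry_set n n2 = ?D \<union> ?O" "?D \<inter> ?O = {}" using entry_set_split(1,2)[of n n2] by blast+
  have "Pi_pmf (entry_set n n2) 0 law = map_pmf (\<lambda>(f, g) x. if x \<in> ?D then f x else g x) (pair_pmf (Pi_pmf ?D 0 law) (Pi_pmf ?O 0 law))"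
    unfolding E(1) by (rule Pi_pmf_union[OF entry_set_split(4,3) E(2)])
  then have "measure_pmf.prob (Pi_pmf (entry_set n n2) 0 law) {y. ?iso y}
    = measure_pmf.prob (pair_pmf (Pi_pmf ?D 0 law) (Pi_pmf ?O 0 law)) {z. ?iso (\<lambda>x. if x \<in> ?D then fst z x else snd z x)}"
    by (simp only: measure_map_pmf vimage_def case_prod_unfold mem_Collect_eq)
  also have "{z. ?iso (\<lambda>x. if x \<in> ?D then fst z x else snd z x)} = {z. ?iso (\<lambda>x. if x \<in> ?O then snd z x else fst z x)}"
  proof -
    have "res_image q n n2 (\<lambda>x. if x \<in> ?D then f x else g x) = res_image q n n2 (\<lambda>x. if x \<in> ?O then g x else f x)"
      for f g :: "entry \<Rightarrow> int"
      by (rule res_image_cong) (use E in auto)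
    then show ?thesis by (simp only:)
  qed
  finally have eq: "measure_pmf.prob (Pi_pmf (entry_set n n2) 0 law) {y. ?iso y} =
    measure_pmf.prob (pair_pmf (Pi_pmf ?D 0 law) (Pi_pmf ?O 0 law)) {z. ?iso (\<lambda>x. if x \<in> ?O then snd z x else fst z x)}" .
  show ?thesis unfolding eq
    by (rule prob_pair_pmf_mixture_bound[OF of_nat_0_le_iff sparse e])
qed

theorem theorem1p6:
  fixes p :: nat and \<epsilon> \<alpha> :: real
    and \<Omega> :: "nat \<Rightarrow> 'w measure"
    and a b :: "nat \<Rightarrow> nat \<Rightarrow> nat \<Rightarrow> 'w \<Rightarrow> padic"
    and c d :: "nat \<Rightarrow> nat \<Rightarrow> 'w \<Rightarrow> padic"
    and G :: "('g, 'r) monoid_scheme"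
  assumes "prime p" and "0 < \<epsilon>" and "\<epsilon> < 1"
    and "1 / real p < \<alpha>" and "\<alpha> \<le> 1"
    and "\<And>n. n \<ge> 1 \<Longrightarrow>
           random_block_entries p \<epsilon> n (nat \<lceil>\<alpha> * real n\<rceil>) (\<Omega> n) (a n) (b n) (c n) (d n)"
    and "comm_group G" and "finite (carrier G)" and "\<exists>k. order G = p ^ k"
  shows "(\<lambda>n. measure (\<Omega> n) {\<omega> \<in> space (\<Omega> n).
            coker p (block_matrix p n (nat \<lceil>\<alpha> * real n\<rceil>)
              (\<lambda>i j. a n i j \<omega>) (\<lambda>i j. b n i j \<omega>) (\<lambda>i. c n i \<omega>) (\<lambda>j. d n j \<omega>)) \<cong> G})
          \<longlonglongrightarrow> P_infinity p 1 G
       \<and> P_infinity p 1 G = 1 / real (card (auto G)) * (\<Prod>j. 1 - 1 / real p ^ Suc j)"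
proof -
  obtain m where m: "order G = p ^ m" using assms by blast
  have p2: "p \<ge> 2" using \<open>prime p\<close> by (rule prime_ge_2_nat)
  define q where "q = p ^ (m + 1)"
  interpret G: comm_group G by fact
  interpret T: target_group p "m + 1" q G
  proof
    show "x [^]\<^bsub>G\<^esub> (p ^ (m + 1 - 1)) = \<one>\<^bsub>G\<^esub>" if "x \<in> carrier G" for x
      using G.power_order_eq_one[OF assms(8) that] m by (simp add: order_def)
  qed (use assms q_def in auto)
  define A where "A = real (card (auto G))"
  have A: "A > 0"
  proof -
    have "auto G \<subseteq> Bij (carrier G)" by (auto simp: auto_def)
    moreover have "finite (Bij (carrier G))"
    proof (rule finite_subset)
      show "Bij (carrier G) \<subseteq> PiE (carrier G) (\<lambda>_. carrier G)" by (auto simp: Bij_def bij_betw_def PiE_def)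
      show "finite (PiE (carrier G) (\<lambda>_. carrier G))" using assms(8) by (intro finite_PiE) auto
    qed
    ultimately have "finite (auto G)" by (rule finite_subset)
    moreover have "auto G \<noteq> {}" using G.id_in_auto by blast
    ultimately show ?thesis by (simp add: A_def card_gt_0_iff)
  qed
  define n2 where "n2 n = nat \<lceil>\<alpha> * real n\<rceil>" for n :: nat
  define P where "P n = measure (\<Omega> n) {\<omega> \<in> space (\<Omega> n).
            coker p (block_matrix p n (n2 n)
              (\<lambda>i j. a n i j \<omega>) (\<lambda>i j. b n i j \<omega>) (\<lambda>i. c n i \<omega>) (\<lambda>j. d n j \<omega>)) \<cong> G}" for n
  \<comment> \<open>Half of the distance between the density \<open>1 / p\<close> of non-units and \<open>\<alpha>\<close>.\<close>
  define \<kappa> where "\<kappa> = (\<alpha> - 1 / real p) / 2"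
  have \<kappa>: "\<kappa> > 0" using assms(4) by (simp add: \<kappa>_def)
  have \<alpha>0: "\<alpha> \<ge> 0" using assms(4) order_trans[of 0 "1 / real p" \<alpha>] by simp
  have n2: "\<alpha> * real n \<le> real (n2 n)" "n2 n \<le> n" for n
  proof -
    show "\<alpha> * real n \<le> real (n2 n)" unfolding n2_def by (rule real_nat_ceiling_ge)
    have "\<alpha> * real n \<le> 1 * real n" using assms(5) by (rule mult_right_mono) simp
    then have "\<lceil>\<alpha> * real n\<rceil> \<le> int n" by (simp add: ceiling_le_iff)
    then show "n2 n \<le> n" by (simp only: n2_def nat_le_iff)
  qed
  define C where "C = A + \<bar>T.euler\<bar>"
  have "(\<lambda>n. A * P n) \<longlonglongrightarrow> T.euler"
  proof (rule tendstoI)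
    fix e :: real assume e: "e > 0"
    have "(\<lambda>n. C * (2 * exp (- 2 * \<kappa>\<^sup>2) ^ n)) \<longlonglongrightarrow> C * (2 * 0)"
      using \<kappa> by (intro tendsto_intros LIMSEQ_realpow_zero) auto
    then have "\<forall>\<^sub>F n in sequentially. C * (2 * exp (- 2 * \<kappa>\<^sup>2) ^ n) < e / 2"
      using e by (intro order_tendstoD(2)) auto
    moreover have "e / 2 > 0" using e by simp
    note T.block_cokernel_prob[OF \<kappa> assms(2,3) this]
    moreover have "\<forall>\<^sub>F n in sequentially. n \<ge> 1" by (rule eventually_ge_at_top)
    ultimately show "\<forall>\<^sub>F n in sequentially. dist (A * P n) T.euler < e"
    proof eventually_elim
      case (elim n)
      have "random_block_entries p \<epsilon> n (n2 n) (\<Omega> n) (a n) (b n) (c n) (d n)"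
        unfolding n2_def by (rule assms(6)[OF elim(3)])
      note entries = this
      obtain law where law: "\<And>x. x \<in> off_entries n (n2 n) \<Longrightarrow> bal_pmf p q \<epsilon> (law x)"
        "\<And>x. x \<in> diag_entries n (n2 n) \<Longrightarrow> measure_pmf.prob (law x) {v. int p dvd v} = 1 / real p"
        and P: "P n = measure_pmf.prob (Pi_pmf (entry_set n (n2 n)) 0 law)
          {y. modvec q (n + n2 n) Mod res_image q n (n2 n) y \<cong> G}"
      proof (rule T.random_block_residue_law[OF entries assms(3) elim(3), folded P_def])
        fix law :: "entry \<Rightarrow> int pmf"
        assume 1: "\<And>x. x \<in> off_entries n (n2 n) \<Longrightarrow> bal_pmf p q \<epsilon> (law x)"
          and 2: "\<And>x. x \<in> diag_entries n (n2 n) \<Longrightarrow> measure_pmf.prob (law x) {v. int p dvd v} = 1 / real p"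
          and 3: "P n = measure_pmf.prob (Pi_pmf (entry_set n (n2 n)) 0 law)
            {y. modvec q (n + n2 n) Mod res_image q n (n2 n) y \<cong> G}"
        show thesis by (rule that[OF 1 2 3])
      qed
      let ?bad = "measure_pmf.prob (Pi_pmf (diag_entries n (n2 n)) 0 law)
        {g. \<not> sparse_diag p \<kappa> n {..<n} {n..<n + n2 n} (\<lambda>s. g (diag_entry n s))}"
      have "\<bar>A * P n - T.euler\<bar> \<le> e / 2 + C * ?bad"
        unfolding A_def C_def P
        by (rule T.prob_residue_cokernel_bound) (use e elim(2) n2(2) law(1) in auto)
      also have "?bad \<le> 2 * exp (- 2 * \<kappa>\<^sup>2 * real n)"
        unfolding \<kappa>_def by (rule prob_not_sparse_diag[OF _ assms(4,5) elim(3) n2 law(2)]) (use p2 in auto)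
      also have "exp (- 2 * \<kappa>\<^sup>2 * real n) = exp (- 2 * \<kappa>\<^sup>2) ^ n"
        by (simp add: exp_of_nat_mult[symmetric] mult.commute)
      finally have "\<bar>A * P n - T.euler\<bar> \<le> e / 2 + C * (2 * exp (- 2 * \<kappa>\<^sup>2) ^ n)"
        using A by (simp add: C_def mult_left_mono)
      then show ?case using elim(1) by (simp add: dist_real_def)
    qed
  qed
  then have "(\<lambda>n. A * P n / A) \<longlonglongrightarrow> T.euler / A" by (intro tendsto_divide tendsto_const) (use A in auto)
  then have lim: "P \<longlonglongrightarrow> T.euler / A" using A by simp
  have "order G > 0" using m p2 by simp
  then have val: "P_infinity p 1 G = 1 / A * (\<Prod>j. 1 - 1 / real p ^ Suc j)"
    by (simp add: P_infinity_def A_def)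
  show ?thesis using lim unfolding val unfolding P_def n2_def A_def T.euler_def by simp
qed

end
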